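(* Let $\mathfrak{I},\mathfrak{p}\subseteq\mathcal{O}$ be nonzero coprime ideals with $\mathfrak{p}\neq\mathcal{O}$, and let $p,q\in\mathbb{Z}_{\ge0}$. For $\underline{\gamma}=(\gamma_1,\dots,\gamma_N)\in\Gamma_0(\mathfrak{p},\Lambda(\mathfrak{I}))^N$ let $A(\underline{\gamma})=(\gamma_1e_1|\cdots|\gamma_Ne_1)\in M_N(\mathcal{O})$ be the matrix of first columns. Then $A(\underline{\gamma})\in\mathrm{End}(\Lambda(\mathfrak{I}))$, and the map $$\mathbf{\Phi}^{p,q}_{\mathfrak{p}}(\Lambda(\mathfrak{I})):\Gamma_0(\mathfrak{p},\Lambda(\mathfrak{I}))^N\to\mathcal{F}\otimes V^{p,q},\qquad \mathbf{\Phi}^{p,q}_{\mathfrak{p}}(z,\underline{\gamma},\Lambda(\mathfrak{I}))=\sum_{|I|=p,\ |J|=q}D^{I,J}_{\mathfrak{p}}(z,A(\underline{\gamma}),\Lambda(\mathfrak{I}))\otimes A(\underline{\gamma})e^{I,J}$$ is a homogeneous $(N-1)$-cocycle: for all $\gamma,\gamma_1,\dots,\gamma_{N+1}\in\Gamma_0(\mathfrak{p},\Lambda(\mathfrak{I}))$, $$\mathbf{\Phi}(\gamma\gamma_1,\dots,\gamma\gamma_N)=\gamma\cdot\mathbf{\Phi}(\gamma_1,\dots,\gamma_N)\quad\text{and}\quad\sum_{i=1}^{N+1}(-1)^{i-1}\mathbf{\Phi}(\gamma_1,\dots,\widehat{\gamma_i},\dots,\gamma_{N+1})=0,$$ where $\gamma$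 acts diagonally on $\mathcal{F}\otimes V^{p,q}$.
   Context: Let $N\ge2$, $k$ an imaginary quadratic field with ring of integers $\mathcal{O}$, and fix an embedding $\sigma:k\to\mathbb{C}$, giving $k^N\subset\mathbb{C}^N=V$ and $\mathrm{SL}_N(k)\subset\mathrm{SL}_N(\mathbb{C})$. $e_1,\dots,e_N$ is the standard basis of $V$. For a nonzero (fractional) ideal $\mathfrak{I}$ put $\Lambda(\mathfrak{I})=\mathfrak{I}^{-1}\oplus\mathcal{O}^{N-1}\subset k^N$; for an $\mathcal{O}$-lattice $\Lambda\subset k^N$ put $\Gamma(\Lambda)=\{\gamma\in\mathrm{SL}_N(k):\gamma\Lambda=\Lambda\}$, and $\Gamma_0(\mathfrak{p},\Lambda(\mathfrak{I}))=\Gamma(\Lambda(\mathfrak{pI}))\cap\Gamma(\Lambda(\mathfrak{I}))$ (matrices $\begin{pmatrix}a&{}^tb\\c&D\end{pmatrix}\in\mathrm{SL}_N(k)$ with $a\in\mathcal{O}$, $b\in(\mathfrak{I}^{-1})^{N-1}$, $c\in(\mathfrak{pI})^{N-1}$, $D\in M_{N-1}(\mathcal{O})$). Kronecker–Eisenstein sums: for an $\mathcal{O}$-lattice $\Lambda\subset k^N$, let $U(\Lambda)\subset\mathbb{C}^N$ be the complement of all $\sigma(\Lambda)$-translates of the coordinate hyperplanes. For multi-indices $I,J\in\mathbb{Z}_{\ge0}^N$ and $z\in U(\Lambda)$, let $K^{I,J}(z,\Lambda)$ be the value at $s=0$ of the analytic continuation of $$K^{I,J}(z,\Lambda,s)=\sum_{\lambda\in\sigma(\Lambda)}\prod_{k=1}^N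 i_k!\,\frac{\overline{z_k+\lambda_k}^{\,j_k}}{(z_k+\lambda_k)^{i_k+1}|z_k+\lambda_k|^{s}}$$ (absolutely convergent for $\mathrm{Re}(s)>1+\max_k(j_k-i_k)$; the continuation is regular at $s=0$). Let $\mathcal{F}$ be the $\mathbb{C}$-span of the functions $z\mapsto K^{I,J}(\gamma^{-1}z,\Lambda)$ ($\gamma\in\mathrm{SL}_N(k)$, $\Lambda$ an $\mathcal{O}$-lattice in $k^N$), with $\mathrm{SL}_N(k)$-action $(\gamma f)(z)=f(\gamma^{-1}z)$. Dedekind sums: for $A\in\mathrm{End}(\Lambda(\mathfrak{I}))\cap\mathrm{GL}_N(k)$, $D^{I,J}(z,A,\Lambda(\mathfrak{I}))=\det A^{-1}K^{I,J}(A^{-1}z,A^{-1}\Lambda(\mathfrak{I}))$, and $D^{I,J}_{\mathfrak{p}}(z,A,\Lambda(\mathfrak{I}))=D^{I,J}(z,A,\Lambda(\mathfrak{pI}))-\mathrm{N}\mathfrak{p}\cdot D^{I,J}(z,A,\Lambda(\mathfrak{I}))$; if $A$ is not invertible both are defined to be $0$. $V^{p,q}=\mathrm{Sym}^pV^\vee\otimes\mathrm{Sym}^q\overline{V}$ with its natural $\mathrm{GL}_N(\mathbb{C})$-action, and basis $e^{I,J}=({}^te_1)^{i_1}\cdots({}^te_N)^{i_N}\otimes\overline{e_1}^{j_1}\cdots\overline{e_N}^{j_N}$ for $|I|=i_1+\dots+i_N=p$, $|J|=q$.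
   Formalization: The basis vectors e^{I,J} are taken as divided-power monomials (the product in Sym^p V^∨ ⊗ Sym^q V̄ divided by ∏ i_k! j_k!); with undivided products the cocycle relation fails when p≥2 or q≥2 (e.g. N=2, p=2, q=0), while for p,q≤1 both agree. *)

theory Defs
  imports
    "HOL-Complex_Analysis.Complex_Analysis"
    "HOL-Algebra.Ideal_Product"
    "HOL-Algebra.QuotRing"
    "Jordan_Normal_Form.Gauss_Jordan_Elimination"
    "Jordan_Normal_Form.Determinant"
begin

unbundle no vec_syntax
hide_const (open) Finite_Cartesian_Product.vec Finite_Cartesian_Product.mat
  Finite_Cartesian_Product.row Finite_Cartesian_Product.column Determinants.det
  Finite_Cartesian_Product.transpose Finite_Cartesian_Product.map_matrix

text \<open>
  Vectors and matrices are those of Jordan Normal Form, so coordinates are numbered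
  \<open>0, ..., N - 1\<close> and the first basis vector is \<open>unit_vec N 0\<close>.  The field is a type
  \<open>'k\<close>; \<open>\<sigma>\<close> is its embedding into the complex numbers.
\<close>

section \<open>Imaginary quadratic fields and lattices\<close>

definition imaginary_quadratic_field :: "'k::field_char_0 itself \<Rightarrow> bool" where
  "imaginary_quadratic_field _ \<longleftrightarrow>
     vector_space.dim (\<lambda>(r::rat) (x::'k). of_rat r * x) UNIV = 2 \<and>
     \<not> (\<exists>\<tau> :: 'k \<Rightarrow> real. field_hom \<tau>)"

definition int_ring :: "'k::field_char_0 ring" where
  "int_ring = \<lparr>carrier = {x. algebraic_int x}, monoid.mult = (*), one = 1, zero = 0, add = (+)\<rparr>"

definition ideal_norm :: "'k::field_char_0 set \<Rightarrow> nat" where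
  "ideal_norm P = card (carrier (int_ring Quot P))"

definition inverse_ideal :: "'k::field_char_0 set \<Rightarrow> 'k set" where
  "inverse_ideal I = {x. \<forall>y\<in>I. x * y \<in> carrier int_ring}"

definition std_lattice :: "nat \<Rightarrow> 'k::field_char_0 set \<Rightarrow> 'k vec set" where
  "std_lattice N I = {v \<in> carrier_vec N.
     v $ 0 \<in> inverse_ideal I \<and> (\<forall>k\<in>{1..<N}. v $ k \<in> carrier int_ring)}"

definition span_over :: "nat \<Rightarrow> 'k::field_char_0 set \<Rightarrow> 'k vec set \<Rightarrow> 'k vec set" where
  "span_over N R S = {vec N (\<lambda>k. \<Sum>v\<in>S. c v * v $ k) | c. c \<in> S \<rightarrow> R}"

definition is_lattice :: "nat \<Rightarrow> 'k::field_char_0 vec set \<Rightarrow> bool" where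
  "is_lattice N \<Lambda> \<longleftrightarrow> (\<exists>S. finite S \<and> S \<subseteq> carrier_vec N \<and>
     \<Lambda> = span_over N (carrier int_ring) S \<and> span_over N UNIV S = carrier_vec N)"

definition SL :: "nat \<Rightarrow> 'k::field_char_0 mat set" where
  "SL N = {A \<in> carrier_mat N N. det A = 1}"

abbreviation mat_inv :: "'a::field mat \<Rightarrow> 'a mat" where
  "mat_inv A \<equiv> the (mat_inverse A)"

abbreviation mat_image :: "'a::field mat \<Rightarrow> 'a vec set \<Rightarrow> 'a vec set" where
  "mat_image A \<Lambda> \<equiv> (\<lambda>v. A *\<^sub>v v) ` \<Lambda>"

definition lattice_End :: "nat \<Rightarrow> 'k::field_char_0 vec set \<Rightarrow> 'k mat set" where
  "lattice_End N \<Lambda> = {A \<in> carrier_mat N N. mat_image A \<Lambda> \<subseteq> \<Lambda>}"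

definition Gamma :: "nat \<Rightarrow> 'k::field_char_0 vec set \<Rightarrow> 'k mat set" where
  "Gamma N \<Lambda> = {\<gamma> \<in> SL N. mat_image \<gamma> \<Lambda> = \<Lambda>}"

definition Gamma0 :: "nat \<Rightarrow> 'k::field_char_0 set \<Rightarrow> 'k set \<Rightarrow> 'k mat set" where
  "Gamma0 N P I = Gamma N (std_lattice N (P \<cdot>\<^bsub>int_ring\<^esub> I)) \<inter> Gamma N (std_lattice N I)"

section \<open>Kronecker--Eisenstein sums\<close>

definition hyperplane_compl :: "nat \<Rightarrow> ('k::field_char_0 \<Rightarrow> complex) \<Rightarrow> 'k vec set \<Rightarrow> complex vec set" where
  "hyperplane_compl N \<sigma> \<Lambda> =
     {z \<in> carrier_vec N. \<forall>l \<in> map_vec \<sigma> ` \<Lambda>. \<forall>k<N. z $ k \<noteq> l $ k}"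

definition KE_series ::
  "nat \<Rightarrow> ('k::field_char_0 \<Rightarrow> complex) \<Rightarrow> (nat \<Rightarrow> nat) \<Rightarrow> (nat \<Rightarrow> nat) \<Rightarrow> complex vec \<Rightarrow> 'k vec set \<Rightarrow> complex \<Rightarrow> complex" where
  "KE_series N \<sigma> I J z \<Lambda> s =
     (\<Sum>\<^sub>\<infinity> l \<in> map_vec \<sigma> ` \<Lambda>. \<Prod>k<N. fact (I k) *
        (cnj (z $ k + l $ k) ^ J k /
         ((z $ k + l $ k) ^ (I k + 1) * complex_of_real (cmod (z $ k + l $ k)) powr s)))"

definition KE_halfplane :: "nat \<Rightarrow> (nat \<Rightarrow> nat) \<Rightarrow> (nat \<Rightarrow> nat) \<Rightarrow> complex set" where
  "KE_halfplane N I J = {s. \<forall>k<N. Re s > 1 + (real (J k) - real (I k))}"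

text \<open>
  The domain \<open>S\<close> of the continuation is left open; the value at \<open>0\<close> does not depend on it,
  since for \<open>z\<close> off the hyperplanes the continuation is in fact entire.
\<close>

definition KE ::
  "nat \<Rightarrow> ('k::field_char_0 \<Rightarrow> complex) \<Rightarrow> (nat \<Rightarrow> nat) \<Rightarrow> (nat \<Rightarrow> nat) \<Rightarrow> complex vec \<Rightarrow> 'k vec set \<Rightarrow> complex" where
  "KE N \<sigma> I J z \<Lambda> = (THE w. \<exists>S f. open S \<and> connected S \<and> KE_halfplane N I J \<subseteq> S \<and> 0 \<in> S \<and>
     f holomorphic_on S \<and> (\<forall>s \<in> KE_halfplane N I J. f s = KE_series N \<sigma> I J z \<Lambda> s) \<and> w = f 0)"

section \<open>Functions with singularities\<close>

text \<open>
  A function with singularities is a pair of its domain and a total function, whose values off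
  the domain carry no meaning.  Sums live on the intersection of the domains.  All domains that
  occur are complements of locally finite unions of affine hyperplanes, so intersections are
  dense; two such functions are identified when they agree wherever both are defined.
\<close>

type_synonym 'v pfun = "complex vec set \<times> (complex vec \<Rightarrow> 'v)"

definition pf_eq :: "'v pfun \<Rightarrow> 'v pfun \<Rightarrow> bool" where
  "pf_eq f g \<longleftrightarrow> (\<forall>z \<in> fst f \<inter> fst g. snd f z = snd g z)"

definition F_generators :: "nat \<Rightarrow> ('k::field_char_0 \<Rightarrow> complex) \<Rightarrow> complex pfun set" where
  "F_generators N \<sigma> =
     {({z \<in> carrier_vec N. map_mat \<sigma> (mat_inv \<gamma>) *\<^sub>v z \<in> hyperplane_compl N \<sigma> \<Lambda>},
       \<lambda>z. KE N \<sigma> I J (map_mat \<sigma> (mat_inv \<gamma>) *\<^sub>v z) \<Lambda>)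
      | \<gamma> \<Lambda> I J. \<gamma> \<in> SL N \<and> is_lattice N \<Lambda>}"

definition F_space :: "nat \<Rightarrow> ('k::field_char_0 \<Rightarrow> complex) \<Rightarrow> complex pfun set" where
  "F_space N \<sigma> = {f. \<exists>X c. finite X \<and> X \<subseteq> F_generators N \<sigma> \<and>
     fst f = carrier_vec N \<inter> (\<Inter>g\<in>X. fst g) \<and>
     (\<forall>z \<in> fst f. snd f z = (\<Sum>g\<in>X. c g * snd g z))}"

section \<open>The coefficient space\<close>

text \<open>
  \<open>Sym\<^sup>p V\<^sup>\<or> \<otimes> Sym\<^sup>q V\<^sup>-\<close> is realised as the space of symmetric tensors inside the \<open>p\<close>-th tensor
  power of the dual \<open>V\<^sup>\<or>\<close> tensored with the \<open>q\<close>-th tensor power of the complex conjugate of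
  \<open>V\<close>.  A tensor is given by its coefficients on pairs of words: \<open>T (u, w)\<close> is the coefficient
  of the elementary tensor formed from the dual basis vectors with indices \<open>u\<close> and the
  conjugate basis vectors with indices \<open>w\<close>.
\<close>

type_synonym tensor = "nat list \<times> nat list \<Rightarrow> complex"

definition words :: "nat \<Rightarrow> nat \<Rightarrow> nat list set" where
  "words N p = {u. set u \<subseteq> {..<N} \<and> length u = p}"

definition Vpq :: "nat \<Rightarrow> nat \<Rightarrow> nat \<Rightarrow> tensor set" where
  "Vpq N p q = {T. (\<forall>u w. (u, w) \<notin> words N p \<times> words N q \<longrightarrow> T (u, w) = 0) \<and>
     (\<forall>u w u' w'. mset u = mset u' \<and> mset w = mset w' \<longrightarrow> T (u, w) = T (u', w'))}"

text \<open>
  The action of a matrix \<open>A\<close> in \<open>GL\<^sub>N(\<complex>)\<close>: it is contragredient on the dual and by the entrywise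
  conjugate of \<open>A\<close> on the conjugate space.
\<close>

definition Vpq_act :: "nat \<Rightarrow> nat \<Rightarrow> nat \<Rightarrow> complex mat \<Rightarrow> tensor \<Rightarrow> tensor" where
  "Vpq_act N p q A T = (\<lambda>(u, w). if (u, w) \<in> words N p \<times> words N q
     then \<Sum>u'\<in>words N p. \<Sum>w'\<in>words N q.
       (\<Prod>m<p. mat_inv A $$ (u' ! m, u ! m)) * (\<Prod>m<q. cnj (A $$ (w ! m, w' ! m))) * T (u', w')
     else 0)"

text \<open>
  The monomial with exponents \<open>I, J\<close>, as a symmetric tensor: the sum of all distinct
  rearrangements of the tensor with every index \<open>k\<close> occurring \<open>I k\<close> (resp. \<open>J k\<close>) times.
  The normalisation matters.  Under the isomorphism of the symmetric algebra with the symmetric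
  tensors that sends a product to the sum over all permutations of its factors, this is the
  product of the basis vectors divided by \<open>\<Prod>k. I k! * J k!\<close>; without that division the cocycle
  relation already fails for \<open>N = 2\<close> and \<open>p + q = 2\<close> with \<open>p = 2\<close> or \<open>q = 2\<close>.
\<close>

definition Vpq_basis :: "nat \<Rightarrow> (nat \<Rightarrow> nat) \<Rightarrow> (nat \<Rightarrow> nat) \<Rightarrow> tensor" where
  "Vpq_basis N I J = (\<lambda>(u, w). if set u \<subseteq> {..<N} \<and> set w \<subseteq> {..<N} \<and>
     (\<forall>k<N. count_list u k = I k \<and> count_list w k = J k) then 1 else 0)"

definition multi_indices :: "nat \<Rightarrow> nat \<Rightarrow> (nat \<Rightarrow> nat) set" where
  "multi_indices N p = {I. (\<forall>k\<ge>N. I k = 0) \<and> (\<Sum>k<N. I k) = p}"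

section \<open>Functions with values in the coefficient space\<close>

text \<open>
  As the coefficient space is finite-dimensional, elements of the tensor product of
  \<open>F_space\<close> with it are functions with values in it.
\<close>

definition pf_tensor :: "complex pfun \<Rightarrow> tensor \<Rightarrow> tensor pfun" where
  "pf_tensor f T = (fst f, \<lambda>z m. snd f z * T m)"

definition pf_zero :: "nat \<Rightarrow> tensor pfun" where
  "pf_zero N = (carrier_vec N, \<lambda>z m. 0)"

definition pf_scale :: "complex \<Rightarrow> tensor pfun \<Rightarrow> tensor pfun" where
  "pf_scale c \<Psi> = (fst \<Psi>, \<lambda>z m. c * snd \<Psi> z m)"

definition pf_sum :: "nat \<Rightarrow> 'i set \<Rightarrow> ('i \<Rightarrow> tensor pfun) \<Rightarrow> tensor pfun" where
  "pf_sum N X \<Psi> = (carrier_vec N \<inter> (\<Inter>i\<in>X. fst (\<Psi> i)), \<lambda>z m. \<Sum>i\<in>X. snd (\<Psi> i) z m)"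

definition F_tensor_V :: "nat \<Rightarrow> ('k::field_char_0 \<Rightarrow> complex) \<Rightarrow> nat \<Rightarrow> nat \<Rightarrow> tensor pfun set" where
  "F_tensor_V N \<sigma> p q = {\<Psi>. \<exists>(n::nat) f T. (\<forall>i<n. f i \<in> F_space N \<sigma> \<and> T i \<in> Vpq N p q) \<and>
     fst \<Psi> = fst (pf_sum N {..<n} (\<lambda>i. pf_tensor (f i) (T i))) \<and>
     pf_eq \<Psi> (pf_sum N {..<n} (\<lambda>i. pf_tensor (f i) (T i)))}"

text \<open>The diagonal action of \<open>\<gamma>\<close>, with \<open>(\<gamma> f) z = f (\<gamma>\<^sup>-\<^sup>1 z)\<close> on functions.\<close>

definition pf_act :: "nat \<Rightarrow> ('k::field_char_0 \<Rightarrow> complex) \<Rightarrow> nat \<Rightarrow> nat \<Rightarrow> 'k mat \<Rightarrow> tensor pfun \<Rightarrow> tensor pfun" where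
  "pf_act N \<sigma> p q \<gamma> \<Psi> =
     ({z \<in> carrier_vec N. map_mat \<sigma> (mat_inv \<gamma>) *\<^sub>v z \<in> fst \<Psi>},
      \<lambda>z. Vpq_act N p q (map_mat \<sigma> \<gamma>) (snd \<Psi> (map_mat \<sigma> (mat_inv \<gamma>) *\<^sub>v z)))"

section \<open>Dedekind sums and the cocycle\<close>

definition dedekind ::
  "nat \<Rightarrow> ('k::field_char_0 \<Rightarrow> complex) \<Rightarrow> (nat \<Rightarrow> nat) \<Rightarrow> (nat \<Rightarrow> nat) \<Rightarrow> 'k mat \<Rightarrow> 'k vec set \<Rightarrow> complex pfun" where
  "dedekind N \<sigma> I J A \<Lambda> =
     (if det A = 0 then (carrier_vec N, \<lambda>z. 0)
      else ({z \<in> carrier_vec N. map_mat \<sigma> (mat_inv A) *\<^sub>v z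
               \<in> hyperplane_compl N \<sigma> (mat_image (mat_inv A) \<Lambda>)},
            \<lambda>z. inverse (\<sigma> (det A)) *
                KE N \<sigma> I J (map_mat \<sigma> (mat_inv A) *\<^sub>v z) (mat_image (mat_inv A) \<Lambda>)))"

definition dedekind_smoothed ::
  "nat \<Rightarrow> ('k::field_char_0 \<Rightarrow> complex) \<Rightarrow> 'k set \<Rightarrow> (nat \<Rightarrow> nat) \<Rightarrow> (nat \<Rightarrow> nat) \<Rightarrow> 'k mat \<Rightarrow> 'k set \<Rightarrow> complex pfun" where
  "dedekind_smoothed N \<sigma> P I J A \<II> =
     (let D\<^sub>P = dedekind N \<sigma> I J A (std_lattice N (P \<cdot>\<^bsub>int_ring\<^esub> \<II>));
          D\<^sub>1 = dedekind N \<sigma> I J A (std_lattice N \<II>)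
      in (fst D\<^sub>P \<inter> fst D\<^sub>1, \<lambda>z. snd D\<^sub>P z - of_nat (ideal_norm P) * snd D\<^sub>1 z))"

definition first_columns :: "nat \<Rightarrow> (nat \<Rightarrow> 'k::field_char_0 mat) \<Rightarrow> 'k mat" where
  "first_columns N \<gamma> = mat_of_cols N (map (\<lambda>i. \<gamma> i *\<^sub>v unit_vec N 0) [0..<N])"

definition Phi ::
  "nat \<Rightarrow> ('k::field_char_0 \<Rightarrow> complex) \<Rightarrow> nat \<Rightarrow> nat \<Rightarrow> 'k set \<Rightarrow> 'k set \<Rightarrow> (nat \<Rightarrow> 'k mat) \<Rightarrow> tensor pfun" where
  "Phi N \<sigma> p q P \<II> \<gamma> =
     pf_sum N (multi_indices N p \<times> multi_indices N q) (\<lambda>(I, J).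
       pf_tensor (dedekind_smoothed N \<sigma> P I J (first_columns N \<gamma>) \<II>)
                 (Vpq_act N p q (map_mat \<sigma> (first_columns N \<gamma>)) (Vpq_basis N I J)))"

definition omit :: "nat \<Rightarrow> (nat \<Rightarrow> 'a) \<Rightarrow> nat \<Rightarrow> 'a" where
  "omit i \<gamma> = (\<lambda>j. if j < i then \<gamma> j else \<gamma> (Suc j))"

end

theory Submission
  imports Defs
begin

text \<open>
  Let \<open>\<Lambda>\<^sub>0 \<subseteq> \<Lambda>\<^sub>1\<close> be the standard lattices of \<open>\<II>\<close> and \<open>P \<II>\<close>.  Give the points of \<open>\<Lambda>\<^sub>0\<close>
  the weight \<open>1 - m\<close>, where \<open>m\<close> is the norm of \<open>P\<close>, and all other points of \<open>\<Lambda>\<^sub>1\<close> the weight \<open>1\<close>.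
  A smoothed Dedekind sum is then the value at \<open>0\<close> of a weighted series over \<open>\<Lambda>\<^sub>1\<close> whose terms
  are products of powers of the coordinates of \<open>A\<^sup>-\<^sup>1 (z + x)\<close>, their conjugates and absolute values.
  As \<open>\<II>\<close> and \<open>P\<close> are coprime, the weight sums to zero over representatives of \<open>\<Lambda>\<^sub>1\<close> modulo \<open>\<Lambda>\<^sub>0\<close> along
  every column of \<open>A\<close>.  Hence a summand may be replaced by its difference with its averages along
  these columns, and repeated differences make the series converge absolutely near \<open>s = 0\<close>.  The
  resulting regularised sum is linear in the summand, so the cocycle relation follows from a
  pointwise identity of rational functions at \<open>s = 0\<close>: the relation
  \<open>\<Sum> (-1)\<^sup>i / (det A\<^sub>i \<Prod> (A\<^sub>i\<^sup>-\<^sup>1 x)\<^sub>k) = 0\<close> between the maximal minors of \<open>N + 1\<close> vectors, and its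
  derivatives.

  The analytic continuation of the series is obtained one coordinate at a time, from the
  self-similarity of a lattice in \<open>\<complex>\<close> with complex multiplication: it is a union of translates of
  a multiple of itself, and a Taylor expansion gives the series in terms of series that converge better.
\<close>

section \<open>Locally dominated series of holomorphic functions\<close>

text \<open>Three obstacles shape the proof. First, \<open>KE\<close> admits every connected open
  domain \<open>S\<close>, and \<open>S\<close> may reach 0 only by a detour far to the left.
  Uniqueness of the value thus needs a continuation to every half plane; it is kept as a quotient
  \<open>h / D\<close> with \<open>D\<close> entire and \<open>D 0 \<noteq> 0\<close>, so that poles
  elsewhere do no harm. Second, if \<open>a + b = -2\<close>, the self-similarity under an integer
  multiplier degenerates at \<open>s = 0\<close>. It is complex multiplication, through a multiplier
  whose direction is not a root of unity of the relevant order, that excludes a pole. The exponents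
  \<open>-1, -1\<close> really give one, but expanding a regular series produces them only with a
  coefficient that vanishes at 0. Third, at \<open>s = 0\<close> the series of the various
  \<open>A_i\<close> need not converge, so they cannot be added term by term. A step along a column
  of \<open>A\<close> changes one coordinate of \<open>A^-1 x\<close>, so differences act factor by
  factor; they commute, so all series can be differenced along one common list. The antiholomorphic
  factors combine to one that is independent of \<open>A\<close>, which leaves an identity of
  holomorphic derivatives.\<close>

definition loc_dominated :: "'a set \<Rightarrow> complex set \<Rightarrow> ('a \<Rightarrow> complex \<Rightarrow> complex) \<Rightarrow> bool" where
  "loc_dominated X S F \<longleftrightarrow> (\<forall>x\<in>X. F x holomorphic_on S) \<and>
     (\<forall>s\<in>S. \<exists>r>0. cball s r \<subseteq> S \<and>
        (\<exists>B. B summable_on X \<and> (\<forall>x\<in>X. \<forall>t\<in>cball s r. cmod (F x t) \<le> B x)))"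

lemma loc_dominatedI:
  assumes "\<And>x. x \<in> X \<Longrightarrow> F x holomorphic_on S"
    and "\<And>s. s \<in> S \<Longrightarrow> \<exists>r>0. cball s r \<subseteq> S \<and>
        (\<exists>B. B summable_on X \<and> (\<forall>x\<in>X. \<forall>t\<in>cball s r. cmod (F x t) \<le> B x))"
  shows "loc_dominated X S F"
  unfolding loc_dominated_def by (intro conjI ballI assms)

lemma loc_dominatedD:
  assumes "loc_dominated X S F" "s \<in> S"
  shows "\<exists>r B. r > 0 \<and> cball s r \<subseteq> S \<and> B summable_on X \<and>
    (\<forall>x\<in>X. \<forall>t\<in>cball s r. cmod (F x t) \<le> B x)"
  using assms unfolding loc_dominated_def by meson

lemma loc_dominated_holomorphic:
  "loc_dominated X S F \<Longrightarrow> x \<in> X \<Longrightarrow> F x holomorphic_on S"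
  by (simp add: loc_dominated_def)

lemma loc_dominated_summable:
  assumes "loc_dominated X S F" "s \<in> S"
  shows "(\<lambda>x. F x s) summable_on X"
proof -
  obtain r B where r: "r > 0" "cball s r \<subseteq> S" and B: "B summable_on X"
    "\<forall>x\<in>X. \<forall>t\<in>cball s r. cmod (F x t) \<le> B x"
    using loc_dominatedD[OF assms] by blast
  have "cmod (F x s) \<le> B x" if "x \<in> X" for x
    using B(2) r(1) that by (metis centre_in_cball less_imp_le)
  hence "(\<lambda>x. cmod (F x s)) summable_on X"
    by (intro summable_on_comparison_test[OF B(1)]) simp_all
  thus ?thesis by (rule abs_summable_summable)
qed

text \<open>The dominating bound is the M of the Weierstrass test: finite partial sums converge
  uniformly on a closed disc around each point, and the limit is holomorphic inside the
  disc.\<close>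

lemma loc_dominated_infsum_holomorphic:
  assumes "loc_dominated X S F"
  shows "(\<lambda>s. \<Sum>\<^sub>\<infinity>x\<in>X. F x s) holomorphic_on S"
proof -
  have "(\<lambda>s. \<Sum>\<^sub>\<infinity>x\<in>X. F x s) field_differentiable (at s within S)" if s: "s \<in> S" for s
  proof -
    obtain r B where r: "r > 0" "cball s r \<subseteq> S" and B: "B summable_on X"
      "\<forall>x\<in>X. \<forall>t\<in>cball s r. cmod (F x t) \<le> B x"
      using loc_dominatedD[OF assms s] by blast
    have u: "uniform_limit (cball s r) (\<lambda>Y t. \<Sum>x\<in>Y. F x t) (\<lambda>t. \<Sum>\<^sub>\<infinity>x\<in>X. F x t)
        (finite_subsets_at_top X)"
      using B by (intro Weierstrass_m_test_general) auto
    have h: "F x holomorphic_on cball s r" if "x \<in> X" for x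
      using loc_dominated_holomorphic[OF assms that] r(2) holomorphic_on_subset by blast
    have "\<forall>\<^sub>F Y in finite_subsets_at_top X. continuous_on (cball s r) (\<lambda>t. \<Sum>x\<in>Y. F x t) \<and>
        (\<lambda>t. \<Sum>x\<in>Y. F x t) holomorphic_on ball s r"
    proof (rule eventually_finite_subsets_at_top_weakI)
      fix Y assume Y: "finite Y" "Y \<subseteq> X"
      have "(\<lambda>t. \<Sum>x\<in>Y. F x t) holomorphic_on cball s r"
        using h Y by (intro holomorphic_on_sum) blast
      thus "continuous_on (cball s r) (\<lambda>t. \<Sum>x\<in>Y. F x t) \<and>
        (\<lambda>t. \<Sum>x\<in>Y. F x t) holomorphic_on ball s r"
        using ball_subset_cball holomorphic_on_subset holomorphic_on_imp_continuous_on by blast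
    qed
    then have "(\<lambda>s. \<Sum>\<^sub>\<infinity>x\<in>X. F x s) holomorphic_on ball s r"
      by (rule holomorphic_uniform_limit[OF _ u]) auto
    hence "(\<lambda>s. \<Sum>\<^sub>\<infinity>x\<in>X. F x s) field_differentiable (at s)"
      using r(1) by (simp add: holomorphic_on_imp_differentiable_at)
    thus ?thesis by (rule field_differentiable_at_within)
  qed
  thus ?thesis by (simp add: holomorphic_on_def)
qed

lemma loc_dominated_mono:
  assumes "loc_dominated X S F" "Y \<subseteq> X" "open S'" "S' \<subseteq> S"
  shows "loc_dominated Y S' F"
proof (rule loc_dominatedI)
  show "F x holomorphic_on S'" if "x \<in> Y" for x
    using that assms loc_dominated_holomorphic holomorphic_on_subset by (metis subsetD)
  fix s assume s: "s \<in> S'"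
  obtain r B where r: "r > 0" "cball s r \<subseteq> S" and B: "B summable_on X"
      "\<forall>x\<in>X. \<forall>t\<in>cball s r. cmod (F x t) \<le> B x"
    using loc_dominatedD[OF assms(1) subsetD[OF assms(4) s]] by blast
  obtain e where e: "e > 0" "cball s e \<subseteq> S'" using assms(3) s open_contains_cball by blast
  have "B summable_on Y" using B(1) assms(2) by (rule summable_on_subset_banach)
  moreover have "cball s (min r e) \<subseteq> S'" using e by auto
  ultimately show "\<exists>r>0. cball s r \<subseteq> S' \<and>
        (\<exists>B. B summable_on Y \<and> (\<forall>x\<in>Y. \<forall>t\<in>cball s r. cmod (F x t) \<le> B x))"
    using r(1) e(1) B(2) assms(2) by (intro exI[of _ "min r e"] conjI exI[of _ B]) auto
qed

lemma loc_dominated_add: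
  assumes "loc_dominated X S F" "loc_dominated X S G"
  shows "loc_dominated X S (\<lambda>x s. F x s + G x s)"
proof (rule loc_dominatedI)
  show "(\<lambda>s. F x s + G x s) holomorphic_on S" if "x \<in> X" for x
    using that loc_dominated_holomorphic[OF assms(1)] loc_dominated_holomorphic[OF assms(2)]
    by (intro holomorphic_on_add) auto
  fix s assume s: "s \<in> S"
  obtain r B where r: "r > 0" "cball s r \<subseteq> S" and B: "B summable_on X"
      "\<forall>x\<in>X. \<forall>t\<in>cball s r. cmod (F x t) \<le> B x"
    using loc_dominatedD[OF assms(1) s] by blast
  obtain r' B' where r': "r' > 0" "cball s r' \<subseteq> S" and B': "B' summable_on X"
      "\<forall>x\<in>X. \<forall>t\<in>cball s r'. cmod (G x t) \<le> B' x"
    using loc_dominatedD[OF assms(2) s] by blast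
  have "(\<lambda>x. B x + B' x) summable_on X" using B B' by (intro summable_on_add)
  moreover have "cmod (F x t + G x t) \<le> B x + B' x" if "x \<in> X" "t \<in> cball s (min r r')" for x t
    using norm_triangle_ineq[of "F x t" "G x t"] bspec[OF bspec[OF B(2) that(1)], of t] bspec[OF bspec[OF B'(2) that(1)], of t] that(2) by simp
  moreover have "cball s (min r r') \<subseteq> S" using r by auto
  ultimately show "\<exists>r>0. cball s r \<subseteq> S \<and>
        (\<exists>B. B summable_on X \<and> (\<forall>x\<in>X. \<forall>t\<in>cball s r. cmod (F x t + G x t) \<le> B x))"
    using r r' by (intro exI[of _ "min r r'"] conjI exI[of _ "\<lambda>x. B x + B' x"]) auto
qed

lemma loc_dominated_cmult:
  assumes "loc_dominated X S F" "c holomorphic_on S"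
  shows "loc_dominated X S (\<lambda>x s. c s * F x s)"
proof (rule loc_dominatedI)
  show "(\<lambda>s. c s * F x s) holomorphic_on S" if "x \<in> X" for x
    using that assms(2) loc_dominated_holomorphic[OF assms(1)] by (intro holomorphic_on_mult) auto
  fix s assume s: "s \<in> S"
  obtain r B where r: "r > 0" "cball s r \<subseteq> S" and B: "B summable_on X"
      "\<forall>x\<in>X. \<forall>t\<in>cball s r. cmod (F x t) \<le> B x"
    using loc_dominatedD[OF assms(1) s] by blast
  have "continuous_on (cball s r) c"
    using assms(2) r(2) holomorphic_on_imp_continuous_on continuous_on_subset by blast
  hence "bounded (c ` cball s r)" by (intro compact_imp_bounded compact_continuous_image) auto
  then obtain K where K: "\<And>t. t \<in> cball s r \<Longrightarrow> cmod (c t) \<le> K"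
    unfolding bounded_iff by blast
  have K0: "K \<ge> 0" using K[of s] r(1) order_trans[OF norm_ge_zero] by auto
  have "(\<lambda>x. K * B x) summable_on X" using B by (intro summable_on_cmult_right)
  moreover have "cmod (c t * F x t) \<le> K * B x" if "x \<in> X" "t \<in> cball s r" for x t
    unfolding norm_mult using K[OF that(2)] bspec[OF bspec[OF B(2) that(1)] that(2)] K0 by (intro mult_mono) auto
  ultimately show "\<exists>r>0. cball s r \<subseteq> S \<and>
        (\<exists>B. B summable_on X \<and> (\<forall>x\<in>X. \<forall>t\<in>cball s r. cmod (c t * F x t) \<le> B x))"
    using r by (intro exI[of _ r] conjI exI[of _ "\<lambda>x. K * B x"]) auto
qed

lemma loc_dominated_0: "open S \<Longrightarrow> loc_dominated X S (\<lambda>x s. 0)"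
proof (rule loc_dominatedI)
  fix s assume "open S" "s \<in> S"
  then obtain e where "e > 0" "cball s e \<subseteq> S" using open_contains_cball by blast
  moreover have "(\<lambda>x. 0::real) summable_on X" by simp
  ultimately show "\<exists>r>0. cball s r \<subseteq> S \<and>
        (\<exists>B. B summable_on X \<and> (\<forall>x\<in>X. \<forall>t\<in>cball s r. cmod 0 \<le> B x))"
    by (intro exI[of _ e] conjI exI[of _ "\<lambda>x. 0::real"]) auto
qed auto

lemma loc_dominated_sum:
  assumes "open S" "\<And>i. i \<in> I \<Longrightarrow> loc_dominated X S (F i)"
  shows "loc_dominated X S (\<lambda>x s. \<Sum>i\<in>I. F i x s)"
  using assms
proof (induction I rule: infinite_finite_induct)
  case (insert i I)
  thus ?case by (simp add: loc_dominated_add)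
qed (auto intro: loc_dominated_0)

lemma loc_dominated_cong:
  assumes "\<And>x s. x \<in> X \<Longrightarrow> s \<in> S \<Longrightarrow> F x s = G x s" "loc_dominated X S F"
  shows "loc_dominated X S G"
proof -
  have "G x holomorphic_on S" if "x \<in> X" for x
    using loc_dominated_holomorphic[OF assms(2) that] assms(1)[OF that] holomorphic_transform by blast
  moreover have "\<exists>r>0. cball s r \<subseteq> S \<and>
        (\<exists>B. B summable_on X \<and> (\<forall>x\<in>X. \<forall>t\<in>cball s r. cmod (G x t) \<le> B x))" if s: "s \<in> S" for s
  proof -
    obtain r B where "r > 0" "cball s r \<subseteq> S" "B summable_on X"
      "\<forall>x\<in>X. \<forall>t\<in>cball s r. cmod (F x t) \<le> B x"
      using loc_dominatedD[OF assms(2) s] by blast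
    thus ?thesis using assms(1) by (intro exI[of _ r] conjI exI[of _ B] ballI) (simp_all, metis mem_cball subsetD)
  qed
  ultimately show ?thesis by (rule loc_dominatedI)
qed

lemma loc_dominated_reindex:
  assumes "loc_dominated Y S F" "inj_on h X" "h ` X \<subseteq> Y"
  shows "loc_dominated X S (\<lambda>x. F (h x))"
proof (rule loc_dominatedI)
  show "F (h x) holomorphic_on S" if "x \<in> X" for x
    using that assms(3) by (intro loc_dominated_holomorphic[OF assms(1)]) auto
  fix s assume s: "s \<in> S"
  obtain r B where r: "r > 0" "cball s r \<subseteq> S" and B: "B summable_on Y"
      "\<forall>x\<in>Y. \<forall>t\<in>cball s r. cmod (F x t) \<le> B x"
    using loc_dominatedD[OF assms(1) s] by blast
  have "B summable_on (h ` X)" using B(1) assms(3) by (rule summable_on_subset_banach)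
  hence "(B \<circ> h) summable_on X" using summable_on_reindex[OF assms(2)] by blast
  moreover have "\<forall>x\<in>X. \<forall>t\<in>cball s r. cmod (F (h x) t) \<le> (B \<circ> h) x"
    using B(2) assms(3) by (simp add: image_subset_iff)
  ultimately show "\<exists>r>0. cball s r \<subseteq> S \<and>
        (\<exists>B. B summable_on X \<and> (\<forall>x\<in>X. \<forall>t\<in>cball s r. cmod (F (h x) t) \<le> B x))"
    using r by blast
qed

text \<open>Any finite family of functions \<open>g\<close> lies in a finite box, where the sum of
  products factors into a product of sums; with nonnegative terms this is bounded by the product of
  the total sums.\<close>

lemma summable_on_prod_PiE_nonneg:
  fixes f :: "'i \<Rightarrow> 'a \<Rightarrow> real"
  assumes A: "finite A" and f: "\<And>k. k \<in> A \<Longrightarrow> f k summable_on X k"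
    and nn: "\<And>k x. k \<in> A \<Longrightarrow> x \<in> X k \<Longrightarrow> f k x \<ge> 0"
  shows "(\<lambda>g. \<Prod>k\<in>A. f k (g k)) summable_on PiE A X"
proof (rule nonneg_bdd_above_summable_on)
  show "(\<Prod>k\<in>A. f k (g k)) \<ge> 0" if "g \<in> PiE A X" for g
    using that nn by (intro prod_nonneg) (auto simp: PiE_def Pi_def)
  show "bdd_above (sum (\<lambda>g. \<Prod>k\<in>A. f k (g k)) ` {F. F \<subseteq> PiE A X \<and> finite F})"
  proof (rule bdd_aboveI2)
    fix P assume P: "P \<in> {F. F \<subseteq> PiE A X \<and> finite F}"
    define Y where "Y k = (\<lambda>g. g k) ` P" for k
    have Yf: "finite (Y k)" for k using P by (simp add: Y_def)
    have Y: "Y k \<subseteq> X k" if "k \<in> A" for k using P that by (auto simp: Y_def PiE_def Pi_def)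
    have sub: "P \<subseteq> PiE A Y" using P by (auto simp: Y_def PiE_def Pi_def extensional_def)
    have "(\<Sum>g\<in>P. \<Prod>k\<in>A. f k (g k)) \<le> (\<Sum>g\<in>PiE A Y. \<Prod>k\<in>A. f k (g k))"
    proof (intro sum_mono2 prod_nonneg finite_PiE A Yf sub)
      fix g k assume "g \<in> PiE A Y - P" "k \<in> A"
      hence "g k \<in> Y k" by (auto simp: PiE_def Pi_def)
      thus "0 \<le> f k (g k)" using Y nn \<open>k \<in> A\<close> by blast
    qed
    also have "\<dots> = (\<Prod>k\<in>A. \<Sum>x\<in>Y k. f k x)"
      using A Yf by (simp add: prod_sum_PiE)
    also have "\<dots> \<le> (\<Prod>k\<in>A. infsum (f k) (X k))"
      using Y nn Yf f by (intro prod_mono conjI sum_nonneg finite_sum_le_infsum) auto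
    finally show "(\<Sum>g\<in>P. \<Prod>k\<in>A. f k (g k)) \<le> (\<Prod>k\<in>A. infsum (f k) (X k))" .
  qed
qed

lemma loc_dominated_prod_PiE:
  assumes A: "finite A" and S: "open S" and F: "\<And>k. k \<in> A \<Longrightarrow> loc_dominated (X k) S (F k)"
  shows "loc_dominated (PiE A X) S (\<lambda>g s. \<Prod>k\<in>A. F k (g k) s)"
proof (rule loc_dominatedI)
  show "(\<lambda>s. \<Prod>k\<in>A. F k (g k) s) holomorphic_on S" if "g \<in> PiE A X" for g
    using that loc_dominated_holomorphic[OF F] by (intro holomorphic_on_prod) (auto simp: PiE_def Pi_def)
  fix s assume s: "s \<in> S"
  have "\<forall>k\<in>A. \<exists>r B. r > 0 \<and> B summable_on X k \<and> (\<forall>x\<in>X k. \<forall>t\<in>cball s r. cmod (F k x t) \<le> B x)"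
    using loc_dominatedD[OF F s] by blast
  then obtain r B where r: "\<And>k. k \<in> A \<Longrightarrow> r k > (0::real)"
    and B: "\<And>k. k \<in> A \<Longrightarrow> B k summable_on X k"
      "\<And>k x t. k \<in> A \<Longrightarrow> x \<in> X k \<Longrightarrow> t \<in> cball s (r k) \<Longrightarrow> cmod (F k x t) \<le> B k x"
    by metis
  obtain e where e: "e > 0" "cball s e \<subseteq> S" using S s open_contains_cball by blast
  \<comment> \<open>One radius must serve all factors; inserting \<open>e\<close> keeps the disc
    inside \<open>S\<close>, and the minimum exists even for empty \<open>A\<close>.\<close>
  define \<rho> where "\<rho> = Min (insert e (r ` A))"
  have \<rho>: "\<rho> > 0" "\<rho> \<le> e" "\<And>k. k \<in> A \<Longrightarrow> \<rho> \<le> r k"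
    using A r e by (auto simp: \<rho>_def)
  have nn: "B k x \<ge> 0" if "k \<in> A" "x \<in> X k" for k x
    using B(2)[OF that, of s] r[OF that(1)] order_trans[OF norm_ge_zero] by auto
  have "(\<lambda>g. \<Prod>k\<in>A. B k (g k)) summable_on PiE A X"
    using A B(1) nn by (rule summable_on_prod_PiE_nonneg)
  moreover have "cmod (\<Prod>k\<in>A. F k (g k) t) \<le> (\<Prod>k\<in>A. B k (g k))"
    if "g \<in> PiE A X" "t \<in> cball s \<rho>" for g t
    unfolding prod_norm[symmetric] using that \<rho>(3) 
    by (intro prod_mono conjI B(2)) (auto simp: PiE_def Pi_def intro: order_trans)
  moreover have "cball s \<rho> \<subseteq> S" using e \<rho>(2) by auto
  ultimately show "\<exists>r>0. cball s r \<subseteq> S \<and> (\<exists>B. B summable_on PiE A X \<and>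
     (\<forall>x\<in>PiE A X. \<forall>t\<in>cball s r. cmod (\<Prod>k\<in>A. F k (x k) t) \<le> B x))"
    using \<rho>(1) by (intro exI[of _ \<rho>] conjI exI[of _ "\<lambda>g. \<Prod>k\<in>A. B k (g k)"]) auto
qed

section \<open>Continuation as a quotient by an entire function\<close>

text \<open>Meromorphic continuation of \<open>F\<close> from \<open>Re s > B\<close> to
  \<open>Re s > A\<close> as \<open>h / D\<close>, with no pole at 0 if 0 lies in that half plane.
  The denominator is entire, so that denominators can be multiplied whatever the half planes
  are.\<close>

definition qcont :: "real \<Rightarrow> real \<Rightarrow> (complex \<Rightarrow> complex) \<Rightarrow> bool" where
  "qcont A B F \<longleftrightarrow> (\<exists>D h. D holomorphic_on UNIV \<and> D 0 \<noteq> 0 \<and> h holomorphic_on {s. Re s > A} \<and>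
     (\<forall>s. Re s > B \<longrightarrow> D s * F s = h s))"

lemma qcont_mono: "qcont A B F \<Longrightarrow> A \<le> A' \<Longrightarrow> B \<le> B' \<Longrightarrow> qcont A' B' F"
  unfolding qcont_def by (elim exE conjE, rule_tac x=D in exI, rule_tac x=h in exI)
    (auto elim!: holomorphic_on_subset)

lemma qcont_cong: "qcont A B F \<Longrightarrow> (\<And>s. Re s > B \<Longrightarrow> F s = G s) \<Longrightarrow> qcont A B G"
  unfolding qcont_def by metis

lemma qcont_holomorphic: "F holomorphic_on {s. Re s > A} \<Longrightarrow> A \<le> B \<Longrightarrow> qcont A B F"
  unfolding qcont_def by (intro exI[of _ "\<lambda>s. 1"] exI[of _ F]) auto

lemma qcont_const: "A \<le> B \<Longrightarrow> qcont A B (\<lambda>s. c)"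
  by (rule qcont_holomorphic) auto

lemma qcont_add:
  assumes "qcont A B F" "qcont A B G"
  shows "qcont A B (\<lambda>s. F s + G s)"
proof -
  obtain D h where D: "D holomorphic_on UNIV" "D 0 \<noteq> 0" "h holomorphic_on {s. Re s > A}"
     "\<And>s. Re s > B \<Longrightarrow> D s * F s = h s" using assms(1) unfolding qcont_def by blast
  obtain E k where E: "E holomorphic_on UNIV" "E 0 \<noteq> 0" "k holomorphic_on {s. Re s > A}"
     "\<And>s. Re s > B \<Longrightarrow> E s * G s = k s" using assms(2) unfolding qcont_def by blast
  note sub = holomorphic_on_subset[OF _ subset_UNIV]
  have "D s * E s * (F s + G s) = E s * h s + D s * k s" if "Re s > B" for s
    unfolding D(4)[OF that, symmetric] E(4)[OF that, symmetric] by (simp add: algebra_simps)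
  thus ?thesis unfolding qcont_def
    using D(1-3) E(1-3)
    by (intro exI[of _ "\<lambda>s. D s * E s"] exI[of _ "\<lambda>s. E s * h s + D s * k s"])
       (auto intro!: holomorphic_intros intro: sub)
qed

lemma qcont_mult:
  assumes "qcont A B F" "qcont A B G"
  shows "qcont A B (\<lambda>s. F s * G s)"
proof -
  obtain D h where D: "D holomorphic_on UNIV" "D 0 \<noteq> 0" "h holomorphic_on {s. Re s > A}"
     "\<And>s. Re s > B \<Longrightarrow> D s * F s = h s" using assms(1) unfolding qcont_def by blast
  obtain E k where E: "E holomorphic_on UNIV" "E 0 \<noteq> 0" "k holomorphic_on {s. Re s > A}"
     "\<And>s. Re s > B \<Longrightarrow> E s * G s = k s" using assms(2) unfolding qcont_def by blast
  have "D s * E s * (F s * G s) = h s * k s" if "Re s > B" for s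
    unfolding D(4)[OF that, symmetric] E(4)[OF that, symmetric] by (simp add: algebra_simps)
  thus ?thesis unfolding qcont_def
    using D(1-3) E(1-3)
    by (intro exI[of _ "\<lambda>s. D s * E s"] exI[of _ "\<lambda>s. h s * k s"])
       (auto intro!: holomorphic_intros)
qed

lemma qcont_cmult:
  assumes "qcont A B F" "c holomorphic_on UNIV"
  shows "qcont A B (\<lambda>s. c s * F s)"
proof -
  obtain D h where D: "D holomorphic_on UNIV" "D 0 \<noteq> 0" "h holomorphic_on {s. Re s > A}"
     "\<And>s. Re s > B \<Longrightarrow> D s * F s = h s" using assms(1) unfolding qcont_def by blast
  have "D s * (c s * F s) = c s * h s" if "Re s > B" for s
    unfolding D(4)[OF that, symmetric] by (simp add: algebra_simps)
  thus ?thesis unfolding qcont_def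
    using D(1-3) holomorphic_on_subset[OF assms(2) subset_UNIV]
    by (intro exI[of _ D] exI[of _ "\<lambda>s. c s * h s"]) (auto intro!: holomorphic_intros)
qed

lemma qcont_sum:
  assumes "\<And>i. i \<in> I \<Longrightarrow> qcont A B (F i)" "A \<le> B"
  shows "qcont A B (\<lambda>s. \<Sum>i\<in>I. F i s)"
  using assms(1)
  by (induction I rule: infinite_finite_induct)
     (auto intro!: qcont_add qcont_const assms(2))

lemma qcont_prod:
  assumes "\<And>i. i \<in> I \<Longrightarrow> qcont A B (F i)" "A \<le> B"
  shows "qcont A B (\<lambda>s. \<Prod>i\<in>I. F i s)"
  using assms(1)
  by (induction I rule: infinite_finite_induct)
     (auto intro!: qcont_mult qcont_const assms(2))

text \<open>This is how a functional equation \<open>d F = ...\<close> is solved for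
  \<open>F\<close>: the factor \<open>d\<close> is absorbed into the denominator, which is possible
  as it does not vanish at 0.\<close>

lemma qcont_cancel:
  assumes "qcont A B (\<lambda>s. d s * F s)" "d holomorphic_on UNIV" "d 0 \<noteq> 0"
  shows "qcont A B F"
proof -
  obtain D h where D: "D holomorphic_on UNIV" "D 0 \<noteq> 0" "h holomorphic_on {s. Re s > A}"
     "\<And>s. Re s > B \<Longrightarrow> D s * (d s * F s) = h s" using assms(1) unfolding qcont_def by blast
  thus ?thesis unfolding qcont_def using assms(2,3)
    by (intro exI[of _ "\<lambda>s. D s * d s"] exI[of _ h]) (auto intro!: holomorphic_intros simp: mult.assoc)
qed

section \<open>The summand of a one-dimensional Kronecker--Eisenstein series\<close>

text \<open>The term \<open>w^a cnj w^b |w|^(-s)\<close>, with integer exponents because Taylor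
  expansion lowers both. The value 0 at the origin drops the singular term from the series of the
  untranslated lattice and keeps the term multiplicative in \<open>w\<close>.\<close>

definition ke_term :: "int \<Rightarrow> int \<Rightarrow> complex \<Rightarrow> complex \<Rightarrow> complex" where
  "ke_term a b s w = (if w = 0 then 0 else
     w powi a * cnj w powi b * exp (- s * of_real (ln (cmod w))))"

lemma ke_term_0 [simp]: "ke_term a b s 0 = 0"
  by (simp add: ke_term_def)

lemma norm_ke_term:
  assumes "w \<noteq> 0"
  shows "cmod (ke_term a b s w) = cmod w powr (of_int (a + b) - Re s)"
proof -
  have p: "cmod w powi k = exp (of_int k * ln (cmod w))" for k
    using assms powr_real_of_int'[of "cmod w" k] by (simp add: powr_def)
  show ?thesis
    using assms by (simp add: ke_term_def norm_mult norm_power_int p powr_def exp_add[symmetric] algebra_simps)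
qed

lemma ke_term_mult: "ke_term a b s (u * w) = ke_term a b s u * ke_term a b s w"
  by (auto simp: ke_term_def power_int_mult_distrib norm_mult ln_mult algebra_simps exp_diff exp_add exp_minus field_simps)

lemma ke_term_holomorphic [holomorphic_intros]:
  "f holomorphic_on S \<Longrightarrow> (\<lambda>s. ke_term a b (f s) w) holomorphic_on S"
  unfolding ke_term_def by (cases "w = 0") (auto intro!: holomorphic_intros)

lemma ke_term_shift:
  assumes "w \<noteq> 0"
  shows "ke_term (a - int i) (b - int j) s w = ke_term a b s w / (w ^ i * cnj w ^ j)"
  using assms by (simp add: ke_term_def power_int_diff field_simps)

text \<open>On the right half plane \<open>Ln\<close> commutes with conjugation, so
  \<open>|u|^(-s)\<close> splits as \<open>u^(-s/2) cnj u^(-s/2)\<close>. This separates a power of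
  \<open>u\<close> from a power of \<open>cnj u\<close>, each with its own binomial series.\<close>

lemma ke_term_powr:
  assumes "Re u > 0"
  shows "ke_term a b s u = u powr (of_int a - s / 2) * cnj u powr (of_int b - s / 2)"
proof -
  have u: "u \<noteq> 0" "u \<notin> \<real>\<^sub>\<le>\<^sub>0" using assms by (auto elim: nonpos_Reals_cases)
  have l: "complex_of_real (ln (cmod u)) = (Ln u + cnj (Ln u)) / 2"
    using u(1) by (simp add: complex_add_cnj Re_Ln)
  have c: "Ln (cnj u) = cnj (Ln u)" using u(2) by (simp add: cnj_Ln)
  have p: "w powi k = exp (of_int k * Ln w)" if "w \<noteq> 0" for w k
    using that by (metis exp_Ln exp_power_int mult.commute)
  show ?thesis
    using u(1) by (simp add: ke_term_def powr_def p c l exp_add[symmetric] algebra_simps add_divide_distrib)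
qed

text \<open>From \<open>|a - i| \<le> B + i\<close> in each factor; the majorants are the
  coefficients of \<open>(1 - x)^(-B)\<close>.\<close>

lemma norm_gbinomial_le:
  fixes a :: complex
  assumes "cmod a \<le> B"
  shows "cmod (a gchoose k) \<le> (-1) ^ k * ((-B) gchoose k)"
proof -
  have "cmod (a gchoose k) = (\<Prod>i=0..<k. cmod (a - of_nat i)) / fact k"
    by (simp add: gbinomial_prod_rev norm_divide prod_norm)
  also have "\<dots> \<le> (\<Prod>i=0..<k. B + of_nat i) / fact k"
  proof (intro divide_right_mono prod_mono conjI)
    fix i show "cmod (a - of_nat i) \<le> B + of_nat i"
      using norm_triangle_ineq4[of a "of_nat i"] assms by simp
  qed auto
  also have "(\<Prod>i=0..<k. B + of_nat i) = (-1) ^ k * (\<Prod>i=0..<k. -B - of_nat i)"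
    by (induction k) (auto simp: algebra_simps)
  finally show ?thesis by (simp add: gbinomial_prod_rev)
qed

text \<open>The tail of the binomial series is compared with the majorant series of
  \<open>(1 - x)^(-B)\<close> at \<open>x = 1/2\<close>, whose sum is \<open>2 powr B\<close>; the
  factor \<open>2 ^ M\<close> comes from trading \<open>(1/2)^M\<close> for
  \<open>|\<tau>|^M\<close>.\<close>

lemma binomial_remainder_bound:
  fixes a \<tau> :: complex
  assumes \<tau>: "cmod \<tau> \<le> 1/2" and a: "cmod a \<le> B"
  shows "cmod ((1 + \<tau>) powr a - (\<Sum>n<M. (a gchoose n) * \<tau> ^ n)) \<le> 2 ^ M * 2 powr B * cmod \<tau> ^ M"
proof -
  define p where "p k = (-1) ^ k * ((-B) gchoose k)" for k
  have p0: "p k \<ge> 0" for k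
    using norm_gbinomial_le[OF a, of k] by (auto simp: p_def intro: order_trans[OF norm_ge_zero])
  have sp: "(\<lambda>k. p k * (1/2) ^ k) sums (1/2) powr (-B)"
    using gen_binomial_real[of "-(1/2)" "-B"] by (simp add: p_def power_minus' mult_ac)
  have sm: "(\<lambda>n. (a gchoose n) * \<tau> ^ n) sums (1 + \<tau>) powr a"
    using \<tau> by (intro gen_binomial_complex) auto
  have s2: "(\<lambda>n. (a gchoose (n + M)) * \<tau> ^ (n + M)) sums
      ((1 + \<tau>) powr a - (\<Sum>n<M. (a gchoose n) * \<tau> ^ n))"
    by (rule sums_split_initial_segment[OF sm])
  have le: "cmod ((a gchoose (n + M)) * \<tau> ^ (n + M)) \<le> 2 ^ M * cmod \<tau> ^ M * (p (n + M) * (1/2) ^ (n + M))" for n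
  proof -
    have "cmod \<tau> ^ (n + M) \<le> (1/2) ^ n * cmod \<tau> ^ M"
      unfolding power_add using \<tau> by (intro mult_right_mono power_mono) auto
    also have "\<dots> = 2 ^ M * cmod \<tau> ^ M * (1/2) ^ (n + M)"
      by (simp add: power_add field_simps)
    finally have "cmod (a gchoose (n + M)) * cmod \<tau> ^ (n + M) \<le>
        p (n + M) * (2 ^ M * cmod \<tau> ^ M * (1/2) ^ (n + M))"
      using norm_gbinomial_le[OF a, of "n + M"] p0 by (intro mult_mono) (auto simp: p_def)
    thus ?thesis by (simp add: norm_mult norm_power mult_ac)
  qed
  have s3: "summable (\<lambda>n. 2 ^ M * cmod \<tau> ^ M * (p (n + M) * (1/2) ^ (n + M)))"
    using sp by (intro summable_mult summable_ignore_initial_segment) (simp add: sums_iff)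
  have "cmod ((1 + \<tau>) powr a - (\<Sum>n<M. (a gchoose n) * \<tau> ^ n))
      \<le> (\<Sum>n. 2 ^ M * cmod \<tau> ^ M * (p (n + M) * (1/2) ^ (n + M)))"
    using s2 le s3 norm_suminf_le[OF le s3] by (simp add: sums_iff)
  also have "\<dots> = 2 ^ M * cmod \<tau> ^ M * (\<Sum>n. p (n + M) * (1/2) ^ (n + M))"
    using sp by (intro suminf_mult summable_ignore_initial_segment) (simp add: sums_iff)
  also have "\<dots> \<le> 2 ^ M * cmod \<tau> ^ M * (\<Sum>n. p n * (1/2) ^ n)"
    using suminf_minus_initial_segment[of "\<lambda>n. p n * (1/2) ^ n" M] sp p0
    by (intro mult_left_mono) (auto simp: sums_iff intro!: sum_nonneg)
  also have "(\<Sum>n. p n * (1/2) ^ n) = 2 powr B"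
    using sp by (simp add: sums_iff powr_minus powr_divide)
  finally show ?thesis by (simp add: mult_ac)
qed

text \<open>Remainder of the Taylor expansion at \<open>w\<close> in \<open>t\<close> and
  \<open>cnj t\<close>. The square range \<open>i, j < M\<close>, rather than
  \<open>i + j < M\<close>, makes the Taylor part a product of two truncated binomial
  series.\<close>

definition ke_rem :: "nat \<Rightarrow> int \<Rightarrow> int \<Rightarrow> complex \<Rightarrow> complex \<Rightarrow> complex \<Rightarrow> complex" where
  "ke_rem M a b s w t = ke_term a b s (w + t) - (\<Sum>i<M. \<Sum>j<M.
     ((of_int a - s / 2) gchoose i) * ((of_int b - s / 2) gchoose j) * t ^ i * cnj t ^ j *
     ke_term (a - int i) (b - int j) s w)"

lemma ke_rem_holomorphic: "(\<lambda>s. ke_rem M a b s w t) holomorphic_on S"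
  unfolding ke_rem_def gbinomial_prod_rev by (intro holomorphic_intros) auto

text \<open>With \<open>w + t = w (1 + \<tau>)\<close> the remainder is
  \<open>ke_term a b s w\<close> times \<open>X Y - P Q\<close>, where \<open>P\<close>,
  \<open>Q\<close> truncate the binomial series of \<open>X\<close>, \<open>Y\<close>. This is
  \<open>(X - P) Y + P (Y - Q)\<close>, of size \<open>|\<tau>|^M\<close>, so each unit of
  \<open>M\<close> gains one power of decay in \<open>w\<close>.\<close>

lemma ke_rem_bound:
  assumes w: "w \<noteq> 0" "2 * cmod t \<le> cmod w"
    and B: "cmod (of_int a - s / 2) \<le> B" "cmod (of_int b - s / 2) \<le> B"
  shows "cmod (ke_rem M a b s w t) \<le>
    (2 ^ M * 2 powr B * (2 * 2 powr B + 2 ^ M * 2 powr B)) * cmod t ^ M * cmod w powr (of_int (a + b) - Re s - M)"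
proof -
  define \<tau> where "\<tau> = t / w"
  define X where "X = (1 + \<tau>) powr (of_int a - s / 2)"
  define Y where "Y = (1 + cnj \<tau>) powr (of_int b - s / 2)"
  define P where "P = (\<Sum>n<M. ((of_int a - s / 2) gchoose n) * \<tau> ^ n)"
  define Q where "Q = (\<Sum>n<M. ((of_int b - s / 2) gchoose n) * cnj \<tau> ^ n)"
  define K where "K = 2 ^ M * 2 powr B"
  have \<tau>: "cmod \<tau> \<le> 1/2" using w by (simp add: \<tau>_def norm_divide field_simps)
  have \<tau>': "cmod (cnj \<tau>) \<le> 1/2" using \<tau> by simp
  have re: "Re (1 + \<tau>) > 0" using \<tau> abs_Re_le_cmod[of \<tau>] by simp
  have eq: "w + t = w * (1 + \<tau>)" using w by (simp add: \<tau>_def field_simps)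
  have t1: "ke_term a b s (w + t) = ke_term a b s w * (X * Y)"
    unfolding eq ke_term_mult ke_term_powr[OF re] by (simp add: X_def Y_def)
  have t2: "(\<Sum>i<M. \<Sum>j<M.
     ((of_int a - s / 2) gchoose i) * ((of_int b - s / 2) gchoose j) * t ^ i * cnj t ^ j *
     ke_term (a - int i) (b - int j) s w) = ke_term a b s w * (P * Q)"
  proof -
    have "P * Q = (\<Sum>i<M. \<Sum>j<M. ((of_int a - s / 2) gchoose i) * \<tau> ^ i *
        (((of_int b - s / 2) gchoose j) * cnj \<tau> ^ j))"
      by (simp add: P_def Q_def sum_product)
    thus ?thesis unfolding sum_distrib_left[where r = "ke_term a b s w"] 
      by (simp only:) (simp add: sum_distrib_left ke_term_shift[OF w(1)] \<tau>_def power_divide mult_ac)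
  qed
  have XP: "cmod (X - P) \<le> K * cmod \<tau> ^ M" unfolding X_def P_def K_def
    by (rule binomial_remainder_bound[OF \<tau> B(1)])
  have YQ: "cmod (Y - Q) \<le> K * cmod \<tau> ^ M" unfolding Y_def Q_def K_def
    using binomial_remainder_bound[OF \<tau>' B(2), of M] by simp
  have X: "cmod X \<le> 2 powr B" using binomial_remainder_bound[OF \<tau> B(1), of 0] by (simp add: X_def)
  have Y: "cmod Y \<le> 2 powr B" using binomial_remainder_bound[OF \<tau>' B(2), of 0] by (simp add: Y_def)
  have K0: "K \<ge> 0" by (simp add: K_def)
  have \<tau>M: "cmod \<tau> ^ M \<le> 1" using \<tau> by (intro power_le_one) auto
  have "K * cmod \<tau> ^ M \<le> K * 1" using \<tau>M K0 by (rule mult_left_mono)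
  hence P: "cmod P \<le> 2 powr B + K" using norm_triangle_ineq4[of X "X - P"] XP X by simp
  have "X * Y - P * Q = (X - P) * Y + P * (Y - Q)" by (simp add: algebra_simps)
  hence "cmod (X * Y - P * Q) \<le> cmod (X - P) * cmod Y + cmod P * cmod (Y - Q)"
    using norm_triangle_ineq[of "(X - P) * Y" "P * (Y - Q)"] by (simp add: norm_mult)
  also have "\<dots> \<le> (K * cmod \<tau> ^ M) * 2 powr B + (2 powr B + K) * (K * cmod \<tau> ^ M)"
    using XP YQ X Y P K0 by (intro add_mono mult_mono) auto
  also have "\<dots> = K * (2 * 2 powr B + K) * cmod \<tau> ^ M" by (simp add: algebra_simps)
  finally have XY: "cmod (X * Y - P * Q) \<le> K * (2 * 2 powr B + K) * cmod \<tau> ^ M" .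
  have "ke_rem M a b s w t = ke_term a b s w * (X * Y - P * Q)"
    unfolding ke_rem_def t1 t2 by (simp only: right_diff_distrib)
  hence "cmod (ke_rem M a b s w t) = cmod w powr (of_int (a + b) - Re s) * cmod (X * Y - P * Q)"
    using w by (simp add: norm_mult norm_ke_term)
  also have "\<dots> \<le> cmod w powr (of_int (a + b) - Re s) * (K * (2 * 2 powr B + K) * cmod \<tau> ^ M)"
    using XY by (intro mult_left_mono) auto
  also have "cmod \<tau> ^ M = cmod t ^ M * cmod w powr (- M)"
    using w by (simp add: \<tau>_def norm_divide power_divide powr_minus powr_realpow field_simps)
  also have "cmod w powr (of_int (a + b) - Re s) * (K * (2 * 2 powr B + K) * (cmod t ^ M * cmod w powr (- M)))
     = K * (2 * 2 powr B + K) * cmod t ^ M * cmod w powr (of_int (a + b) - Re s - M)"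
    by (simp add: powr_diff powr_minus powr_add field_simps)
  finally show ?thesis by (simp add: K_def mult_ac)
qed

section \<open>Eisenstein--Kronecker series of a lattice with complex multiplication\<close>

lemma summable_on_int_powr:
  assumes "x > (1::real)"
  shows "(\<lambda>m::int. (1 + \<bar>of_int m\<bar>) powr - x) summable_on UNIV"
proof -
  have "summable (\<lambda>n. real n powr - x)" using assms by (simp add: summable_real_powr_iff)
  hence "summable (\<lambda>n. real (Suc n) powr - x)" by (subst summable_Suc_iff)
  hence nat: "(\<lambda>n. real (Suc n) powr - x) summable_on UNIV"
    by (intro summable_nonneg_imp_summable_on) auto
  have "(\<lambda>m::int. (1 + \<bar>of_int m\<bar>) powr - x) summable_on range int"
    using nat by (subst summable_on_reindex) (auto simp: o_def)
  moreover have "(\<lambda>m::int. (1 + \<bar>of_int m\<bar>) powr - x) summable_on range (\<lambda>n. - int n)"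
    using nat by (subst summable_on_reindex) (auto simp: o_def inj_on_def)
  ultimately have "(\<lambda>m::int. (1 + \<bar>of_int m\<bar>) powr - x) summable_on (range int \<union> range (\<lambda>n. - int n))"
    by (rule summable_on_union)
  also have "range int \<union> range (\<lambda>n. - int n) = UNIV"
    by (auto simp: image_iff) (metis int_cases2)
  finally show ?thesis .
qed

lemma has_sum_finite_sum:
  fixes f :: "'i \<Rightarrow> 'a \<Rightarrow> complex"
  assumes "\<And>i. i \<in> I \<Longrightarrow> (f i has_sum S i) A"
  shows "((\<lambda>x. \<Sum>i\<in>I. f i x) has_sum (\<Sum>i\<in>I. S i)) A"
  using assms by (induction I rule: infinite_finite_induct) (auto intro!: has_sum_add)

text \<open>The lattice \<open>w1 (Z + Z \<omega>)\<close>, where \<omega> is an integral quadratic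
  number of trace \<open>tr\<close> and norm \<open>nm\<close>, so that multiplication by \<omega>
  preserves it. The scale \<open>w1\<close> makes both the fractions and the multiples of a ring of
  integers instances.\<close>

locale cm_lattice =
  fixes \<omega> w1 :: complex and tr nm :: int
  assumes Im_\<omega>: "Im \<omega> \<noteq> 0" and w1: "w1 \<noteq> 0"
    and \<omega>_square: "\<omega> * \<omega> = of_int tr * \<omega> - of_int nm"
begin

definition pt :: "int \<times> int \<Rightarrow> complex" where
  "pt = (\<lambda>(m, n). w1 * (of_int m + of_int n * \<omega>))"

definition L :: "complex set" where "L = range pt"

lemma inj_pt: "inj pt"
proof (rule injI)
  fix x y assume "pt x = pt y"
  then have e: "of_int (fst x) + of_int (snd x) * \<omega> = of_int (fst y) + of_int (snd y) * \<omega>"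
    using w1 by (auto simp: pt_def split: prod.splits)
  from arg_cong[OF e, of Im] Im_\<omega> have "snd x = snd y" by simp
  with e have "fst x = fst y" by simp
  with \<open>snd x = snd y\<close> show "x = y" by (simp add: prod_eq_iff)
qed

lemma pt_add: "pt (m, n) + pt (m', n') = pt (m + m', n + n')"
  by (simp add: pt_def algebra_simps)

lemma L_add: "x \<in> L \<Longrightarrow> y \<in> L \<Longrightarrow> x + y \<in> L"
  unfolding L_def by (auto simp: pt_add)

lemma pt_bound:
  obtains C where "C \<ge> 0" "\<And>m n. \<bar>of_int m\<bar> \<le> C * cmod (pt (m, n))"
    "\<And>m n. \<bar>of_int n\<bar> \<le> C * cmod (pt (m, n))"
proof -
  define c where "c = 1 / cmod w1"
  define d where "d = c / \<bar>Im \<omega>\<bar>"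
  have c: "c > 0" using w1 by (simp add: c_def)
  have d: "d \<ge> 0" using c by (simp add: d_def)
  have q: "cmod (of_int m + of_int n * \<omega>) = c * cmod (pt (m, n))" for m n
    using w1 by (simp add: pt_def norm_mult c_def)
  have n: "\<bar>of_int n\<bar> \<le> d * cmod (pt (m, n))" for m n
  proof -
    have "\<bar>of_int n\<bar> * \<bar>Im \<omega>\<bar> \<le> c * cmod (pt (m, n))"
      using abs_Im_le_cmod[of "of_int m + of_int n * \<omega>"] unfolding q by (simp add: abs_mult)
    thus ?thesis using Im_\<omega> by (simp add: d_def field_simps)
  qed
  have m: "\<bar>of_int m\<bar> \<le> (c + d * cmod \<omega>) * cmod (pt (m, n))" for m n
  proof -
    have "\<bar>of_int m\<bar> = cmod (of_int m + of_int n * \<omega> - of_int n * \<omega>)" by simp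
    also have "\<dots> \<le> cmod (of_int m + of_int n * \<omega>) + cmod (of_int n * \<omega>)"
      by (rule norm_triangle_ineq4)
    also have "\<dots> = c * cmod (pt (m, n)) + \<bar>of_int n\<bar> * cmod \<omega>" by (simp only: q norm_mult norm_of_int)
    also have "\<dots> \<le> c * cmod (pt (m, n)) + d * cmod (pt (m, n)) * cmod \<omega>"
      using n[of n m] by (intro add_mono mult_right_mono) auto
    finally show ?thesis by (simp add: algebra_simps)
  qed
  show ?thesis
  proof (rule that[of "c + d * cmod \<omega> + d"])
    show "c + d * cmod \<omega> + d \<ge> 0" using c d by simp
    show "\<bar>of_int m\<bar> \<le> (c + d * cmod \<omega> + d) * cmod (pt (m, n))" for m n
      by (rule order_trans[OF m[of m n]]) (use d in \<open>auto intro!: mult_right_mono\<close>)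
    show "\<bar>of_int n\<bar> \<le> (c + d * cmod \<omega> + d) * cmod (pt (m, n))" for m n
      by (rule order_trans[OF n[of n m]]) (use c d in \<open>auto intro!: mult_right_mono\<close>)
  qed
qed

text \<open>Both coordinates of a lattice point are at most a constant times its modulus, so the
  term is dominated by a product of two one-dimensional terms with exponent
  \<open>\<kappa> / 2 > 1\<close>.\<close>

lemma summable_on_L:
  assumes "\<kappa> > 2"
  shows "(\<lambda>l. (1 + cmod l) powr - \<kappa>) summable_on L"
proof -
  obtain C where C: "C \<ge> 0" "\<And>m n. \<bar>of_int m\<bar> \<le> C * cmod (pt (m, n))"
    "\<And>m n. \<bar>of_int n\<bar> \<le> C * cmod (pt (m, n))" using pt_bound by blast
  define g where "g = (\<lambda>m::int. (1 + \<bar>of_int m :: real\<bar>) powr - (\<kappa> / 2))"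
  have g: "g summable_on UNIV" unfolding g_def using assms by (intro summable_on_int_powr) simp
  have "(\<lambda>(m, n). g m * g n) summable_on UNIV \<times> UNIV"
  proof (rule summable_on_SigmaI[where g = "\<lambda>m. g m * infsum g UNIV"])
    show "((\<lambda>n. case (m, n) of (m, n) \<Rightarrow> g m * g n) has_sum g m * infsum g UNIV) UNIV" for m
      using g by (auto intro: has_sum_cmult_right)
    show "(\<lambda>m. g m * infsum g UNIV) summable_on UNIV" using g by (rule summable_on_cmult_left)
  qed (auto simp: g_def)
  hence s: "(\<lambda>(m, n). (1 + C) powr \<kappa> * (g m * g n)) summable_on UNIV"
    using summable_on_cmult_right[of "\<lambda>(m, n). g m * g n"] by (simp add: case_prod_unfold)
  have "(1 + cmod (pt (m, n))) powr - \<kappa> \<le> (1 + C) powr \<kappa> * (g m * g n)" for m n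
  proof -
    define x where "x = cmod (pt (m, n))"
    have x: "x \<ge> 0" by (simp add: x_def)
    have 1: "1 + \<bar>of_int m\<bar> \<le> (1 + C) * (1 + x)" "1 + \<bar>of_int n\<bar> \<le> (1 + C) * (1 + x)"
    proof -
      have "(1 + C) * (1 + x) = 1 + C + x + C * x" by (simp add: algebra_simps)
      thus "1 + \<bar>of_int m\<bar> \<le> (1 + C) * (1 + x)" "1 + \<bar>of_int n\<bar> \<le> (1 + C) * (1 + x)"
        using C(2)[of m n] C(3)[of n m] C(1) x unfolding x_def by linarith+
    qed
    have 2: "((1 + C) * (1 + x)) powr - (\<kappa> / 2) \<le> g m" "((1 + C) * (1 + x)) powr - (\<kappa> / 2) \<le> g n"
      unfolding g_def using 1 assms by (auto intro!: powr_mono2')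
    have "((1 + C) * (1 + x)) powr - (\<kappa> / 2) * ((1 + C) * (1 + x)) powr - (\<kappa> / 2) \<le> g m * g n"
      using 2 by (intro mult_mono) (auto simp: g_def)
    hence "((1 + C) * (1 + x)) powr - \<kappa> \<le> g m * g n" by (simp add: powr_add[symmetric])
    hence "(1 + C) powr \<kappa> * ((1 + C) * (1 + x)) powr - \<kappa> \<le> (1 + C) powr \<kappa> * (g m * g n)"
      by (intro mult_left_mono) auto
    also have "(1 + C) powr \<kappa> * ((1 + C) * (1 + x)) powr - \<kappa> = (1 + x) powr - \<kappa>"
    proof -
      have "((1 + C) * (1 + x)) powr - \<kappa> = (1 + C) powr - \<kappa> * (1 + x) powr - \<kappa>"
        using C(1) x by (simp add: powr_mult)
      moreover have "(1 + C) powr \<kappa> * (1 + C) powr - \<kappa> = 1" using C(1) by (simp flip: powr_add)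
      ultimately show ?thesis by (simp flip: mult.assoc)
    qed
    finally show ?thesis by (simp add: x_def)
  qed
  hence "(\<lambda>p. (1 + cmod (pt p)) powr - \<kappa>) summable_on UNIV"
    by (intro summable_on_comparison_test[OF s]) auto
  thus ?thesis unfolding L_def by (subst summable_on_reindex[OF inj_pt]) (simp add: o_def)
qed

lemma finite_L_ball: "finite {l \<in> L. cmod (z + l) < \<rho>}"
proof -
  obtain C where C: "C \<ge> 0" "\<And>m n. \<bar>of_int m\<bar> \<le> C * cmod (pt (m, n))"
    "\<And>m n. \<bar>of_int n\<bar> \<le> C * cmod (pt (m, n))" using pt_bound by blast
  define K where "K = \<lceil>C * (\<bar>\<rho>\<bar> + cmod z)\<rceil>"
  have "{l \<in> L. cmod (z + l) < \<rho>} \<subseteq> pt ` ({-K..K} \<times> {-K..K})"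
  proof
    fix l assume l: "l \<in> {l \<in> L. cmod (z + l) < \<rho>}"
    then obtain m n where mn: "l = pt (m, n)" by (auto simp: L_def)
    have "cmod l \<le> cmod (z + l) + cmod z" using norm_triangle_ineq4[of "z + l" z] by simp
    hence "cmod l \<le> \<bar>\<rho>\<bar> + cmod z" using l abs_ge_self[of \<rho>] by (simp del: abs_ge_self)
    hence "C * cmod l \<le> C * (\<bar>\<rho>\<bar> + cmod z)" using C(1) by (rule mult_left_mono)
    hence "\<bar>of_int m :: real\<bar> \<le> of_int K" "\<bar>of_int n :: real\<bar> \<le> of_int K"
      using C(2)[of m n] C(3)[of n m] by (auto simp: K_def mn intro: order_trans[OF _ le_of_int_ceiling])
    hence "\<bar>m\<bar> \<le> K" "\<bar>n\<bar> \<le> K" by linarith+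
    thus "l \<in> pt ` ({-K..K} \<times> {-K..K})" unfolding mn by (intro imageI) (auto simp: abs_le_iff)
  qed
  thus ?thesis by (rule finite_subset) auto
qed

text \<open>A bound is required only far from \<open>-z\<close>: the finitely many other lattice
  points are bounded by compactness of the disc, and away from them \<open>|z + l|\<close> is
  comparable with \<open>1 + |l|\<close>.\<close>

lemma loc_dominated_L:
  assumes hol: "\<And>l. l \<in> L \<Longrightarrow> F l holomorphic_on S"
    and bd: "\<And>s. s \<in> S \<Longrightarrow> \<exists>r \<kappa> C \<rho>. r > 0 \<and> \<kappa> > 2 \<and> cball s r \<subseteq> S \<and>
       (\<forall>l\<in>L. cmod (z + l) \<ge> \<rho> \<longrightarrow> (\<forall>t\<in>cball s r. cmod (F l t) \<le> C * cmod (z + l) powr - \<kappa>))"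
  shows "loc_dominated L S F"
proof (rule loc_dominatedI)
  fix s assume s: "s \<in> S"
  obtain r \<kappa> C \<rho> where r: "r > 0" "\<kappa> > 2" "cball s r \<subseteq> S"
    and F: "\<And>l t. l \<in> L \<Longrightarrow> cmod (z + l) \<ge> \<rho> \<Longrightarrow> t \<in> cball s r \<Longrightarrow> cmod (F l t) \<le> C * cmod (z + l) powr - \<kappa>"
    using bd[OF s] by blast
  define X where "X = {l \<in> L. cmod (z + l) < max \<rho> 1}"
  define C' where "C' = \<bar>C\<bar> * (2 * (1 + cmod z)) powr \<kappa>"
  have "\<forall>l\<in>X. \<exists>K. \<forall>t\<in>cball s r. cmod (F l t) \<le> K"
  proof
    fix l assume "l \<in> X"
    hence "F l holomorphic_on cball s r"
      using hol[of l] holomorphic_on_subset[OF _ r(3)] by (simp add: X_def)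
    hence "bounded (F l ` cball s r)"
      by (intro compact_imp_bounded compact_continuous_image holomorphic_on_imp_continuous_on) auto
    thus "\<exists>K. \<forall>t\<in>cball s r. cmod (F l t) \<le> K" unfolding bounded_iff by blast
  qed
  then obtain K where K: "\<And>l t. l \<in> X \<Longrightarrow> t \<in> cball s r \<Longrightarrow> cmod (F l t) \<le> K l" by metis
  define B where "B l = (if l \<in> X then K l else C' * (1 + cmod l) powr - \<kappa>)" for l
  have "B summable_on X" using finite_L_ball by (simp add: X_def)
  moreover have "(\<lambda>l. C' * (1 + cmod l) powr - \<kappa>) summable_on (L - X)"
    by (intro summable_on_cmult_right summable_on_subset_banach[OF summable_on_L[OF r(2)]]) auto
  hence "B summable_on (L - X)" by (rule summable_on_cong[THEN iffD1, rotated]) (auto simp: B_def)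
  ultimately have "B summable_on (X \<union> (L - X))" by (rule summable_on_union)
  also have "X \<union> (L - X) = L" by (auto simp: X_def)
  finally have BL: "B summable_on L" .
  have "cmod (F l t) \<le> B l" if l: "l \<in> L" "t \<in> cball s r" for l t
  proof (cases "l \<in> X")
    case True thus ?thesis using K that by (simp add: B_def)
  next
    case False
    define y where "y = cmod (z + l)"
    have y: "y \<ge> \<rho>" "y \<ge> 1" using False l by (auto simp: X_def y_def)
    have "1 + cmod l \<le> 1 + (y + cmod z)" using norm_triangle_ineq4[of "z + l" z] by (simp add: y_def)
    also have "\<dots> \<le> (1 + cmod z) * (1 + y)" using y by (simp add: algebra_simps)
    also have "\<dots> \<le> (1 + cmod z) * (2 * y)" using y by (intro mult_left_mono) auto
    finally have "((1 + cmod z) * (2 * y)) powr - \<kappa> \<le> (1 + cmod l) powr - \<kappa>"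
      using r(2) by (intro powr_mono2') (auto simp: add_pos_nonneg)
    moreover have "y powr - \<kappa> = (2 * (1 + cmod z)) powr \<kappa> * ((1 + cmod z) * (2 * y)) powr - \<kappa>"
    proof -
      define q where "q = 2 * (1 + cmod z)"
      have q: "q > 0" by (simp add: q_def add_pos_nonneg)
      have e: "(1 + cmod z) * (2 * y) = q * y" by (simp add: q_def)
      show ?thesis unfolding e q_def[symmetric] using y q by (simp add: powr_mult powr_minus)
    qed
    ultimately have "y powr - \<kappa> \<le> (2 * (1 + cmod z)) powr \<kappa> * (1 + cmod l) powr - \<kappa>"
      by (simp add: mult_left_mono)
    hence "\<bar>C\<bar> * y powr - \<kappa> \<le> C' * (1 + cmod l) powr - \<kappa>"
      unfolding C'_def mult.assoc by (intro mult_left_mono) auto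
    moreover have "cmod (F l t) \<le> C * y powr - \<kappa>" using F[OF l(1) _ l(2)] y by (simp add: y_def)
    moreover have "C * y powr - \<kappa> \<le> \<bar>C\<bar> * y powr - \<kappa>" by (intro mult_right_mono) auto
    ultimately show ?thesis using False by (simp add: B_def)
  qed
  thus "\<exists>r>0. cball s r \<subseteq> S \<and> (\<exists>B. B summable_on L \<and> (\<forall>x\<in>L. \<forall>t\<in>cball s r. cmod (F x t) \<le> B x))"
    using r BL by blast
qed (rule hol)

lemma loc_dominated_L_powr:
  assumes hol: "\<And>l s. F l holomorphic_on UNIV"
    and bd: "\<And>s. \<exists>C \<rho>. \<forall>l\<in>L. cmod (z + l) \<ge> \<rho> \<longrightarrow>
      (\<forall>t\<in>cball s 1. cmod (F l t) \<le> C * cmod (z + l) powr (e - Re t))"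
  shows "loc_dominated L {s. Re s > 2 + e} F"
proof (rule loc_dominated_L)
  show "F l holomorphic_on {s. Re s > 2 + e}" for l using hol holomorphic_on_subset by blast
  fix s assume s: "s \<in> {s. Re s > 2 + e}"
  \<comment> \<open>At most half of the distance to the abscissa: on the disc
    \<open>e - Re t\<close> is then at most \<open>-(2 + \<delta>)\<close>, strictly inside the
    range of convergence in real dimension two.\<close>
  define \<delta> where "\<delta> = min 1 ((Re s - 2 - e) / 2)"
  have \<delta>: "\<delta> > 0" "\<delta> \<le> 1" "\<delta> \<le> (Re s - 2 - e) / 2"
    using s unfolding \<delta>_def by (simp, simp, intro min.cobounded2)
  obtain C \<rho> where C: "\<forall>l\<in>L. cmod (z + l) \<ge> \<rho> \<longrightarrow>
      (\<forall>t\<in>cball s 1. cmod (F l t) \<le> C * cmod (z + l) powr (e - Re t))" using bd by blast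
  have re: "Re t \<ge> Re s - \<delta>" if "t \<in> cball s \<delta>" for t
    using that abs_Re_le_cmod[of "s - t"] by (auto simp: dist_norm)
  have "cball s \<delta> \<subseteq> {s. Re s > 2 + e}" using re \<delta> s by force
  moreover have "cmod (F l t) \<le> \<bar>C\<bar> * cmod (z + l) powr - (2 + \<delta>)"
    if l: "l \<in> L" "cmod (z + l) \<ge> max 1 \<rho>" "t \<in> cball s \<delta>" for l t
  proof -
    have "cmod (F l t) \<le> C * cmod (z + l) powr (e - Re t)" using C l \<delta> by auto
    also have "\<dots> \<le> \<bar>C\<bar> * cmod (z + l) powr (e - Re t)" by (intro mult_right_mono) auto
    also have "\<dots> \<le> \<bar>C\<bar> * cmod (z + l) powr - (2 + \<delta>)"
      using re[OF l(3)] \<delta> l(2) by (intro mult_left_mono powr_mono) auto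
    finally show ?thesis .
  qed
  ultimately show "\<exists>r \<kappa> C \<rho>. r > 0 \<and> \<kappa> > 2 \<and> cball s r \<subseteq> {s. Re s > 2 + e} \<and>
       (\<forall>l\<in>L. cmod (z + l) \<ge> \<rho> \<longrightarrow> (\<forall>t\<in>cball s r. cmod (F l t) \<le> C * cmod (z + l) powr - \<kappa>))"
    using \<delta>(1) by (intro exI[of _ \<delta>] exI[of _ "2 + \<delta>"] exI[of _ "\<bar>C\<bar>"] exI[of _ "max 1 \<rho>"]) auto
qed

lemma loc_dominated_ke_term:
  "loc_dominated L {s. Re s > 2 + of_int (a + b)} (\<lambda>l s. ke_term a b s (z + l))"
proof (rule loc_dominated_L_powr[where z = z])
  show "(\<lambda>s. ke_term a b s (z + l)) holomorphic_on UNIV" for l by (intro holomorphic_intros)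
  show "\<exists>C \<rho>. \<forall>l\<in>L. cmod (z + l) \<ge> \<rho> \<longrightarrow> (\<forall>t\<in>cball s 1. cmod (ke_term a b t (z + l)) \<le>
    C * cmod (z + l) powr (of_int (a + b) - Re t))" for s
  proof (intro exI[of _ 1] ballI impI)
    fix l t assume "1 \<le> cmod (z + l)"
    hence "z + l \<noteq> 0" by auto
    thus "cmod (ke_term a b t (z + l)) \<le> 1 * cmod (z + l) powr (of_int (a + b) - Re t)"
      using norm_ke_term[of "z + l" a b t] by simp
  qed
qed

lemma loc_dominated_ke_rem:
  "loc_dominated L {s. Re s > 2 + (of_int (a + b) - real M)} (\<lambda>l s. ke_rem M a b s (z + l) t)"
proof (rule loc_dominated_L_powr[where z = z])
  show "(\<lambda>s. ke_rem M a b s (z + l) t) holomorphic_on UNIV" for l by (rule ke_rem_holomorphic)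
  fix s :: complex
  define B where "B = \<bar>of_int a\<bar> + \<bar>of_int b\<bar> + cmod s + 1"
  have B: "cmod (of_int c - u / 2) \<le> B" if "u \<in> cball s 1" "c = a \<or> c = b" for u c
  proof -
    have "cmod u \<le> cmod s + 1"
      using that(1) norm_triangle_ineq2[of u s] by (auto simp: dist_norm norm_minus_commute)
    moreover have "cmod (of_int c - u / 2) \<le> \<bar>of_int c\<bar> + cmod u / 2"
      using norm_triangle_ineq4[of "of_int c" "u / 2"] by (simp add: norm_divide)
    ultimately show ?thesis using that(2) norm_ge_zero[of u] unfolding B_def by linarith
  qed
  define C where "C = (2 ^ M * 2 powr B * (2 * 2 powr B + 2 ^ M * 2 powr B)) * cmod t ^ M"
  have "cmod (ke_rem M a b u (z + l) t) \<le> C * cmod (z + l) powr (of_int (a + b) - real M - Re u)"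
    if "cmod (z + l) \<ge> max 1 (2 * cmod t)" "u \<in> cball s 1" for l u
  proof -
    have nz: "z + l \<noteq> 0" and le: "2 * cmod t \<le> cmod (z + l)" using that(1) by auto
    show ?thesis using ke_rem_bound[OF nz le B[OF that(2)] B[OF that(2)], of a b M] 
      by (simp add: C_def algebra_simps)
  qed
  thus "\<exists>C \<rho>. \<forall>l\<in>L. cmod (z + l) \<ge> \<rho> \<longrightarrow> (\<forall>u\<in>cball s 1. cmod (ke_rem M a b u (z + l) t) \<le>
    C * cmod (z + l) powr (of_int (a + b) - real M - Re u))" by blast
qed

definition KE1 :: "complex \<Rightarrow> int \<Rightarrow> int \<Rightarrow> complex \<Rightarrow> complex" where
  "KE1 z a b s = (\<Sum>\<^sub>\<infinity>l\<in>L. ke_term a b s (z + l))"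

definition KE_rem :: "nat \<Rightarrow> complex \<Rightarrow> complex \<Rightarrow> int \<Rightarrow> int \<Rightarrow> complex \<Rightarrow> complex" where
  "KE_rem M z t a b s = (\<Sum>\<^sub>\<infinity>l\<in>L. ke_rem M a b s (z + l) t)"

definition tcoef :: "int \<Rightarrow> int \<Rightarrow> nat \<Rightarrow> nat \<Rightarrow> complex \<Rightarrow> complex \<Rightarrow> complex" where
  "tcoef a b i j t s =
     ((of_int a - s / 2) gchoose i) * ((of_int b - s / 2) gchoose j) * t ^ i * cnj t ^ j"

lemma tcoef_holomorphic: "tcoef a b i j t holomorphic_on S"
  unfolding tcoef_def gbinomial_prod_rev by (intro holomorphic_intros) auto

text \<open>Termwise Taylor expansion at \<open>z + l\<close>. The series of the remainders
  converges \<open>M\<close> units further left than the original one; this is the source of the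
  continuation.\<close>

lemma KE1_Taylor:
  assumes s: "Re s > 2 + of_int (a + b)"
  shows "KE1 (z + t) a b s =
    (\<Sum>i<M. \<Sum>j<M. tcoef a b i j t s * KE1 z (a - int i) (b - int j) s) + KE_rem M z t a b s"
proof -
  have 1: "((\<lambda>l. ke_term (a - int i) (b - int j) s (z + l)) has_sum KE1 z (a - int i) (b - int j) s) L" for i j
    unfolding KE1_def using s
    by (intro has_sum_infsum loc_dominated_summable[OF loc_dominated_ke_term]) auto
  have 2: "((\<lambda>l. ke_rem M a b s (z + l) t) has_sum KE_rem M z t a b s) L"
    unfolding KE_rem_def using s
    by (intro has_sum_infsum loc_dominated_summable[OF loc_dominated_ke_rem]) auto
  have "((\<lambda>l. (\<Sum>i<M. \<Sum>j<M. tcoef a b i j t s * ke_term (a - int i) (b - int j) s (z + l)) + ke_rem M a b s (z + l) t)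
     has_sum (\<Sum>i<M. \<Sum>j<M. tcoef a b i j t s * KE1 z (a - int i) (b - int j) s) + KE_rem M z t a b s) L"
    by (intro has_sum_add has_sum_finite_sum has_sum_cmult_right 1 2)
  also have "(\<lambda>l. (\<Sum>i<M. \<Sum>j<M. tcoef a b i j t s * ke_term (a - int i) (b - int j) s (z + l)) + ke_rem M a b s (z + l) t)
     = (\<lambda>l. ke_term a b s (z + t + l))"
    by (simp add: ke_rem_def tcoef_def fun_eq_iff add_ac)
  finally show ?thesis unfolding KE1_def by (simp add: infsumI)
qed

text \<open>Self-similarity: \<open>L\<close> is the disjoint union of the translates
  \<open>t + \<mu> L\<close>, and \<open>ke_term\<close> is multiplicative, so \<mu> can be pulled
  out of each partial series.\<close>

lemma KE1_distribution:
  assumes s: "Re s > 2 + of_int (a + b)" and \<mu>: "\<mu> \<noteq> 0"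
    and R: "finite R" "bij_betw (\<lambda>(t, l). t + \<mu> * l) (R \<times> L) L"
  shows "KE1 0 a b s = (\<Sum>t\<in>R. ke_term a b s \<mu> * KE1 (t / \<mu>) a b s)"
proof -
  let ?f = "ke_term a b s"
  have sm: "(\<lambda>l. ?f (z + l)) summable_on L" for z
    by (intro loc_dominated_summable[OF loc_dominated_ke_term]) (use s in auto)
  have inj: "inj_on (\<lambda>(t, l). t + \<mu> * l) (R \<times> L)" and im: "(\<lambda>(t, l). t + \<mu> * l) ` (R \<times> L) = L"
    using R(2) by (auto simp: bij_betw_def)
  have f: "?f (t + \<mu> * l) = ?f \<mu> * ?f (t / \<mu> + l)" for t l
    using ke_term_mult[of a b s \<mu> "t / \<mu> + l"] \<mu> by (simp add: algebra_simps)
  have "?f summable_on (\<lambda>(t, l). t + \<mu> * l) ` (R \<times> L)" unfolding im using sm[of 0] by simp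
  hence "(?f \<circ> (\<lambda>(t, l). t + \<mu> * l)) summable_on (R \<times> L)" by (simp only: summable_on_reindex[OF inj])
  hence sm2: "(\<lambda>(t, l). ?f (t + \<mu> * l)) summable_on (R \<times> L)"
    by (simp add: o_def case_prod_unfold)
  have "KE1 0 a b s = infsum ?f ((\<lambda>(t, l). t + \<mu> * l) ` (R \<times> L))" by (simp add: KE1_def im)
  also have "\<dots> = (\<Sum>\<^sub>\<infinity>(t, l)\<in>R \<times> L. ?f (t + \<mu> * l))"
    by (subst infsum_reindex[OF inj]) (simp add: o_def case_prod_unfold)
  also have "\<dots> = (\<Sum>\<^sub>\<infinity>t\<in>R. \<Sum>\<^sub>\<infinity>l\<in>L. ?f (t + \<mu> * l))"
    using sm2 by (intro infsum_Sigma'_banach[symmetric]) (simp add: case_prod_unfold)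
  also have "\<dots> = (\<Sum>t\<in>R. \<Sum>\<^sub>\<infinity>l\<in>L. ?f \<mu> * ?f (t / \<mu> + l))" using R(1) by (simp add: f)
  also have "\<dots> = (\<Sum>t\<in>R. ?f \<mu> * KE1 (t / \<mu>) a b s)"
    unfolding KE1_def by (intro sum.cong refl infsum_cmult_right') 
  finally show ?thesis .
qed

end

section \<open>Multipliers of the lattice, and continuation by the functional equation\<close>

context cm_lattice begin

lemma L_eq: "L = {w1 * (of_int m + of_int n * \<omega>) | m n. True}"
  by (auto simp: L_def pt_def)

lemma bij_betw_integer_residues:
  assumes "N > 0"
  shows "bij_betw (\<lambda>(t, l). t + of_int N * l) (pt ` ({0..<N} \<times> {0..<N}) \<times> L) L"
proof -
  have e: "pt (i, j) + of_int N * pt (m, n) = pt (i + N * m, j + N * n)" for i j m n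
    by (simp add: pt_def algebra_simps)
  show ?thesis unfolding bij_betw_def
  proof (intro conjI inj_onI subset_antisym subsetI)
    fix x y
    assume x: "x \<in> pt ` ({0..<N} \<times> {0..<N}) \<times> L" and y: "y \<in> pt ` ({0..<N} \<times> {0..<N}) \<times> L"
      and eq: "(case x of (t, l) \<Rightarrow> t + of_int N * l) = (case y of (t, l) \<Rightarrow> t + of_int N * l)"
    from x obtain i j m n where x': "x = (pt (i, j), pt (m, n))" "i \<in> {0..<N}" "j \<in> {0..<N}"
      by (auto simp: L_def)
    from y obtain i' j' m' n' where y': "y = (pt (i', j'), pt (m', n'))" "i' \<in> {0..<N}" "j' \<in> {0..<N}"
      by (auto simp: L_def)
    have "i + N * m = i' + N * m'" "j + N * n = j' + N * n'"
      using eq inj_pt by (auto simp: x' y' e dest: injD)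
    moreover from this have "i = i'" "j = j'" using x' y' 
      by (metis atLeastLessThan_iff mod_mult_self2 mod_pos_pos_trivial)+
    ultimately show "x = y" using assms by (simp add: x' y')
  next
    fix l assume "l \<in> (\<lambda>(t, l). t + of_int N * l) ` (pt ` ({0..<N} \<times> {0..<N}) \<times> L)"
    thus "l \<in> L" by (auto simp: L_def e)
  next
    fix l assume "l \<in> L"
    then obtain m n where l: "l = pt (m, n)" by (auto simp: L_def)
    have "l = pt (m mod N, n mod N) + of_int N * pt (m div N, n div N)"
      by (simp add: e l)
    moreover have "(pt (m mod N, n mod N), pt (m div N, n div N)) \<in> pt ` ({0..<N} \<times> {0..<N}) \<times> L"
      using assms by (auto simp: L_def)
    ultimately show "l \<in> (\<lambda>(t, l). t + of_int N * l) ` (pt ` ({0..<N} \<times> {0..<N}) \<times> L)" by force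
  qed
qed

lemma card_integer_residues: "N > 0 \<Longrightarrow> card (pt ` ({0..<N} \<times> {0..<N})) = nat N * nat N"
  by (subst card_image[OF inj_on_subset[OF inj_pt]]) auto

lemma L_diff: "x \<in> L \<Longrightarrow> y \<in> L \<Longrightarrow> x - y \<in> L"
proof -
  have "pt p - pt q = pt (fst p - fst q, snd p - snd q)" for p q
    by (cases p; cases q) (simp add: pt_def algebra_simps)
  thus "x \<in> L \<Longrightarrow> y \<in> L \<Longrightarrow> x - y \<in> L" by (auto simp: L_def)
qed

lemma zero_in_L: "0 \<in> L"
  by (auto simp: L_def pt_def intro!: image_eqI[of _ _ "(0, 0)"])

text \<open>There are finitely many cosets of \<open>\<mu> L\<close> because \<open>N L\<close> lies
  in \<open>\<mu> L\<close> and \<open>L / N L\<close> is finite. The chosen representative depends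
  on the coset alone, since its defining predicate does.\<close>

lemma residues_exist:
  assumes \<mu>: "\<mu> \<noteq> 0" "\<And>l. l \<in> L \<Longrightarrow> \<mu> * l \<in> L" and N: "N > 0"
    and NL: "\<And>l. l \<in> L \<Longrightarrow> \<exists>l'\<in>L. of_int N * l = \<mu> * l'"
  shows "\<exists>R. finite R \<and> R \<noteq> {} \<and> bij_betw (\<lambda>(t, l). t + \<mu> * l) (R \<times> L) L"
proof -
  define r where "r = (\<lambda>l. SOME l'. l' \<in> L \<and> (\<exists>m\<in>L. l = l' + \<mu> * m))"
  have r: "r l \<in> L \<and> (\<exists>m\<in>L. l = r l + \<mu> * m)" if "l \<in> L" for l
  proof -
    have "\<exists>l'. l' \<in> L \<and> (\<exists>m\<in>L. l = l' + \<mu> * m)"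
      using that zero_in_L by (intro exI[of _ l]) auto
    thus ?thesis unfolding r_def by (rule someI_ex)
  qed
  have rr: "r (l + \<mu> * m) = r l" if m: "m \<in> L" for l m
  proof -
    have "(\<exists>k\<in>L. l + \<mu> * m = l' + \<mu> * k) \<longleftrightarrow> (\<exists>k\<in>L. l = l' + \<mu> * k)" for l'
    proof
      assume "\<exists>k\<in>L. l + \<mu> * m = l' + \<mu> * k"
      then obtain k where "k \<in> L" "l + \<mu> * m = l' + \<mu> * k" by blast
      hence "l = l' + \<mu> * (k - m)" by (simp add: algebra_simps)
      thus "\<exists>k\<in>L. l = l' + \<mu> * k" using L_diff[OF \<open>k \<in> L\<close> m] by blast
    next
      assume "\<exists>k\<in>L. l = l' + \<mu> * k"
      then obtain k where "k \<in> L" "l = l' + \<mu> * k" by blast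
      hence "l + \<mu> * m = l' + \<mu> * (k + m)" by (simp add: algebra_simps)
      thus "\<exists>k\<in>L. l + \<mu> * m = l' + \<mu> * k" using L_add[OF \<open>k \<in> L\<close> m] by blast
    qed
    thus ?thesis by (simp add: r_def)
  qed
  have fin: "finite (r ` L)"
  proof (rule finite_subset)
    show "r ` L \<subseteq> r ` (pt ` ({0..<N} \<times> {0..<N}))"
    proof
      fix x assume "x \<in> r ` L"
      then obtain l where l: "l \<in> L" "x = r l" by blast
      obtain t k where t: "t \<in> pt ` ({0..<N} \<times> {0..<N})" "k \<in> L" "l = t + of_int N * k"
        using bij_betw_integer_residues[OF N] l(1) unfolding bij_betw_def by fast
      obtain k' where "k' \<in> L" "of_int N * k = \<mu> * k'" using NL[OF t(2)] by blast
      hence "r l = r t" using rr t(3) by simp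
      thus "x \<in> r ` (pt ` ({0..<N} \<times> {0..<N}))" using l t by auto
    qed
  qed auto
  have "bij_betw (\<lambda>(t, l). t + \<mu> * l) (r ` L \<times> L) L" unfolding bij_betw_def
  proof (intro conjI inj_onI subset_antisym subsetI)
    fix x y assume x: "x \<in> r ` L \<times> L" and y: "y \<in> r ` L \<times> L"
      and eq: "(case x of (t, l) \<Rightarrow> t + \<mu> * l) = (case y of (t, l) \<Rightarrow> t + \<mu> * l)"
    from x obtain k m where x': "x = (r k, m)" "k \<in> L" "m \<in> L" by auto
    from y obtain k' m' where y': "y = (r k', m')" "k' \<in> L" "m' \<in> L" by auto
    have rid: "r (r k) = r k" if k: "k \<in> L" for k
    proof -
      obtain m where "m \<in> L" "k = r k + \<mu> * m" using r[OF k] by blast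
      thus ?thesis using rr[of m "r k"] by simp
    qed
    have "r k + \<mu> * m = r k' + \<mu> * m'" using eq by (simp add: x' y')
    hence "r (r k) = r (r k')" using rr[OF x'(3), of "r k"] rr[OF y'(3), of "r k'"] by simp
    hence "r k = r k'" using rid x' y' by simp
    thus "x = y" using eq \<mu> by (simp add: x' y')
  next
    fix l assume "l \<in> (\<lambda>(t, l). t + \<mu> * l) ` (r ` L \<times> L)"
    thus "l \<in> L" using r \<mu> by (auto intro!: L_add)
  next
    fix l assume l: "l \<in> L"
    then obtain m where "m \<in> L" "l = r l + \<mu> * m" using r by blast
    thus "l \<in> (\<lambda>(t, l). t + \<mu> * l) ` (r ` L \<times> L)"
      using l by (intro image_eqI[of _ _ "(r l, m)"]) auto
  qed
  thus ?thesis using fin zero_in_L by (intro exI[of _ "r ` L"]) auto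
qed

text \<open>
  For \<open>\<mu> = j + \<omega>\<close> the directions \<open>\<mu> / \<bar>\<mu>\<bar>\<close> are pairwise distinct, so only finitely many of
  them can be \<open>n\<close>-th roots of unity.
\<close>

lemma multiplier_exists:
  assumes "n > 0"
  obtains \<mu> R where "\<mu> \<noteq> 0" "finite R" "R \<noteq> {}" "bij_betw (\<lambda>(t, l). t + \<mu> * l) (R \<times> L) L"
    "(\<mu> / of_real (cmod \<mu>)) ^ n \<noteq> 1"
proof -
  define u where "u j = of_int j + \<omega>" for j :: int
  have u0: "u j \<noteq> 0" for j using Im_\<omega> by (auto simp: u_def complex_eq_iff)
  have "inj (\<lambda>j. u j / of_real (cmod (u j)))"
  proof (rule injI)
    fix i j assume e: "u i / of_real (cmod (u i)) = u j / of_real (cmod (u j))"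
    have "Im \<omega> / cmod (u i) = Im \<omega> / cmod (u j)"
      using arg_cong[OF e, of Im] by (simp add: u_def)
    hence "cmod (u i) = cmod (u j)" using Im_\<omega> u0 by (simp add: field_simps)
    with e have "u i = u j" using u0[of j] by simp
    thus "i = j" by (simp add: u_def)
  qed
  hence "infinite (range (\<lambda>j. u j / of_real (cmod (u j))))" by (simp add: finite_image_iff)
  moreover have "finite {z :: complex. z ^ n = 1}" using assms by (simp add: finite_roots_unity)
  ultimately have "\<not> range (\<lambda>j. u j / of_real (cmod (u j))) \<subseteq> {z. z ^ n = 1}"
    using finite_subset by blast
  then obtain j where j: "(u j / of_real (cmod (u j))) ^ n \<noteq> 1" by blast
  \<comment> \<open>The norm of \<open>u j\<close>, that is \<open>u j\<close> times its conjugate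
    \<open>j + tr - \<omega>\<close>; hence it is positive and \<open>N L\<close> lies in
    \<open>u j L\<close>.\<close>
  define N where "N = j * j + j * tr + nm"
  have mul: "(of_int a + of_int b * \<omega>) * pt (m, k) =
    pt (a * m - b * k * nm, a * k + b * m + b * k * tr)" for a b m k
  proof -
    have "(of_int a + of_int b * \<omega>) * pt (m, k) = w1 * (of_int a * of_int m +
      (of_int a * of_int k + of_int b * of_int m) * \<omega> + of_int b * of_int k * (\<omega> * \<omega>))"
      by (simp add: pt_def algebra_simps)
    also have "\<dots> = pt (a * m - b * k * nm, a * k + b * m + b * k * tr)"
      unfolding \<omega>_square by (simp add: pt_def algebra_simps)
    finally show ?thesis .
  qed
  have N: "of_int N = u j * (of_int (j + tr) - \<omega>)"
    using \<omega>_square by (simp add: N_def u_def algebra_simps)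
  have "Im (\<omega> * \<omega>) = of_int tr * Im \<omega>" using \<omega>_square by simp
  hence "2 * Re \<omega> = of_int tr" using Im_\<omega> by simp
  hence cj: "cnj (u j) = of_int (j + tr) - \<omega>" by (simp add: u_def complex_eq_iff)
  have "complex_of_int N = of_real ((cmod (u j))\<^sup>2)"
    unfolding N cj[symmetric] by (rule complex_norm_square[symmetric])
  hence "real_of_int N = (cmod (u j))\<^sup>2" by (metis of_real_eq_iff of_real_of_int_eq)
  hence N0: "N > 0" using u0[of j] by (metis of_int_0_less_iff zero_less_norm_iff zero_less_power)
  have "u j * l \<in> L" if "l \<in> L" for l
    using that mul[of j 1] by (auto simp: L_def u_def)
  moreover have "\<exists>l'\<in>L. of_int N * l = u j * l'" if "l \<in> L" for l
  proof (intro bexI)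
    show "of_int N * l = u j * ((of_int (j + tr) - \<omega>) * l)" by (simp add: N)
    show "(of_int (j + tr) - \<omega>) * l \<in> L" using that mul[of "j + tr" "-1"] by (auto simp: L_def)
  qed
  ultimately obtain R where "finite R" "R \<noteq> {}" "bij_betw (\<lambda>(t, l). t + u j * l) (R \<times> L) L"
    using residues_exist[OF u0 _ N0] by blast
  thus ?thesis using that[of "u j"] u0 j by blast
qed

text \<open>Exponents for which the continued series will be regular at 0. The Kronecker-Eisenstein
  sums have \<open>a = - i - 1 < 0\<close> and \<open>b = j \<ge> 0\<close>; the second alternative
  takes in the exponents that Taylor expansion adds. The pair \<open>-1, -1\<close>, whose series
  has a pole at 0, is left out.\<close>

definition regular_exponents :: "int \<Rightarrow> int \<Rightarrow> bool" where
  "regular_exponents a b \<longleftrightarrow> a < 0 \<and> 0 \<le> b \<or> a + b \<le> - 3"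

text \<open>The factor with index \<open>b\<close> in the numerator is \<open>- s / 2\<close>. This
  zero of a Taylor coefficient compensates a possible simple pole at 0 of the series that it
  multiplies.\<close>

lemma gbinomial_vanishing_factor:
  assumes "0 \<le> b" "b < int j"
  obtains c where "c holomorphic_on UNIV" "\<And>s. ((of_int b - s / 2) gchoose j) = s * c s"
proof
  let ?I = "{0..<j} - {nat b}"
  have nb: "nat b \<in> {0..<j}" using assms by auto
  show "(\<lambda>s::complex. - (1/2) * (\<Prod>i\<in>?I. of_int b - s / 2 - of_nat i) / fact j) holomorphic_on UNIV"
    by (intro holomorphic_intros) auto
  show "((of_int b - s / 2) gchoose j) = s * (- (1/2) * (\<Prod>i\<in>?I. of_int b - s / 2 - of_nat i) / fact j)"
    for s :: complex
    unfolding gbinomial_prod_rev using assms by (subst prod.remove[OF _ nb]) auto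
qed

text \<open>Induction hypothesis: every series continues \<open>n\<close> units beyond its half
  plane of convergence, with at most a simple pole at 0, and with none for regular exponents. All
  exponents are treated at once, since the functional equation refers to smaller ones.\<close>

definition cont_level :: "nat \<Rightarrow> bool" where
  "cont_level n \<longleftrightarrow> (\<forall>a b.
     qcont (2 + of_int (a + b) - n) (2 + of_int (a + b)) (\<lambda>s. s * KE1 0 a b s) \<and>
     (regular_exponents a b \<longrightarrow> qcont (2 + of_int (a + b) - n) (2 + of_int (a + b)) (KE1 0 a b)))"

lemma cont_levelD:
  assumes "cont_level n" "of_int (a + b) + 2 - real n \<le> A" "2 + of_int (a + b) \<le> B"
  shows "qcont A B (\<lambda>s. s * KE1 0 a b s)" "regular_exponents a b \<Longrightarrow> qcont A B (KE1 0 a b)"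
proof -
  have le: "2 + of_int (a + b) - real n \<le> A" using assms(2) by linarith
  show "qcont A B (\<lambda>s. s * KE1 0 a b s)" "regular_exponents a b \<Longrightarrow> qcont A B (KE1 0 a b)"
    using assms(1) unfolding cont_level_def by (blast intro: qcont_mono[OF _ le assms(3)])+
qed

lemma KE_rem_holomorphic:
  "KE_rem M z t a b holomorphic_on {s. Re s > 2 + (of_int (a + b) - real M)}"
  using loc_dominated_infsum_holomorphic[OF loc_dominated_ke_rem] by (simp add: KE_rem_def[abs_def])

text \<open>If lowering destroys regularity, then \<open>a < 0 \<le> b < j\<close>: the coefficient
  is divisible by \<open>s\<close>, and \<open>s\<close> times the series is covered by the first
  half of \<open>cont_level\<close>.\<close>

lemma qcont_Taylor_term:
  assumes n: "cont_level n" and A: "of_int (a + b) - real (i + j) + 2 - real n \<le> A"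
    and B: "2 + of_int (a + b) \<le> B"
    and reg: "regular_exponents (a - int i) (b - int j) \<or> regular_exponents a b"
  shows "qcont A B (\<lambda>s. tcoef a b i j t s * KE1 0 (a - int i) (b - int j) s)"
proof (cases "regular_exponents (a - int i) (b - int j)")
  case True
  thus ?thesis using A B
    by (intro qcont_cmult[OF _ tcoef_holomorphic] cont_levelD(2)[OF n]) auto
next
  case False
  hence "0 \<le> b" "b < int j" using reg by (auto simp: regular_exponents_def)
  then obtain c where c: "c holomorphic_on UNIV" "\<And>s. ((of_int b - s / 2) gchoose j) = s * c s"
    using gbinomial_vanishing_factor by blast
  have "qcont A B (\<lambda>s. (((of_int a - s / 2) gchoose i) * c s * t ^ i * cnj t ^ j) *
      (s * KE1 0 (a - int i) (b - int j) s))"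
  proof (rule qcont_cmult)
    show "(\<lambda>s. ((of_int a - s / 2) gchoose i) * c s * t ^ i * cnj t ^ j) holomorphic_on UNIV"
      unfolding gbinomial_prod_rev by (intro holomorphic_intros c(1)) auto
    show "qcont A B (\<lambda>s. s * KE1 0 (a - int i) (b - int j) s)"
      using A B by (intro cont_levelD(1)[OF n]) auto
  qed
  thus ?thesis by (rule qcont_cong) (simp add: tcoef_def c(2) mult_ac)
qed

text \<open>Self-similarity expresses the series at 0 through its translates by
  \<open>t / \<mu>\<close>, which are expanded at 0 to order \<open>n + 1\<close>. The coefficient
  at \<open>(0, 0)\<close> is 1, so each of the \<open>card R\<close> translates returns a copy of
  the series, which moves to the left; all other terms have smaller \<open>a + b\<close>.\<close>

lemma KE1_functional:
  assumes s: "Re s > 2 + of_int (a + b)" and \<mu>: "\<mu> \<noteq> 0" and R: "finite R"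
    and bij: "bij_betw (\<lambda>(t, l). t + \<mu> * l) (R \<times> L) L"
  shows "(1 - of_nat (card R) * ke_term a b s \<mu>) * KE1 0 a b s =
    (\<Sum>t\<in>R. ke_term a b s \<mu> * ((\<Sum>(i, j)\<in>{..n} \<times> {..n} - {(0, 0)}.
       tcoef a b i j (t / \<mu>) s * KE1 0 (a - int i) (b - int j) s) + KE_rem (Suc n) 0 (t / \<mu>) a b s))"
proof -
  have T: "KE1 (t / \<mu>) a b s = KE1 0 a b s + ((\<Sum>(i, j)\<in>{..n} \<times> {..n} - {(0, 0)}.
       tcoef a b i j (t / \<mu>) s * KE1 0 (a - int i) (b - int j) s) + KE_rem (Suc n) 0 (t / \<mu>) a b s)" for t
  proof -
    have "KE1 (0 + t / \<mu>) a b s = (\<Sum>(i, j)\<in>{..n} \<times> {..n}.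
       tcoef a b i j (t / \<mu>) s * KE1 0 (a - int i) (b - int j) s) + KE_rem (Suc n) 0 (t / \<mu>) a b s"
      unfolding KE1_Taylor[OF s, of 0 _ "Suc n"] lessThan_Suc_atMost by (simp add: sum.cartesian_product)
    also have "(\<Sum>(i, j)\<in>{..n} \<times> {..n}. tcoef a b i j (t / \<mu>) s * KE1 0 (a - int i) (b - int j) s)
      = KE1 0 a b s + (\<Sum>(i, j)\<in>{..n} \<times> {..n} - {(0, 0)}.
       tcoef a b i j (t / \<mu>) s * KE1 0 (a - int i) (b - int j) s)"
      by (subst sum.remove[of _ "(0, 0)"]) (auto simp: tcoef_def)
    finally show ?thesis by simp
  qed
  have "KE1 0 a b s = (\<Sum>t\<in>R. ke_term a b s \<mu> * KE1 (t / \<mu>) a b s)"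
    by (rule KE1_distribution[OF s \<mu> R bij])
  also have "\<dots> = of_nat (card R) * ke_term a b s \<mu> * KE1 0 a b s +
    (\<Sum>t\<in>R. ke_term a b s \<mu> * ((\<Sum>(i, j)\<in>{..n} \<times> {..n} - {(0, 0)}.
       tcoef a b i j (t / \<mu>) s * KE1 0 (a - int i) (b - int j) s) + KE_rem (Suc n) 0 (t / \<mu>) a b s))"
    unfolding T by (simp only: distrib_left sum.distrib) (simp add: mult_ac)
  finally show ?thesis by (simp add: algebra_simps)
qed

text \<open>
  The functional equation expresses \<open>KE1 0 a b\<close> through series with smaller exponents, whose
  half planes of continuation are one unit larger.
\<close>

lemma qcont_functional:
  assumes n: "cont_level n" and \<mu>: "\<mu> \<noteq> 0" and R: "finite R"
    and bij: "bij_betw (\<lambda>(t, l). t + \<mu> * l) (R \<times> L) L"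
    and reg: "regular_exponents a b \<or> a + b \<le> - 2"
  shows "qcont (2 + of_int (a + b) - real (Suc n)) (2 + of_int (a + b))
    (\<lambda>s. (1 - of_nat (card R) * ke_term a b s \<mu>) * KE1 0 a b s)"
proof -
  let ?A = "2 + of_int (a + b) - real (Suc n)" and ?B = "2 + of_int (a + b) :: real"
  have "qcont ?A ?B (\<lambda>s. \<Sum>t\<in>R. ke_term a b s \<mu> * ((\<Sum>p\<in>{..n} \<times> {..n} - {(0, 0)}.
       tcoef a b (fst p) (snd p) (t / \<mu>) s * KE1 0 (a - int (fst p)) (b - int (snd p)) s) +
       KE_rem (Suc n) 0 (t / \<mu>) a b s))"
  proof (rule qcont_sum, rule qcont_cmult, rule qcont_add, rule qcont_sum)
    fix t p assume "t \<in> R" and p: "p \<in> {..n} \<times> {..n} - {(0, 0)}"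
    hence pp: "fst p + snd p \<ge> 1" by (cases p) auto
    hence pr: "real (fst p + snd p) \<ge> 1" by linarith
    show "qcont ?A ?B (\<lambda>s. tcoef a b (fst p) (snd p) (t / \<mu>) s * KE1 0 (a - int (fst p)) (b - int (snd p)) s)"
      using pr pp reg by (intro qcont_Taylor_term[OF n]) (auto simp: regular_exponents_def)
  next
    fix t show "qcont ?A ?B (KE_rem (Suc n) 0 (t / \<mu>) a b)"
      using KE_rem_holomorphic[of "Suc n" 0 "t / \<mu>" a b] by (intro qcont_holomorphic) (auto simp: add_diff_eq)
  qed (auto intro!: holomorphic_intros)
  thus ?thesis
    by (rule qcont_cong) (subst KE1_functional[OF _ \<mu> R bij, of _ _ _ n], simp_all add: case_prod_unfold)
qed

text \<open>After multiplication by \<open>s\<close> the first half of \<open>cont_level\<close>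
  covers every lowered series, whatever the exponents.\<close>

lemma qcont_functional':
  assumes n: "cont_level n" and \<mu>: "\<mu> \<noteq> 0" and R: "finite R"
    and bij: "bij_betw (\<lambda>(t, l). t + \<mu> * l) (R \<times> L) L"
  shows "qcont (2 + of_int (a + b) - real (Suc n)) (2 + of_int (a + b))
    (\<lambda>s. (1 - of_nat (card R) * ke_term a b s \<mu>) * (s * KE1 0 a b s))"
proof -
  let ?A = "2 + of_int (a + b) - real (Suc n)" and ?B = "2 + of_int (a + b) :: real"
  have "qcont ?A ?B (\<lambda>s. \<Sum>t\<in>R. ke_term a b s \<mu> * ((\<Sum>p\<in>{..n} \<times> {..n} - {(0, 0)}.
       tcoef a b (fst p) (snd p) (t / \<mu>) s * (s * KE1 0 (a - int (fst p)) (b - int (snd p)) s)) +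
       s * KE_rem (Suc n) 0 (t / \<mu>) a b s))"
  proof (rule qcont_sum, rule qcont_cmult, rule qcont_add, rule qcont_sum, rule qcont_cmult)
    fix t p assume "t \<in> R" and p: "p \<in> {..n} \<times> {..n} - {(0, 0)}"
    hence "fst p + snd p \<ge> 1" by (cases p) auto
    hence pr: "real (fst p + snd p) \<ge> 1" by linarith
    show "qcont ?A ?B (\<lambda>s. s * KE1 0 (a - int (fst p)) (b - int (snd p)) s)"
      using pr by (intro cont_levelD(1)[OF n]) auto
  next
    fix t show "qcont ?A ?B (\<lambda>s. s * KE_rem (Suc n) 0 (t / \<mu>) a b s)"
      using KE_rem_holomorphic[of "Suc n" 0 "t / \<mu>" a b]
      by (intro qcont_cmult qcont_holomorphic) (auto simp: add_diff_eq)
  qed (auto intro!: holomorphic_intros tcoef_holomorphic)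
  moreover have "(\<Sum>t\<in>R. ke_term a b s \<mu> * ((\<Sum>p\<in>{..n} \<times> {..n} - {(0, 0)}.
       tcoef a b (fst p) (snd p) (t / \<mu>) s * (s * KE1 0 (a - int (fst p)) (b - int (snd p)) s)) +
       s * KE_rem (Suc n) 0 (t / \<mu>) a b s)) =
     (1 - of_nat (card R) * ke_term a b s \<mu>) * (s * KE1 0 a b s)" if "Re s > ?B" for s
  proof -
    have "(1 - of_nat (card R) * ke_term a b s \<mu>) * (s * KE1 0 a b s) =
      s * ((1 - of_nat (card R) * ke_term a b s \<mu>) * KE1 0 a b s)" by (simp add: mult_ac)
    also have "\<dots> = s * (\<Sum>t\<in>R. ke_term a b s \<mu> * ((\<Sum>(i, j)\<in>{..n} \<times> {..n} - {(0, 0)}.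
       tcoef a b i j (t / \<mu>) s * KE1 0 (a - int i) (b - int j) s) + KE_rem (Suc n) 0 (t / \<mu>) a b s))"
      by (simp only: KE1_functional[OF that \<mu> R bij, of n])
    finally show ?thesis
      by (simp add: sum_distrib_left distrib_left case_prod_unfold mult_ac)
  qed
  ultimately show ?thesis by (rule qcont_cong)
qed

text \<open>The functional equation can be solved where
  \<open>1 - card R * ke_term a b s \<mu>\<close> does not vanish at 0. For \<mu> = 2 its value
  there is \<open>1 - 4 * 2^(a + b)\<close>, so only \<open>a + b = -2\<close> resists. In that case
  regular exponents need a multiplier of another direction, while for the weaker claim about
  \<open>s\<close> times the series the zero of the factor is simple and may be divided out.\<close>

lemma cont_level_Suc:
  assumes n: "cont_level n"
  shows "cont_level (Suc n)"
  unfolding cont_level_def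
proof (intro allI conjI impI)
  fix a b :: int
  let ?A = "2 + of_int (a + b) - real (Suc n)" and ?B = "2 + of_int (a + b) :: real"
  define R where "R = pt ` ({0..<2} \<times> {0..<2})"
  have R: "finite R" "card R = 4" "bij_betw (\<lambda>(t, l). t + 2 * l) (R \<times> L) L"
    using bij_betw_integer_residues[of 2] card_integer_residues[of 2] by (auto simp: R_def)
  have g2: "(\<lambda>s. 1 - of_nat (card R') * ke_term a b s \<mu>) holomorphic_on UNIV" for \<mu> and R' :: "complex set"
    by (intro holomorphic_intros)
  have nz: "1 - of_nat (card R) * ke_term a b 0 2 \<noteq> 0" if "a + b \<noteq> - 2"
  proof
    assume "1 - of_nat (card R) * ke_term a b 0 2 = 0"
    hence "complex_of_real (2 powi 2 * 2 powi (a + b)) = 1"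
      by (simp add: R(2) ke_term_def power_int_add)
    hence "(2::real) powi (2 + (a + b)) = 1" by (subst power_int_add) (simp_all only: of_real_eq_1_iff, simp)
    hence "(2::real) powr of_int (2 + (a + b)) = 1" by (subst powr_real_of_int') auto
    hence "2 + (a + b) = 0" by (subst (asm) powr_eq_one_iff) (auto simp del: of_int_add)
    thus False using that by simp
  qed
  show reg: "qcont ?A ?B (KE1 0 a b)" if r: "regular_exponents a b"
  proof (cases "a + b = - 2")
    case False
    thus ?thesis
      using qcont_functional[OF n _ R(1,3), of a b] r nz g2[of R 2] by (auto intro: qcont_cancel)
  next
    case True
    with r have ab: "a < 0" "0 \<le> b" "a = - 2 - b" by (auto simp: regular_exponents_def)
    \<comment> \<open>At \<open>s = 0\<close> the term of \<mu> is a positive real times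
      \<open>v^(-k)\<close>, where \<open>v = \<mu> / |\<mu>|\<close>. If the factor vanished,
      \<open>v^k\<close> would be a positive real of modulus 1, contrary to the choice of
      \<mu>.\<close>
    define k where "k = nat (b - a)"
    have "k > 0" using ab by (simp add: k_def)
    obtain \<mu> R' where \<mu>: "\<mu> \<noteq> 0" "finite R'" "R' \<noteq> {}" "bij_betw (\<lambda>(t, l). t + \<mu> * l) (R' \<times> L) L"
      "(\<mu> / of_real (cmod \<mu>)) ^ k \<noteq> 1" using multiplier_exists[OF \<open>k > 0\<close>] .
    have "1 - of_nat (card R') * ke_term a b 0 \<mu> \<noteq> 0"
    proof
      assume e: "1 - of_nat (card R') * ke_term a b 0 \<mu> = 0"
      define v where "v = \<mu> / of_real (cmod \<mu>)"
      define c where "c = real (card R') * cmod \<mu> powi (a + b)"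
      have v: "\<mu> = of_real (cmod \<mu>) * v" "cmod v = 1" using \<mu>(1) by (auto simp: v_def norm_divide)
      have v0: "v \<noteq> 0" using v by auto
      have cv: "cnj v = inverse v" using v(2) by (metis inverse_unique complex_norm_square of_real_1 one_power2 v0 mult.commute)
      have c0: "c > 0" using \<mu> by (auto simp: c_def card_gt_0_iff zero_less_power_int)
      have "ke_term a b 0 \<mu> = (of_real (cmod \<mu>) * v) powi a * cnj (of_real (cmod \<mu>) * v) powi b"
        using \<mu>(1) v(1) by (simp add: ke_term_def)
      also have "\<dots> = of_real (cmod \<mu> powi (a + b)) * (v powi a * inverse v powi b)"
        using \<mu>(1) by (simp add: power_int_mult_distrib power_int_add cv)
      also have "v powi a * inverse v powi b = inverse (v ^ k)"
      proof -
        have "v powi a * inverse v powi b = v powi (a - b)"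
          using v0 by (simp add: power_int_diff power_int_inverse divide_inverse)
        also have "a - b = - int k" using ab by (simp add: k_def)
        finally show ?thesis by (simp add: power_int_minus)
      qed
      finally have K: "v ^ k * ke_term a b 0 \<mu> = of_real (cmod \<mu> powi (a + b))" using v0 by (simp add: field_simps)
      have "of_real c = v ^ k * (of_nat (card R') * ke_term a b 0 \<mu>)"
        using K by (simp add: c_def mult.left_commute)
      hence "of_real c = v ^ k" using e by simp
      moreover from this have "cmod (of_real c) = 1" using v(2) by (simp add: norm_power)
      hence "c = 1" using c0 by simp
      ultimately show False using \<mu>(5) by (simp add: v_def)
    qed
    with qcont_functional[OF n \<mu>(1,2,4), of a b] r g2[of R' \<mu>] show ?thesis
      by (auto intro: qcont_cancel)
  qed
  show "qcont ?A ?B (\<lambda>s. s * KE1 0 a b s)"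
  proof (cases "a + b = - 2")
    case False
    thus ?thesis using qcont_functional'[OF n _ R(1,3), of a b] nz g2[of R 2] by (auto intro: qcont_cancel)
  next
    case True
    \<comment> \<open>Here \<open>4 * 2^(-2) = 1\<close>, so the factor is
      \<open>1 - 2^(-s)\<close>, with a simple zero at 0; its quotient \<phi> by \<open>s\<close>
      has the value \<open>ln 2\<close> there. Exponents lowered from \<open>a + b = -2\<close> are
      all regular, so the equation without the extra \<open>s\<close> applies.\<close>
    let ?g = "\<lambda>s. 1 - of_nat (card R) * ke_term a b s 2"
    have g: "?g s = 1 - exp (- s * of_real (ln 2))" for s
    proof -
      have "(2::complex) powi a * 2 powi b = inverse 4"
        using True by (simp add: power_int_minus flip: power_int_add)
      thus ?thesis by (simp add: R(2) ke_term_def mult_ac)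
    qed
    define \<phi> where "\<phi> = (\<lambda>s. if s = 0 then deriv ?g 0 else (?g s - ?g 0) / (s - 0))"
    have "\<phi> holomorphic_on UNIV" unfolding \<phi>_def by (rule pole_lemma[OF g2]) simp
    moreover have "((\<lambda>s::complex. 1 - exp (- s * of_real (ln 2))) has_field_derivative of_real (ln 2)) (at 0)"
      by (auto intro!: derivative_eq_intros)
    hence "\<phi> 0 \<noteq> 0" unfolding \<phi>_def g by (simp add: DERIV_imp_deriv)
    moreover have "?g s = s * \<phi> s" for s by (simp add: \<phi>_def g)
    hence "(\<lambda>s. ?g s * KE1 0 a b s) = (\<lambda>s. \<phi> s * (s * KE1 0 a b s))" by (simp add: fun_eq_iff)
    ultimately show ?thesis using qcont_functional[OF n _ R(1,3), of a b] True
      by (auto intro: qcont_cancel)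
  qed
qed

lemma cont_level: "cont_level n"
proof (induction n)
  case 0
  have "qcont (2 + of_int (a + b) - real 0) (2 + of_int (a + b)) (KE1 0 a b)" for a b
    using loc_dominated_infsum_holomorphic[OF loc_dominated_ke_term, of a b 0]
    by (intro qcont_holomorphic) (auto simp: KE1_def[abs_def])
  thus ?case unfolding cont_level_def by (auto intro!: qcont_cmult holomorphic_intros)
qed (rule cont_level_Suc)

text \<open>Taylor expansion from 0 to \<open>z\<close> reduces the translated series to those at 0;
  the order \<open>n\<close> is large enough for both these and the remainder to reach
  \<open>Re s > A\<close>.\<close>

theorem qcont_KE1:
  assumes "regular_exponents a b" "A \<le> 2 + of_int (a + b)"
  shows "qcont A (2 + of_int (a + b)) (KE1 z a b)"
proof -
  obtain n where n: "real n \<ge> 2 + of_int (a + b) - A" using real_arch_simple by blast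
  let ?B = "2 + of_int (a + b) :: real"
  have "qcont A ?B (\<lambda>s. (\<Sum>i<n. \<Sum>j<n. tcoef a b i j z s * KE1 0 (a - int i) (b - int j) s) + KE_rem n 0 z a b s)"
  proof (intro qcont_add qcont_sum assms(2))
    fix i j
    have "2 + of_int (a + b) - real n \<le> A" using n by linarith
    thus "qcont A ?B (\<lambda>s. tcoef a b i j z s * KE1 0 (a - int i) (b - int j) s)"
      using assms by (intro qcont_Taylor_term[OF cont_level[of n]]) auto
    show "qcont A ?B (KE_rem n 0 z a b)"
      using n assms(2) by (intro qcont_holomorphic holomorphic_on_subset[OF KE_rem_holomorphic]) auto
  qed
  thus ?thesis by (rule qcont_cong) (use KE1_Taylor[of a b _ 0 z n] in simp)
qed

end

section \<open>The value of a continuation at the origin\<close>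

lemma open_Re_gt: "open {s. Re s > A}" and convex_Re_gt: "convex {s. Re s > A}"
  and connected_Re_gt: "connected {s. Re s > A}"
  by (simp_all add: open_halfspace_Re_gt convex_halfspace_Re_gt convex_connected)

lemma holomorphic_zero_halfplane:
  assumes "f holomorphic_on S" "open S" "connected S" "s1 \<in> S" "Re s1 > B"
    and "\<And>s. s \<in> S \<Longrightarrow> Re s > B \<Longrightarrow> f s = 0" "s \<in> S"
  shows "f s = 0"
proof (rule analytic_continuation_open[of "S \<inter> {s. Re s > B}" S f "\<lambda>_. 0"])
  show "open (S \<inter> {s. Re s > B})" using assms open_Re_gt by blast
  show "S \<inter> {s. Re s > B} \<noteq> {}" using assms by blast
qed (use assms in auto)

text \<open>The domain \<open>S\<close> may leave any given half plane on its way to 0. A path in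
  \<open>S\<close> from 0 to the region of convergence is compact, so it stays in some half plane
  \<open>Re s > A'\<close>. A second quotient \<open>h' / D'\<close>, valid there, represents
  \<open>f\<close> along the path, and both quotients agree on a common half plane that contains
  0.\<close>

lemma quotient_value_unique:
  assumes D: "D holomorphic_on UNIV" "D 0 \<noteq> 0" "h holomorphic_on {s. Re s > A}" "A < 0"
      "\<And>s. Re s > B \<Longrightarrow> D s * G s = h s"
    and cont: "\<And>A. A \<le> B \<Longrightarrow> qcont A B G"
    and S: "open S" "connected S" "{s. Re s > B} \<subseteq> S" "0 \<in> S" "f holomorphic_on S"
      "\<And>s. Re s > B \<Longrightarrow> f s = G s"
  shows "D 0 * f 0 = h 0"
proof -
  define s1 where "s1 = complex_of_real (B + 1)"
  have s1: "Re s1 > B" by (simp add: s1_def)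
  have "path_connected S" using S(1,2) connected_open_path_connected by blast
  then obtain g where g: "path g" "path_image g \<subseteq> S" "pathstart g = 0" "pathfinish g = s1"
    using S(3,4) s1 unfolding path_connected_def by blast
  have "compact (Re ` path_image g)"
    using g(1) by (intro compact_continuous_image compact_path_image continuous_intros)
  then obtain m where m: "\<And>s. s \<in> path_image g \<Longrightarrow> m \<le> Re s"
    using compact_imp_bounded bounded_imp_bdd_below by (metis bdd_below.E imageI)
  \<comment> \<open>Left of the whole path, at most \<open>B\<close> so that \<open>cont\<close>
    applies, and negative so that 0 is inside.\<close>
  define A' where "A' = min (min (m - 1) B) (-1)"
  have "A' \<le> B" by (simp add: A'_def)
  from cont[OF this] obtain D' h' where D': "D' holomorphic_on UNIV" "D' 0 \<noteq> 0"
     "h' holomorphic_on {s. Re s > A'}" "\<And>s. Re s > B \<Longrightarrow> D' s * G s = h' s"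
    unfolding qcont_def by blast
  define W where "W = S \<inter> {s. Re s > A'}"
  have oW: "open W" using S(1) open_Re_gt by (auto simp: W_def)
  \<comment> \<open>\<open>W\<close> may be disconnected; the identity theorem is applied on the
    component that contains the path.\<close>
  define U where "U = connected_component_set W 0"
  have pW: "path_image g \<subseteq> W" using g(2) m by (force simp: W_def A'_def)
  have "connected (path_image g)" using g(1) by (rule connected_path_image)
  hence "path_image g \<subseteq> U" unfolding U_def
    using pW g(3) pathstart_in_path_image[of g] by (intro connected_component_maximal) auto
  hence U: "0 \<in> U" "s1 \<in> U"
    using g(3,4) pathstart_in_path_image[of g] pathfinish_in_path_image[of g] by auto
  have UW: "U \<subseteq> W" unfolding U_def by (rule connected_component_subset)
  have "D' 0 * f 0 - h' 0 = 0"
  proof (rule holomorphic_zero_halfplane[of "\<lambda>s. D' s * f s - h' s" U s1 B])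
    show "(\<lambda>s. D' s * f s - h' s) holomorphic_on U"
      using UW holomorphic_on_subset[OF D'(1)] holomorphic_on_subset[OF D'(3)] holomorphic_on_subset[OF S(5)]
      by (intro holomorphic_intros) (auto simp: W_def)
    show "open U" unfolding U_def using oW by (rule open_connected_component)
    show "connected U" unfolding U_def by simp
  qed (use U s1 S(6) D'(4) in auto)
  moreover have "D 0 * h' 0 - D' 0 * h 0 = 0"
  proof (rule holomorphic_zero_halfplane[of "\<lambda>s. D s * h' s - D' s * h s" "{s. Re s > max A A'}"
        "of_real (max (max A A') B + 1)" B])
    show "(\<lambda>s. D s * h' s - D' s * h s) holomorphic_on {s. Re s > max A A'}"
      by (intro holomorphic_intros holomorphic_on_subset[OF D'(1)] holomorphic_on_subset[OF D'(3)]
        holomorphic_on_subset[OF D(1)] holomorphic_on_subset[OF D(3)]) auto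
    show "D s * h' s - D' s * h s = 0" if "Re s > B" for s
      by (simp add: D(5)[OF that, symmetric] D'(4)[OF that, symmetric])
    show "open {s. Re s > max A A'}" "connected {s. Re s > max A A'}"
      by (rule open_Re_gt connected_Re_gt)+
  qed (use \<open>A < 0\<close> in \<open>auto simp: A'_def\<close>)
  ultimately have "D' 0 * (D 0 * f 0) = D' 0 * h 0" by (simp add: mult.left_commute)
  thus ?thesis using D'(2) by simp
qed

text \<open>Removing the countable closed set of zeros of \<open>D\<close> leaves the half plane
  open and connected, and \<open>h / D\<close> is holomorphic there. Zeros to the right of
  \<open>B\<close> are restored with \<open>G\<close> itself, since the whole half plane of
  convergence must belong to the domain.\<close>

lemma continuation_exists:
  assumes G: "G holomorphic_on {s. Re s > B}" and cont: "\<And>A. A \<le> B \<Longrightarrow> qcont A B G"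
  obtains S f where "open S" "connected S" "{s. Re s > B} \<subseteq> S" "0 \<in> S" "f holomorphic_on S"
      "\<And>s. Re s > B \<Longrightarrow> f s = G s"
proof -
  define A where "A = min B (-1)"
  obtain D h where D: "D holomorphic_on UNIV" "D 0 \<noteq> 0" "h holomorphic_on {s. Re s > A}"
     "\<And>s. Re s > B \<Longrightarrow> D s * G s = h s"
    using cont[of A, unfolded A_def, OF min.cobounded1] unfolding qcont_def A_def by blast
  define Z where "Z = {s. D s = 0}"
  let ?H = "{s. Re s > B}" and ?T = "{s. Re s > A} - Z"
  have cZ: "countable Z"
  proof (cases "D constant_on UNIV")
    case True
    hence "Z = {}" using D(2) by (auto simp: Z_def constant_on_def)
    thus ?thesis by simp
  next
    case False
    thus ?thesis using holomorphic_countable_zeros[OF D(1)]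
      by (simp add: Z_def connected_UNIV)
  qed
  have clZ: "closed Z"
    using continuous_closed_preimage_constant[OF holomorphic_on_imp_continuous_on[OF D(1)], of 0]
    by (simp add: Z_def)
  have oT: "open ?T" using clZ open_Re_gt by blast
  have cT: "connected ?T" using cZ by (intro connected_open_diff_countable open_Re_gt connected_Re_gt) auto
  have "\<exists>s1. Re s1 > B \<and> D s1 \<noteq> 0"
  proof (rule ccontr)
    assume n: "\<nexists>s1. Re s1 > B \<and> D s1 \<noteq> 0"
    have "D 0 = 0"
      by (rule holomorphic_zero_halfplane[OF D(1) open_UNIV connected_UNIV, of "of_real (B + 1)" B])
         (use n in auto)
    thus False using D(2) by simp
  qed
  then obtain s1 where s1: "s1 \<in> ?H" "s1 \<notin> Z" by (auto simp: Z_def)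
  define f where "f = (\<lambda>s. if Re s > B then G s else h s / D s)"
  have fT: "f s = h s / D s" if "s \<in> ?T" for s
    using that D(4)[of s] by (auto simp: f_def Z_def field_simps)
  show ?thesis
  proof (rule that[of "?T \<union> ?H" f])
    show "open (?T \<union> ?H)" using oT open_Re_gt by blast
    have "s1 \<in> ?T \<inter> ?H" using s1 by (simp add: A_def min_less_iff_disj)
    hence "?T \<inter> ?H \<noteq> {}" by blast
    thus "connected (?T \<union> ?H)" using cT connected_Re_gt by (intro connected_Un)
    have "(\<lambda>s. h s / D s) holomorphic_on ?T"
      using holomorphic_on_subset[OF D(1)] holomorphic_on_subset[OF D(3)]
      by (intro holomorphic_intros) (auto simp: Z_def)
    hence "f holomorphic_on ?T" by (rule holomorphic_transform) (rule fT[symmetric])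
    moreover have "f holomorphic_on ?H" using G by (rule holomorphic_transform) (simp add: f_def)
    ultimately show "f holomorphic_on ?T \<union> ?H" using oT open_Re_gt by (simp add: holomorphic_on_Un)
    show "0 \<in> ?T \<union> ?H" using D(2) by (simp add: Z_def A_def min_less_iff_disj)
  qed (auto simp: f_def)
qed

text \<open>The description operator of \<open>KE\<close>, with the series and its half plane as
  parameters.\<close>

definition cont_value :: "complex set \<Rightarrow> (complex \<Rightarrow> complex) \<Rightarrow> complex" where
  "cont_value H G = (THE w. \<exists>S f. open S \<and> connected S \<and> H \<subseteq> S \<and> 0 \<in> S \<and>
     f holomorphic_on S \<and> (\<forall>s\<in>H. f s = G s) \<and> w = f 0)"

lemma cont_value_eq:
  assumes G: "G holomorphic_on {s. Re s > B}" and cont: "\<And>A. A \<le> B \<Longrightarrow> qcont A B G"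
    and D: "D holomorphic_on UNIV" "D 0 \<noteq> 0" "h holomorphic_on {s. Re s > A}" "A < 0"
      "\<And>s. Re s > B \<Longrightarrow> D s * G s = h s"
  shows "D 0 * cont_value {s. Re s > B} G = h 0"
proof -
  have u: "D 0 * f 0 = h 0" if "open S" "connected S" "{s. Re s > B} \<subseteq> S" "0 \<in> S" "f holomorphic_on S"
      "\<And>s. Re s > B \<Longrightarrow> f s = G s" for S f
    by (rule quotient_value_unique[OF D(1-4)]) (use D(5) cont that in blast)+
  obtain S f where S: "open S" "connected S" "{s. Re s > B} \<subseteq> S" "0 \<in> S" "f holomorphic_on S"
      "\<And>s. Re s > B \<Longrightarrow> f s = G s" using continuation_exists[OF G cont] by blast
  have "cont_value {s. Re s > B} G = f 0" unfolding cont_value_def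
  proof (rule the_equality)
    show "\<exists>S f'. open S \<and> connected S \<and> {s. Re s > B} \<subseteq> S \<and> 0 \<in> S \<and>
     f' holomorphic_on S \<and> (\<forall>s\<in>{s. Re s > B}. f' s = G s) \<and> f 0 = f' 0" using S by blast
  next
    fix w assume "\<exists>S f. open S \<and> connected S \<and> {s. Re s > B} \<subseteq> S \<and> 0 \<in> S \<and>
     f holomorphic_on S \<and> (\<forall>s\<in>{s. Re s > B}. f s = G s) \<and> w = f 0"
    then obtain S' f' where S': "open S'" "connected S'" "{s. Re s > B} \<subseteq> S'" "0 \<in> S'" "f' holomorphic_on S'"
      "\<And>s. Re s > B \<Longrightarrow> f' s = G s" "w = f' 0" by auto
    have "D 0 * f' 0 = D 0 * f 0" using u[OF S'(1-6)] u[OF S] by simp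
    thus "w = f 0" using D(2) S'(7) by simp
  qed
  thus ?thesis using u[OF S] by simp
qed

section \<open>Averaged differences\<close>

definition avg_diff :: "complex set \<Rightarrow> (complex \<Rightarrow> complex) \<Rightarrow> complex \<Rightarrow> complex" where
  "avg_diff T F = (\<lambda>y. F y - (\<Sum>t\<in>T. F (y + t)) / of_nat (card T))"

text \<open>Vanishing of all \<open>n\<close>-fold finite differences: a coordinate-free substitute
  for being a polynomial in \<open>y\<close> and \<open>cnj y\<close> of degree below
  \<open>n\<close>.\<close>

fun polynomial_like :: "nat \<Rightarrow> (complex \<Rightarrow> complex) \<Rightarrow> bool" where
  "polynomial_like 0 F \<longleftrightarrow> (\<forall>y. F y = 0)"
| "polynomial_like (Suc n) F \<longleftrightarrow> (\<forall>t. polynomial_like n (\<lambda>y. F (y + t) - F y))"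

lemma polynomial_like_zero: "polynomial_like n (\<lambda>y. 0)"
  by (induction n) auto

lemma polynomial_like_add:
  "polynomial_like n F \<Longrightarrow> polynomial_like n G \<Longrightarrow> polynomial_like n (\<lambda>y. F y + G y)"
proof (induction n arbitrary: F G)
  case (Suc n)
  have "polynomial_like n (\<lambda>y. (F (y + t) - F y) + (G (y + t) - G y))" for t
    using Suc by auto
  thus ?case by (simp add: algebra_simps)
qed auto

lemma polynomial_like_cmult: "polynomial_like n F \<Longrightarrow> polynomial_like n (\<lambda>y. c * F y)"
proof (induction n arbitrary: F)
  case (Suc n)
  have "polynomial_like n (\<lambda>y. c * (F (y + t) - F y))" for t using Suc by auto
  thus ?case by (simp add: algebra_simps)
qed auto

lemma polynomial_like_sum:
  "(\<And>i. i \<in> I \<Longrightarrow> polynomial_like n (F i)) \<Longrightarrow> polynomial_like n (\<lambda>y. \<Sum>i\<in>I. F i y)"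
  by (induction I rule: infinite_finite_induct) (auto intro: polynomial_like_zero polynomial_like_add)

lemma polynomial_like_shift: "polynomial_like n F \<Longrightarrow> polynomial_like n (\<lambda>y. F (y + c))"
proof (induction n arbitrary: F)
  case (Suc n)
  have "polynomial_like n (\<lambda>y. F (y + c + t) - F (y + c))" for t
    using Suc.IH[of "\<lambda>y. F (y + t) - F y"] Suc.prems by simp
  thus ?case by (simp add: add_ac)
qed auto

lemma polynomial_like_mono: "polynomial_like n F \<Longrightarrow> n \<le> m \<Longrightarrow> polynomial_like m F"
proof -
  have "polynomial_like n F \<Longrightarrow> polynomial_like (Suc n) F" for n F
    by (induction n arbitrary: F) auto
  thus "polynomial_like n F \<Longrightarrow> n \<le> m \<Longrightarrow> polynomial_like m F"
    by (induction m) (auto simp: le_Suc_eq)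
qed

text \<open>Leibniz rule for finite differences. The order is one more than the degree, hence the
  \<open>- 1\<close>.\<close>

lemma polynomial_like_mult:
  "polynomial_like a F \<Longrightarrow> polynomial_like b G \<Longrightarrow> polynomial_like (a + b - 1) (\<lambda>y. F y * G y)"
proof (induction "a + b" arbitrary: a b F G rule: less_induct)
  case less
  show ?case
  proof (cases "a = 0 \<or> b = 0")
    case True
    hence "(\<lambda>y. F y * G y) = (\<lambda>y. 0)" using less.prems by auto
    thus ?thesis by (simp only: polynomial_like_zero)
  next
    case False
    then obtain a' b' where ab: "a = Suc a'" "b = Suc b'" by (meson not0_implies_Suc)
    have "polynomial_like (a' + b') (\<lambda>y. (F (y + t) - F y) * G (y + t) + F y * (G (y + t) - G y))" for t
    proof (rule polynomial_like_add)
      show "polynomial_like (a' + b') (\<lambda>y. (F (y + t) - F y) * G (y + t))"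
        using less.hyps[of a' b "\<lambda>y. F (y + t) - F y" "\<lambda>y. G (y + t)"] less.prems ab
        by (simp add: polynomial_like_shift del: polynomial_like.simps(2))
           (metis polynomial_like.simps(2) polynomial_like_shift)
      show "polynomial_like (a' + b') (\<lambda>y. F y * (G (y + t) - G y))"
        using less.hyps[of a b' F "\<lambda>y. G (y + t) - G y"] less.prems ab by simp
    qed
    moreover have "(\<lambda>y. (F (y + t) - F y) * G (y + t) + F y * (G (y + t) - G y)) =
      (\<lambda>y. F (y + t) * G (y + t) - F y * G y)" for t by (simp add: algebra_simps)
    ultimately show ?thesis using ab by simp
  qed
qed

lemma polynomial_like_monomial: "polynomial_like (Suc (i + j)) (\<lambda>y. y ^ i * cnj y ^ j)"
proof -
  have 1: "polynomial_like 1 (\<lambda>y. 1)" by simp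
  have 2: "polynomial_like (Suc i) (\<lambda>y. y ^ i)" for i
  proof (induction i)
    case (Suc i)
    have "polynomial_like 2 (\<lambda>y. y)" by (simp add: numeral_2_eq_2)
    from polynomial_like_mult[OF this Suc] show ?case by simp
  qed (use 1 in simp)
  have 3: "polynomial_like (Suc i) (\<lambda>y. cnj y ^ i)" for i
  proof (induction i)
    case (Suc i)
    have "polynomial_like 2 cnj" by (simp add: numeral_2_eq_2)
    from polynomial_like_mult[OF this Suc] show ?case by simp
  qed (use 1 in simp)
  from polynomial_like_mult[OF 2[of i] 3[of j]] show ?thesis by simp
qed

lemma avg_diff_funpow_add:
  "(avg_diff T ^^ n) (\<lambda>y. F y + G y) = (\<lambda>y. (avg_diff T ^^ n) F y + (avg_diff T ^^ n) G y)"
proof (induction n)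
  case (Suc n)
  thus ?case by (simp add: fun_eq_iff) (simp add: avg_diff_def sum.distrib add_divide_distrib)
qed auto

lemma avg_diff_funpow_shift:
  "(avg_diff T ^^ n) (\<lambda>y. F (c + y)) y = (avg_diff T ^^ n) F (c + y)"
proof (induction n arbitrary: y)
  case (Suc n)
  thus ?case by (simp add: avg_diff_def add_ac)
qed auto

text \<open>\<open>avg_diff\<close> is minus the mean of the differences
  \<open>F (y + t) - F y\<close>, so each application lowers the order by one.\<close>

lemma avg_diff_kills_polynomial:
  assumes "finite T" "T \<noteq> {}" "polynomial_like n F"
  shows "(avg_diff T ^^ n) F = (\<lambda>y. 0)"
  using assms(3)
proof (induction n arbitrary: F)
  case (Suc n)
  have c: "card T \<noteq> 0" using assms by simp
  have "avg_diff T F = (\<lambda>y. (- 1 / of_nat (card T)) * (\<Sum>t\<in>T. F (y + t) - F y))"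
    using c by (simp add: avg_diff_def sum_subtractf field_simps fun_eq_iff)
  moreover have "polynomial_like n (\<lambda>y. (- 1 / of_nat (card T)) * (\<Sum>t\<in>T. F (y + t) - F y))"
    using Suc.prems by (intro polynomial_like_cmult polynomial_like_sum) auto
  ultimately show ?case using Suc.IH by (simp add: funpow_swap1)
qed auto

lemma loc_dominated_avg_diff:
  assumes "open S" "\<And>y. loc_dominated X S (\<lambda>x s. \<Phi> x s y)"
  shows "loc_dominated X S (\<lambda>x s. (avg_diff T ^^ n) (\<Phi> x s) y)"
proof (induction n arbitrary: y)
  case (Suc n)
  have "loc_dominated X S (\<lambda>x s. (avg_diff T ^^ n) (\<Phi> x s) y +
    (- 1 / of_nat (card T)) * (\<Sum>t\<in>T. (avg_diff T ^^ n) (\<Phi> x s) (y + t)))"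
    by (intro loc_dominated_add loc_dominated_cmult loc_dominated_sum Suc assms(1) holomorphic_intros)
  moreover have "(avg_diff T ^^ n) F y + (- 1 / of_nat (card T)) * (\<Sum>t\<in>T. (avg_diff T ^^ n) F (y + t)) =
    (avg_diff T ^^ Suc n) F y" for F
    by (simp add: avg_diff_def[of T "(avg_diff T ^^ n) F"])
  ultimately show ?case by simp
qed (use assms in simp)

text \<open>Around \<open>z + l\<close> the term is its Taylor part plus \<open>ke_rem\<close>. The
  Taylor part has degree below \<open>2 M\<close> in the displacement and is killed by
  \<open>n \<ge> 2 M\<close> averaged differences. The remainder series converges for
  \<open>Re s > 2 + (a + b) - M\<close>, and the condition on \<open>M\<close> places this abscissa
  at or below \<open>-1/2\<close>.\<close>

lemma (in cm_lattice) loc_dominated_avg_diff_ke_term: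
  assumes T: "finite T" "T \<noteq> {}" and M: "of_int (a + b) + 5 / 2 \<le> real M" and n: "2 * M \<le> n"
  shows "loc_dominated L {s. Re s > - (1/2)} (\<lambda>l s. (avg_diff T ^^ n) (ke_term a b s) (z + l))"
proof -
  have "loc_dominated L {s. Re s > - (1/2)} (\<lambda>l s. (avg_diff T ^^ n) (ke_rem M a b s (z + l)) 0)"
    by (intro loc_dominated_avg_diff open_Re_gt loc_dominated_mono[OF loc_dominated_ke_rem[where M = M]])
       (use M in auto)
  moreover have "(avg_diff T ^^ n) (ke_rem M a b s (z + l)) 0 = (avg_diff T ^^ n) (ke_term a b s) (z + l)" for l s
  proof -
    define P where "P = (\<lambda>t. \<Sum>i<M. \<Sum>j<M. (((of_int a - s / 2) gchoose i) * ((of_int b - s / 2) gchoose j) *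
       ke_term (a - int i) (b - int j) s (z + l)) * (t ^ i * cnj t ^ j))"
    have "polynomial_like n P" unfolding P_def
      using n by (intro polynomial_like_sum polynomial_like_cmult polynomial_like_mono[OF polynomial_like_monomial]) auto
    hence P0: "(avg_diff T ^^ n) P = (\<lambda>y. 0)" by (rule avg_diff_kills_polynomial[OF T])
    have e: "(\<lambda>t. ke_term a b s (z + l + t)) = (\<lambda>t. ke_rem M a b s (z + l) t + P t)"
      by (simp add: ke_rem_def P_def mult_ac)
    have "(avg_diff T ^^ n) (ke_term a b s) (z + l + 0) = (avg_diff T ^^ n) (\<lambda>t. ke_term a b s (z + l + t)) 0"
      by (rule avg_diff_funpow_shift[symmetric])
    also have "\<dots> = (avg_diff T ^^ n) (ke_rem M a b s (z + l)) 0 + (avg_diff T ^^ n) P 0"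
      unfolding e avg_diff_funpow_add ..
    finally show ?thesis by (simp add: P0)
  qed
  ultimately show ?thesis by simp
qed

no_notation fps_nth (infixl "$" 75)

section \<open>The rational cocycle\<close>

text \<open>Up to sign the divided difference of the constant 1 at the points \<open>r i\<close>.
  Deleting \<open>a\<close> or \<open>b\<close> from \<open>S\<close> gives equal sums by induction,
  while these two sums differ by \<open>r a - r b\<close> times the sum over
  \<open>S\<close>.\<close>

lemma sum_inverse_differences:
  fixes r :: "'i \<Rightarrow> 'a :: field"
  assumes "finite S" "inj_on r S" "S \<noteq> {}"
  shows "(\<Sum>i\<in>S. 1 / (\<Prod>k\<in>S - {i}. r k - r i)) = (if card S = 1 then 1 else 0)"
  using assms
proof (induction "card S" arbitrary: S rule: less_induct)
  case less
  show ?case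
  proof (cases "card S = 1")
    case True
    then obtain a where "S = {a}" by (auto simp: card_1_singleton_iff)
    thus ?thesis by simp
  next
    case False
    define g where "g T = (\<Sum>i\<in>T. 1 / (\<Prod>k\<in>T - {i}. r k - r i))" for T
    have "card S \<noteq> 0" using less.prems by simp
    with False have "\<not> card S \<le> Suc 0" by linarith
    then obtain a b where ab: "a \<in> S" "b \<in> S" "a \<noteq> b"
      using less.prems(1) by (auto simp: card_le_Suc0_iff_eq)
    have ca: "card (S - {a}) = card S - 1" "card (S - {b}) = card S - 1"
      using ab less.prems(1) by auto
    have "g (S - {a}) = (if card (S - {a}) = 1 then 1 else 0)"
      unfolding g_def using less.prems ab \<open>\<not> card S \<le> Suc 0\<close>
      by (intro less.hyps) (auto simp: ca intro: inj_on_subset)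
    moreover have "g (S - {b}) = (if card (S - {b}) = 1 then 1 else 0)"
      unfolding g_def using less.prems ab \<open>\<not> card S \<le> Suc 0\<close>
      by (intro less.hyps) (auto simp: ca intro: inj_on_subset)
    ultimately have eq: "g (S - {a}) = g (S - {b})" by (simp add: ca)
    define t where "t i = 1 / (\<Prod>k\<in>S - {i}. r k - r i)" for i
    have nz: "r k - r i \<noteq> 0" if "k \<in> S" "i \<in> S" "k \<noteq> i" for k i
      using less.prems(2) that by (auto dest: inj_onD)
    have drop: "1 / (\<Prod>k\<in>S - {c} - {i}. r k - r i) = (r c - r i) * t i"
      if "c \<in> S" "i \<in> S" "c \<noteq> i" for c i
    proof -
      have "(\<Prod>k\<in>S - {i}. r k - r i) = (r c - r i) * (\<Prod>k\<in>S - {i} - {c}. r k - r i)"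
        using that less.prems(1) by (intro prod.remove) auto
      also have "S - {i} - {c} = S - {c} - {i}" by blast
      finally show ?thesis using nz[OF that] by (simp add: t_def)
    qed
    have "g (S - {c}) = (\<Sum>i\<in>S. (r c - r i) * t i)" if "c \<in> S" for c
    proof -
      have "g (S - {c}) = (\<Sum>i\<in>S - {c}. (r c - r i) * t i)"
        unfolding g_def using that by (intro sum.cong refl drop) auto
      also have "\<dots> = (\<Sum>i\<in>S. (r c - r i) * t i)"
        using that less.prems(1) by (intro sum.mono_neutral_left) auto
      finally show ?thesis .
    qed
    hence "g (S - {a}) - g (S - {b}) = (\<Sum>i\<in>S. (r a - r i) * t i - (r b - r i) * t i)"
      using ab by (simp add: sum_subtractf)
    also have "\<dots> = (r a - r b) * g S"
      by (simp add: g_def t_def[symmetric] sum_distrib_left flip: left_diff_distrib)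
    finally have "g S = 0" using eq nz[OF ab] by simp
    thus ?thesis using False by (simp add: g_def)
  qed
qed

section \<open>Maximal minors of N + 1 vectors and the coordinates that they determine\<close>

definition skip :: "nat \<Rightarrow> nat \<Rightarrow> nat" where
  "skip i k = (if k < i then k else Suc k)"

lemma omit_skip: "omit i f k = f (skip i k)"
  by (simp add: omit_def skip_def)

lemma bij_betw_skip: "i \<le> N \<Longrightarrow> bij_betw (skip i) {..<N} ({..N} - {i})"
proof (rule bij_betwI[where g = "\<lambda>k. if k < i then k else k - 1"])
qed (auto simp: skip_def split: if_splits)

definition mat_cols :: "nat \<Rightarrow> (nat \<Rightarrow> 'a vec) \<Rightarrow> 'a mat" where
  "mat_cols N v = mat N N (\<lambda>(r, k). v k $ r)"

lemma mat_cols_carrier [simp]: "mat_cols N v \<in> carrier_mat N N"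
  by (simp add: mat_cols_def)

text \<open>Put a second copy of row \<open>r\<close> on top of the matrix with columns
  \<open>v k\<close>: the determinant vanishes, and its expansion along the top row is the
  claim.\<close>

lemma minor_relation:
  fixes v :: "nat \<Rightarrow> 'a :: comm_ring_1 vec"
  assumes "r < N"
  shows "(\<Sum>i\<le>N. (-1) ^ i * det (mat_cols N (omit i v)) * v i $ r) = 0"
proof -
  define B where "B = mat (Suc N) (Suc N) (\<lambda>(a, k). v k $ (if a = 0 then r else a - 1))"
  have B: "B \<in> carrier_mat (Suc N) (Suc N)" by (simp add: B_def)
  have "det B = 0"
    by (rule det_identical_rows[OF B, of 0 "Suc r"]) (use assms in \<open>auto simp: B_def intro!: eq_vecI\<close>)
  moreover have "det B = (\<Sum>j<Suc N. B $$ (0, j) * cofactor B 0 j)"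
    by (rule laplace_expansion_row[OF B]) simp
  moreover have "mat_delete B 0 j = mat_cols N (omit j v)" if "j \<le> N" for j
    using that by (intro eq_matI) (auto simp: B_def mat_delete_def mat_cols_def omit_skip skip_def)
  ultimately have "(\<Sum>j<Suc N. v j $ r * ((-1) ^ j * det (mat_cols N (omit j v)))) = 0"
    by (simp add: cofactor_def B_def lessThan_Suc_atMost)
  thus ?thesis by (simp add: lessThan_Suc_atMost mult_ac)
qed

lemma mat_inv_exists:
  fixes A :: "'a :: field mat"
  assumes "A \<in> carrier_mat N N" "det A \<noteq> 0"
  shows "mat_inv A \<in> carrier_mat N N" "mat_inv A * A = 1\<^sub>m N" "A * mat_inv A = 1\<^sub>m N"
proof -
  have "A \<in> Units (ring_mat TYPE('a) N ())" using det_non_zero_imp_unit[OF assms] .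
  then obtain B where "mat_inverse A = Some B"
    using mat_inverse(1)[OF assms(1), where b = "()"] by (cases "mat_inverse A") auto
  thus "mat_inv A \<in> carrier_mat N N" "mat_inv A * A = 1\<^sub>m N" "A * mat_inv A = 1\<^sub>m N"
    using mat_inverse(2)[OF assms(1)] by auto
qed

lemma mat_inv_unique:
  fixes A :: "'a :: field mat"
  assumes A: "A \<in> carrier_mat N N" and B: "B \<in> carrier_mat N N" "B * A = 1\<^sub>m N"
  shows "mat_inv A = B" "det A \<noteq> 0"
proof -
  have "det B * det A = 1" using B A by (metis det_mult det_one)
  thus d: "det A \<noteq> 0" by auto
  note i = mat_inv_exists[OF A d]
  have "mat_inv A = (B * A) * mat_inv A" using i B by simp
  also have "\<dots> = B * (A * mat_inv A)" using A B i by (intro assoc_mult_mat) auto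
  finally show "mat_inv A = B" using i B by simp
qed

lemma mat_inv_mult_vec:
  fixes A :: "'a :: field mat"
  assumes A: "A \<in> carrier_mat N N" "det A \<noteq> 0" and w: "w \<in> carrier_vec N"
  shows "mat_inv A *\<^sub>v (A *\<^sub>v w) = w" "A *\<^sub>v (mat_inv A *\<^sub>v w) = w"
  using mat_inv_exists[OF A] assms by (simp_all flip: assoc_mult_mat_vec)

text \<open>By \<open>minor_relation\<close> a multiple of \<open>c\<close> may be subtracted from
  the coefficients \<open>y\<close>; the coordinates in the basis without \<open>v i\<close> belong
  to the representation whose \<open>i\<close>-th coefficient is 0.\<close>

lemma omitted_coordinates:
  fixes v :: "nat \<Rightarrow> 'a :: field vec" and N :: nat
  defines "c \<equiv> \<lambda>i. (-1) ^ i * det (mat_cols N (omit i v))"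
  assumes i: "i \<le> N" "c i \<noteq> 0" and x: "x \<in> carrier_vec N"
    and y: "\<And>r. r < N \<Longrightarrow> (\<Sum>k\<le>N. y k * v k $ r) = x $ r" and k: "k < N"
  shows "(mat_inv (mat_cols N (omit i v)) *\<^sub>v x) $ k = y (skip i k) - y i / c i * c (skip i k)"
proof -
  define A where "A = mat_cols N (omit i v)"
  define u where "u k = y k - y i / c i * c k" for k
  define w where "w = vec N (\<lambda>k. u (skip i k))"
  have A: "A \<in> carrier_mat N N" "det A \<noteq> 0" using i by (auto simp: A_def c_def)
  have "A *\<^sub>v w = x"
  proof (rule eq_vecI)
    fix r assume "r < dim_vec x"
    hence r: "r < N" using x by simp
    have "(A *\<^sub>v w) $ r = (\<Sum>k<N. v (skip i k) $ r * u (skip i k))"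
      using r by (simp add: A_def mat_cols_def w_def scalar_prod_def omit_skip lessThan_atLeast0)
    also have "\<dots> = (\<Sum>k\<in>{..N} - {i}. v k $ r * u k)"
      using sum.reindex_bij_betw[OF bij_betw_skip[OF i(1)], of "\<lambda>k. v k $ r * u k"] .
    also have "\<dots> = (\<Sum>k\<le>N. v k $ r * u k)"
      using i by (intro sum.mono_neutral_left) (auto simp: u_def)
    also have "\<dots> = (\<Sum>k\<le>N. y k * v k $ r) - y i / c i * (\<Sum>k\<le>N. c k * v k $ r)"
      by (simp add: u_def algebra_simps sum_subtractf sum_distrib_left)
    also have "(\<Sum>k\<le>N. c k * v k $ r) = 0" unfolding c_def by (rule minor_relation[OF r])
    finally show "(A *\<^sub>v w) $ r = x $ r" using y[OF r] by simp
  qed (use A x in auto)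
  hence "mat_inv A *\<^sub>v x = w" using mat_inv_mult_vec(1)[OF A, of w] by (auto simp: w_def)
  thus ?thesis using k by (simp add: A_def[symmetric] w_def u_def)
qed

text \<open>
  With \<open>x = \<Sum> y\<^sub>k v\<^sub>k\<close>, \<open>c\<^sub>i = (-1)\<^sup>i det A\<^sub>i\<close> and \<open>r\<^sub>k = y\<^sub>k / c\<^sub>k\<close>, the alternating sum is,
  up to a common factor, the divided difference of a constant at the points \<open>r\<^sub>k\<close> with \<open>c\<^sub>k \<noteq> 0\<close>.
\<close>

lemma rational_cocycle:
  fixes v :: "nat \<Rightarrow> 'a :: field vec" and N :: nat
  defines "A \<equiv> \<lambda>i. mat_cols N (omit i v)"
  assumes x: "x \<in> carrier_vec N"
    and off: "\<And>i k. i \<le> N \<Longrightarrow> det (A i) \<noteq> 0 \<Longrightarrow> k < N \<Longrightarrow> (mat_inv (A i) *\<^sub>v x) $ k \<noteq> 0"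
    and v: "\<And>k. k \<le> N \<Longrightarrow> \<exists>r<N. v k $ r \<noteq> 0"
  shows "(\<Sum>i\<in>{i. i \<le> N \<and> det (A i) \<noteq> 0}.
    (-1) ^ i / (det (A i) * (\<Prod>k<N. (mat_inv (A i) *\<^sub>v x) $ k))) = 0"
proof -
  define c where "c i = (-1) ^ i * det (A i)" for i
  define S where "S = {i. i \<le> N \<and> det (A i) \<noteq> 0}"
  have S: "i \<in> S \<longleftrightarrow> i \<le> N \<and> c i \<noteq> 0" for i by (auto simp: S_def c_def)
  have fS: "finite S" "S \<subseteq> {..N}" by (auto simp: S_def)
  show ?thesis
  proof (cases "S = {}")
    case True
    thus ?thesis by (simp add: S_def)
  next
    case False
    then obtain m where m: "m \<in> S" by blast
    \<comment> \<open>One representation of \<open>x\<close> by all \<open>N + 1\<close> vectors: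
      the coordinates in the basis \<open>A m\<close>, with 0 inserted at position
      \<open>m\<close>.\<close>
    define y where "y k = (if k = m then 0 else (mat_inv (A m) *\<^sub>v x) $ (if k < m then k else k - 1))" for k
    have ysk: "y (skip m k) = (mat_inv (A m) *\<^sub>v x) $ k" for k by (auto simp: y_def skip_def)
    have Am: "A m \<in> carrier_mat N N" "det (A m) \<noteq> 0" using m by (auto simp: A_def S_def)
    have y: "(\<Sum>k\<le>N. y k * v k $ r) = x $ r" if r: "r < N" for r
    proof -
      have "(\<Sum>k\<le>N. y k * v k $ r) = (\<Sum>k\<in>{..N} - {m}. y k * v k $ r)"
        by (intro sum.mono_neutral_right) (auto simp: y_def)
      also have "\<dots> = (\<Sum>k<N. y (skip m k) * v (skip m k) $ r)"
        using sum.reindex_bij_betw[OF bij_betw_skip, of m N "\<lambda>k. y k * v k $ r"] m by (simp add: S)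
      also have "\<dots> = (A m *\<^sub>v (mat_inv (A m) *\<^sub>v x)) $ r"
        using r mat_inv_exists(1)[OF Am]
        by (auto simp: ysk A_def mat_cols_def scalar_prod_def omit_skip lessThan_atLeast0 mult.commute intro!: sum.cong)
      also have "\<dots> = x $ r" by (simp add: mat_inv_mult_vec(2)[OF Am x])
      finally show ?thesis .
    qed
    have coord: "(mat_inv (A i) *\<^sub>v x) $ k = y (skip i k) - y i / c i * c (skip i k)"
      if "i \<in> S" "k < N" for i k
      using omitted_coordinates[of i N v x y k] that x y by (simp add: S A_def c_def)
    have nz: "y k - y i / c i * c k \<noteq> 0" if i: "i \<in> S" and k: "k \<le> N" "k \<noteq> i" for i k
    proof -
      obtain k' where "k' < N" "k = skip i k'"
        using bij_betw_skip[of i N] i k unfolding bij_betw_def by (auto simp: S)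
      thus ?thesis using coord[OF i] off[of i k'] i by (simp add: S_def)
    qed
    define r where "r k = y k / c k" for k
    \<comment> \<open>Indices with \<open>c k = 0\<close> contribute \<open>y k\<close> for every
      \<open>i\<close>; for the others, pulling out \<open>c k\<close> leaves
      \<open>r k - r i\<close>. Together with \<open>c i\<close> from the determinant this gives the
      same \<open>K\<close> for all \<open>i\<close>.\<close>
    define K where "K = (\<Prod>k\<in>{..N} - S. y k) * (\<Prod>k\<in>S. c k)"
    have "inj_on r S"
    proof (rule inj_onI, rule ccontr)
      fix i k assume ik: "i \<in> S" "k \<in> S" "r i = r k" "i \<noteq> k"
      hence "y k - y i / c i * c k = 0" by (simp add: S r_def)
      thus False using nz[of i k] ik by (simp add: S)
    qed
    have summand: "(-1) ^ i / (det (A i) * (\<Prod>k<N. (mat_inv (A i) *\<^sub>v x) $ k)) =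
      1 / K * (1 / (\<Prod>k\<in>S - {i}. r k - r i))" if i: "i \<in> S" for i
    proof -
      have "(\<Prod>k<N. (mat_inv (A i) *\<^sub>v x) $ k) = (\<Prod>k<N. y (skip i k) - y i / c i * c (skip i k))"
        using coord[OF i] by simp
      also have "\<dots> = (\<Prod>k\<in>{..N} - {i}. y k - y i / c i * c k)"
        using prod.reindex_bij_betw[OF bij_betw_skip, of i N "\<lambda>k. y k - y i / c i * c k"] i by (simp add: S)
      also have "{..N} - {i} = ({..N} - S) \<union> (S - {i})" using i by (auto simp: S)
      also have "(\<Prod>k\<in>({..N} - S) \<union> (S - {i}). y k - y i / c i * c k) =
        (\<Prod>k\<in>{..N} - S. y k - y i / c i * c k) * (\<Prod>k\<in>S - {i}. y k - y i / c i * c k)"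
        using fS by (intro prod.union_disjoint) auto
      also have "(\<Prod>k\<in>{..N} - S. y k - y i / c i * c k) = (\<Prod>k\<in>{..N} - S. y k)"
        by (intro prod.cong) (auto simp: S)
      also have "(\<Prod>k\<in>S - {i}. y k - y i / c i * c k) = (\<Prod>k\<in>S - {i}. c k * (r k - r i))"
        by (intro prod.cong) (auto simp: S r_def field_simps)
      finally have e: "(\<Prod>k<N. (mat_inv (A i) *\<^sub>v x) $ k) =
        (\<Prod>k\<in>{..N} - S. y k) * ((\<Prod>k\<in>S - {i}. c k) * (\<Prod>k\<in>S - {i}. r k - r i))"
        by (simp add: prod.distrib)
      have Kc: "K = (\<Prod>k\<in>{..N} - S. y k) * (c i * (\<Prod>k\<in>S - {i}. c k))"
        unfolding K_def using fS i by (subst prod.remove[of S i]) auto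
      have sg: "(-1) ^ i / (det (A i) * X) = 1 / (c i * X)" for X
      proof -
        have "(-1) ^ i * (-1 :: 'a) ^ i = 1" by (simp flip: power_add)
        thus ?thesis by (cases "even i") (auto simp: c_def)
      qed
      show ?thesis unfolding e Kc sg by (simp add: mult_ac)
    qed
    \<comment> \<open>With a single nonzero minor, \<open>minor_relation\<close> would read
      \<open>c m v m = 0\<close>, but no vector is zero. This excludes the case in which the divided
      difference is 1.\<close>
    have "card S \<noteq> 1"
    proof
      assume "card S = 1"
      hence Sm: "S = {m}" using m by (auto simp: card_1_singleton_iff)
      obtain r' where r': "r' < N" "v m $ r' \<noteq> 0" using v m by (auto simp: S)
      have "(\<Sum>i\<le>N. c i * v i $ r') = 0" unfolding c_def A_def by (rule minor_relation[OF r'(1)])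
      also have "(\<Sum>i\<le>N. c i * v i $ r') = (\<Sum>i\<in>S. c i * v i $ r')"
        using fS S by (intro sum.mono_neutral_right) auto
      finally show False using Sm S[of m] r' by simp
    qed
    hence "(\<Sum>i\<in>S. 1 / (\<Prod>k\<in>S - {i}. r k - r i)) = 0"
      using sum_inverse_differences[OF fS(1) \<open>inj_on r S\<close> False] by simp
    hence "(\<Sum>i\<in>S. 1 / K * (1 / (\<Prod>k\<in>S - {i}. r k - r i))) = 0"
      by (simp only: sum_distrib_left[symmetric] mult_zero_right)
    thus ?thesis unfolding S_def[symmetric] using summand by simp
  qed
qed

section \<open>Derivatives of the rational cocycle, indexed by words\<close>

lemma finite_words [simp]: "finite (words N p)"
  using finite_lists_length_eq[of "{..<N}" p] by (simp add: words_def conj_commute)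

lemma words_0: "words N 0 = {[]}"
  by (auto simp: words_def)

lemma sum_words_Suc: "(\<Sum>u\<in>words N (Suc p). f u) = (\<Sum>k<N. \<Sum>u\<in>words N p. f (k # u))"
proof -
  have "(\<Sum>k<N. \<Sum>u\<in>words N p. f (k # u)) = (\<Sum>(k, u)\<in>{..<N} \<times> words N p. f (k # u))"
    by (simp add: sum.cartesian_product)
  also have "\<dots> = (\<Sum>u\<in>words N (Suc p). f u)"
    by (rule sum.reindex_bij_witness[of _ "\<lambda>u. (hd u, tl u)" "\<lambda>(k, u). k # u"])
       (auto simp: words_def length_Suc_conv)
  finally show ?thesis ..
qed

definition lin_form :: "nat \<Rightarrow> (nat \<Rightarrow> nat \<Rightarrow> complex) \<Rightarrow> nat \<Rightarrow> (nat \<Rightarrow> complex) \<Rightarrow> complex" where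
  "lin_form N b k x = (\<Sum>j<N. b k j * x j)"

text \<open>
  Up to sign, \<open>word_derivative N b u\<close> is the iterated partial derivative along the letters of \<open>u\<close>
  of the reciprocal of the product of the linear forms.
\<close>

definition word_derivative ::
  "nat \<Rightarrow> (nat \<Rightarrow> nat \<Rightarrow> complex) \<Rightarrow> nat list \<Rightarrow> (nat \<Rightarrow> complex) \<Rightarrow> complex" where
  "word_derivative N b u x = (\<Sum>u'\<in>words N (length u). (\<Prod>m<length u. b (u' ! m) (u ! m)) *
     (\<Prod>k<N. fact (count_list u' k) / lin_form N b k x ^ (count_list u' k + 1)))"

lemma lin_form_update:
  "a < N \<Longrightarrow> lin_form N b k (\<lambda>j. x j + (if j = a then h else 0)) = lin_form N b k x + b k a * h"
  by (simp add: lin_form_def distrib_left sum.distrib if_distrib[of "(*) _"] cong: if_cong)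

text \<open>Differentiating \<open>c! / l^(c + 1)\<close> in direction \<open>a\<close> gives
  \<open>- b k a (c + 1)! / l^(c + 2)\<close>: the factorials absorb the exponent. The product rule
  sums over the form \<open>k\<close> that is hit, and \<open>k\<close> becomes the new first letter
  of \<open>u'\<close>.\<close>

lemma word_derivative_Cons:
  assumes a: "a < N" and nz: "\<And>k. k < N \<Longrightarrow> lin_form N b k x \<noteq> 0"
  shows "((\<lambda>h. word_derivative N b u (\<lambda>j. x j + (if j = a then h else 0))) has_field_derivative
    - word_derivative N b (a # u) x) (at 0)"
proof -
  let ?l = "\<lambda>k. lin_form N b k x"
  have l: "lin_form N b k (\<lambda>j. x j + (if j = a then h else 0)) = ?l k + b k a * h" for k h
    using a by (rule lin_form_update)
  have summand: "((\<lambda>h. \<Prod>k<N. fact (c k) / (?l k + b k a * h) ^ (c k + 1)) has_field_derivative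
     (\<Sum>k<N. - b k a * (\<Prod>k'<N. fact ((c(k := c k + 1)) k') / ?l k' ^ ((c(k := c k + 1)) k' + 1)))) (at 0)"
    for c :: "nat \<Rightarrow> nat"
  proof -
    have "((\<lambda>h. fact (c k) / (?l k + b k a * h) ^ (c k + 1)) has_field_derivative
      - (b k a * (fact (c k + 1) / ?l k ^ (c k + 2)))) (at 0)" if "k < N" for k
    proof -
      have "((\<lambda>h. inverse (?l k + b k a * h)) has_field_derivative
          - (inverse (?l k) * b k a * inverse (?l k))) (at 0)"
        using nz[OF that] by (auto intro!: derivative_eq_intros)
      from DERIV_cmult[OF DERIV_power_Suc[OF this, of "c k"], of "fact (c k)"]
      have "((\<lambda>h. fact (c k) * inverse (?l k + b k a * h) ^ Suc (c k)) has_field_derivative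
        fact (c k) * ((1 + of_nat (c k)) * (- (inverse (?l k) * b k a * inverse (?l k)) * inverse (?l k) ^ c k))) (at 0)"
        by simp
      moreover have "fact (c k) * ((1 + of_nat (c k)) * (- (inverse (?l k) * b k a * inverse (?l k)) * inverse (?l k) ^ c k))
        = - (b k a * (fact (c k + 1) / ?l k ^ (c k + 2)))"
        by (simp add: divide_inverse power_add power2_eq_square power_inverse mult_ac)
      ultimately have "((\<lambda>h. fact (c k) * inverse (?l k + b k a * h) ^ Suc (c k)) has_field_derivative
        - (b k a * (fact (c k + 1) / ?l k ^ (c k + 2)))) (at 0)" by (simp only:)
      moreover have "(\<lambda>h. fact (c k) * inverse (?l k + b k a * h) ^ Suc (c k)) =
        (\<lambda>h. fact (c k) / (?l k + b k a * h) ^ (c k + 1))"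
        by (simp add: divide_inverse power_inverse)
      ultimately show ?thesis by (simp only:)
    qed
    hence "((\<lambda>h. \<Prod>k<N. fact (c k) / (?l k + b k a * h) ^ (c k + 1)) has_field_derivative
      (\<Sum>k<N. - (b k a * (fact (c k + 1) / ?l k ^ (c k + 2))) *
        (\<Prod>k'\<in>{..<N} - {k}. fact (c k') / (?l k' + b k' a * 0) ^ (c k' + 1)))) (at 0)"
      by (intro has_field_derivative_prod) auto
    moreover have "- (b k a * (fact (c k + 1) / ?l k ^ (c k + 2))) *
        (\<Prod>k'\<in>{..<N} - {k}. fact (c k') / (?l k' + b k' a * 0) ^ (c k' + 1)) =
       - b k a * (\<Prod>k'<N. fact ((c(k := c k + 1)) k') / ?l k' ^ ((c(k := c k + 1)) k' + 1))"
      if "k < N" for k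
    proof -
      have "(\<Prod>k'<N. fact ((c(k := c k + 1)) k') / ?l k' ^ ((c(k := c k + 1)) k' + 1)) =
        fact (c k + 1) / ?l k ^ (c k + 2) * (\<Prod>k'\<in>{..<N} - {k}. fact (c k') / ?l k' ^ (c k' + 1))"
        using that by (subst prod.remove[of _ k]) (auto intro!: prod.cong)
      thus ?thesis by simp
    qed
    ultimately show ?thesis by simp
  qed
  have der: "((\<lambda>h. word_derivative N b u (\<lambda>j. x j + (if j = a then h else 0))) has_field_derivative
    (\<Sum>u'\<in>words N (length u). (\<Prod>m<length u. b (u' ! m) (u ! m)) *
      (\<Sum>k<N. - b k a * (\<Prod>k'<N. fact (((count_list u')(k := count_list u' k + 1)) k') /
        ?l k' ^ (((count_list u')(k := count_list u' k + 1)) k' + 1))))) (at 0)"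
    unfolding word_derivative_def l by (intro DERIV_sum DERIV_cmult summand)
  have c: "(count_list u')(k := count_list u' k + 1) = count_list (k # u')" for u' and k :: nat
    by (auto simp: fun_eq_iff)
  have "word_derivative N b (a # u) x = (\<Sum>k<N. \<Sum>u'\<in>words N (length u).
      b k a * (\<Prod>m<length u. b (u' ! m) (u ! m)) *
      (\<Prod>k'<N. fact (count_list (k # u') k') / ?l k' ^ (count_list (k # u') k' + 1)))"
    unfolding word_derivative_def length_Cons sum_words_Suc prod.lessThan_Suc_shift by simp
  also have "\<dots> = (\<Sum>u'\<in>words N (length u). \<Sum>k<N.
      b k a * (\<Prod>m<length u. b (u' ! m) (u ! m)) *
      (\<Prod>k'<N. fact (count_list (k # u') k') / ?l k' ^ (count_list (k # u') k' + 1)))"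
    by (rule sum.swap)
  finally have "- word_derivative N b (a # u) x = - (\<Sum>u'\<in>words N (length u). \<Sum>k<N.
      b k a * (\<Prod>m<length u. b (u' ! m) (u ! m)) *
      (\<Prod>k'<N. fact (count_list (k # u') k') / ?l k' ^ (count_list (k # u') k' + 1)))" by (simp only:)
  also have "\<dots> = (\<Sum>u'\<in>words N (length u). (\<Prod>m<length u. b (u' ! m) (u ! m)) *
      (\<Sum>k<N. - b k a * (\<Prod>k'<N. fact (count_list (k # u') k') / ?l k' ^ (count_list (k # u') k' + 1))))"
    unfolding sum_negf[symmetric] sum_distrib_left by (intro sum.cong refl) (simp only: mult_ac mult_minus_left mult_minus_right)
  finally show ?thesis using der unfolding c by (simp only:)
qed

text \<open>The forms stay nonzero near \<open>x\<close>, so the relation for \<open>u\<close> holds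
  for small displacements along any coordinate and may be differentiated; each letter is one
  differentiation.\<close>

lemma word_derivative_relation:
  assumes I: "finite I"
    and base: "\<And>x. (\<And>i k. i \<in> I \<Longrightarrow> k < N \<Longrightarrow> lin_form N (b i) k x \<noteq> 0) \<Longrightarrow>
       (\<Sum>i\<in>I. d i / (\<Prod>k<N. lin_form N (b i) k x)) = 0"
    and off: "\<And>i k. i \<in> I \<Longrightarrow> k < N \<Longrightarrow> lin_form N (b i) k x \<noteq> 0"
    and u: "set u \<subseteq> {..<N}"
  shows "(\<Sum>i\<in>I. d i * word_derivative N (b i) u x) = 0"
  using off u
proof (induction u arbitrary: x)
  case Nil
  have "(\<Prod>k<N. 1 / lin_form N (b i) k x) = 1 / (\<Prod>k<N. lin_form N (b i) k x)" for i
    by (simp add: prod_dividef)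
  thus ?case using base[of x] Nil by (simp add: word_derivative_def words_0)
next
  case (Cons a u)
  let ?x = "\<lambda>h j. x j + (if j = a then h else 0)"
  have "((\<lambda>h. \<Sum>i\<in>I. d i * word_derivative N (b i) u (?x h)) has_field_derivative
    (\<Sum>i\<in>I. d i * - word_derivative N (b i) (a # u) x)) (at 0)"
    using Cons.prems by (intro DERIV_sum DERIV_cmult word_derivative_Cons) auto
  moreover have "\<forall>\<^sub>F h in nhds 0. (\<Sum>i\<in>I. d i * word_derivative N (b i) u (?x h)) = 0"
  proof -
    have "\<forall>\<^sub>F h in nhds 0. lin_form N (b i) k (?x h) \<noteq> 0" if "i \<in> I" "k < N" for i k
    proof -
      have "isCont (\<lambda>h. lin_form N (b i) k (?x h)) 0"
        using Cons.prems(2) by (simp add: lin_form_update)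
      moreover have "lin_form N (b i) k (?x 0) \<noteq> 0" using Cons.prems(1)[OF that] by simp
      ultimately have "\<forall>\<^sub>F h in at 0. lin_form N (b i) k (?x h) \<noteq> 0"
        by (intro tendsto_imp_eventually_ne) (auto simp: isCont_def)
      thus ?thesis using Cons.prems(1)[OF that] by (auto simp: eventually_at_filter elim: eventually_mono)
    qed
    hence "\<forall>\<^sub>F h in nhds 0. \<forall>i\<in>I. \<forall>k\<in>{..<N}. lin_form N (b i) k (?x h) \<noteq> 0"
      using I by (intro eventually_ball_finite ballI) auto
    thus ?thesis by (rule eventually_mono) (use Cons in auto)
  qed
  ultimately have "((\<lambda>h. 0) has_field_derivative (\<Sum>i\<in>I. d i * - word_derivative N (b i) (a # u) x)) (at 0)"
    by (subst (asm) DERIV_cong_ev[OF refl _ refl]) auto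
  hence "(\<Sum>i\<in>I. d i * - word_derivative N (b i) (a # u) x) = 0"
    by (metis DERIV_const DERIV_unique)
  thus ?case by (simp add: sum_negf)
qed

section \<open>Sublattices of the integer plane\<close>

text \<open>Hermite normal form: the lattice with basis \<open>(a, 0)\<close> and
  \<open>(b, d)\<close>.\<close>

definition hnf_lattice :: "int \<Rightarrow> int \<Rightarrow> int \<Rightarrow> (int \<times> int) set" where
  "hnf_lattice a b d = {(i * a + j * b, j * d) | i j. True}"

lemma hnf_latticeI: "x = i * a + j * b \<Longrightarrow> y = j * d \<Longrightarrow> (x, y) \<in> hnf_lattice a b d"
  by (auto simp: hnf_lattice_def)

lemma int_subgroup_generator:
  fixes H :: "int set"
  assumes H: "\<And>x y. x \<in> H \<Longrightarrow> y \<in> H \<Longrightarrow> x - y \<in> H" and e: "e \<in> H" "e > 0"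
  obtains a where "a > 0" "a \<in> H" "\<forall>x\<in>H. a dvd x"
proof -
  define n where "n = (LEAST n::nat. n > 0 \<and> int n \<in> H)"
  have "\<exists>n::nat. n > 0 \<and> int n \<in> H" using e by (intro exI[of _ "nat e"]) auto
  hence n: "n > 0" "int n \<in> H" unfolding n_def by (metis (mono_tags, lifting) LeastI_ex)+
  have zero: "0 \<in> H" using H[OF n(2) n(2)] by simp
  have add: "x + y \<in> H" if "x \<in> H" "y \<in> H" for x y using H[OF that(1) H[OF zero that(2)]] by simp
  have "int n dvd x" if x: "x \<in> H" for x
  proof -
    have m: "int k * int n \<in> H" for k by (induction k) (use zero add n in \<open>auto simp: algebra_simps\<close>)
    have m': "k * int n \<in> H" for k
      using m[of "nat k"] H[OF zero m[of "nat (- k)"]] by (cases "k \<ge> 0") auto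
    have "x - (x div int n) * int n \<in> H" using H[OF x m'] .
    hence r: "x mod int n \<in> H" by (simp add: minus_div_mult_eq_mod)
    have "x mod int n < int n" "x mod int n \<ge> 0" using n by simp_all
    moreover have "\<not> (nat (x mod int n) > 0)"
    proof
      assume "nat (x mod int n) > 0"
      hence "n \<le> nat (x mod int n)" using r unfolding n_def by (intro Least_le) auto
      thus False using \<open>x mod int n < int n\<close> \<open>x mod int n \<ge> 0\<close> by linarith
    qed
    ultimately show ?thesis by auto
  qed
  thus ?thesis using that[of "int n"] n by auto
qed

text \<open>\<open>a\<close> generates the part of \<open>G\<close> on the first axis and
  \<open>d\<close> its projection to the second; the points at distance \<open>e\<close> on the axes
  make both nonzero.\<close>

lemma hnf_exists:
  fixes G :: "(int \<times> int) set"
  assumes G: "\<And>x y x' y'. (x, y) \<in> G \<Longrightarrow> (x', y') \<in> G \<Longrightarrow> (x - x', y - y') \<in> G"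
    and e: "e > 0" "(e, 0) \<in> G" "(0, e) \<in> G"
  obtains a b d where "a > 0" "d > 0" "G = hnf_lattice a b d"
proof -
  define H1 where "H1 = {x. (x, 0) \<in> G}"
  define H2 where "H2 = {y. \<exists>x. (x, y) \<in> G}"
  have H1: "x - y \<in> H1" if "x \<in> H1" "y \<in> H1" for x y
    using G[of x 0 y 0] that by (simp add: H1_def)
  have H2: "x - y \<in> H2" if xy: "x \<in> H2" "y \<in> H2" for x y
  proof -
    obtain u v where "(u, x) \<in> G" "(v, y) \<in> G" using xy unfolding H2_def by blast
    hence "(u - v, x - y) \<in> G" by (rule G)
    thus ?thesis unfolding H2_def by blast
  qed
  have "e \<in> H1" "e \<in> H2" using e unfolding H1_def H2_def by blast+
  obtain a where a0: "a > 0" "a \<in> H1" "\<forall>x\<in>H1. a dvd x"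
    by (rule int_subgroup_generator[OF H1 \<open>e \<in> H1\<close> e(1)])
  obtain d where d0: "d > 0" "d \<in> H2" "\<forall>x\<in>H2. d dvd x"
    by (rule int_subgroup_generator[OF H2 \<open>e \<in> H2\<close> e(1)])
  have a: "a > 0" "(a, 0) \<in> G" "\<And>x. (x, 0) \<in> G \<Longrightarrow> a dvd x"
    using a0 by (simp_all add: H1_def)
  have d: "d > 0" "\<exists>b. (b, d) \<in> G" using d0(1,2) by (simp_all add: H2_def)
  have d3: "d dvd y" if "(x, y) \<in> G" for x y
    using that by (intro bspec[OF d0(3)]) (auto simp: H2_def)
  obtain b where b: "(b, d) \<in> G" using d(2) by blast
  have zero: "(0, 0) \<in> G" using G[OF e(2) e(2)] by simp
  have add: "(x + x', y + y') \<in> G" if "(x, y) \<in> G" "(x', y') \<in> G" for x y x' y'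
    using G[OF that(1) G[OF zero that(2)]] by simp
  have mult: "(k * x, k * y) \<in> G" if "(x, y) \<in> G" for k x y
  proof -
    have m: "(int n * x, int n * y) \<in> G" for n
    proof (induction n)
      case (Suc n)
      from add[OF that Suc] show ?case by (simp add: algebra_simps)
    qed (use zero in simp)
    show ?thesis using m[of "nat k"] G[OF zero m[of "nat (- k)"]] by (cases "k \<ge> 0") auto
  qed
  have "G = hnf_lattice a b d"
  proof (intro subset_antisym subsetI)
    fix p assume p: "p \<in> G"
    obtain x y where xy: "p = (x, y)" by (cases p)
    obtain j where j: "y = d * j" using d3 p xy by blast
    have "(x - j * b, 0) \<in> G" using G[OF p[unfolded xy] mult[OF b, of j]] j by (simp add: mult.commute)
    then obtain i where "x - j * b = a * i" using a(3) by blast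
    thus "p \<in> hnf_lattice a b d"
      unfolding xy j by (intro hnf_latticeI[of _ i _ j]) (simp_all add: algebra_simps)
  next
    fix p assume "p \<in> hnf_lattice a b d"
    then obtain i j where "p = (i * a + j * b, j * d)" by (auto simp: hnf_lattice_def)
    thus "p \<in> G" using add[OF mult[OF a(2), of i] mult[OF b, of j]] by simp
  qed
  thus ?thesis using that a(1) d(1) by blast
qed

text \<open>The box is a fundamental domain: reduction of the second coordinate modulo
  \<open>d\<close> fixes the multiple of \<open>(b, d)\<close>, then the first is reduced modulo
  \<open>a\<close>.\<close>

lemma hnf_residues:
  assumes "a > 0" "d > 0"
  shows "\<exists>!p. p \<in> {0..<a} \<times> {0..<d} \<and> (x - fst p, y - snd p) \<in> hnf_lattice a b d"
proof (rule ex_ex1I)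
  define j where "j = y div d"
  define i where "i = (x - j * b) div a"
  have "(x - (x - j * b) mod a, y - y mod d) = (i * a + j * b, j * d)"
    by (simp add: i_def j_def minus_mod_eq_div_mult algebra_simps)
  thus "\<exists>p. p \<in> {0..<a} \<times> {0..<d} \<and> (x - fst p, y - snd p) \<in> hnf_lattice a b d"
    using assms by (intro exI[of _ "((x - j * b) mod a, y mod d)"]) (auto simp: hnf_lattice_def)
next
  fix p q
  assume p: "p \<in> {0..<a} \<times> {0..<d} \<and> (x - fst p, y - snd p) \<in> hnf_lattice a b d"
    and q: "q \<in> {0..<a} \<times> {0..<d} \<and> (x - fst q, y - snd q) \<in> hnf_lattice a b d"
  obtain i j where ij: "x - fst p = i * a + j * b" "y - snd p = j * d" using p by (auto simp: hnf_lattice_def)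
  obtain i' j' where ij': "x - fst q = i' * a + j' * b" "y - snd q = j' * d" using q by (auto simp: hnf_lattice_def)
  have small: "k = 0" if "\<bar>k * c\<bar> < c" "c > 0" for k c :: int
  proof (rule ccontr)
    assume "k \<noteq> 0"
    hence "1 * c \<le> \<bar>k\<bar> * c" using that by (intro mult_right_mono) auto
    thus False using that by (simp add: abs_mult)
  qed
  have "snd p - snd q = (j' - j) * d" using ij(2) ij'(2) by (simp add: algebra_simps)
  moreover have "\<bar>snd p - snd q\<bar> < d" using p q by auto
  ultimately have j: "j' = j" using small[of "j' - j" d] assms by simp
  have "fst p - fst q = (i' - i) * a" using ij(1) ij'(1) j by (simp add: algebra_simps)
  moreover have "\<bar>fst p - fst q\<bar> < a" using p q by auto
  ultimately have "i' = i" using small[of "i' - i" a] assms by simp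
  thus "p = q" using ij ij' j by (simp add: prod_eq_iff)
qed

section \<open>The ring of integers of an imaginary quadratic field\<close>

lemma algebraic_int_hom:
  assumes "field_hom (\<sigma> :: 'k::field_char_0 \<Rightarrow> 'l::field_char_0)"
  shows "algebraic_int (\<sigma> x) \<longleftrightarrow> algebraic_int x"
proof -
  interpret field_hom \<sigma> by fact
  have "poly (map_poly of_int p) (\<sigma> x) = \<sigma> (poly (map_poly of_int p) x)" for p
    by (induction p) (simp_all add: map_poly_pCons hom_distribs)
  thus ?thesis by (simp add: algebraic_int_altdef_ipoly)
qed

locale quadratic_order =
  fixes \<sigma> :: "'k::field_char_0 \<Rightarrow> complex" and \<omega> :: 'k and tr nm :: int
  assumes hom: "field_hom \<sigma>"
    and Im_\<omega>: "Im (\<sigma> \<omega>) \<noteq> 0"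
    and \<omega>_square: "\<omega> * \<omega> = of_int tr * \<omega> - of_int nm"
    and int_iff: "algebraic_int x \<longleftrightarrow> (\<exists>m n. x = of_int m + of_int n * \<omega>)"
    and rat_coords: "\<exists>u v. x = of_rat u + of_rat v * \<omega>"

text \<open>If \<sigma> took only real values, it would give a real embedding; so some \<alpha> has
  a nonreal image and, in dimension two, spans the field together with 1. Completing the square and
  clearing denominators gives a square root of a negative integer.\<close>

lemma imaginary_quadratic_field_generator:
  fixes \<sigma> :: "'k::field_char_0 \<Rightarrow> complex"
  assumes iqf: "imaginary_quadratic_field TYPE('k)" and hom: "field_hom \<sigma>"
  obtains \<theta> :: 'k and D :: int where "D > 0" "\<theta> * \<theta> = - of_int D" "Im (\<sigma> \<theta>) \<noteq> 0" "Re (\<sigma> \<theta>) = 0"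
    "\<And>x. \<exists>u v. x = of_rat u + of_rat v * \<theta>"
proof -
  interpret field_hom \<sigma> by fact
  interpret V: vector_space "\<lambda>(r::rat) (x::'k). of_rat r * x"
    by unfold_locales (simp_all add: algebra_simps of_rat_add of_rat_mult)
  have \<sigma>_rat: "\<sigma> (of_rat r) = of_rat r" for r
    by (cases r) (simp add: of_rat_rat hom_distribs)
  have "\<exists>x. Im (\<sigma> x) \<noteq> 0"
  proof (rule ccontr)
    assume "\<nexists>x. Im (\<sigma> x) \<noteq> 0"
    hence "field_hom (\<lambda>x. Re (\<sigma> x))"
      by unfold_locales (auto simp: hom_distribs)
    thus False using iqf by (auto simp: imaginary_quadratic_field_def)
  qed
  then obtain \<alpha> where \<alpha>: "Im (\<sigma> \<alpha>) \<noteq> 0" by blast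
  have real: "Im (of_rat r :: complex) = 0" for r
    by (cases r) (simp add: of_rat_rat complex_is_Real_iff[symmetric])
  have span2: "\<exists>u v. x = of_rat u + of_rat v * \<beta>" if \<beta>: "Im (\<sigma> \<beta>) \<noteq> 0" for x \<beta>
  proof -
    have "\<beta> \<notin> V.span {1}"
    proof
      assume "\<beta> \<in> V.span {1}"
      then obtain r where "\<beta> = of_rat r * 1" by (auto simp: V.span_singleton)
      hence "\<beta> = of_rat r" by simp
      thus False using \<beta> real by (simp add: \<sigma>_rat)
    qed
    moreover from this have "\<beta> \<noteq> 1" using V.span_base[of 1 "{1}"] by auto
    ultimately have ind: "V.independent {\<beta>, 1}" by (simp add: V.independent_insert V.dependent_single)
    have "x \<in> V.span {\<beta>, 1}"
    proof (rule ccontr)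
      assume x: "x \<notin> V.span {\<beta>, 1}"
      hence xn: "x \<notin> {\<beta>, 1}" using V.span_base by blast
      have "V.independent {x, \<beta>, 1}" using x ind xn by (simp add: V.independent_insert)
      moreover obtain B where B: "V.independent B" "UNIV \<subseteq> V.span B" "card B = 2"
        using V.basis_exists[of UNIV] iqf unfolding imaginary_quadratic_field_def by metis
      moreover have "finite B" using B(3) by (metis card.infinite zero_neq_numeral)
      ultimately have "card {x, \<beta>, 1} \<le> card B"
        using V.independent_span_bound[of B "{x, \<beta>, 1}"] by auto
      thus False using B(3) xn \<open>\<beta> \<noteq> 1\<close> by auto
    qed
    then obtain k where k: "x - of_rat k * \<beta> \<in> V.span {1}" by (auto simp: V.span_insert)
    then obtain r where "x - of_rat k * \<beta> = of_rat r" by (auto simp: V.span_singleton)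
    hence "x = of_rat r + of_rat k * \<beta>" by (simp add: algebra_simps)
    thus ?thesis by blast
  qed
  obtain u v where uv: "\<alpha> * \<alpha> = of_rat u + of_rat v * \<alpha>" using span2[OF \<alpha>] by blast
  define \<beta> where "\<beta> = \<alpha> - of_rat (v / 2)"
  define d where "d = u + v * v / 4"
  have \<beta>2: "\<beta> * \<beta> = of_rat d"
  proof -
    have "\<beta> * \<beta> = \<alpha> * \<alpha> - of_rat v * \<alpha> + of_rat (v * v / 4)"
      by (simp add: \<beta>_def algebra_simps of_rat_mult of_rat_divide) 
    thus ?thesis unfolding uv by (simp add: d_def of_rat_add)
  qed
  obtain n m where nm: "d = of_int n / of_int m" "m > 0" by (cases d) (auto simp: Fract_of_int_quotient)
  \<comment> \<open>As \<open>\<beta>^2 = n / m\<close>, the square of \<open>m \<beta>\<close> is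
    the integer \<open>n m\<close>.\<close>
  define \<theta> where "\<theta> = of_int m * \<beta>"
  define D where "D = - (n * m)"
  have th: "\<theta> * \<theta> = - of_int D"
  proof -
    have "\<theta> * \<theta> = of_int m * of_int m * (\<beta> * \<beta>)" by (simp add: \<theta>_def)
    also have "\<dots> = of_rat (of_int (n * m))" unfolding \<beta>2 using nm by (simp add: of_rat_divide of_rat_mult)
    finally show ?thesis by (simp add: D_def of_rat_mult)
  qed
  have im: "Im (\<sigma> \<theta>) \<noteq> 0"
    using \<alpha> nm(2) real by (simp add: \<theta>_def \<beta>_def hom_distribs \<sigma>_rat)
  have sq: "\<sigma> \<theta> * \<sigma> \<theta> = - of_int D" using arg_cong[OF th, of \<sigma>] by (simp add: hom_distribs)
  have re: "Re (\<sigma> \<theta>) = 0" using arg_cong[OF sq, of Im] im by simp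
  have "- (Im (\<sigma> \<theta>) * Im (\<sigma> \<theta>)) = - of_int D" using arg_cong[OF sq, of Re] re by simp
  hence "D > 0" using im by (metis neg_equal_iff_equal not_real_square_gt_zero of_int_0_less_iff)
  thus ?thesis using that th im re span2[OF im] by blast
qed

text \<open>The numbers \<open>2 D v\<close> for algebraic integers \<open>u + v \<theta>\<close>
  form a subgroup of the rational integers. An \<omega> whose number generates this subgroup works:
  subtracting a suitable multiple of \<omega> from an algebraic integer leaves a rational one, hence
  an ordinary integer.\<close>

theorem imaginary_quadratic_order:
  fixes \<sigma> :: "'k::field_char_0 \<Rightarrow> complex"
  assumes iqf: "imaginary_quadratic_field TYPE('k)" and hom: "field_hom \<sigma>"
    and ring: "ring (int_ring :: 'k ring)"
  obtains \<omega> tr nm where "quadratic_order \<sigma> \<omega> tr nm"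
proof -
  interpret field_hom \<sigma> by fact
  obtain \<theta> :: 'k and D :: int where D: "D > 0" "\<theta> * \<theta> = - of_int D" "Im (\<sigma> \<theta>) \<noteq> 0" "Re (\<sigma> \<theta>) = 0"
    and coords: "\<And>x. \<exists>u v. x = of_rat u + of_rat v * \<theta>"
    using imaginary_quadratic_field_generator[OF iqf hom] by metis
  have \<sigma>_rat: "\<sigma> (of_rat r) = of_rat r" for r
    by (cases r) (simp add: of_rat_rat hom_distribs)
  have cnj_rat: "cnj (of_rat r) = of_rat r" for r
    by (cases r) (simp add: of_rat_rat)
  have ai_add: "algebraic_int (x + y)" and ai_mult: "algebraic_int (x * y)"
    if "algebraic_int x" "algebraic_int y" for x y :: 'k
    using ring.ring_simprules(1,5)[OF ring, of x y] that by (simp_all add: int_ring_def)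
  have ai_int: "algebraic_int (of_int n :: 'k)" for n by (simp add: int_imp_algebraic_int)
  have ai_diff: "algebraic_int (x - y)" if "algebraic_int x" "algebraic_int y" for x y :: 'k
    using ai_add[of x "- y"] that by simp
  have ai_\<theta>: "algebraic_int \<theta>"
    by (rule algebraic_int_root[of "- of_int D" "[:0, 0, 1:]"])
       (use D(2) ai_int[of "-D"] in \<open>auto simp: coeff_pCons split: nat.splits\<close>)
  have rat_int: "r \<in> \<int>" if r: "algebraic_int (of_rat r :: 'k)" for r
  proof -
    obtain z where "(of_rat r :: 'k) = of_int z"
      using rational_algebraic_int_is_int[OF r] by (auto elim: Ints_cases)
    hence "r = of_int z" by (metis of_rat_eq_iff of_rat_of_int_eq)
    thus ?thesis by simp
  qed
  have bound: "2 * of_int D * v \<in> \<int>" if x: "algebraic_int (of_rat u + of_rat v * \<theta>)" for u v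
  proof -
    \<comment> \<open>\<open>?y\<close> is the conjugate of \<open>?x\<close>, integral because
      \<sigma> carries it to the complex conjugate of the image of \<open>?x\<close>. With trace
      \<open>T = 2 u\<close> and norm \<open>n = u^2 + D v^2\<close>, the square of
      \<open>2 D v\<close> is \<open>D (4 n - T^2)\<close>; a rational number with integral square
      is integral.\<close>
    let ?x = "of_rat u + of_rat v * \<theta>" and ?y = "of_rat u - of_rat v * \<theta>"
    have "cnj (\<sigma> \<theta>) = - \<sigma> \<theta>" using D(4) by (simp add: complex_eq_iff)
    hence "\<sigma> ?y = cnj (\<sigma> ?x)" by (simp add: hom_distribs \<sigma>_rat cnj_rat)
    hence y: "algebraic_int ?y" using x by (metis algebraic_int_hom[OF hom] algebraic_int_cnj)
    have "?x + ?y = of_rat (2 * u)" by (simp add: of_rat_mult)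
    hence 1: "2 * u \<in> \<int>" using ai_add[OF x y] rat_int by metis
    have "?x * ?y = of_rat u * of_rat u - of_rat v * of_rat v * (\<theta> * \<theta>)" by (simp add: algebra_simps)
    also have "\<dots> = of_rat (u * u + of_int D * v * v)"
      unfolding D(2) by (simp add: of_rat_mult of_rat_add algebra_simps)
    finally have 2: "u * u + of_int D * v * v \<in> \<int>" using ai_mult[OF x y] rat_int by metis
    have "(2 * of_int D * v) * (2 * of_int D * v) =
        of_int D * (4 * (u * u + of_int D * v * v) - (2 * u) * (2 * u))" by (simp add: algebra_simps)
    also have "\<dots> \<in> \<int>"
      by (rule Ints_mult[OF Ints_of_int Ints_diff[OF Ints_mult[OF Ints_numeral 2] Ints_mult[OF 1 1]]])
    finally obtain z where z: "(2 * of_int D * v) * (2 * of_int D * v) = of_int z" by (auto elim: Ints_cases)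
    have "algebraic_int (of_rat (2 * of_int D * v) :: 'k)"
    proof (rule algebraic_int_root[of "of_int z" "[:0, 0, 1:]"])
      have "of_rat (2 * of_int D * v) * of_rat (2 * of_int D * v) = (of_int z :: 'k)"
        unfolding of_rat_mult[symmetric] z by simp
      thus "poly [:0, 0, 1:] (of_rat (2 * of_int D * v) :: 'k) = of_int z" by simp
    qed (use ai_int in \<open>auto simp: coeff_pCons split: nat.splits\<close>)
    thus ?thesis by (rule rat_int)
  qed
  have indep: "v = v'" "u = u'" if "of_rat u + of_rat v * \<theta> = of_rat u' + of_rat v' * \<theta>" for u v u' v'
  proof -
    have e: "of_rat (u - u') = of_rat (v' - v) * \<theta>" using that by (simp add: of_rat_diff algebra_simps)
    have "Im (of_rat r :: complex) = 0" for r
      using cnj_rat[of r] by (simp add: complex_eq_iff)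
    hence "Re (of_rat (v' - v) :: complex) * Im (\<sigma> \<theta>) = 0"
      using arg_cong[OF e, of "\<lambda>x. Im (\<sigma> x)"] by (simp add: hom_distribs \<sigma>_rat D(4))
    hence "Re (of_rat (v' - v) :: complex) = 0" using D(3) by simp
    hence "(of_rat (v' - v) :: complex) = 0"
      using \<open>\<And>r. Im (of_rat r :: complex) = 0\<close> by (simp add: complex_eq_iff)
    thus "v = v'" by simp
    thus "u = u'" using that by simp
  qed
  define H where "H = {z. \<exists>u v. algebraic_int (of_rat u + of_rat v * \<theta>) \<and> 2 * of_int D * v = of_int z}"
  have "x - y \<in> H" if "x \<in> H" "y \<in> H" for x y
  proof -
    from that obtain u v u' v' where a: "algebraic_int (of_rat u + of_rat v * \<theta>)" "2 * of_int D * v = of_int x"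
      "algebraic_int (of_rat u' + of_rat v' * \<theta>)" "2 * of_int D * v' = of_int y" by (auto simp: H_def)
    have "algebraic_int (of_rat (u - u') + of_rat (v - v') * \<theta>)"
      using ai_diff[OF a(1,3)] by (simp add: of_rat_diff algebra_simps)
    moreover have "2 * of_int D * (v - v') = of_int (x - y)" using a(2,4) by (simp add: algebra_simps)
    ultimately show ?thesis unfolding H_def by blast
  qed
  moreover have "2 * D \<in> H"
    unfolding H_def mem_Collect_eq by (rule exI[of _ 0], rule exI[of _ 1]) (use ai_\<theta> in simp)
  moreover have "2 * D > 0" using D(1) by simp
  ultimately obtain g where g: "g > 0" "g \<in> H" "\<forall>x\<in>H. g dvd x"
    by (rule int_subgroup_generator)
  then obtain u0 v0 where uv0: "algebraic_int (of_rat u0 + of_rat v0 * \<theta>)" "2 * of_int D * v0 = of_int g"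
    by (auto simp: H_def)
  define \<omega> where "\<omega> = of_rat u0 + of_rat v0 * \<theta>"
  have v0: "v0 \<noteq> 0" using uv0(2) g(1) by auto
  have ai_\<omega>: "algebraic_int \<omega>" using uv0 by (simp add: \<omega>_def)
  have int_iff: "algebraic_int x \<longleftrightarrow> (\<exists>m n. x = of_int m + of_int n * \<omega>)" for x
  proof
    assume x: "algebraic_int x"
    obtain u v where uv: "x = of_rat u + of_rat v * \<theta>" using coords by blast
    have "2 * of_int D * v \<in> \<int>" using bound[of u v] x uv by simp
    then obtain z where z: "2 * of_int D * v = of_int z" by (rule Ints_cases)
    hence "z \<in> H" using x uv by (auto simp: H_def)
    then obtain k where k: "z = g * k" using bspec[OF g(3)] by blast
    have "2 * of_int D * v = 2 * of_int D * (of_int k * v0)" using z k uv0(2) by simp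
    hence v: "v = of_int k * v0" using D(1) by simp
    have "x - of_int k * \<omega> = of_rat (u - of_int k * u0)"
      by (simp add: uv v \<omega>_def of_rat_mult of_rat_diff algebra_simps)
    moreover have "algebraic_int (x - of_int k * \<omega>)" using ai_diff[OF x ai_mult[OF ai_int ai_\<omega>]] .
    ultimately have "u - of_int k * u0 \<in> \<int>" using rat_int by metis
    then obtain m where "u - of_int k * u0 = of_int m" by (auto elim: Ints_cases)
    hence "x = of_int m + of_int k * \<omega>" using \<open>x - of_int k * \<omega> = _\<close> by (simp add: algebra_simps)
    thus "\<exists>m n. x = of_int m + of_int n * \<omega>" by blast
  qed (use ai_add ai_mult ai_int ai_\<omega> in auto)
  have rat_coords: "\<exists>u v. x = of_rat u + of_rat v * \<omega>" for x
  proof -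
    obtain u v where uv: "x = of_rat u + of_rat v * \<theta>" using coords by blast
    have "x = of_rat (u - v / v0 * u0) + of_rat (v / v0) * \<omega>"
      using v0 by (simp add: uv \<omega>_def of_rat_mult of_rat_diff of_rat_divide algebra_simps)
    thus ?thesis by blast
  qed
  obtain m n where mn: "\<omega> * \<omega> = of_int m + of_int n * \<omega>" using ai_mult[OF ai_\<omega> ai_\<omega>] int_iff by blast
  have "Im (\<sigma> \<omega>) \<noteq> 0"
  proof
    assume "Im (\<sigma> \<omega>) = 0"
    moreover have "Im (of_rat r :: complex) = 0" for r using cnj_rat[of r] by (simp add: complex_eq_iff)
    ultimately have "Re (of_rat v0 :: complex) * Im (\<sigma> \<theta>) = 0"
      by (simp add: \<omega>_def hom_distribs \<sigma>_rat D(4))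
    hence "(of_rat v0 :: complex) = 0" using D(3) \<open>\<And>r. Im (of_rat r :: complex) = 0\<close>
      by (simp add: complex_eq_iff)
    thus False using v0 by simp
  qed
  hence "quadratic_order \<sigma> \<omega> n (- m)"
    using hom int_iff rat_coords mn by unfold_locales (auto simp: algebra_simps)
  thus ?thesis by (rule that)
qed

section \<open>Ideals and inverse ideals of the order, and the index of the integers in an inverse
  ideal\<close>

lemma int_ring_simps [simp]:
  "x \<in> carrier int_ring \<longleftrightarrow> algebraic_int x" "x \<otimes>\<^bsub>int_ring\<^esub> y = x * y" "x \<oplus>\<^bsub>int_ring\<^esub> y = x + y"
  "\<one>\<^bsub>int_ring\<^esub> = 1" "\<zero>\<^bsub>int_ring\<^esub> = 0"
  by (simp_all add: int_ring_def)

context quadratic_order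
begin

interpretation \<sigma>: field_hom \<sigma> by (rule hom)

lemma \<sigma>_of_rat: "\<sigma> (of_rat r) = of_rat r"
  by (cases r) (simp add: of_rat_rat hom_distribs)

lemma Im_of_rat: "Im (of_rat r :: complex) = 0"
  by (cases r) (simp add: of_rat_rat complex_is_Real_iff[symmetric])

lemma coords_unique:
  assumes "of_rat u + of_rat v * \<omega> = of_rat u' + of_rat v' * \<omega>"
  shows "u = u'" "v = v'"
proof -
  have e: "of_rat (u - u') = of_rat (v' - v) * \<omega>" using assms by (simp add: of_rat_diff algebra_simps)
  have "Re (of_rat (v' - v) :: complex) * Im (\<sigma> \<omega>) = 0"
    using arg_cong[OF e, of "\<lambda>x. Im (\<sigma> x)"] by (simp add: hom_distribs \<sigma>_of_rat Im_of_rat)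
  hence "(of_rat (v' - v) :: complex) = 0" using Im_\<omega> by (simp add: complex_eq_iff Im_of_rat)
  thus "v = v'" by simp
  thus "u = u'" using assms by simp
qed

definition cu :: "'k \<Rightarrow> rat" where "cu x = (SOME u. \<exists>v. x = of_rat u + of_rat v * \<omega>)"
definition cv :: "'k \<Rightarrow> rat" where "cv x = (SOME v. x = of_rat (cu x) + of_rat v * \<omega>)"

lemma coords: "x = of_rat (cu x) + of_rat (cv x) * \<omega>"
proof -
  have "\<exists>v. x = of_rat (cu x) + of_rat v * \<omega>"
    unfolding cu_def by (rule someI_ex[OF rat_coords])
  thus ?thesis unfolding cv_def by (rule someI_ex)
qed

lemma cu_eq: "cu (of_rat u + of_rat v * \<omega>) = u" and cv_eq: "cv (of_rat u + of_rat v * \<omega>) = v"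
  using coords_unique[OF coords[of "of_rat u + of_rat v * \<omega>"]] by auto

lemma cv_add: "cv (x + y) = cv x + cv y"
proof -
  have "x + y = of_rat (cu x + cu y) + of_rat (cv x + cv y) * \<omega>"
    by (subst coords[of x], subst coords[of y]) (simp add: of_rat_add algebra_simps)
  thus ?thesis using cv_eq by metis
qed

lemma cv_mult: "cv (x * y) = cu x * cv y + cv x * cu y + of_int tr * cv x * cv y"
proof -
  have "x * y = of_rat (cu x * cu y) + of_rat (cu x * cv y + cv x * cu y) * \<omega> +
      of_rat (cv x * cv y) * (\<omega> * \<omega>)"
    by (subst coords[of x], subst coords[of y]) (simp add: of_rat_add of_rat_mult algebra_simps)
  also have "\<dots> = of_rat (cu x * cu y - cv x * cv y * of_int nm) +
      of_rat (cu x * cv y + cv x * cu y + of_int tr * cv x * cv y) * \<omega>"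
    unfolding \<omega>_square by (simp add: of_rat_add of_rat_diff of_rat_mult algebra_simps)
  finally show ?thesis using cv_eq by metis
qed

lemma cu_of_int [simp]: "cu (of_int m) = of_int m" and cv_of_int [simp]: "cv (of_int m) = 0"
  using cu_eq[of "of_int m" 0] cv_eq[of "of_int m" 0] by simp_all

lemma cu_\<omega> [simp]: "cu \<omega> = 0" and cv_\<omega> [simp]: "cv \<omega> = 1"
  using cu_eq[of 0 1] cv_eq[of 0 1] by simp_all

lemma int_iff_coords: "algebraic_int x \<longleftrightarrow> cu x \<in> \<int> \<and> cv x \<in> \<int>"
proof
  assume "algebraic_int x"
  then obtain m n where "x = of_int m + of_int n * \<omega>" using int_iff by blast
  hence "x = of_rat (of_int m) + of_rat (of_int n) * \<omega>" by simp
  hence "cu x = of_int m" "cv x = of_int n" using cu_eq cv_eq by metis+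
  thus "cu x \<in> \<int> \<and> cv x \<in> \<int>" by simp
next
  assume "cu x \<in> \<int> \<and> cv x \<in> \<int>"
  then obtain m n where "cu x = of_int m" "cv x = of_int n" by (auto elim!: Ints_cases)
  hence "x = of_int m + of_int n * \<omega>" by (subst coords) simp
  thus "algebraic_int x" using int_iff by blast
qed

lemma int_add: "algebraic_int x \<Longrightarrow> algebraic_int y \<Longrightarrow> algebraic_int (x + y :: 'k)"
proof -
  assume "algebraic_int x" "algebraic_int y"
  then obtain m n m' n' where "x = of_int m + of_int n * \<omega>" "y = of_int m' + of_int n' * \<omega>"
    using int_iff by meson
  hence "x + y = of_int (m + m') + of_int (n + n') * \<omega>" by (simp add: algebra_simps)
  thus ?thesis using int_iff by blast
qed

lemma int_mult: "algebraic_int x \<Longrightarrow> algebraic_int y \<Longrightarrow> algebraic_int (x * y :: 'k)"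
proof -
  assume "algebraic_int x" "algebraic_int y"
  then obtain m n m' n' where xy: "x = of_int m + of_int n * \<omega>" "y = of_int m' + of_int n' * \<omega>"
    using int_iff by meson
  have "x * y = of_int m * of_int m' + (of_int m * of_int n' + of_int n * of_int m') * \<omega> + 
      of_int n * of_int n' * (\<omega> * \<omega>)" by (simp add: xy algebra_simps)
  also have "\<dots> = of_int (m * m' - n * n' * nm) + of_int (m * n' + n * m' + n * n' * tr) * \<omega>"
    unfolding \<omega>_square by (simp add: algebra_simps)
  finally show ?thesis using int_iff by blast
qed

lemma int_of_int: "algebraic_int (of_int m :: 'k)"
  by (rule int_imp_algebraic_int) simp

lemma int_\<omega>: "algebraic_int \<omega>"
  unfolding int_iff by (rule exI[of _ 0], rule exI[of _ 1]) simp

lemma int_diff: "algebraic_int x \<Longrightarrow> algebraic_int y \<Longrightarrow> algebraic_int (x - y :: 'k)"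
  using int_add[of x "- y"] by simp

lemma common_denominator: "\<exists>c>0. algebraic_int (of_int c * x)" for x :: 'k
proof -
  obtain a b where u: "cu x = of_int a / of_int b" "b > 0" by (cases "cu x") (auto simp: Fract_of_int_quotient)
  obtain a' b' where v: "cv x = of_int a' / of_int b'" "b' > 0" by (cases "cv x") (auto simp: Fract_of_int_quotient)
  have "of_int (b * b') * x = of_rat (of_int (b * b') * cu x) + of_rat (of_int (b * b') * cv x) * \<omega>"
    by (subst coords) (simp add: of_rat_mult algebra_simps)
  also have "of_int (b * b') * cu x = of_int (b' * a)" using u v by simp
  also have "of_int (b * b') * cv x = of_int (b * a')" using u v by simp
  finally have "of_int (b * b') * x = of_int (b' * a) + of_int (b * a') * \<omega>" by (simp only: of_rat_of_int_eq)
  hence "algebraic_int (of_int (b * b') * x)" using int_iff by blast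
  thus ?thesis using u v by (intro exI[of _ "b * b'"]) simp
qed

lemma idealD:
  fixes J :: "'k set"
  assumes "ideal J int_ring"
  shows "x \<in> J \<Longrightarrow> algebraic_int x" "x \<in> J \<Longrightarrow> y \<in> J \<Longrightarrow> x + y \<in> J" "0 \<in> J"
    "x \<in> J \<Longrightarrow> algebraic_int a \<Longrightarrow> a * x \<in> J" "x \<in> J \<Longrightarrow> - x \<in> J" "x \<in> J \<Longrightarrow> y \<in> J \<Longrightarrow> x - y \<in> J"
proof -
  interpret J: ideal J int_ring by fact
  show 1: "algebraic_int x" if "x \<in> J" for x using J.Icarr[OF that] by simp
  note sg = ideal.axioms(1)[OF assms]
  show 2: "x + y \<in> J" if "x \<in> J" "y \<in> J" for x y using additive_subgroup.a_closed[OF sg that] by simp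
  show "0 \<in> J" using additive_subgroup.zero_closed[OF sg] by simp
  show 3: "a * x \<in> J" if "x \<in> J" "algebraic_int a" for a x using J.I_l_closed[of x a] that by simp
  show 4: "- x \<in> J" if "x \<in> J" for x using 3[OF that, of "-1"] int_of_int[of "-1"] by simp
  show "x - y \<in> J" if "x \<in> J" "y \<in> J" using 2[OF that(1) 4[OF that(2)]] by simp
qed

lemma ideal_contains_integer:
  fixes J :: "'k set"
  assumes J: "ideal J int_ring" "J \<noteq> {0}"
  obtains e where "e > 0" "of_int e \<in> J"
proof -
  obtain x where x: "x \<in> J" "x \<noteq> 0" using J idealD(3)[OF J(1)] by blast
  obtain c where c: "c > 0" "algebraic_int (of_int c * inverse x)" using common_denominator[of "inverse x"] by blast
  have "(of_int c * inverse x) * x \<in> J" using idealD(4)[OF J(1) x(1) c(2)] .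
  thus ?thesis using that[OF c(1)] x(2) by (simp add: mult.assoc)
qed

lemma inverse_idealD:
  fixes J :: "'k set"
  shows "x \<in> inverse_ideal J \<Longrightarrow> y \<in> inverse_ideal J \<Longrightarrow> x + y \<in> inverse_ideal J"
  "x \<in> inverse_ideal J \<Longrightarrow> y \<in> inverse_ideal J \<Longrightarrow> x - y \<in> inverse_ideal J"
  "x \<in> inverse_ideal J \<Longrightarrow> algebraic_int a \<Longrightarrow> a * x \<in> inverse_ideal J"
  "0 \<in> inverse_ideal J"
  by (auto simp: inverse_ideal_def distrib_right left_diff_distrib mult.assoc intro: int_add int_diff int_mult)

lemma int_subset_inverse_ideal:
  fixes J :: "'k set"
  shows "ideal J int_ring \<Longrightarrow> algebraic_int x \<Longrightarrow> x \<in> inverse_ideal J"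
  by (auto simp: inverse_ideal_def intro: int_mult idealD(1))

lemma inverse_ideal_bounded:
  fixes J :: "'k set"
  assumes "ideal J int_ring" "J \<noteq> {0}"
  obtains e where "e > 0" "\<forall>x\<in>inverse_ideal J. algebraic_int (of_int e * x)"
proof -
  obtain e where "e > 0" "of_int e \<in> J" using ideal_contains_integer[OF assms] .
  thus ?thesis using that[of e] by (auto simp: inverse_ideal_def mult.commute)
qed

text \<open>\<open>M\<close> lies in \<open>1 / e\<close> times the ring of integers and contains
  \<open>e'\<close> and \<open>e' \<omega>\<close>, so in coordinates scaled by \<open>e\<close> it
  is a sublattice of the integer plane of full rank.\<close>

lemma hnf_basis:
  fixes M :: "'k set"
  assumes M: "\<And>x y. x \<in> M \<Longrightarrow> y \<in> M \<Longrightarrow> x - y \<in> M" and e: "e > 0" "e' > 0"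
    "\<And>x. x \<in> M \<Longrightarrow> algebraic_int (of_int e * x)" "of_int e' \<in> M" "of_int e' * \<omega> \<in> M"
  obtains a b d where "a > 0" "d > 0"
    "\<forall>m n. (of_int m + of_int n * \<omega>) / of_int e \<in> M \<longleftrightarrow> (m, n) \<in> hnf_lattice a b d"
proof -
  define G where "G = {(m, n). (of_int m + of_int n * \<omega>) / of_int e \<in> M}"
  have G: "(x - x', y - y') \<in> G" if "(x, y) \<in> G" "(x', y') \<in> G" for x y x' y'
  proof -
    have "(of_int x + of_int y * \<omega>) / of_int e - (of_int x' + of_int y' * \<omega>) / of_int e \<in> M"
      using that M by (simp add: G_def)
    also have "(of_int x + of_int y * \<omega>) / of_int e - (of_int x' + of_int y' * \<omega>) / of_int e =
      (of_int (x - x') + of_int (y - y') * \<omega>) / of_int e"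
      by (simp add: diff_divide_distrib add_divide_distrib left_diff_distrib)
    finally show ?thesis by (simp add: G_def)
  qed
  have "e * e' > 0" "(e * e', 0) \<in> G" "(0, e * e') \<in> G" using e by (simp_all add: G_def)
  note 0 = this
  obtain a b d where "a > 0" "d > 0" and eq: "G = hnf_lattice a b d"
    by (rule hnf_exists[of G "e * e'"]) (use G 0 in blast)+
  have "\<forall>m n. (of_int m + of_int n * \<omega>) / of_int e \<in> M \<longleftrightarrow> (m, n) \<in> hnf_lattice a b d"
    unfolding eq[symmetric] by (simp add: G_def)
  with \<open>a > 0\<close> \<open>d > 0\<close> show ?thesis by (rule that)
qed

text \<open>In a basis of the rank two module \<open>M\<close>, multiplication by \<open>t\<close> is an integral matrix.\<close>

lemma multiplier_integral:
  fixes M :: "'k set"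
  assumes M: "\<And>x y. x \<in> M \<Longrightarrow> y \<in> M \<Longrightarrow> x - y \<in> M" and e: "e > 0" "e' > 0"
    "\<And>x. x \<in> M \<Longrightarrow> algebraic_int (of_int e * x)" "of_int e' \<in> M" "of_int e' * \<omega> \<in> M"
    and t: "\<And>x. x \<in> M \<Longrightarrow> t * x \<in> M"
  shows "algebraic_int t"
proof -
  obtain a b d where ad: "a > 0" "d > 0"
    and iff': "\<forall>m n. (of_int m + of_int n * \<omega>) / of_int e \<in> M \<longleftrightarrow> (m, n) \<in> hnf_lattice a b d"
    by (rule hnf_basis[OF M e])
  note iff = iff'[rule_format]
  define x1 where "x1 = of_int a / (of_int e :: 'k)"
  define x2 where "x2 = (of_int b + of_int d * \<omega>) / of_int e"
  have x1: "x1 \<in> M" using iff[of a 0] hnf_latticeI[of a 1 a 0 b 0 d] by (simp add: x1_def)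
  have x2: "x2 \<in> M" using iff[of b d] hnf_latticeI[of b 0 a 1 b d d] by (simp add: x2_def)
  have span: "\<exists>i j. x = of_int i * x1 + of_int j * x2" if x: "x \<in> M" for x
  proof -
    obtain m n where mn: "of_int e * x = of_int m + of_int n * \<omega>" using e(3)[OF x] int_iff by blast
    hence xe: "x = (of_int m + of_int n * \<omega>) / of_int e" using e(1) by (simp add: field_simps)
    with x iff obtain i j where "m = i * a + j * b" "n = j * d" by (auto simp: hnf_lattice_def)
    hence "x = of_int i * x1 + of_int j * x2"
      by (simp add: xe x1_def x2_def add_divide_distrib algebra_simps)
    thus ?thesis by blast
  qed
  obtain p q where pq: "t * x1 = of_int p * x1 + of_int q * x2" using span t[OF x1] by blast
  obtain r s where rs: "t * x2 = of_int r * x1 + of_int s * x2" using span t[OF x2] by blast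
  \<comment> \<open>Cayley-Hamilton for the matrix of multiplication by \<open>t\<close>, applied to
    the basis vector \<open>x1\<close>.\<close>
  have "(t * t - of_int (p + s) * t + of_int (p * s - q * r)) * x1 = 0"
  proof -
    have "(t * t - of_int (p + s) * t + of_int (p * s - q * r)) * x1 =
      t * (t * x1) - of_int (p + s) * (t * x1) + of_int (p * s - q * r) * x1" by (simp add: algebra_simps)
    also have "\<dots> = of_int p * (t * x1) + of_int q * (t * x2) - of_int (p + s) * (t * x1) + of_int (p * s - q * r) * x1"
      by (subst pq) (simp add: algebra_simps)
    also have "\<dots> = 0" unfolding pq rs by (simp add: algebra_simps)
    finally show ?thesis .
  qed
  moreover have "x1 \<noteq> 0" using ad e by (simp add: x1_def)
  ultimately have "t * t - of_int (p + s) * t + of_int (p * s - q * r) = 0" by simp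
  hence "poly [:of_int (p * s - q * r), - of_int (p + s), 1:] t = 0" by (simp add: algebra_simps)
  thus ?thesis
    by (rule algebraic_int.intros[rotated 2]) (auto simp: coeff_pCons split: nat.splits)
qed

text \<open>
  For an ideal \<open>P\<close> an element \<open>x\<close> lies in \<open>P\<^sup>-\<^sup>1\<close> as soon as the \<open>\<omega>\<close>-coordinates of \<open>x P\<close> are
  integral; so \<open>P\<^sup>-\<^sup>1\<close> is a dual lattice of \<open>P\<close>, and the index of the integers in it is the norm.
\<close>

lemma inverse_ideal_residues:
  fixes P :: "'k set"
  assumes P: "ideal P int_ring" "P \<noteq> {0}"
  shows "\<exists>R. finite R \<and> card R = ideal_norm P \<and> R \<subseteq> inverse_ideal P \<and>
    (\<forall>x\<in>inverse_ideal P. \<exists>!r. r \<in> R \<and> algebraic_int (x - r))"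
proof -
  obtain e where e: "e > 0" "of_int e \<in> P" using ideal_contains_integer[OF P] .
  have e\<omega>: "of_int e * \<omega> \<in> P" using idealD(4)[OF P(1) e(2) int_\<omega>] by (simp add: mult.commute)
  have PO: "algebraic_int (of_int 1 * x)" if "x \<in> P" for x using idealD(1)[OF P(1) that] by simp
  obtain a b d where ad: "a > 0" "d > 0"
    and iff1: "\<forall>m n. (of_int m + of_int n * \<omega>) / of_int 1 \<in> P \<longleftrightarrow> (m, n) \<in> hnf_lattice a b d"
  proof (rule hnf_basis[of P 1 e])
    show "x - y \<in> P" if "x \<in> P" "y \<in> P" for x y using idealD(6)[OF P(1) that] .
    show "e > 0" "of_int e \<in> P" "of_int e * \<omega> \<in> P" using e e\<omega> by blast+
  qed (simp_all only: PO zero_less_one, erule that)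
  have iff: "of_int m + of_int n * \<omega> \<in> P \<longleftrightarrow> (m, n) \<in> hnf_lattice a b d" for m n
    using iff1[rule_format, of m n] by simp
  let ?Box = "{0..<a} \<times> {0..<d}"
  define pt where "pt = (\<lambda>p. of_int (fst p) + of_int (snd p) * \<omega>)"
  have pt_diff: "pt p - pt q \<in> P \<longleftrightarrow> (fst p - fst q, snd p - snd q) \<in> hnf_lattice a b d" for p q
    using iff[of "fst p - fst q" "snd p - snd q"] by (simp add: pt_def algebra_simps)
  have coset: "P +>\<^bsub>int_ring\<^esub> x = P +>\<^bsub>int_ring\<^esub> y \<longleftrightarrow> x - y \<in> P" for x y
  proof -
    have c: "P +>\<^bsub>int_ring\<^esub> x = {z. z - x \<in> P}" for x
      by (auto simp: a_r_coset_def' intro!: bexI[of _ "_ - x"])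
    show ?thesis
    proof
      assume "P +>\<^bsub>int_ring\<^esub> x = P +>\<^bsub>int_ring\<^esub> y"
      moreover have "x \<in> P +>\<^bsub>int_ring\<^esub> x" using idealD(3)[OF P(1)] by (simp add: c)
      ultimately show "x - y \<in> P" by (simp add: c)
    next
      assume xy: "x - y \<in> P"
      have "z - x \<in> P \<longleftrightarrow> z - y \<in> P" for z
        using idealD(2)[OF P(1) _ xy, of "z - x"] idealD(6)[OF P(1) _ xy, of "z - y"] by auto
      thus "P +>\<^bsub>int_ring\<^esub> x = P +>\<^bsub>int_ring\<^esub> y" by (simp add: c)
    qed
  qed
  have "bij_betw (\<lambda>p. P +>\<^bsub>int_ring\<^esub> pt p) ?Box (carrier (int_ring Quot P))"
  proof (rule bij_betwI')
    fix p q assume pq: "p \<in> ?Box" "q \<in> ?Box"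
    have "(P +>\<^bsub>int_ring\<^esub> pt p = P +>\<^bsub>int_ring\<^esub> pt q) \<longleftrightarrow>
       (fst p - fst q, snd p - snd q) \<in> hnf_lattice a b d" by (simp add: coset pt_diff)
    also have "\<dots> \<longleftrightarrow> p = q"
    proof
      have "(0, 0) \<in> hnf_lattice a b d" by (rule hnf_latticeI[of _ 0 _ 0]) simp_all
      thus "(fst p - fst q, snd p - snd q) \<in> hnf_lattice a b d" if "p = q" using that by simp
      assume "(fst p - fst q, snd p - snd q) \<in> hnf_lattice a b d"
      moreover obtain t where "\<And>u. u \<in> ?Box \<and> (fst p - fst u, snd p - snd u) \<in> hnf_lattice a b d \<Longrightarrow> u = t"
        using hnf_residues[OF ad, of "fst p" "snd p" b] by (auto elim!: ex1E)
      moreover have "(fst p - fst p, snd p - snd p) \<in> hnf_lattice a b d"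
        using \<open>(0, 0) \<in> _\<close> by simp
      ultimately have "p = t" "q = t" using pq by blast+
      thus "p = q" by simp
    qed
    finally show "(P +>\<^bsub>int_ring\<^esub> pt p = P +>\<^bsub>int_ring\<^esub> pt q) \<longleftrightarrow> p = q" .
  next
    fix p assume "p \<in> ?Box"
    have "algebraic_int (pt p)" unfolding pt_def using int_iff by blast
    thus "P +>\<^bsub>int_ring\<^esub> pt p \<in> carrier (int_ring Quot P)" by (auto simp: FactRing_def A_RCOSETS_def')
  next
    fix C assume "C \<in> carrier (int_ring Quot P)"
    then obtain x where x: "algebraic_int x" "C = P +>\<^bsub>int_ring\<^esub> x"
      by (auto simp: FactRing_def A_RCOSETS_def')
    obtain m n where "x = pt (m, n)" using x int_iff by (auto simp: pt_def)
    moreover obtain q where q: "q \<in> ?Box" "(m - fst q, n - snd q) \<in> hnf_lattice a b d"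
      using hnf_residues[OF ad, of m n b] by blast
    ultimately have "C = P +>\<^bsub>int_ring\<^esub> pt q"
      using pt_diff[of "(m, n)" q] x coset[of x "pt q"] by simp
    thus "\<exists>q\<in>?Box. C = P +>\<^bsub>int_ring\<^esub> pt q" using q(1) by blast
  qed
  hence norm: "ideal_norm P = card ?Box" by (simp add: ideal_norm_def bij_betw_same_card)
  define \<beta> where "\<beta> = of_int b + of_int d * \<omega>"
  have aP: "of_int a \<in> P" using iff[of a 0] hnf_latticeI[of a 1 a 0 b 0 d] by simp
  have \<beta>P: "\<beta> \<in> P" using iff[of b d] hnf_latticeI[of b 0 a 1 b d d] by (simp add: \<beta>_def)
  have cv\<beta>: "cv (x * \<beta>) = of_int b * cv x + of_int d * (cu x + of_int tr * cv x)" for x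
  proof -
    have "cu \<beta> = of_int b" "cv \<beta> = of_int d"
      using cu_eq[of "of_int b" "of_int d"] cv_eq[of "of_int b" "of_int d"] by (simp_all add: \<beta>_def)
    thus ?thesis by (simp add: cv_mult algebra_simps)
  qed
  have cva: "cv (x * of_int a) = of_int a * cv x" for x by (simp add: cv_mult mult.commute)
  \<comment> \<open>The conditions on the basis elements \<open>a\<close> and \<beta> extend to all
    of \<open>P\<close> by additivity. As \<open>P\<close> is stable under \<omega> and
    \<open>cv (\<omega> y) = cu y + tr cv y\<close>, integral \<open>cv\<close> on
    \<open>x P\<close> forces integral \<open>cu\<close> as well.\<close>
  have dual: "x \<in> inverse_ideal P \<longleftrightarrow> cv (x * of_int a) \<in> \<int> \<and> cv (x * \<beta>) \<in> \<int>" for x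
  proof
    assume "x \<in> inverse_ideal P"
    thus "cv (x * of_int a) \<in> \<int> \<and> cv (x * \<beta>) \<in> \<int>"
      using aP \<beta>P int_iff_coords by (auto simp: inverse_ideal_def)
  next
    assume h: "cv (x * of_int a) \<in> \<int> \<and> cv (x * \<beta>) \<in> \<int>"
    have cvP: "cv (x * y) \<in> \<int>" if y: "y \<in> P" for y
    proof -
      obtain m n where "y = of_int m + of_int n * \<omega>" using idealD(1)[OF P(1) y] int_iff by blast
      then obtain i j where y': "y = of_int (i * a + j * b) + of_int (j * d) * \<omega>"
        using y iff by (auto simp: hnf_lattice_def)
      have "x * y = of_int i * (x * of_int a) + of_int j * (x * \<beta>)"
        by (simp add: y' \<beta>_def algebra_simps)
      hence "cv (x * y) = of_int i * cv (x * of_int a) + of_int j * cv (x * \<beta>)"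
        by (simp only: cv_add cv_mult[of "of_int _"]) simp
      thus ?thesis using h by auto
    qed
    have "algebraic_int (x * y)" if y: "y \<in> P" for y
    proof -
      have e: "x * (\<omega> * y) = \<omega> * (x * y)" by (rule mult.left_commute)
      have "cv (x * (\<omega> * y)) = cu (x * y) + of_int tr * cv (x * y)"
        unfolding e using cv_mult[of \<omega> "x * y"] by simp
      moreover have "cv (x * (\<omega> * y)) \<in> \<int>" using cvP idealD(4)[OF P(1) y int_\<omega>] by blast
      ultimately have "cu (x * y) + of_int tr * cv (x * y) - of_int tr * cv (x * y) \<in> \<int>"
        using cvP[OF y] by (metis Ints_diff Ints_mult Ints_of_int)
      thus ?thesis using cvP[OF y] by (simp add: int_iff_coords)
    qed
    thus "x \<in> inverse_ideal P" by (auto simp: inverse_ideal_def)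
  qed
  \<comment> \<open>The dual coordinates \<open>(cv (x \<beta>), cv (x a))\<close> identify the
    inverse ideal with the integer plane, with inverse map \<open>g\<close>. In them
    \<open>u + v \<omega>\<close> becomes \<open>(u d + v b', v a)\<close>, so the integers form
    \<open>hnf_lattice d b' a\<close>, of index \<open>d a\<close>, the norm of
    \<open>P\<close>.\<close>
  define b' where "b' = b + d * tr"
  define g where "g = (\<lambda>p. of_rat ((of_int (fst p) - of_int b' * (of_int (snd p) / of_int a)) / of_int d) +
    of_rat (of_int (snd p) / of_int a) * \<omega>)"
  have g1: "cv (g p * of_int a) = of_int (snd p)" "cv (g p * \<beta>) = of_int (fst p)" for p
  proof -
    have 1: "cv (g p) = of_int (snd p) / of_int a" unfolding g_def by (rule cv_eq)
    have 2: "cu (g p) = (of_int (fst p) - of_int b' * (of_int (snd p) / of_int a)) / of_int d"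
      unfolding g_def by (rule cu_eq)
    show "cv (g p * of_int a) = of_int (snd p)" unfolding cva 1 using ad by simp
    have "cv (g p * \<beta>) = of_int b' * cv (g p) + of_int d * cu (g p)"
      unfolding cv\<beta> b'_def by (simp add: algebra_simps)
    thus "cv (g p * \<beta>) = of_int (fst p)" unfolding 1 2 using ad by simp
  qed
  have cv_diff: "cv (x - y) = cv x - cv y" for x y using cv_add[of "x - y" y] by simp
  have int_g: "algebraic_int (x - g p) \<longleftrightarrow> (m - fst p, n - snd p) \<in> hnf_lattice d b' a"
    if x: "cv (x * of_int a) = of_int n" "cv (x * \<beta>) = of_int m" for x m n p
  proof -
    define z where "z = x - g p"
    have "cv (z * of_int a) = of_int (n - snd p)"
      using x(1) g1(1)[of p] by (simp add: z_def left_diff_distrib cv_diff)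
    hence z1: "of_int a * cv z = of_int (n - snd p)" by (simp only: cva)
    have "cv (z * \<beta>) = of_int (m - fst p)"
      using x(2) g1(2)[of p] by (simp add: z_def left_diff_distrib cv_diff)
    hence z2: "of_int b' * cv z + of_int d * cu z = of_int (m - fst p)"
      unfolding cv\<beta> b'_def by (simp add: algebra_simps)
    have "cu z \<in> \<int> \<and> cv z \<in> \<int> \<longleftrightarrow> (m - fst p, n - snd p) \<in> hnf_lattice d b' a"
    proof
      assume "cu z \<in> \<int> \<and> cv z \<in> \<int>"
      then obtain u v where uv: "cu z = of_int u" "cv z = of_int v" by (auto elim!: Ints_cases)
      have "of_int (v * a) = (of_int (n - snd p) :: rat)" using z1 uv by (simp add: mult.commute)
      hence 1: "n - snd p = v * a" by (simp only: of_int_eq_iff)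
      have "of_int (u * d + v * b') = (of_int (m - fst p) :: rat)" using z2 uv by (simp add: algebra_simps)
      hence "m - fst p = u * d + v * b'" by (simp only: of_int_eq_iff)
      with 1 show "(m - fst p, n - snd p) \<in> hnf_lattice d b' a" by (auto simp: hnf_lattice_def)
    next
      assume "(m - fst p, n - snd p) \<in> hnf_lattice d b' a"
      then obtain u v where uv: "m - fst p = u * d + v * b'" "n - snd p = v * a" by (auto simp: hnf_lattice_def)
      have v: "cv z = of_int v" using z1 ad unfolding uv by simp
      have "cu z = of_int u" using z2 ad unfolding uv v by (simp add: algebra_simps)
      with v show "cu z \<in> \<int> \<and> cv z \<in> \<int>" by simp
    qed
    thus ?thesis by (simp add: int_iff_coords z_def)
  qed
  let ?Box' = "{0..<d} \<times> {0..<a}"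
  have inj: "inj g"
  proof (rule injI)
    fix p q assume "g p = g q"
    hence "of_int (fst p) = (of_int (fst q) :: rat)" "of_int (snd p) = (of_int (snd q) :: rat)"
      using g1[of p] g1[of q] by simp_all
    thus "p = q" by (simp add: prod_eq_iff)
  qed
  show ?thesis
  proof (intro exI[of _ "g ` ?Box'"] conjI ballI)
    show "card (g ` ?Box') = ideal_norm P"
      by (subst card_image[OF inj_on_subset[OF inj]]) (auto simp: norm mult.commute)
    show "g ` ?Box' \<subseteq> inverse_ideal P" by (auto simp: dual g1)
    fix x assume "x \<in> inverse_ideal P"
    then obtain m n where x: "cv (x * of_int a) = of_int n" "cv (x * \<beta>) = of_int m"
      by (auto simp: dual elim!: Ints_cases)
    have "\<exists>!p. p \<in> ?Box' \<and> algebraic_int (x - g p)"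
      using hnf_residues[OF ad(2,1), of m n b'] by (simp only: int_g[OF x])
    then obtain p where p: "p \<in> ?Box' \<and> algebraic_int (x - g p)"
      and u: "\<forall>q. q \<in> ?Box' \<and> algebraic_int (x - g q) \<longrightarrow> q = p"
      unfolding Ex1_def by blast
    show "\<exists>!r. r \<in> g ` ?Box' \<and> algebraic_int (x - r)"
    proof (rule ex1I[of _ "g p"])
      fix r assume "r \<in> g ` ?Box' \<and> algebraic_int (x - r)"
      then obtain q where "q \<in> ?Box'" "r = g q" "algebraic_int (x - g q)" by blast
      thus "r = g p" using u by blast
    qed (use p in blast)
  qed auto
qed

text \<open>Coprimality gives \<open>i + p = 1\<close> with \<open>i\<close> in \<II> and
  \<open>p\<close> in \<open>P\<close>. For \<open>x\<close> in the inverse of the product,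
  \<open>x i\<close> lies in the inverse of \<open>P\<close> and \<open>x - x i = x p\<close> in the
  inverse of \<II>, and these two inverses meet in the integers. So representatives of the inverse
  of \<open>P\<close> modulo the integers also serve here.\<close>

lemma coprime_inverse_ideal_residues:
  fixes \<II> P :: "'k set"
  assumes I: "ideal \<II> int_ring" "\<II> \<noteq> {0}" and P: "ideal P int_ring" "P \<noteq> {0}"
    and cop: "\<II> <+>\<^bsub>int_ring\<^esub> P = carrier int_ring"
  shows "\<exists>R. finite R \<and> card R = ideal_norm P \<and> R \<subseteq> inverse_ideal (P \<cdot>\<^bsub>int_ring\<^esub> \<II>) \<and>
    (\<forall>x\<in>inverse_ideal (P \<cdot>\<^bsub>int_ring\<^esub> \<II>). \<exists>!r. r \<in> R \<and> x - r \<in> inverse_ideal \<II>)"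
proof -
  let ?PI = "P \<cdot>\<^bsub>int_ring\<^esub> \<II>"
  obtain R where R: "finite R" "card R = ideal_norm P" "R \<subseteq> inverse_ideal P"
    "\<forall>x\<in>inverse_ideal P. \<exists>!r. r \<in> R \<and> algebraic_int (x - r)"
    using inverse_ideal_residues[OF P] by blast
  have "(1 :: 'k) \<in> \<II> <+>\<^bsub>int_ring\<^esub> P" unfolding cop by (simp add: int_of_int[of 1, simplified])
  then obtain i p where ip: "i \<in> \<II>" "p \<in> P" "i + p = 1" by (auto simp: set_add_def' )
  have cap: "u \<in> inverse_ideal P \<and> u \<in> inverse_ideal \<II> \<longleftrightarrow> algebraic_int u" for u
  proof
    assume u: "u \<in> inverse_ideal P \<and> u \<in> inverse_ideal \<II>"
    have "u = u * i + u * p" using ip(3) by (simp flip: distrib_left)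
    moreover have "algebraic_int (u * i)" "algebraic_int (u * p)" using u ip by (auto simp: inverse_ideal_def)
    ultimately show "algebraic_int u" using int_add by metis
  qed (use I P int_subset_inverse_ideal in auto)
  have sub: "inverse_ideal P \<subseteq> inverse_ideal ?PI"
  proof
    fix x assume x: "x \<in> inverse_ideal P"
    have "algebraic_int (x * y)" if "y \<in> ?PI" for y
      using that
    proof (induction rule: ideal_prod.induct)
      case (prod p i)
      have "algebraic_int (x * p)" using x prod by (auto simp: inverse_ideal_def)
      from int_mult[OF this idealD(1)[OF I(1) prod(2)]] show ?case by (simp add: mult.assoc)
    qed (simp add: distrib_left int_add)
    thus "x \<in> inverse_ideal ?PI" by (simp add: inverse_ideal_def)
  qed
  have split: "t * i \<in> inverse_ideal P" "t * p \<in> inverse_ideal \<II>" if t: "t \<in> inverse_ideal ?PI" for t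
  proof -
    have pi: "algebraic_int (t * (p' * i'))" if "p' \<in> P" "i' \<in> \<II>" for p' i'
      using t ideal_prod.prod[OF that, of int_ring] by (auto simp: inverse_ideal_def)
    have "algebraic_int (t * i * p')" if "p' \<in> P" for p' using pi[OF that ip(1)] by (simp add: mult_ac)
    thus "t * i \<in> inverse_ideal P" by (auto simp: inverse_ideal_def)
    have "algebraic_int (t * p * i')" if "i' \<in> \<II>" for i' using pi[OF ip(2) that] by (simp add: mult_ac)
    thus "t * p \<in> inverse_ideal \<II>" by (auto simp: inverse_ideal_def)
  qed
  show ?thesis
  proof (intro exI[of _ R] conjI ballI)
    fix x assume x: "x \<in> inverse_ideal ?PI"
    have "x - r \<in> inverse_ideal \<II> \<longleftrightarrow> algebraic_int (x * i - r)" if r: "r \<in> R" for r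
    proof -
      have e: "x - r = (x * i - r) + x * p" using ip(3) by (simp flip: distrib_left)
      have e': "x - r - x * p = x * i - r" unfolding e by simp
      have "x - r \<in> inverse_ideal \<II> \<longleftrightarrow> x * i - r \<in> inverse_ideal \<II>"
        using inverse_idealD(1)[OF _ split(2)[OF x], of "x * i - r", folded e]
          inverse_idealD(2)[OF _ split(2)[OF x], of "x - r", unfolded e'] by blast
      also have "\<dots> \<longleftrightarrow> algebraic_int (x * i - r)"
        using cap[of "x * i - r"] inverse_idealD(2)[OF split(1)[OF x], of r] r R(3) by auto
      finally show ?thesis .
    qed
    thus "\<exists>!r. r \<in> R \<and> x - r \<in> inverse_ideal \<II>"
      using R(4) split(1)[OF x] by (metis (no_types, lifting))
  qed (use R sub in auto)
qed

end

section \<open>Regularised sums against a weight\<close>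

text \<open>
  The weight \<open>c\<close> sums to zero along every direction \<open>j\<close>, so subtracting from \<open>h\<close> its average
  along \<open>j\<close> does not change the sum of \<open>c h\<close>.  Repeating this makes the sums absolutely
  convergent that are needed, and defines a linear notion of regularised value.
\<close>

locale weighted_sum =
  fixes X :: "'x set" and J :: "'j set" and T :: "'t set"
    and act act' :: "'j \<Rightarrow> 't \<Rightarrow> 'x \<Rightarrow> 'x" and c :: "'x \<Rightarrow> complex" and K :: real
  assumes T: "finite T" "T \<noteq> {}"
    and act: "\<And>j t x. j \<in> J \<Longrightarrow> t \<in> T \<Longrightarrow> x \<in> X \<Longrightarrow> act j t x \<in> X"
    and act': "\<And>j t x. j \<in> J \<Longrightarrow> t \<in> T \<Longrightarrow> x \<in> X \<Longrightarrow> act' j t x \<in> X"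
    and inverse: "\<And>j t x. j \<in> J \<Longrightarrow> t \<in> T \<Longrightarrow> x \<in> X \<Longrightarrow> act j t (act' j t x) = x"
      "\<And>j t x. j \<in> J \<Longrightarrow> t \<in> T \<Longrightarrow> x \<in> X \<Longrightarrow> act' j t (act j t x) = x"
    and commute: "\<And>i j t u x. i \<in> J \<Longrightarrow> j \<in> J \<Longrightarrow> t \<in> T \<Longrightarrow> u \<in> T \<Longrightarrow> x \<in> X \<Longrightarrow>
      act i t (act j u x) = act j u (act i t x)"
    and bound: "\<And>x. x \<in> X \<Longrightarrow> cmod (c x) \<le> K"
    and zero_sum: "\<And>j x. j \<in> J \<Longrightarrow> x \<in> X \<Longrightarrow> (\<Sum>t\<in>T. c (act' j t x)) = 0"
begin

definition dif :: "'j \<Rightarrow> ('x \<Rightarrow> complex) \<Rightarrow> 'x \<Rightarrow> complex" where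
  "dif j h x = h x - (\<Sum>t\<in>T. h (act j t x)) / of_nat (card T)"

definition difs :: "'j list \<Rightarrow> ('x \<Rightarrow> complex) \<Rightarrow> 'x \<Rightarrow> complex" where
  "difs js h = foldr dif js h"

text \<open>A relation, because the list of differences that makes the sum converge depends on
  \<open>h\<close>. Linearity comes from joining lists, and \<open>regular_sum_vanishes\<close> is
  the only uniqueness that the cocycle relation uses.\<close>

definition regular_sum :: "('x \<Rightarrow> complex) \<Rightarrow> complex \<Rightarrow> bool" where
  "regular_sum h v \<longleftrightarrow> (\<exists>js. set js \<subseteq> J \<and> difs js h summable_on X \<and>
     (\<Sum>\<^sub>\<infinity>x\<in>X. c x * difs js h x) = v)"

lemma difs_Nil [simp]: "difs [] h = h" and difs_Cons [simp]: "difs (j # js) h = dif j (difs js h)"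
  and difs_append: "difs (is @ js) h = difs is (difs js h)"
  by (simp_all add: difs_def)

lemma dif_cong: "j \<in> J \<Longrightarrow> x \<in> X \<Longrightarrow> (\<And>x. x \<in> X \<Longrightarrow> h x = h' x) \<Longrightarrow> dif j h x = dif j h' x"
  by (simp add: dif_def act cong: sum.cong)

lemma difs_cong:
  "set js \<subseteq> J \<Longrightarrow> x \<in> X \<Longrightarrow> (\<And>x. x \<in> X \<Longrightarrow> h x = h' x) \<Longrightarrow> difs js h x = difs js h' x"
  by (induction js arbitrary: x) (auto intro: dif_cong)

lemma bij_act: "j \<in> J \<Longrightarrow> t \<in> T \<Longrightarrow> bij_betw (act j t) X X"
  by (rule bij_betwI[where g = "act' j t"]) (auto simp: act act' inverse)

lemma weight_summable: "h summable_on X \<Longrightarrow> (\<lambda>x. c x * h x) summable_on X"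
proof -
  assume h: "h summable_on X"
  have "(\<lambda>x. cmod (h x)) summable_on X" using h summable_on_iff_abs_summable_on_complex by blast
  hence "(\<lambda>x. K * cmod (h x)) summable_on X" by (rule summable_on_cmult_right)
  hence "(\<lambda>x. cmod (c x * h x)) summable_on X"
    by (rule summable_on_comparison_test) (use bound in \<open>auto simp: norm_mult intro!: mult_right_mono\<close>)
  thus ?thesis by (rule abs_summable_summable)
qed

text \<open>Translation moves the shift from \<open>h\<close> to the weight: the sum of
  \<open>c x h (act j t x)\<close> is that of \<open>c (act' j t x) h x\<close>, and over
  \<open>t\<close> these cancel by \<open>zero_sum\<close>.\<close>

lemma dif_sum:
  assumes j: "j \<in> J" and h: "h summable_on X"
  shows "dif j h summable_on X" "(\<Sum>\<^sub>\<infinity>x\<in>X. c x * dif j h x) = (\<Sum>\<^sub>\<infinity>x\<in>X. c x * h x)"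
proof -
  have s: "(\<lambda>x. h (act j t x)) summable_on X" if "t \<in> T" for t
    using summable_on_reindex_bij_betw[OF bij_act[OF j that], of h] h by simp
  have sT: "(\<lambda>x. \<Sum>t\<in>T. h (act j t x)) summable_on X"
    by (rule has_sum_imp_summable[OF has_sum_finite_sum]) (rule has_sum_infsum[OF s])
  have "(\<lambda>x. h x + (- 1 / of_nat (card T)) * (\<Sum>t\<in>T. h (act j t x))) summable_on X"
    by (intro summable_on_add summable_on_cmult_right sT h)
  thus "dif j h summable_on X" by (simp add: dif_def[abs_def])
  have ch: "((\<lambda>x. c x * h x) has_sum (\<Sum>\<^sub>\<infinity>x\<in>X. c x * h x)) X"
    by (intro has_sum_infsum weight_summable h)
  have ct: "((\<lambda>x. c x * h (act j t x)) has_sum (\<Sum>\<^sub>\<infinity>x\<in>X. c (act' j t x) * h x)) X" if t: "t \<in> T" for t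
  proof -
    have "((\<lambda>x. c x * h (act j t x)) has_sum (\<Sum>\<^sub>\<infinity>x\<in>X. c x * h (act j t x))) X"
      by (intro has_sum_infsum weight_summable s t)
    also have "(\<Sum>\<^sub>\<infinity>x\<in>X. c x * h (act j t x)) = (\<Sum>\<^sub>\<infinity>x\<in>X. c (act' j t (act j t x)) * h (act j t x))"
      using inverse(2)[OF j t] by (intro infsum_cong) simp
    also have "\<dots> = (\<Sum>\<^sub>\<infinity>x\<in>X. c (act' j t x) * h x)"
      by (rule infsum_reindex_bij_betw[OF bij_act[OF j t]])
    finally show ?thesis .
  qed
  have cs: "((\<lambda>x. c (act' j t x) * h x) has_sum (\<Sum>\<^sub>\<infinity>x\<in>X. c (act' j t x) * h x)) X" if t: "t \<in> T" for t
  proof -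
    have "(\<lambda>x. c (act' j t (act j t x)) * h (act j t x)) summable_on X"
      using has_sum_imp_summable[OF ct[OF t]]
      by (rule summable_on_cong[THEN iffD1, rotated]) (simp add: inverse(2)[OF j t])
    hence "(\<lambda>x. c (act' j t x) * h x) summable_on X"
      using summable_on_reindex_bij_betw[OF bij_act[OF j t], of "\<lambda>x. c (act' j t x) * h x"] by simp
    thus ?thesis by (rule has_sum_infsum)
  qed
  have "((\<lambda>x. \<Sum>t\<in>T. c (act' j t x) * h x) has_sum (\<Sum>t\<in>T. \<Sum>\<^sub>\<infinity>x\<in>X. c (act' j t x) * h x)) X"
    by (intro has_sum_finite_sum cs)
  moreover have "((\<lambda>x. \<Sum>t\<in>T. c (act' j t x) * h x) has_sum 0) X"
    by (rule has_sum_cong[THEN iffD1, OF _ has_sum_0_simp]) (simp add: zero_sum[OF j] flip: sum_distrib_right)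
  ultimately have z: "(\<Sum>t\<in>T. \<Sum>\<^sub>\<infinity>x\<in>X. c (act' j t x) * h x) = 0" by (rule has_sum_unique)
  have "((\<lambda>x. c x * h x + (- 1 / of_nat (card T)) * (\<Sum>t\<in>T. c x * h (act j t x))) has_sum
    (\<Sum>\<^sub>\<infinity>x\<in>X. c x * h x) + (- 1 / of_nat (card T)) * (\<Sum>t\<in>T. \<Sum>\<^sub>\<infinity>x\<in>X. c (act' j t x) * h x)) X"
    by (intro has_sum_add has_sum_cmult_right has_sum_finite_sum ch ct)
  moreover have "(\<lambda>x. c x * h x + (- 1 / of_nat (card T)) * (\<Sum>t\<in>T. c x * h (act j t x))) =
     (\<lambda>x. c x * dif j h x)"
    by (simp add: fun_eq_iff dif_def right_diff_distrib sum_distrib_left sum_negf sum_divide_distrib)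
  ultimately show "(\<Sum>\<^sub>\<infinity>x\<in>X. c x * dif j h x) = (\<Sum>\<^sub>\<infinity>x\<in>X. c x * h x)"
    by (simp add: z infsumI)
qed

lemma difs_sum:
  assumes "set js \<subseteq> J" "h summable_on X"
  shows "difs js h summable_on X" "(\<Sum>\<^sub>\<infinity>x\<in>X. c x * difs js h x) = (\<Sum>\<^sub>\<infinity>x\<in>X. c x * h x)"
  using assms by (induction js) (auto simp: dif_sum)

lemma dif_commute:
  assumes ij: "i \<in> J" "j \<in> J" and x: "x \<in> X"
  shows "dif i (dif j h) x = dif j (dif i h) x"
proof -
  have "(\<Sum>t\<in>T. \<Sum>u\<in>T. h (act j u (act i t x))) = (\<Sum>u\<in>T. \<Sum>t\<in>T. h (act i t (act j u x)))"
    by (subst sum.swap) (simp add: commute[OF ij _ _ x] cong: sum.cong)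
  thus ?thesis by (simp add: dif_def sum_subtractf sum_divide_distrib[symmetric] diff_divide_distrib)
qed

lemma dif_difs_commute:
  assumes "set js \<subseteq> J" "i \<in> J" "x \<in> X"
  shows "dif i (difs js h) x = difs js (dif i h) x"
  using assms
proof (induction js arbitrary: x)
  case (Cons j js)
  have "dif i (dif j (difs js h)) x = dif j (dif i (difs js h)) x" using Cons.prems by (intro dif_commute) auto
  also have "\<dots> = dif j (difs js (dif i h)) x" using Cons by (intro dif_cong) auto
  finally show ?case by simp
qed simp

lemma difs_commute:
  assumes "set is \<subseteq> J" "set js \<subseteq> J" "x \<in> X"
  shows "difs is (difs js h) x = difs js (difs is h) x"
  using assms
proof (induction "is" arbitrary: x)
  case (Cons i "is")
  have "dif i (difs is (difs js h)) x = dif i (difs js (difs is h)) x" using Cons by (intro dif_cong) auto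
  also have "\<dots> = difs js (dif i (difs is h)) x" using Cons.prems by (intro dif_difs_commute) auto
  finally show ?case by simp
qed simp

text \<open>Further differences preserve convergence and the sum, and differences commute; so the
  lists of two regular sums can be replaced by one common list.\<close>

lemma regular_sum_extend:
  assumes js: "set js \<subseteq> J" "difs js h summable_on X" "(\<Sum>\<^sub>\<infinity>x\<in>X. c x * difs js h x) = v"
    and "is": "set is \<subseteq> J"
  shows "difs (is @ js) h summable_on X" "(\<Sum>\<^sub>\<infinity>x\<in>X. c x * difs (is @ js) h x) = v"
    "difs (js @ is) h summable_on X" "(\<Sum>\<^sub>\<infinity>x\<in>X. c x * difs (js @ is) h x) = v"
proof -
  show 1: "difs (is @ js) h summable_on X" "(\<Sum>\<^sub>\<infinity>x\<in>X. c x * difs (is @ js) h x) = v"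
    using difs_sum[OF "is" js(2)] js(3) by (simp_all add: difs_append)
  have e: "difs (is @ js) h x = difs (js @ is) h x" if "x \<in> X" for x
    using difs_commute[OF "is" js(1) that] by (simp add: difs_append)
  show "difs (js @ is) h summable_on X"
    by (rule summable_on_cong[THEN iffD1, OF _ 1(1)]) (rule e)
  show "(\<Sum>\<^sub>\<infinity>x\<in>X. c x * difs (js @ is) h x) = v" using 1(2) by (simp add: e cong: infsum_cong)
qed

lemma difs_add: "difs js (\<lambda>x. h x + h' x) = (\<lambda>x. difs js h x + difs js h' x)"
proof (induction js)
  case (Cons j js)
  have "dif j (\<lambda>x. difs js h x + difs js h' x) x = dif j (difs js h) x + dif j (difs js h') x" for x
    by (simp add: dif_def sum.distrib add_divide_distrib)
  thus ?case by (simp add: Cons fun_eq_iff)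
qed simp

lemma difs_cmult: "difs js (\<lambda>x. a * h x) = (\<lambda>x. a * difs js h x)"
proof (induction js)
  case (Cons j js)
  have "dif j (\<lambda>x. a * difs js h x) x = a * dif j (difs js h) x" for x
    by (simp add: dif_def sum_distrib_left right_diff_distrib)
  thus ?case by (simp add: Cons fun_eq_iff)
qed simp

lemma regular_sum_add:
  assumes "regular_sum h v" "regular_sum h' v'"
  shows "regular_sum (\<lambda>x. h x + h' x) (v + v')"
proof -
  obtain js where js: "set js \<subseteq> J" "difs js h summable_on X" "(\<Sum>\<^sub>\<infinity>x\<in>X. c x * difs js h x) = v"
    using assms(1) unfolding regular_sum_def by blast
  obtain js' where js': "set js' \<subseteq> J" "difs js' h' summable_on X" "(\<Sum>\<^sub>\<infinity>x\<in>X. c x * difs js' h' x) = v'"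
    using assms(2) unfolding regular_sum_def by blast
  note 1 = regular_sum_extend(3,4)[OF js js'(1)] and 2 = regular_sum_extend(1,2)[OF js' js(1)]
  have "(\<lambda>x. difs (js @ js') h x + difs (js @ js') h' x) summable_on X" using 1 2 by (intro summable_on_add)
  moreover have "(\<Sum>\<^sub>\<infinity>x\<in>X. c x * difs (js @ js') h x + c x * difs (js @ js') h' x) = v + v'"
    using 1 2 by (subst infsum_add) (auto intro: weight_summable)
  ultimately show ?thesis unfolding regular_sum_def using js(1) js'(1)
    by (intro exI[of _ "js @ js'"]) (simp add: difs_add distrib_left)
qed

lemma regular_sum_cmult:
  assumes "regular_sum h v"
  shows "regular_sum (\<lambda>x. a * h x) (a * v)"
proof -
  obtain js where js: "set js \<subseteq> J" "difs js h summable_on X" "(\<Sum>\<^sub>\<infinity>x\<in>X. c x * difs js h x) = v"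
    using assms(1) unfolding regular_sum_def by blast
  have "(\<Sum>\<^sub>\<infinity>x\<in>X. c x * (a * difs js h x)) = a * v"
    unfolding js(3)[symmetric] by (subst infsum_cmult_right'[symmetric]) (simp add: mult_ac)
  thus ?thesis unfolding regular_sum_def using js
    by (intro exI[of _ js]) (auto simp: difs_cmult intro: summable_on_cmult_right)
qed

lemma regular_sum_zero: "regular_sum (\<lambda>x. 0) 0"
  unfolding regular_sum_def by (intro exI[of _ "[]"]) simp

lemma regular_sum_sum:
  assumes "\<And>i. i \<in> A \<Longrightarrow> regular_sum (h i) (v i)"
  shows "regular_sum (\<lambda>x. \<Sum>i\<in>A. h i x) (\<Sum>i\<in>A. v i)"
  using assms by (induction A rule: infinite_finite_induct) (auto intro: regular_sum_zero regular_sum_add)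

lemma regular_sum_vanishes:
  assumes "regular_sum h v" "\<And>x. x \<in> X \<Longrightarrow> h x = 0"
  shows "v = 0"
proof -
  obtain js where js: "set js \<subseteq> J" "(\<Sum>\<^sub>\<infinity>x\<in>X. c x * difs js h x) = v"
    using assms(1) unfolding regular_sum_def by blast
  have "difs js h x = 0" if "x \<in> X" for x
  proof -
    have "difs js h x = difs js (\<lambda>x. 0 * 0) x" using assms(2) js(1) that by (intro difs_cong) auto
    also have "\<dots> = 0" unfolding difs_cmult by simp
    finally show ?thesis .
  qed
  hence "(\<Sum>\<^sub>\<infinity>x\<in>X. c x * difs js h x) = (\<Sum>\<^sub>\<infinity>x\<in>X. 0)" by (intro infsum_cong) simp
  thus ?thesis using js(2) by simp
qed

end

section \<open>Kronecker--Eisenstein sums of lattices in \<open>k\<^sup>N\<close>\<close>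

lemma ke_term_quotient:
  assumes "w \<noteq> 0"
  shows "cnj w ^ j / (w ^ (i + 1) * complex_of_real (cmod w) powr s) = ke_term (- int i - 1) (int j) s w"
proof -
  have "w powi (- int i - 1) = inverse (w ^ (i + 1))"
    by (metis minus_diff_commute of_nat_1 of_nat_add power_int_minus power_int_of_nat minus_diff_eq diff_minus_eq_add add.commute)
  thus ?thesis using assms
    by (simp add: ke_term_def powr_def exp_minus divide_inverse Ln_of_real mult_ac)
qed

context quadratic_order
begin

interpretation \<sigma>: field_hom \<sigma> by (rule hom)

lemma cm_lattice: "b \<noteq> 0 \<Longrightarrow> cm_lattice (\<sigma> \<omega>) b tr nm"
  using Im_\<omega> arg_cong[OF \<omega>_square, of \<sigma>] by unfold_locales (simp_all add: hom_distribs)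

lemma inj_\<sigma>: "inj \<sigma>"
  by (rule injI) simp

definition fractions :: "int \<Rightarrow> 'k set" where
  "fractions b = {x. algebraic_int (of_int b * x)}"

definition multiples :: "int \<Rightarrow> 'k set" where
  "multiples b = (\<lambda>x. of_int b * x) ` {x. algebraic_int x}"

lemma \<sigma>_fractions: "b \<noteq> 0 \<Longrightarrow> \<sigma> ` fractions b = cm_lattice.L (\<sigma> \<omega>) (1 / of_int b)"
proof -
  assume b: "b \<noteq> 0"
  interpret C: cm_lattice "\<sigma> \<omega>" "1 / of_int b" tr nm by (rule cm_lattice) (use b in simp)
  have "fractions b = {(of_int m + of_int n * \<omega>) / of_int b | m n. True}"
  proof (intro subset_antisym subsetI)
    fix x assume "x \<in> fractions b"
    then obtain m n where "of_int b * x = of_int m + of_int n * \<omega>" using int_iff by (auto simp: fractions_def)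
    hence "x = (of_int m + of_int n * \<omega>) / of_int b" using b by (simp add: field_simps)
    thus "x \<in> {(of_int m + of_int n * \<omega>) / of_int b | m n. True}" by auto
  next
    fix x assume "x \<in> {(of_int m + of_int n * \<omega>) / of_int b | m n. True}"
    then obtain m n where "x = (of_int m + of_int n * \<omega>) / of_int b" by blast
    hence "of_int b * x = of_int m + of_int n * \<omega>" using b by simp
    thus "x \<in> fractions b" unfolding fractions_def using int_iff by blast
  qed
  hence "\<sigma> ` fractions b = {\<sigma> ((of_int m + of_int n * \<omega>) / of_int b) | m n. True}" by auto
  moreover have "\<sigma> ((of_int m + of_int n * \<omega>) / of_int b) = 1 / of_int b * (of_int m + of_int n * \<sigma> \<omega>)" for m n
    by (simp add: hom_distribs add_divide_distrib)
  ultimately show "\<sigma> ` fractions b = C.L" unfolding C.L_eq by (simp only:)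
qed

lemma \<sigma>_multiples: "b \<noteq> 0 \<Longrightarrow> \<sigma> ` multiples b = cm_lattice.L (\<sigma> \<omega>) (of_int b)"
proof -
  assume b: "b \<noteq> 0"
  interpret C: cm_lattice "\<sigma> \<omega>" "of_int b" tr nm by (rule cm_lattice) (use b in simp)
  have "multiples b = {of_int b * (of_int m + of_int n * \<omega>) | m n. True}"
  proof (intro subset_antisym subsetI)
    fix x assume "x \<in> multiples b"
    then obtain y where "algebraic_int y" "x = of_int b * y" by (auto simp: multiples_def)
    moreover obtain m n where "y = of_int m + of_int n * \<omega>" using \<open>algebraic_int y\<close> int_iff by blast
    ultimately show "x \<in> {of_int b * (of_int m + of_int n * \<omega>) | m n. True}" by auto
  next
    fix x assume "x \<in> {of_int b * (of_int m + of_int n * \<omega>) | m n. True}"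
    then obtain m n where x: "x = of_int b * (of_int m + of_int n * \<omega>)" by blast
    have "algebraic_int (of_int m + of_int n * \<omega>)" using int_iff by blast
    thus "x \<in> multiples b" unfolding multiples_def x by (intro imageI) simp
  qed
  hence "\<sigma> ` multiples b = {\<sigma> (of_int b * (of_int m + of_int n * \<omega>)) | m n. True}" by auto
  moreover have "\<sigma> (of_int b * (of_int m + of_int n * \<omega>)) = of_int b * (of_int m + of_int n * \<sigma> \<omega>)" for m n
    by (simp add: hom_distribs)
  ultimately show "\<sigma> ` multiples b = C.L" unfolding C.L_eq by (simp only:)
qed

lemma multiples_residues:
  assumes b: "b > 0"
  shows "\<exists>B. finite B \<and> (\<forall>x\<in>fractions b. \<exists>!t. t \<in> B \<and> x - t \<in> multiples b)"
proof -
  define p where "p = (\<lambda>q. (of_int (fst q) + of_int (snd q) * \<omega>) / of_int b)"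
  \<comment> \<open>In coordinates scaled by \<open>b\<close>, the multiples of \<open>b\<close> are
    the points divisible by the square of \<open>b\<close>.\<close>
  define c where "c = b * b"
  have c: "c > 0" using b by (simp add: c_def)
  have pc: "p q \<in> multiples b \<longleftrightarrow> q \<in> hnf_lattice c 0 c" for q
  proof
    assume "p q \<in> multiples b"
    then obtain m n where "p q = of_int b * (of_int m + of_int n * \<omega>)" using int_iff by (auto simp: multiples_def)
    hence "of_int (fst q) + of_int (snd q) * \<omega> = of_int b * of_int b * (of_int m + of_int n * \<omega>)"
      using b by (simp add: p_def field_simps)
    also have "\<dots> = of_int (m * c) + of_int (n * c) * \<omega>" by (simp add: c_def algebra_simps)
    finally have "of_rat (of_int (fst q)) + of_rat (of_int (snd q)) * \<omega> =
        of_rat (of_int (m * c)) + of_rat (of_int (n * c)) * \<omega>" by (simp only: of_rat_of_int_eq)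
    hence "of_int (fst q) = (of_int (m * c) :: rat)" "of_int (snd q) = (of_int (n * c) :: rat)"
      using coords_unique by blast+
    hence "fst q = m * c" "snd q = n * c" by (simp_all only: of_int_eq_iff)
    thus "q \<in> hnf_lattice c 0 c" using hnf_latticeI[of "fst q" m c n 0 "snd q" c] by (cases q) simp
  next
    assume "q \<in> hnf_lattice c 0 c"
    then obtain m n where "q = (m * c, n * c)" by (auto simp: hnf_lattice_def)
    hence "p q = of_int b * (of_int m + of_int n * \<omega>)" using b by (simp add: p_def c_def field_simps)
    thus "p q \<in> multiples b" unfolding multiples_def using int_iff by blast
  qed
  have pd: "p q - p q' = p (fst q - fst q', snd q - snd q')" for q q'
    by (simp add: p_def diff_divide_distrib add_divide_distrib left_diff_distrib)
  show ?thesis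
  proof (intro exI[of _ "p ` ({0..<c} \<times> {0..<c})"] conjI ballI)
    fix x assume "x \<in> fractions b"
    then obtain m n where "of_int b * x = of_int m + of_int n * \<omega>" using int_iff by (auto simp: fractions_def)
    hence x: "x = p (m, n)" using b by (simp add: p_def field_simps)
    obtain q where q: "q \<in> {0..<c} \<times> {0..<c} \<and> (m - fst q, n - snd q) \<in> hnf_lattice c 0 c"
      and u: "\<forall>q'. q' \<in> {0..<c} \<times> {0..<c} \<and> (m - fst q', n - snd q') \<in> hnf_lattice c 0 c \<longrightarrow> q' = q"
      using hnf_residues[OF c c, of m n 0] unfolding Ex1_def by blast
    show "\<exists>!t. t \<in> p ` ({0..<c} \<times> {0..<c}) \<and> x - t \<in> multiples b"
    proof (rule ex1I[of _ "p q"])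
      show "p q \<in> p ` ({0..<c} \<times> {0..<c}) \<and> x - p q \<in> multiples b" using q by (simp add: x pd pc)
      fix t assume "t \<in> p ` ({0..<c} \<times> {0..<c}) \<and> x - t \<in> multiples b"
      then obtain q' where q': "q' \<in> {0..<c} \<times> {0..<c}" "t = p q'" "x - p q' \<in> multiples b" by blast
      hence "(m - fst q', n - snd q') \<in> hnf_lattice c 0 c" by (simp add: x pd pc)
      thus "t = p q" using u q' by blast
    qed
  qed auto
qed

text \<open>A module over the integers between \<open>b\<close> times and \<open>1 / b\<close> times
  the standard lattice. The single denominator lets sums over it be dominated by products of
  one-dimensional sums and be split into cosets of a product lattice.\<close>

definition full_lattice :: "nat \<Rightarrow> int \<Rightarrow> 'k vec set \<Rightarrow> bool" where
  "full_lattice N b \<Lambda> \<longleftrightarrow> b > 0 \<and> \<Lambda> \<subseteq> carrier_vec N \<and> (\<forall>x\<in>\<Lambda>. \<forall>y\<in>\<Lambda>. x + y \<in> \<Lambda>) \<and>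
     (\<forall>a. algebraic_int a \<longrightarrow> (\<forall>x\<in>\<Lambda>. a \<cdot>\<^sub>v x \<in> \<Lambda>)) \<and>
     (\<forall>x\<in>carrier_vec N. (\<forall>k<N. algebraic_int (x $ k)) \<longrightarrow> of_int b \<cdot>\<^sub>v x \<in> \<Lambda>) \<and>
     (\<forall>x\<in>\<Lambda>. \<forall>k<N. x $ k \<in> fractions b)"

lemma full_latticeD:
  assumes "full_lattice N b \<Lambda>"
  shows "b > 0" "x \<in> \<Lambda> \<Longrightarrow> x \<in> carrier_vec N" "x \<in> \<Lambda> \<Longrightarrow> y \<in> \<Lambda> \<Longrightarrow> x + y \<in> \<Lambda>"
    "algebraic_int a \<Longrightarrow> x \<in> \<Lambda> \<Longrightarrow> a \<cdot>\<^sub>v x \<in> \<Lambda>"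
    "x \<in> carrier_vec N \<Longrightarrow> (\<And>k. k < N \<Longrightarrow> algebraic_int (x $ k)) \<Longrightarrow> of_int b \<cdot>\<^sub>v x \<in> \<Lambda>"
    "x \<in> \<Lambda> \<Longrightarrow> k < N \<Longrightarrow> x $ k \<in> fractions b" "x \<in> \<Lambda> \<Longrightarrow> - x \<in> \<Lambda>" "x \<in> \<Lambda> \<Longrightarrow> y \<in> \<Lambda> \<Longrightarrow> x - y \<in> \<Lambda>"
proof -
  show "b > 0" using assms by (simp add: full_lattice_def)
  show 1: "x \<in> carrier_vec N" if "x \<in> \<Lambda>" for x using assms that by (auto simp: full_lattice_def)
  show 2: "x + y \<in> \<Lambda>" if "x \<in> \<Lambda>" "y \<in> \<Lambda>" for x y using assms that by (simp add: full_lattice_def)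
  show 3: "a \<cdot>\<^sub>v x \<in> \<Lambda>" if "algebraic_int a" "x \<in> \<Lambda>" for a x using assms that by (simp add: full_lattice_def)
  show "of_int b \<cdot>\<^sub>v x \<in> \<Lambda>" if "x \<in> carrier_vec N" "\<And>k. k < N \<Longrightarrow> algebraic_int (x $ k)"
    using assms that by (simp add: full_lattice_def)
  show "x $ k \<in> fractions b" if "x \<in> \<Lambda>" "k < N" using assms that by (simp add: full_lattice_def)
  show 4: "- x \<in> \<Lambda>" if "x \<in> \<Lambda>" for x
  proof -
    have "(- 1) \<cdot>\<^sub>v x \<in> \<Lambda>" using 3[OF _ that, of "- 1"] int_of_int[of "- 1"] by simp
    also have "(- 1) \<cdot>\<^sub>v x = - x" using 1[OF that] by (intro eq_vecI) auto
    finally show ?thesis .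
  qed
  show "x - y \<in> \<Lambda>" if "x \<in> \<Lambda>" "y \<in> \<Lambda>"
  proof -
    have "x - y = x + - y" using 1 that by (intro eq_vecI) auto
    thus ?thesis using 2[OF that(1) 4[OF that(2)]] by simp
  qed
qed

text \<open>Domination is inherited from the larger product lattice of fractions, where the bound is
  a product of one-dimensional bounds.\<close>

lemma loc_dominated_lattice:
  assumes \<Lambda>: "\<Lambda> \<subseteq> carrier_vec N" "\<And>x k. x \<in> \<Lambda> \<Longrightarrow> k < N \<Longrightarrow> x $ k \<in> fractions b"
    and S: "open S" and F: "\<And>k. k < N \<Longrightarrow> loc_dominated (fractions b) S (F k)"
  shows "loc_dominated \<Lambda> S (\<lambda>x s. \<Prod>k<N. F k (x $ k) s)"
proof -
  have "loc_dominated ({..<N} \<rightarrow>\<^sub>E fractions b) S (\<lambda>g s. \<Prod>k\<in>{..<N}. F k (g k) s)"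
    using F by (intro loc_dominated_prod_PiE S) auto
  hence "loc_dominated \<Lambda> S (\<lambda>x s. \<Prod>k\<in>{..<N}. F k ((\<lambda>k\<in>{..<N}. x $ k) k) s)"
  proof (rule loc_dominated_reindex)
    show "inj_on (\<lambda>x. \<lambda>k\<in>{..<N}. x $ k) \<Lambda>"
    proof (rule inj_onI)
      fix x y assume xy: "x \<in> \<Lambda>" "y \<in> \<Lambda>" and e: "(\<lambda>k\<in>{..<N}. x $ k) = (\<lambda>k\<in>{..<N}. y $ k)"
      have "x $ k = y $ k" if "k < N" for k using fun_cong[OF e, of k] that by simp
      moreover have "x \<in> carrier_vec N" "y \<in> carrier_vec N" using xy \<Lambda>(1) by blast+
      ultimately show "x = y" by (intro eq_vecI) auto
    qed
    show "(\<lambda>x. \<lambda>k\<in>{..<N}. x $ k) ` \<Lambda> \<subseteq> {..<N} \<rightarrow>\<^sub>E fractions b"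
      using \<Lambda>(2) by (intro image_subsetI restrict_PiE_iff[THEN iffD2] ballI) auto
  qed
  thus ?thesis by simp
qed

lemma loc_dominated_fractions:
  assumes b: "b \<noteq> 0" and F: "loc_dominated (cm_lattice.L (\<sigma> \<omega>) (1 / of_int b)) S F"
  shows "loc_dominated (fractions b) S (\<lambda>x. F (\<sigma> x))"
  using F by (rule loc_dominated_reindex) (use \<sigma>_fractions[OF b] inj_on_subset[OF inj_\<sigma>] in auto)

lemma loc_dominated_fractions_ke_term:
  assumes b: "b \<noteq> 0"
  shows "loc_dominated (fractions b) {s. Re s > 2 + of_int (i + j)} (\<lambda>x s. ke_term i j s (z + \<sigma> x))"
proof -
  interpret C: cm_lattice "\<sigma> \<omega>" "1 / of_int b" tr nm by (rule cm_lattice) (use b in simp)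
  show ?thesis by (rule loc_dominated_fractions[OF b C.loc_dominated_ke_term])
qed

definition ke_product ::
  "nat \<Rightarrow> (nat \<Rightarrow> nat) \<Rightarrow> (nat \<Rightarrow> nat) \<Rightarrow> complex vec \<Rightarrow> 'k vec \<Rightarrow> complex \<Rightarrow> complex" where
  "ke_product N I J z x s = (\<Prod>k<N. fact (I k) * ke_term (- int (I k) - 1) (int (J k)) s (z $ k + \<sigma> (x $ k)))"

definition KE_abscissa :: "nat \<Rightarrow> (nat \<Rightarrow> nat) \<Rightarrow> (nat \<Rightarrow> nat) \<Rightarrow> real" where
  "KE_abscissa N I J = Max ((\<lambda>k. 1 + (real (J k) - real (I k))) ` {..<N})"

lemma KE_abscissa_ge: "k < N \<Longrightarrow> 1 + (real (J k) - real (I k)) \<le> KE_abscissa N I J"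
  by (simp add: KE_abscissa_def)

lemma KE_halfplane_eq: "N > 0 \<Longrightarrow> KE_halfplane N I J = {s. Re s > KE_abscissa N I J}"
proof -
  assume "N > 0"
  have "Max ((\<lambda>k. 1 + (real (J k) - real (I k))) ` {..<N}) < x \<longleftrightarrow>
      (\<forall>a\<in>(\<lambda>k. 1 + (real (J k) - real (I k))) ` {..<N}. a < x)" for x
    by (rule Max_less_iff) (use \<open>N > 0\<close> in blast)+
  also have "\<dots> x \<longleftrightarrow> (\<forall>k<N. 1 + (real (J k) - real (I k)) < x)" for x by blast
  finally show ?thesis unfolding KE_halfplane_def KE_abscissa_def by blast
qed

lemma loc_dominated_ke_product:
  assumes \<Lambda>: "full_lattice N b \<Lambda>"
  shows "loc_dominated \<Lambda> {s. Re s > KE_abscissa N I J} (ke_product N I J z)"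
proof -
  have b: "b \<noteq> 0" using full_latticeD(1)[OF \<Lambda>] by simp
  have "loc_dominated \<Lambda> {s. Re s > KE_abscissa N I J} (\<lambda>x s. \<Prod>k<N. (\<lambda>x s. fact (I k) *
      ke_term (- int (I k) - 1) (int (J k)) s (z $ k + \<sigma> x)) (x $ k) s)"
  proof (rule loc_dominated_lattice)
    fix k assume k: "k < N"
    have "loc_dominated (fractions b) {s. Re s > KE_abscissa N I J}
        (\<lambda>x s. ke_term (- int (I k) - 1) (int (J k)) s (z $ k + \<sigma> x))"
      using KE_abscissa_ge[OF k, of J I]
      by (intro loc_dominated_mono[OF loc_dominated_fractions_ke_term[OF b]] open_Re_gt) auto
    thus "loc_dominated (fractions b) {s. Re s > KE_abscissa N I J} (\<lambda>x s. fact (I k) *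
      ke_term (- int (I k) - 1) (int (J k)) s (z $ k + \<sigma> x))"
      by (rule loc_dominated_cmult) simp
  qed (use full_latticeD[OF \<Lambda>] open_Re_gt in auto)
  thus ?thesis by (simp add: ke_product_def[abs_def])
qed

lemma hyperplane_compl_nonzero:
  assumes \<Lambda>: "full_lattice N b \<Lambda>" and z: "z \<in> hyperplane_compl N \<sigma> \<Lambda>" and x: "x \<in> \<Lambda>" and k: "k < N"
  shows "z $ k + \<sigma> (x $ k) \<noteq> 0"
proof
  assume "z $ k + \<sigma> (x $ k) = 0"
  hence "z $ k = - \<sigma> (x $ k)" by (simp add: eq_neg_iff_add_eq_0)
  hence "z $ k = map_vec \<sigma> (- x) $ k" using full_latticeD(2)[OF \<Lambda> x] k by (simp add: hom_distribs)
  moreover have "map_vec \<sigma> (- x) \<in> map_vec \<sigma> ` \<Lambda>" using full_latticeD(7)[OF \<Lambda> x] by blast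
  ultimately show False using z k unfolding hyperplane_compl_def by blast
qed

lemma inj_map_vec_\<sigma>: "inj_on (map_vec \<sigma>) X"
proof (rule inj_onI)
  fix x y assume e: "map_vec \<sigma> x = map_vec \<sigma> y"
  have d: "dim_vec x = dim_vec y" using arg_cong[OF e, of dim_vec] by simp
  show "x = y"
  proof (rule eq_vecI)
    fix i assume "i < dim_vec y"
    thus "x $ i = y $ i" using arg_cong[OF e, of "\<lambda>v. v $ i"] d by simp
  qed (rule d)
qed

lemma KE_series_eq:
  assumes \<Lambda>: "full_lattice N b \<Lambda>" and z: "z \<in> hyperplane_compl N \<sigma> \<Lambda>"
  shows "KE_series N \<sigma> I J z \<Lambda> s = (\<Sum>\<^sub>\<infinity>x\<in>\<Lambda>. ke_product N I J z x s)"
proof -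
  have "KE_series N \<sigma> I J z \<Lambda> s = (\<Sum>\<^sub>\<infinity>x\<in>\<Lambda>. \<Prod>k<N. fact (I k) *
    (cnj (z $ k + map_vec \<sigma> x $ k) ^ J k /
         ((z $ k + map_vec \<sigma> x $ k) ^ (I k + 1) * complex_of_real (cmod (z $ k + map_vec \<sigma> x $ k)) powr s)))"
    unfolding KE_series_def by (subst infsum_reindex[OF inj_map_vec_\<sigma>]) (simp add: o_def)
  also have "\<dots> = (\<Sum>\<^sub>\<infinity>x\<in>\<Lambda>. ke_product N I J z x s)"
    unfolding ke_product_def
  proof (intro infsum_cong prod.cong refl)
    fix x k assume x: "x \<in> \<Lambda>" and k: "k \<in> {..<N}"
    have e: "map_vec \<sigma> x $ k = \<sigma> (x $ k)" using full_latticeD(2)[OF \<Lambda> x] k by simp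
    have nz: "z $ k + \<sigma> (x $ k) \<noteq> 0" using hyperplane_compl_nonzero[OF \<Lambda> z x] k by simp
    show "fact (I k) * (cnj (z $ k + map_vec \<sigma> x $ k) ^ J k /
         ((z $ k + map_vec \<sigma> x $ k) ^ (I k + 1) * complex_of_real (cmod (z $ k + map_vec \<sigma> x $ k)) powr s)) =
      fact (I k) * ke_term (- int (I k) - 1) (int (J k)) s (z $ k + \<sigma> (x $ k))"
      unfolding e ke_term_quotient[OF nz] ..
  qed
  finally show ?thesis .
qed

text \<open>On each of the finitely many cosets of \<open>b\<close> times the standard lattice, a
  sum of products of functions of single coordinates factors.\<close>

lemma lattice_residues:
  assumes \<Lambda>: "full_lattice N b \<Lambda>"
  obtains R where "finite R" "R \<subseteq> \<Lambda>"
    "bij_betw (\<lambda>(r, g). r + vec N g) (R \<times> ({..<N} \<rightarrow>\<^sub>E multiples b)) \<Lambda>"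
proof -
  note D = full_latticeD[OF \<Lambda>]
  obtain B where B: "finite B" and ex1: "\<forall>x\<in>fractions b. \<exists>!t. t \<in> B \<and> x - t \<in> multiples b"
    using multiples_residues[OF D(1)] by blast
  define R where "R = {x \<in> \<Lambda>. \<forall>k<N. x $ k \<in> B}"
  have multiples_in: "vec N g \<in> \<Lambda>" if g: "\<And>k. k < N \<Longrightarrow> g k \<in> multiples b" for g
  proof -
    define y where "y k = g k / of_int b" for k
    have y: "algebraic_int (y k)" "g k = of_int b * y k" if "k < N" for k
      using g[OF that] D(1) by (auto simp: multiples_def y_def)
    have "of_int b \<cdot>\<^sub>v vec N y \<in> \<Lambda>" using y(1) by (intro D(5)) auto
    also have "of_int b \<cdot>\<^sub>v vec N y = vec N g" using y(2) by (intro eq_vecI) auto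
    finally show ?thesis .
  qed
  have "R \<subseteq> (\<lambda>g. vec N g) ` ({..<N} \<rightarrow>\<^sub>E B)"
  proof
    fix x assume x: "x \<in> R"
    have "x = vec N (\<lambda>k\<in>{..<N}. x $ k)" using x D(2)[of x] by (intro eq_vecI) (auto simp: R_def)
    moreover have "(\<lambda>k\<in>{..<N}. x $ k) \<in> {..<N} \<rightarrow>\<^sub>E B" using x by (auto simp: R_def)
    ultimately show "x \<in> (\<lambda>g. vec N g) ` ({..<N} \<rightarrow>\<^sub>E B)" by blast
  qed
  moreover have "finite ((\<lambda>g. vec N g) ` ({..<N} \<rightarrow>\<^sub>E B))" using B by (intro finite_imageI finite_PiE) auto
  ultimately have fin: "finite R" by (rule finite_subset)
  have "bij_betw (\<lambda>(r, g). r + vec N g) (R \<times> ({..<N} \<rightarrow>\<^sub>E multiples b)) \<Lambda>"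
    unfolding bij_betw_def
  proof (intro conjI inj_onI subset_antisym subsetI)
    fix p q assume p: "p \<in> R \<times> ({..<N} \<rightarrow>\<^sub>E multiples b)" and q: "q \<in> R \<times> ({..<N} \<rightarrow>\<^sub>E multiples b)"
      and e: "(case p of (r, g) \<Rightarrow> r + vec N g) = (case q of (r, g) \<Rightarrow> r + vec N g)"
    obtain r g where rg: "p = (r, g)" "r \<in> R" "g \<in> {..<N} \<rightarrow>\<^sub>E multiples b" using p by auto
    obtain r' g' where rg': "q = (r', g')" "r' \<in> R" "g' \<in> {..<N} \<rightarrow>\<^sub>E multiples b" using q by auto
    have dims: "r \<in> carrier_vec N" "r' \<in> carrier_vec N" using rg rg' D(2) by (auto simp: R_def)
    have L: "r + vec N g \<in> \<Lambda>" using rg by (intro D(3) multiples_in) (auto simp: R_def)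
    have eq: "r $ k = r' $ k \<and> g k = g' k" if k: "k < N" for k
    proof -
      define x where "x = (r + vec N g) $ k"
      have x: "x = r $ k + g k" using dims k by (simp add: x_def)
      have "r + vec N g = r' + vec N g'" using e by (simp add: rg(1) rg'(1))
      hence x': "x = r' $ k + g' k" using dims k by (simp add: x_def)
      have "x \<in> fractions b" using D(6)[OF L k] by (simp add: x_def)
      then obtain u where u: "\<forall>t. t \<in> B \<and> x - t \<in> multiples b \<longrightarrow> t = u"
        using ex1 unfolding Ex1_def by blast
      have "x - r $ k = g k" unfolding x by simp
      moreover have "x - r' $ k = g' k" unfolding x' by simp
      moreover have "g k \<in> multiples b" "g' k \<in> multiples b" using PiE_mem[OF rg(3), of k] PiE_mem[OF rg'(3), of k] k by simp_all
      moreover have "r $ k \<in> B" "r' $ k \<in> B" using rg(2) rg'(2) k by (simp_all add: R_def)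
      ultimately have "r $ k = u" "r' $ k = u" using u by simp_all
      hence "r $ k = r' $ k" by simp
      thus ?thesis using x x' by simp
    qed
    have "r = r'" using eq dims by (intro eq_vecI) auto
    moreover have "g = g'" using eq rg(3) rg'(3) by (intro PiE_ext[of g]) auto
    ultimately show "p = q" by (simp add: rg(1) rg'(1))
  next
    fix x assume "x \<in> (\<lambda>(r, g). r + vec N g) ` (R \<times> ({..<N} \<rightarrow>\<^sub>E multiples b))"
    then obtain r g where "x = r + vec N g" "r \<in> R" "g \<in> {..<N} \<rightarrow>\<^sub>E multiples b" by auto
    thus "x \<in> \<Lambda>" by (auto simp: R_def intro!: D(3) multiples_in)
  next
    fix x assume x: "x \<in> \<Lambda>"
    have "\<forall>k. \<exists>t. k < N \<longrightarrow> t \<in> B \<and> x $ k - t \<in> multiples b" using ex1 D(6)[OF x] by blast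
    then obtain t where t: "\<And>k. k < N \<Longrightarrow> t k \<in> B" "\<And>k. k < N \<Longrightarrow> x $ k - t k \<in> multiples b" by metis
    define g where "g = (\<lambda>k\<in>{..<N}. x $ k - t k)"
    have g: "g \<in> {..<N} \<rightarrow>\<^sub>E multiples b" using t by (auto simp: g_def)
    have "vec N g \<in> \<Lambda>" using g by (intro multiples_in) auto
    hence "x - vec N g \<in> \<Lambda>" using x D(8) by blast
    also have "x - vec N g = vec N t" using D(2)[OF x] by (intro eq_vecI) (auto simp: g_def)
    finally have "vec N t \<in> R" using t by (auto simp: R_def)
    moreover have "x = vec N t + vec N g" using D(2)[OF x] by (intro eq_vecI) (auto simp: g_def)
    ultimately show "x \<in> (\<lambda>(r, g). r + vec N g) ` (R \<times> ({..<N} \<rightarrow>\<^sub>E multiples b))"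
      using g by (intro image_eqI[of _ _ "(vec N t, g)"]) auto
  qed
  thus ?thesis using that fin by (auto simp: R_def)
qed

lemma infsum_multiples:
  assumes b: "b \<noteq> 0"
  shows "(\<Sum>\<^sub>\<infinity>x\<in>multiples b. ke_term i j s (z + \<sigma> x)) = cm_lattice.KE1 (\<sigma> \<omega>) (of_int b) z i j s"
proof -
  interpret C: cm_lattice "\<sigma> \<omega>" "of_int b" tr nm by (rule cm_lattice) (use b in simp)
  have "(\<Sum>\<^sub>\<infinity>l\<in>\<sigma> ` multiples b. ke_term i j s (z + l)) = (\<Sum>\<^sub>\<infinity>x\<in>multiples b. ke_term i j s (z + \<sigma> x))"
    by (subst infsum_reindex[OF inj_on_subset[OF inj_\<sigma>]]) (auto simp: o_def)
  thus ?thesis by (simp add: C.KE1_def \<sigma>_multiples[OF b])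
qed

lemma multiples_shift:
  assumes "r \<in> fractions b" "x \<in> multiples b"
  shows "r + x \<in> fractions b"
proof -
  obtain y where "algebraic_int y" "x = of_int b * y" using assms(2) by (auto simp: multiples_def)
  hence "algebraic_int (of_int b * x)" using int_mult[OF int_of_int int_mult[OF int_of_int]] by simp
  hence "algebraic_int (of_int b * r + of_int b * x)"
    using assms(1) int_add by (simp add: fractions_def)
  thus ?thesis by (simp add: fractions_def distrib_left)
qed

text \<open>Split into cosets, the series is a finite sum of products of one-dimensional series
  \<open>KE1\<close>, whose continuation is known. Absolute convergence to the right of
  \<open>KE_abscissa\<close> justifies the rearrangement and the factorisation.\<close>

lemma qcont_ke_product_sum:
  assumes \<Lambda>: "full_lattice N b \<Lambda>" and A: "A \<le> KE_abscissa N I J"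
  shows "qcont A (KE_abscissa N I J) (\<lambda>s. \<Sum>\<^sub>\<infinity>x\<in>\<Lambda>. ke_product N I J z x s)"
proof -
  let ?B = "KE_abscissa N I J"
  have b: "b \<noteq> 0" using full_latticeD(1)[OF \<Lambda>] by simp
  interpret C: cm_lattice "\<sigma> \<omega>" "of_int b" tr nm by (rule cm_lattice) (use b in simp)
  obtain R where R: "finite R" "R \<subseteq> \<Lambda>"
    and bij: "bij_betw (\<lambda>(r, g). r + vec N g) (R \<times> ({..<N} \<rightarrow>\<^sub>E multiples b)) \<Lambda>"
    using lattice_residues[OF \<Lambda>] by metis
  define t where "t k = (\<lambda>x s. fact (I k) * ke_term (- int (I k) - 1) (int (J k)) s (z $ k + \<sigma> x))" for k
  have eq: "(\<Sum>\<^sub>\<infinity>x\<in>\<Lambda>. ke_product N I J z x s) =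
     (\<Sum>r\<in>R. \<Prod>k<N. fact (I k) * C.KE1 (z $ k + \<sigma> (r $ k)) (- int (I k) - 1) (int (J k)) s)"
    if s: "Re s > ?B" for s
  proof -
    have prod: "ke_product N I J z (r + vec N g) s = (\<Prod>k<N. t k (r $ k + g k) s)" if "r \<in> R" for r g
      using R(2) that full_latticeD(2)[OF \<Lambda>, of r] by (auto simp: ke_product_def t_def intro!: prod.cong)
    have "(\<lambda>x. ke_product N I J z x s) summable_on \<Lambda>"
      using loc_dominated_summable[OF loc_dominated_ke_product[OF \<Lambda>], of s] s by simp
    hence sm: "(\<lambda>p. ke_product N I J z (case p of (r, g) \<Rightarrow> r + vec N g) s) summable_on (R \<times> ({..<N} \<rightarrow>\<^sub>E multiples b))"
      using summable_on_reindex_bij_betw[OF bij, of "\<lambda>x. ke_product N I J z x s"] by simp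
    have "(\<Sum>\<^sub>\<infinity>x\<in>\<Lambda>. ke_product N I J z x s) = (\<Sum>\<^sub>\<infinity>p\<in>R \<times> ({..<N} \<rightarrow>\<^sub>E multiples b).
        ke_product N I J z (case p of (r, g) \<Rightarrow> r + vec N g) s)"
      by (rule infsum_reindex_bij_betw[OF bij, symmetric])
    also have "\<dots> = (\<Sum>\<^sub>\<infinity>r\<in>R. \<Sum>\<^sub>\<infinity>g\<in>{..<N} \<rightarrow>\<^sub>E multiples b. ke_product N I J z (r + vec N g) s)"
      using infsum_Sigma_banach[OF sm] by simp
    also have "\<dots> = (\<Sum>r\<in>R. \<Sum>\<^sub>\<infinity>g\<in>{..<N} \<rightarrow>\<^sub>E multiples b. \<Prod>k<N. t k (r $ k + g k) s)"
      using R(1) by (simp add: prod)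
    also have "\<dots> = (\<Sum>r\<in>R. \<Prod>k<N. \<Sum>\<^sub>\<infinity>x\<in>multiples b. t k (r $ k + x) s)"
    proof (intro sum.cong refl infsum_prod_PiE_abs)
      fix r k assume r: "r \<in> R" and k: "k \<in> {..<N}"
      have "loc_dominated (fractions b) {s. Re s > ?B} (t k)"
        unfolding t_def using KE_abscissa_ge[of k N J I] k
        by (intro loc_dominated_cmult loc_dominated_mono[OF loc_dominated_fractions_ke_term[OF b]] open_Re_gt) auto
      hence "loc_dominated (multiples b) {s. Re s > ?B} (\<lambda>x. t k (r $ k + x))"
      proof (rule loc_dominated_reindex)
        show "inj_on (\<lambda>x. r $ k + x) (multiples b)" by (rule inj_onI) simp
        have "r $ k \<in> fractions b" using full_latticeD(6)[OF \<Lambda>, of r k] r R(2) k by blast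
        thus "(\<lambda>x. r $ k + x) ` multiples b \<subseteq> fractions b" using multiples_shift by blast
      qed
      from loc_dominated_summable[OF this, of s]
      show "(\<lambda>x. norm (t k (r $ k + x) s)) summable_on multiples b"
        using s by (subst summable_on_iff_abs_summable_on_complex[symmetric]) simp
    qed simp
    also have "\<dots> = (\<Sum>r\<in>R. \<Prod>k<N. fact (I k) * C.KE1 (z $ k + \<sigma> (r $ k)) (- int (I k) - 1) (int (J k)) s)"
    proof (intro sum.cong prod.cong refl)
      fix r k
      have "(\<Sum>\<^sub>\<infinity>x\<in>multiples b. t k (r $ k + x) s) = fact (I k) *
        (\<Sum>\<^sub>\<infinity>x\<in>multiples b. ke_term (- int (I k) - 1) (int (J k)) s (z $ k + \<sigma> (r $ k) + \<sigma> x))"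
        unfolding t_def by (subst infsum_cmult_right') (simp add: hom_distribs add.assoc)
      thus "(\<Sum>\<^sub>\<infinity>x\<in>multiples b. t k (r $ k + x) s) =
        fact (I k) * C.KE1 (z $ k + \<sigma> (r $ k)) (- int (I k) - 1) (int (J k)) s"
        by (simp add: infsum_multiples[OF b])
    qed
    finally show ?thesis .
  qed
  have "qcont A ?B (\<lambda>s. \<Sum>r\<in>R. \<Prod>k<N. fact (I k) * C.KE1 (z $ k + \<sigma> (r $ k)) (- int (I k) - 1) (int (J k)) s)"
  proof (rule qcont_sum, rule qcont_prod, rule qcont_cmult)
    fix r k assume k: "k \<in> {..<N}"
    let ?B' = "1 + (real (J k) - real (I k))"
    \<comment> \<open>\<open>?B'\<close> is \<open>2 + (a + b)\<close> for
      \<open>a = - I k - 1\<close> and \<open>b = J k\<close>. This abscissa of the single factor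
      may lie left of \<open>A\<close>, whence the \<open>min\<close>.\<close>
    have "qcont (min A ?B') ?B' (C.KE1 (z $ k + \<sigma> (r $ k)) (- int (I k) - 1) (int (J k)))"
      using C.qcont_KE1[of "- int (I k) - 1" "int (J k)" "min A ?B'" "z $ k + \<sigma> (r $ k)"]
      by (simp add: C.regular_exponents_def algebra_simps)
    thus "qcont A ?B (C.KE1 (z $ k + \<sigma> (r $ k)) (- int (I k) - 1) (int (J k)))"
      using KE_abscissa_ge[of k N J I] k by (rule_tac qcont_mono) auto
  qed (use A in auto)
  thus ?thesis by (rule qcont_cong) (simp add: eq)
qed

lemma ke_product_sum_holomorphic:
  assumes \<Lambda>: "full_lattice N b \<Lambda>"
  shows "(\<lambda>s. \<Sum>\<^sub>\<infinity>x\<in>\<Lambda>. ke_product N I J z x s) holomorphic_on {s. Re s > KE_abscissa N I J}"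
  by (rule loc_dominated_infsum_holomorphic[OF loc_dominated_ke_product[OF \<Lambda>]])

lemma KE_eq_cont_value:
  assumes "N > 0" and \<Lambda>: "full_lattice N b \<Lambda>" and z: "z \<in> hyperplane_compl N \<sigma> \<Lambda>"
  shows "KE N \<sigma> I J z \<Lambda> = cont_value {s. Re s > KE_abscissa N I J} (\<lambda>s. \<Sum>\<^sub>\<infinity>x\<in>\<Lambda>. ke_product N I J z x s)"
  unfolding KE_def cont_value_def KE_halfplane_eq[OF assms(1)] KE_series_eq[OF \<Lambda> z] ..

text \<open>Frees later arguments from the description operator in \<open>KE\<close>: any quotient
  that continues the series past 0 computes the value.\<close>

lemma KE_value:
  assumes "N > 0" and \<Lambda>: "full_lattice N b \<Lambda>" and z: "z \<in> hyperplane_compl N \<sigma> \<Lambda>"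
    and D: "D holomorphic_on UNIV" "D 0 \<noteq> 0" "h holomorphic_on {s. Re s > A}" "A < 0"
      "\<And>s. Re s > KE_abscissa N I J \<Longrightarrow> D s * (\<Sum>\<^sub>\<infinity>x\<in>\<Lambda>. ke_product N I J z x s) = h s"
  shows "D 0 * KE N \<sigma> I J z \<Lambda> = h 0"
  unfolding KE_eq_cont_value[OF assms(1-3)]
  by (rule cont_value_eq[OF ke_product_sum_holomorphic[OF \<Lambda>] qcont_ke_product_sum[OF \<Lambda>] D])

lemma KE_continuation:
  assumes "N > 0" and \<Lambda>: "full_lattice N b \<Lambda>" and z: "z \<in> hyperplane_compl N \<sigma> \<Lambda>" and A: "A < 0"
  obtains D h where "D holomorphic_on UNIV" "D 0 \<noteq> 0" "h holomorphic_on {s. Re s > A}"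
    "\<forall>s. Re s > KE_abscissa N I J \<longrightarrow> D s * (\<Sum>\<^sub>\<infinity>x\<in>\<Lambda>. ke_product N I J z x s) = h s"
    "D 0 * KE N \<sigma> I J z \<Lambda> = h 0"
proof -
  define A' where "A' = min A (KE_abscissa N I J)"
  obtain D h where D: "D holomorphic_on UNIV" "D 0 \<noteq> 0" "h holomorphic_on {s. Re s > A'}"
    "\<forall>s. Re s > KE_abscissa N I J \<longrightarrow> D s * (\<Sum>\<^sub>\<infinity>x\<in>\<Lambda>. ke_product N I J z x s) = h s"
    using qcont_ke_product_sum[OF \<Lambda>, of A' I J z] unfolding qcont_def A'_def by auto
  have "A' < 0" using A by (simp add: A'_def min_less_iff_disj)
  hence "D 0 * KE N \<sigma> I J z \<Lambda> = h 0" using KE_value[OF assms(1-3) D(1-3)] D(4) by blast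
  moreover have "h holomorphic_on {s. Re s > A}"
    by (rule holomorphic_on_subset[OF D(3)]) (auto simp: A'_def)
  ultimately show ?thesis using that D(1,2,4) by blast
qed

end

section \<open>Dedekind sums as regularised sums\<close>

lemma loc_dominated_weight:
  assumes F: "loc_dominated X S F" and c: "\<And>x. x \<in> X \<Longrightarrow> cmod (c x) \<le> K"
  shows "loc_dominated X S (\<lambda>x s. c x * F x s)"
proof (rule loc_dominatedI)
  show "(\<lambda>s. c x * F x s) holomorphic_on S" if "x \<in> X" for x
    using loc_dominated_holomorphic[OF F that] by (intro holomorphic_intros)
  fix s assume s: "s \<in> S"
  obtain r B where r: "r > 0" "cball s r \<subseteq> S" and B: "B summable_on X"
      "\<forall>x\<in>X. \<forall>t\<in>cball s r. cmod (F x t) \<le> B x"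
    using loc_dominatedD[OF F s] by blast
  have "(\<lambda>x. K * B x) summable_on X" using B(1) by (intro summable_on_cmult_right)
  moreover have "cmod (c x * F x t) \<le> K * B x" if x: "x \<in> X" and t: "t \<in> cball s r" for x t
    unfolding norm_mult using c[OF x] bspec[OF bspec[OF B(2) x] t] order_trans[OF norm_ge_zero c[OF x]]
    by (intro mult_mono) auto
  ultimately show "\<exists>r>0. cball s r \<subseteq> S \<and>
        (\<exists>B. B summable_on X \<and> (\<forall>x\<in>X. \<forall>t\<in>cball s r. cmod (c x * F x t) \<le> B x))"
    using r by (intro exI[of _ r] conjI exI[of _ "\<lambda>x. K * B x"]) auto
qed

lemma GammaD:
  assumes "\<gamma> \<in> Gamma N \<Lambda>"
  shows "\<gamma> \<in> carrier_mat N N" "det \<gamma> = 1" "x \<in> \<Lambda> \<Longrightarrow> \<gamma> *\<^sub>v x \<in> \<Lambda>"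
    "x \<in> \<Lambda> \<Longrightarrow> \<exists>y\<in>\<Lambda>. x = \<gamma> *\<^sub>v y"
proof -
  have 1: "\<gamma> \<in> SL N" and 2: "mat_image \<gamma> \<Lambda> = \<Lambda>" using assms by (simp_all add: Gamma_def)
  show "\<gamma> \<in> carrier_mat N N" "det \<gamma> = 1" using 1 by (simp_all add: SL_def)
  show "\<gamma> *\<^sub>v x \<in> \<Lambda>" if "x \<in> \<Lambda>" using 2 that by blast
  show "\<exists>y\<in>\<Lambda>. x = \<gamma> *\<^sub>v y" if "x \<in> \<Lambda>" using 2 that by blast
qed

lemma mat_mult_inj:
  fixes A :: "'a :: field mat"
  assumes "A \<in> carrier_mat N N" "det A \<noteq> 0" "x \<in> carrier_vec N" "y \<in> carrier_vec N"
    "A *\<^sub>v x = A *\<^sub>v y"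
  shows "x = y"
proof -
  have "x = mat_inv A *\<^sub>v (A *\<^sub>v x)" by (rule mat_inv_mult_vec(1)[OF assms(1,2,3), symmetric])
  also have "\<dots> = y" unfolding assms(5) by (rule mat_inv_mult_vec(1)[OF assms(1,2,4)])
  finally show ?thesis .
qed

context quadratic_order
begin

interpretation \<sigma>: field_hom \<sigma> by (rule hom)

lemma std_lattice_full:
  fixes J :: "'k set"
  assumes J: "ideal J int_ring" "J \<noteq> {0}" and N: "N > 0"
  obtains b where "full_lattice N b (std_lattice N J)"
proof -
  obtain e where e: "e > 0" "\<forall>x\<in>inverse_ideal J. algebraic_int (of_int e * x)"
    by (rule inverse_ideal_bounded[OF J])
  have "full_lattice N e (std_lattice N J)"
    unfolding full_lattice_def
  proof (intro conjI ballI allI impI)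
    fix x y assume x: "x \<in> std_lattice N J" and y: "y \<in> std_lattice N J"
    have d: "x \<in> carrier_vec N" "y \<in> carrier_vec N" using x y by (simp_all add: std_lattice_def)
    have "(x + y) $ 0 \<in> inverse_ideal J"
      using inverse_idealD(1)[of "x $ 0" J "y $ 0"] x y d N by (simp add: std_lattice_def)
    moreover have "algebraic_int ((x + y) $ k)" if "k \<in> {1..<N}" for k
      using int_add[of "x $ k" "y $ k"] x y d that by (simp add: std_lattice_def)
    ultimately show "x + y \<in> std_lattice N J" using d by (simp add: std_lattice_def)
  next
    fix a x assume a: "algebraic_int (a :: 'k)" and x: "x \<in> std_lattice N J"
    have d: "x \<in> carrier_vec N" using x by (simp add: std_lattice_def)
    have "(a \<cdot>\<^sub>v x) $ 0 \<in> inverse_ideal J"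
      using inverse_idealD(3)[OF _ a, of "x $ 0" J] x d N by (simp add: std_lattice_def)
    moreover have "algebraic_int ((a \<cdot>\<^sub>v x) $ k)" if "k \<in> {1..<N}" for k
      using int_mult[OF a, of "x $ k"] x d that by (simp add: std_lattice_def)
    ultimately show "a \<cdot>\<^sub>v x \<in> std_lattice N J" using d by (simp add: std_lattice_def)
  next
    fix x :: "'k vec" assume x: "x \<in> carrier_vec N" "\<forall>k<N. algebraic_int (x $ k)"
    have k: "algebraic_int ((of_int e \<cdot>\<^sub>v x) $ k)" if "k < N" for k
      using int_mult[OF int_of_int[of e], of "x $ k"] x that by simp
    thus "of_int e \<cdot>\<^sub>v x \<in> std_lattice N J"
      using x(1) int_subset_inverse_ideal[OF J(1) k[OF N]] by (simp add: std_lattice_def)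
  next
    fix x k assume x: "x \<in> std_lattice N J" and k: "k < N"
    show "x $ k \<in> fractions e"
    proof (cases "k = 0")
      case True
      thus ?thesis using x e(2) by (simp add: std_lattice_def fractions_def)
    next
      case False
      hence "algebraic_int (x $ k)" using x k by (simp add: std_lattice_def)
      from int_mult[OF int_of_int[of e] this] show ?thesis by (simp add: fractions_def)
    qed
  qed (use e(1) in \<open>auto simp: std_lattice_def\<close>)
  thus ?thesis by (rule that)
qed

lemma finite_common_denominator:
  assumes "finite (X :: 'k set)"
  shows "\<exists>c>0. \<forall>x\<in>X. algebraic_int (of_int c * x)"
  using assms
proof (induction rule: finite_induct)
  case (insert x X)
  then obtain c where c: "c > 0" "\<forall>x\<in>X. algebraic_int (of_int c * x)" by blast
  obtain d where d: "d > 0" "algebraic_int (of_int d * x)" using common_denominator[of x] by blast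
  have "algebraic_int (of_int (c * d) * y)" if "y \<in> insert x X" for y
  proof (cases "y = x")
    case True
    thus ?thesis using int_mult[OF int_of_int[of c] d(2)] by (simp add: mult_ac)
  next
    case False
    hence "algebraic_int (of_int c * y)" using that c(2) by blast
    from int_mult[OF int_of_int[of d] this] show ?thesis by (simp add: mult_ac)
  qed
  thus ?case using c(1) d(1) by (intro exI[of _ "c * d"]) simp
qed (auto intro: exI[of _ 1])

lemma int_sum: "(\<And>i. i \<in> X \<Longrightarrow> algebraic_int (f i :: 'k)) \<Longrightarrow> algebraic_int (\<Sum>i\<in>X. f i)"
  by (induction X rule: infinite_finite_induct) (auto intro: int_add)

lemma matrix_common_denominator:
  fixes A :: "'k mat"
  assumes A: "A \<in> carrier_mat N N"
  shows "\<exists>c>0. \<forall>x\<in>carrier_vec N. (\<forall>k<N. algebraic_int (x $ k)) \<longrightarrow>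
    (\<forall>k<N. algebraic_int (of_int c * (A *\<^sub>v x) $ k))"
proof -
  have "finite ((\<lambda>(i, j). A $$ (i, j)) ` ({..<N} \<times> {..<N}))" by simp
  from finite_common_denominator[OF this]
  obtain c where c: "c > 0" "\<forall>y\<in>(\<lambda>(i, j). A $$ (i, j)) ` ({..<N} \<times> {..<N}). algebraic_int (of_int c * y)" by blast
  have "algebraic_int (of_int c * (A *\<^sub>v x) $ k)"
    if x: "x \<in> carrier_vec N" "\<And>k. k < N \<Longrightarrow> algebraic_int (x $ k)" and k: "k < N" for x k
  proof -
    have "of_int c * (A *\<^sub>v x) $ k = (\<Sum>j<N. of_int c * A $$ (k, j) * x $ j)"
      using A x(1) k by (simp add: scalar_prod_def sum_distrib_left lessThan_atLeast0 mult.assoc)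
    also have "algebraic_int \<dots>"
    proof (rule int_sum)
      fix j assume "j \<in> {..<N}"
      hence j: "j < N" by simp
      have "algebraic_int (of_int c * A $$ (k, j))" using c(2) k j by auto
      thus "algebraic_int (of_int c * A $$ (k, j) * x $ j)" by (rule int_mult) (use x(2) j in simp)
    qed
    finally show ?thesis .
  qed
  thus ?thesis using c(1) by blast
qed

lemma full_lattice_image:
  fixes A :: "'k mat"
  assumes A: "A \<in> carrier_mat N N" "det A \<noteq> 0" and \<Lambda>: "full_lattice N b \<Lambda>"
  obtains b' where "full_lattice N b' (mat_image A \<Lambda>)"
proof -
  note D = full_latticeD[OF \<Lambda>] and inv = mat_inv_exists[OF A]
  obtain c where c: "c > 0" "\<forall>x\<in>carrier_vec N. (\<forall>k<N. algebraic_int (x $ k)) \<longrightarrow>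
    (\<forall>k<N. algebraic_int (of_int c * (A *\<^sub>v x) $ k))" using matrix_common_denominator[OF A(1)] by blast
  obtain d where d: "d > 0" "\<forall>x\<in>carrier_vec N. (\<forall>k<N. algebraic_int (x $ k)) \<longrightarrow>
    (\<forall>k<N. algebraic_int (of_int d * (mat_inv A *\<^sub>v x) $ k))" using matrix_common_denominator[OF inv(1)] by blast
  \<comment> \<open>\<open>c\<close> clears the denominators of \<open>A\<close>, for the upper
    inclusion, and \<open>d\<close> those of its inverse, for the lower one.\<close>
  have "full_lattice N (b * c * d) (mat_image A \<Lambda>)"
    unfolding full_lattice_def
  proof (intro conjI ballI allI impI)
    show "b * c * d > 0" using D(1) c(1) d(1) by simp
    show "mat_image A \<Lambda> \<subseteq> carrier_vec N" using mult_mat_vec_carrier[OF A(1) D(2)] by blast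
  next
    fix x y assume "x \<in> mat_image A \<Lambda>" "y \<in> mat_image A \<Lambda>"
    then obtain x' y' where xy: "x = A *\<^sub>v x'" "x' \<in> \<Lambda>" "y = A *\<^sub>v y'" "y' \<in> \<Lambda>" by blast
    have "x + y = A *\<^sub>v (x' + y')"
      unfolding xy using mult_add_distrib_mat_vec[OF A(1) D(2)[OF xy(2)] D(2)[OF xy(4)]] by simp
    thus "x + y \<in> mat_image A \<Lambda>" using D(3)[OF xy(2,4)] by blast
  next
    fix a x assume a: "algebraic_int (a :: 'k)" and "x \<in> mat_image A \<Lambda>"
    then obtain x' where x: "x = A *\<^sub>v x'" "x' \<in> \<Lambda>" by blast
    have "a \<cdot>\<^sub>v x = A *\<^sub>v (a \<cdot>\<^sub>v x')" unfolding x using mult_mat_vec[OF A(1) D(2)[OF x(2)]] by simp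
    thus "a \<cdot>\<^sub>v x \<in> mat_image A \<Lambda>" using D(4)[OF a x(2)] by blast
  next
    fix x :: "'k vec" assume x: "x \<in> carrier_vec N" "\<forall>k<N. algebraic_int (x $ k)"
    define y where "y = of_int d \<cdot>\<^sub>v (mat_inv A *\<^sub>v x)"
    have y: "y \<in> carrier_vec N" using mult_mat_vec_carrier[OF inv(1) x(1)] by (simp add: y_def)
    have "algebraic_int (y $ k)" if "k < N" for k
      using d(2) x that inv(1) by (simp add: y_def)
    hence "of_int b \<cdot>\<^sub>v y \<in> \<Lambda>" using y by (intro D(5)) auto
    hence "of_int c \<cdot>\<^sub>v (of_int b \<cdot>\<^sub>v y) \<in> \<Lambda>" by (rule D(4)[OF int_of_int])
    moreover have "A *\<^sub>v (of_int c \<cdot>\<^sub>v (of_int b \<cdot>\<^sub>v y)) = of_int (b * c * d) \<cdot>\<^sub>v x"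
    proof -
      have "of_int c \<cdot>\<^sub>v (of_int b \<cdot>\<^sub>v y) = of_int (b * c * d) \<cdot>\<^sub>v (mat_inv A *\<^sub>v x)"
        unfolding y_def smult_smult_assoc by (simp add: mult_ac)
      thus ?thesis using mult_mat_vec[OF A(1) mult_mat_vec_carrier[OF inv(1) x(1)]] mat_inv_mult_vec(2)[OF A x(1)] by simp
    qed
    ultimately show "of_int (b * c * d) \<cdot>\<^sub>v x \<in> mat_image A \<Lambda>" by (metis image_eqI)
  next
    fix x k assume "x \<in> mat_image A \<Lambda>" and k: "k < N"
    then obtain x' where x: "x = A *\<^sub>v x'" "x' \<in> \<Lambda>" by blast
    have "algebraic_int ((of_int b \<cdot>\<^sub>v x') $ k)" if "k < N" for k
      using D(6)[OF x(2) that] D(2)[OF x(2)] that by (simp add: fractions_def)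
    hence "algebraic_int (of_int c * (A *\<^sub>v (of_int b \<cdot>\<^sub>v x')) $ k)"
      using c(2) k D(2)[OF x(2)] by simp
    also have "A *\<^sub>v (of_int b \<cdot>\<^sub>v x') = of_int b \<cdot>\<^sub>v x" unfolding x using mult_mat_vec[OF A(1) D(2)[OF x(2)]] by simp
    finally have "algebraic_int (of_int d * (of_int c * (of_int b \<cdot>\<^sub>v x) $ k))"
      by (rule int_mult[OF int_of_int])
    thus "x $ k \<in> fractions (b * c * d)" using k A(1) x by (simp add: fractions_def mult_ac)
  qed
  thus ?thesis by (rule that)
qed

lemma Gamma0_lattices:
  fixes \<II> P :: "'k set"
  assumes I: "ideal \<II> int_ring" "\<II> \<noteq> {0}" and P: "ideal P int_ring" "P \<noteq> {0}"
  shows "ideal (P \<cdot>\<^bsub>int_ring\<^esub> \<II>) int_ring" "P \<cdot>\<^bsub>int_ring\<^esub> \<II> \<noteq> {0}"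
    "inverse_ideal \<II> \<subseteq> inverse_ideal (P \<cdot>\<^bsub>int_ring\<^esub> \<II>)"
    "std_lattice N \<II> \<subseteq> std_lattice N (P \<cdot>\<^bsub>int_ring\<^esub> \<II>)"
proof -
  have ring: "ring (int_ring :: 'k ring)" using I(1) by (simp add: ideal_def)
  show "ideal (P \<cdot>\<^bsub>int_ring\<^esub> \<II>) int_ring" by (rule ring.ideal_prod_is_ideal[OF ring P(1) I(1)])
  obtain e where e: "e > 0" "of_int e \<in> P" using ideal_contains_integer[OF P] .
  obtain f where f: "f > 0" "of_int f \<in> \<II>" using ideal_contains_integer[OF I] .
  have mem: "of_int e * of_int f \<in> P \<cdot>\<^bsub>int_ring\<^esub> \<II>" using ideal_prod.prod[OF e(2) f(2), of int_ring] by simp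
  have "of_int e * of_int f \<noteq> (0 :: 'k)" using e(1) f(1) by simp
  show "P \<cdot>\<^bsub>int_ring\<^esub> \<II> \<noteq> {0}"
  proof
    assume "P \<cdot>\<^bsub>int_ring\<^esub> \<II> = {0}"
    with mem \<open>of_int e * of_int f \<noteq> (0 :: 'k)\<close> show False by simp
  qed
  have "P \<cdot>\<^bsub>int_ring\<^esub> \<II> \<subseteq> \<II>" using ring.ideal_prod_inter[OF ring P(1) I(1)] by blast
  thus 1: "inverse_ideal \<II> \<subseteq> inverse_ideal (P \<cdot>\<^bsub>int_ring\<^esub> \<II>)" by (auto simp: inverse_ideal_def)
  show "std_lattice N \<II> \<subseteq> std_lattice N (P \<cdot>\<^bsub>int_ring\<^esub> \<II>)" using 1 by (auto simp: std_lattice_def)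
qed

end

text \<open>\<open>J\<close> indexes the group elements whose first columns serve as directions:
  \<open>{..<N}\<close> for a single value of \<open>Phi\<close> and \<open>{..N}\<close> for the
  cocycle relation, where all \<open>N + 1\<close> matrices must share one weight and one supply of
  directions. Maps \<open>sel\<close> then pick the \<open>N\<close> columns of each matrix.\<close>

locale smoothing_data = quadratic_order \<sigma> \<omega> tr nm
  for \<sigma> :: "'k::field_char_0 \<Rightarrow> complex" and \<omega> tr nm +
  fixes N :: nat and \<II> P R :: "'k set" and J :: "'j set" and \<gamma> :: "'j \<Rightarrow> 'k mat"
  assumes N: "N > 0" and I: "ideal \<II> int_ring" "\<II> \<noteq> {0}" and P: "ideal P int_ring" "P \<noteq> {0}"
    and R: "finite R" "card R = ideal_norm P" "R \<subseteq> inverse_ideal (P \<cdot>\<^bsub>int_ring\<^esub> \<II>)"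
    "\<forall>x\<in>inverse_ideal (P \<cdot>\<^bsub>int_ring\<^esub> \<II>). \<exists>!r. r \<in> R \<and> x - r \<in> inverse_ideal \<II>"
    and \<gamma>: "\<And>j. j \<in> J \<Longrightarrow> \<gamma> j \<in> Gamma0 N P \<II>"
begin

interpretation \<sigma>: field_hom \<sigma> by (rule hom)

abbreviation \<Lambda>1 where "\<Lambda>1 \<equiv> std_lattice N (P \<cdot>\<^bsub>int_ring\<^esub> \<II>)"
abbreviation \<Lambda>0 where "\<Lambda>0 \<equiv> std_lattice N \<II>"

definition vcol :: "'j \<Rightarrow> 'k vec" where "vcol j = \<gamma> j *\<^sub>v unit_vec N 0"

definition weight :: "'k vec \<Rightarrow> complex" where
  "weight x = (if x \<in> \<Lambda>0 then 1 - of_nat (ideal_norm P) else 1)"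

lemma std_carrier: "x \<in> std_lattice N K \<Longrightarrow> x \<in> carrier_vec N"
  by (simp add: std_lattice_def)

lemma full_lattices: "\<exists>b. full_lattice N b \<Lambda>1" "\<exists>b. full_lattice N b \<Lambda>0"
proof -
  obtain b where "full_lattice N b \<Lambda>1" by (rule std_lattice_full[OF Gamma0_lattices(1,2)[OF I P] N])
  thus "\<exists>b. full_lattice N b \<Lambda>1" ..
  obtain b where "full_lattice N b \<Lambda>0" by (rule std_lattice_full[OF I N])
  thus "\<exists>b. full_lattice N b \<Lambda>0" ..
qed

lemma \<Lambda>1_add: "x \<in> \<Lambda>1 \<Longrightarrow> y \<in> \<Lambda>1 \<Longrightarrow> x + y \<in> \<Lambda>1" and \<Lambda>1_diff: "x \<in> \<Lambda>1 \<Longrightarrow> y \<in> \<Lambda>1 \<Longrightarrow> x - y \<in> \<Lambda>1"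
proof -
  obtain b where b: "full_lattice N b \<Lambda>1" using full_lattices(1) ..
  show "x \<in> \<Lambda>1 \<Longrightarrow> y \<in> \<Lambda>1 \<Longrightarrow> x + y \<in> \<Lambda>1" by (rule full_latticeD(3)[OF b])
  show "x \<in> \<Lambda>1 \<Longrightarrow> y \<in> \<Lambda>1 \<Longrightarrow> x - y \<in> \<Lambda>1" by (rule full_latticeD(8)[OF b])
qed

lemma \<gamma>D:
  assumes "j \<in> J"
  shows "\<gamma> j \<in> carrier_mat N N" "det (\<gamma> j) \<noteq> 0" "x \<in> \<Lambda>1 \<Longrightarrow> \<gamma> j *\<^sub>v x \<in> \<Lambda>1" "x \<in> \<Lambda>0 \<Longrightarrow> \<gamma> j *\<^sub>v x \<in> \<Lambda>0"
    "x \<in> \<Lambda>1 \<Longrightarrow> \<exists>y\<in>\<Lambda>1. x = \<gamma> j *\<^sub>v y" "x \<in> carrier_vec N \<Longrightarrow> \<gamma> j *\<^sub>v x \<in> \<Lambda>0 \<Longrightarrow> x \<in> \<Lambda>0"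
proof -
  have g1: "\<gamma> j \<in> Gamma N \<Lambda>1" and g0: "\<gamma> j \<in> Gamma N \<Lambda>0" using \<gamma>[OF assms] by (simp_all add: Gamma0_def)
  show c: "\<gamma> j \<in> carrier_mat N N" and d: "det (\<gamma> j) \<noteq> 0" using GammaD(1,2)[OF g1] by simp_all
  show "\<gamma> j *\<^sub>v x \<in> \<Lambda>1" if "x \<in> \<Lambda>1" using GammaD(3)[OF g1 that] .
  show "\<gamma> j *\<^sub>v x \<in> \<Lambda>0" if "x \<in> \<Lambda>0" using GammaD(3)[OF g0 that] .
  show "\<exists>y\<in>\<Lambda>1. x = \<gamma> j *\<^sub>v y" if "x \<in> \<Lambda>1" using GammaD(4)[OF g1 that] .
  show "x \<in> \<Lambda>0" if x: "x \<in> carrier_vec N" "\<gamma> j *\<^sub>v x \<in> \<Lambda>0"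
  proof -
    obtain y where y: "y \<in> \<Lambda>0" "\<gamma> j *\<^sub>v x = \<gamma> j *\<^sub>v y" using GammaD(4)[OF g0 x(2)] by blast
    have "x = y" using mat_mult_inj[OF c d x(1) std_carrier[OF y(1)] y(2)] .
    thus ?thesis using y(1) by simp
  qed
qed

lemma vcol_carrier: "j \<in> J \<Longrightarrow> vcol j \<in> carrier_vec N"
  unfolding vcol_def by (rule mult_mat_vec_carrier[OF \<gamma>D(1)]) auto

lemma vcol_shift: "j \<in> J \<Longrightarrow> t \<cdot>\<^sub>v vcol j = \<gamma> j *\<^sub>v (t \<cdot>\<^sub>v unit_vec N 0)"
  unfolding vcol_def by (rule mult_mat_vec[OF \<gamma>D(1), symmetric]) auto

lemma smult_unit_in_std_lattice:
  assumes "t \<in> inverse_ideal K"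
  shows "t \<cdot>\<^sub>v unit_vec N 0 \<in> std_lattice N K"
  using assms N int_of_int[of 0] by (auto simp: std_lattice_def)

lemma vcol_\<Lambda>1: "j \<in> J \<Longrightarrow> t \<in> R \<Longrightarrow> t \<cdot>\<^sub>v vcol j \<in> \<Lambda>1"
  using R(3) by (auto simp: vcol_shift intro!: \<gamma>D(3) smult_unit_in_std_lattice)

text \<open>As \<open>\<gamma> j\<close> preserves both lattices and sends the first unit vector to
  \<open>vcol j\<close>, the claim reduces to the first coordinate, where the quotient of the
  lattices is that of the two inverse ideals.\<close>

lemma unique_residue:
  assumes j: "j \<in> J" and x: "x \<in> \<Lambda>1"
  shows "\<exists>!t. t \<in> R \<and> x - t \<cdot>\<^sub>v vcol j \<in> \<Lambda>0"
proof -
  obtain y where y: "y \<in> \<Lambda>1" "x = \<gamma> j *\<^sub>v y" using \<gamma>D(5)[OF j x] by blast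
  have "x - t \<cdot>\<^sub>v vcol j \<in> \<Lambda>0 \<longleftrightarrow> y $ 0 - t \<in> inverse_ideal \<II>" for t
  proof -
    let ?w = "y - t \<cdot>\<^sub>v unit_vec N 0"
    have w: "?w \<in> carrier_vec N" using std_carrier[OF y(1)] by simp
    have "x - t \<cdot>\<^sub>v vcol j = \<gamma> j *\<^sub>v ?w"
      unfolding y(2) vcol_shift[OF j] by (rule mult_minus_distrib_mat_vec[OF \<gamma>D(1)[OF j] std_carrier[OF y(1)], symmetric]) simp
    hence "x - t \<cdot>\<^sub>v vcol j \<in> \<Lambda>0 \<longleftrightarrow> ?w \<in> \<Lambda>0" using \<gamma>D(4)[OF j] \<gamma>D(6)[OF j w] by auto
    also have "\<dots> \<longleftrightarrow> y $ 0 - t \<in> inverse_ideal \<II>"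
      using y(1) N by (auto simp: std_lattice_def)
    finally show ?thesis .
  qed
  moreover have "y $ 0 \<in> inverse_ideal (P \<cdot>\<^bsub>int_ring\<^esub> \<II>)" using y(1) by (simp add: std_lattice_def)
  ultimately show ?thesis using R(4) by simp
qed

lemma R_nonempty: "R \<noteq> {}"
proof -
  have "0 \<in> inverse_ideal (P \<cdot>\<^bsub>int_ring\<^esub> \<II>)" by (rule inverse_idealD(4))
  thus ?thesis using R(4) by blast
qed

text \<open>Along column \<open>j\<close> exactly one of the
  \<open>m = card R = ideal_norm P\<close> translates meets \<Lambda>0. It has weight
  \<open>1 - m\<close> and the other \<open>m - 1\<close> have weight 1, which gives
  \<open>zero_sum\<close>.\<close>

sublocale W: weighted_sum \<Lambda>1 J R "\<lambda>j t x. x + t \<cdot>\<^sub>v vcol j" "\<lambda>j t x. x - t \<cdot>\<^sub>v vcol j" weight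
  "1 + real (ideal_norm P)"
proof unfold_locales
  show "finite R" "R \<noteq> {}" by (rule R(1) R_nonempty)+
  fix j t x assume j: "j \<in> J" and t: "t \<in> R" and x: "x \<in> \<Lambda>1"
  show "x + t \<cdot>\<^sub>v vcol j \<in> \<Lambda>1" "x - t \<cdot>\<^sub>v vcol j \<in> \<Lambda>1"
    using \<Lambda>1_add \<Lambda>1_diff x vcol_\<Lambda>1[OF j t] by blast+
  show "x - t \<cdot>\<^sub>v vcol j + t \<cdot>\<^sub>v vcol j = x" "x + t \<cdot>\<^sub>v vcol j - t \<cdot>\<^sub>v vcol j = x"
    using std_carrier[OF x] vcol_carrier[OF j] by (auto intro!: eq_vecI)
next
  fix i j t u x assume "i \<in> J" "j \<in> J" "t \<in> R" "u \<in> R" "x \<in> \<Lambda>1"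
  hence "vcol i \<in> carrier_vec N" "vcol j \<in> carrier_vec N" "x \<in> carrier_vec N"
    using vcol_carrier std_carrier by simp_all
  thus "x + u \<cdot>\<^sub>v vcol j + t \<cdot>\<^sub>v vcol i = x + t \<cdot>\<^sub>v vcol i + u \<cdot>\<^sub>v vcol j"
    by (intro eq_vecI) auto
next
  fix x show "cmod (weight x) \<le> 1 + real (ideal_norm P)"
    using norm_triangle_ineq4[of 1 "of_nat (ideal_norm P) :: complex"] by (simp add: weight_def)
next
  fix j x assume j: "j \<in> J" and x: "x \<in> \<Lambda>1"
  obtain t where t: "t \<in> R" "x - t \<cdot>\<^sub>v vcol j \<in> \<Lambda>0" "\<forall>u. u \<in> R \<and> x - u \<cdot>\<^sub>v vcol j \<in> \<Lambda>0 \<longrightarrow> u = t"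
    using unique_residue[OF j x] unfolding Ex1_def by blast
  have "weight (x - u \<cdot>\<^sub>v vcol j) = 1 - (if u = t then of_nat (ideal_norm P) else 0)" if "u \<in> R" for u
  proof (cases "u = t")
    case True
    thus ?thesis using t(2) by (simp add: weight_def)
  next
    case False
    hence "x - u \<cdot>\<^sub>v vcol j \<notin> \<Lambda>0" using t(3) that by blast
    thus ?thesis using False by (simp add: weight_def)
  qed
  hence "(\<Sum>u\<in>R. weight (x - u \<cdot>\<^sub>v vcol j)) = (\<Sum>u\<in>R. 1 - (if u = t then of_nat (ideal_norm P) else 0))"
    by (rule sum.cong[OF refl])
  also have "\<dots> = 0" using t(1) R(1,2) by (simp add: sum_subtractf)
  finally show "(\<Sum>t\<in>R. weight (x - t \<cdot>\<^sub>v vcol j)) = 0" .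
qed

end

section \<open>Differences along the columns of a matrix, and the regularised Dedekind sum\<close>

context smoothing_data
begin

interpretation \<sigma>: field_hom \<sigma> by (rule hom)

definition cmat :: "(nat \<Rightarrow> 'j) \<Rightarrow> 'k mat" where
  "cmat sel = mat_cols N (\<lambda>k. vcol (sel k))"

definition coord_prod ::
  "(nat \<Rightarrow> 'j) \<Rightarrow> complex vec \<Rightarrow> (nat \<Rightarrow> complex \<Rightarrow> complex) \<Rightarrow> 'k vec \<Rightarrow> complex" where
  "coord_prod sel z g x = (\<Prod>k<N. g k (z $ k + \<sigma> ((mat_inv (cmat sel) *\<^sub>v x) $ k)))"

lemma cmat_carrier [simp]: "cmat sel \<in> carrier_mat N N"
  by (simp add: cmat_def)

lemma cmat_dim [simp]: "dim_row (cmat sel) = N" "dim_col (cmat sel) = N"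
  by (simp_all add: cmat_def mat_cols_def)

text \<open>\<open>vcol (sel k)\<close> is the \<open>k\<close>-th column of
  \<open>cmat sel\<close>, so the inverse matrix sends it to the \<open>k\<close>-th unit
  vector.\<close>

lemma inv_cmat_shift:
  assumes d: "det (cmat sel) \<noteq> 0" and sel: "\<forall>k<N. sel k \<in> J" and x: "x \<in> carrier_vec N"
    and k: "k < N"
  shows "mat_inv (cmat sel) *\<^sub>v (x + t \<cdot>\<^sub>v vcol (sel k)) = mat_inv (cmat sel) *\<^sub>v x + t \<cdot>\<^sub>v unit_vec N k"
proof -
  note inv = mat_inv_exists[OF cmat_carrier d]
  have v: "vcol (sel k) \<in> carrier_vec N" using vcol_carrier sel k by blast
  have "cmat sel *\<^sub>v unit_vec N k = vcol (sel k)"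
    using k v by (intro eq_vecI) (auto simp: cmat_def mat_cols_def)
  hence "mat_inv (cmat sel) *\<^sub>v vcol (sel k) = unit_vec N k"
    using mat_inv_mult_vec(1)[OF cmat_carrier d, of "unit_vec N k"] by simp
  moreover have "mat_inv (cmat sel) *\<^sub>v (x + t \<cdot>\<^sub>v vcol (sel k)) =
      mat_inv (cmat sel) *\<^sub>v x + t \<cdot>\<^sub>v (mat_inv (cmat sel) *\<^sub>v vcol (sel k))"
    using mult_add_distrib_mat_vec[OF inv(1) x, of "t \<cdot>\<^sub>v vcol (sel k)"] mult_mat_vec[OF inv(1) v] v by simp
  ultimately show ?thesis by simp
qed

text \<open>A step along the column \<open>k0\<close> moves only the coordinate \<open>k0\<close>,
  so the difference acts on that factor alone, as the averaged difference over the image of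
  \<open>R\<close> under \<sigma>.\<close>

lemma dif_coord_prod:
  assumes d: "det (cmat sel) \<noteq> 0" and sel: "\<forall>k<N. sel k \<in> J" and x: "x \<in> \<Lambda>1" and k0: "k0 < N"
  shows "W.dif (sel k0) (coord_prod sel z g) x =
    coord_prod sel z (g(k0 := avg_diff (\<sigma> ` R) (g k0))) x"
proof -
  define y where "y k = z $ k + \<sigma> ((mat_inv (cmat sel) *\<^sub>v x) $ k)" for k
  define Q where "Q = (\<Prod>k\<in>{..<N} - {k0}. g k (y k))"
  have inv: "mat_inv (cmat sel) \<in> carrier_mat N N" by (rule mat_inv_exists(1)[OF cmat_carrier d])
  have split: "(\<Prod>k<N. f k) = f k0 * (\<Prod>k\<in>{..<N} - {k0}. f k)" for f :: "nat \<Rightarrow> complex"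
    using k0 by (intro prod.remove) auto
  have shift: "coord_prod sel z g (x + t \<cdot>\<^sub>v vcol (sel k0)) = g k0 (y k0 + \<sigma> t) * Q" for t
  proof -
    have "z $ k + \<sigma> ((mat_inv (cmat sel) *\<^sub>v (x + t \<cdot>\<^sub>v vcol (sel k0))) $ k) = y k + (if k = k0 then \<sigma> t else 0)"
      if "k < N" for k
    proof -
      have "mat_inv (cmat sel) *\<^sub>v (x + t \<cdot>\<^sub>v vcol (sel k0)) = mat_inv (cmat sel) *\<^sub>v x + t \<cdot>\<^sub>v unit_vec N k0"
        by (rule inv_cmat_shift[OF d sel std_carrier[OF x] k0])
      from arg_cong[OF this, of "\<lambda>v. v $ k"] show ?thesis
        using that k0 inv by (simp add: y_def hom_distribs unit_vec_def del: index_mult_mat_vec)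
    qed
    hence "coord_prod sel z g (x + t \<cdot>\<^sub>v vcol (sel k0)) = (\<Prod>k<N. g k (y k + (if k = k0 then \<sigma> t else 0)))"
      by (simp add: coord_prod_def)
    also have "\<dots> = g k0 (y k0 + \<sigma> t) * Q" unfolding split Q_def by simp
    finally show ?thesis .
  qed
  have g0: "coord_prod sel z g' x = g' k0 (y k0) * (\<Prod>k\<in>{..<N} - {k0}. g' k (y k))" for g'
    unfolding coord_prod_def y_def[symmetric] by (rule split)
  have inj: "inj_on \<sigma> R" using inj_\<sigma> inj_on_subset by blast
  have "W.dif (sel k0) (coord_prod sel z g) x =
      g k0 (y k0) * Q - (\<Sum>t\<in>R. g k0 (y k0 + \<sigma> t) * Q) / of_nat (card R)"
    unfolding W.dif_def shift g0 Q_def ..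
  also have "\<dots> = (g k0 (y k0) - (\<Sum>t\<in>R. g k0 (y k0 + \<sigma> t)) / of_nat (card R)) * Q"
    by (simp add: left_diff_distrib sum_distrib_right[symmetric])
  also have "\<dots> = avg_diff (\<sigma> ` R) (g k0) (y k0) * Q"
    unfolding avg_diff_def by (simp add: sum.reindex[OF inj] card_image[OF inj])
  also have "\<dots> = coord_prod sel z (g(k0 := avg_diff (\<sigma> ` R) (g k0))) x"
    unfolding g0 Q_def by simp
  finally show ?thesis .
qed

lemma difs_replicate:
  assumes d: "det (cmat sel) \<noteq> 0" and sel: "\<forall>k<N. sel k \<in> J" and x: "x \<in> \<Lambda>1" and k0: "k0 < N"
  shows "W.difs (replicate n (sel k0)) (coord_prod sel z g) x =
    coord_prod sel z (g(k0 := (avg_diff (\<sigma> ` R) ^^ n) (g k0))) x"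
  using x
proof (induction n arbitrary: x)
  case (Suc n)
  let ?g = "g(k0 := (avg_diff (\<sigma> ` R) ^^ n) (g k0))"
  have "W.difs (replicate (Suc n) (sel k0)) (coord_prod sel z g) x = W.dif (sel k0) (coord_prod sel z ?g) x"
    unfolding replicate_Suc W.difs_Cons by (rule W.dif_cong[OF sel[rule_format, OF k0] Suc.prems Suc.IH])
  also have "\<dots> = coord_prod sel z (?g(k0 := avg_diff (\<sigma> ` R) (?g k0))) x"
    by (rule dif_coord_prod[OF d sel Suc.prems k0])
  also have "?g(k0 := avg_diff (\<sigma> ` R) (?g k0)) = g(k0 := (avg_diff (\<sigma> ` R) ^^ Suc n) (g k0))"
    by simp
  finally show ?case .
qed simp

lemma difs_columns:
  assumes d: "det (cmat sel) \<noteq> 0" and sel: "\<forall>k<N. sel k \<in> J" and x: "x \<in> \<Lambda>1"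
    and ks: "distinct ks" "set ks \<subseteq> {..<N}"
  shows "W.difs (concat (map (\<lambda>k. replicate n (sel k)) ks)) (coord_prod sel z g) x =
    coord_prod sel z (\<lambda>k. if k \<in> set ks then (avg_diff (\<sigma> ` R) ^^ n) (g k) else g k) x"
  using x ks
proof (induction ks arbitrary: x)
  case (Cons k ks)
  let ?g = "\<lambda>i. if i \<in> set ks then (avg_diff (\<sigma> ` R) ^^ n) (g i) else g i"
  have k: "k < N" using Cons.prems by simp
  have "W.difs (concat (map (\<lambda>k. replicate n (sel k)) (k # ks))) (coord_prod sel z g) x =
      W.difs (replicate n (sel k)) (coord_prod sel z ?g) x"
    unfolding list.map concat.simps W.difs_append using Cons sel[rule_format, OF k] by (intro W.difs_cong) auto
  also have "\<dots> = coord_prod sel z (?g(k := (avg_diff (\<sigma> ` R) ^^ n) (?g k))) x"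
    by (rule difs_replicate[OF d sel Cons.prems(1) k])
  also have "?g(k := (avg_diff (\<sigma> ` R) ^^ n) (?g k)) =
      (\<lambda>i. if i \<in> set (k # ks) then (avg_diff (\<sigma> ` R) ^^ n) (g i) else g i)"
    using Cons.prems by (auto simp: fun_eq_iff)
  finally show ?case .
qed simp

lemma ke_product_coord_prod:
  "ke_product N E F z (mat_inv (cmat sel) *\<^sub>v x) s =
    (\<Prod>k<N. fact (E k)) * coord_prod sel z (\<lambda>k. ke_term (- int (E k) - 1) (int (F k)) s) x"
  by (simp add: ke_product_def coord_prod_def prod.distrib)

text \<open>
  For large \<open>Re s\<close> the smoothed series is the weighted sum of its terms, hence also of their
  iterated differences, and the latter sum is holomorphic around the origin.
\<close>

theorem regular_sum_KE:
  fixes z :: "complex vec" and E F :: "nat \<Rightarrow> nat" and sel :: "nat \<Rightarrow> 'j"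
  defines "B \<equiv> mat_inv (cmat sel)"
  assumes d: "det (cmat sel) \<noteq> 0" and sel: "\<forall>k<N. sel k \<in> J"
    and z1: "z \<in> hyperplane_compl N \<sigma> (mat_image B \<Lambda>1)" and z0: "z \<in> hyperplane_compl N \<sigma> (mat_image B \<Lambda>0)"
  shows "W.regular_sum (\<lambda>x. ke_product N E F z (B *\<^sub>v x) 0)
    (KE N \<sigma> E F z (mat_image B \<Lambda>1) - of_nat (ideal_norm P) * KE N \<sigma> E F z (mat_image B \<Lambda>0))"
proof -
  have B: "B \<in> carrier_mat N N" unfolding B_def by (rule mat_inv_exists(1)[OF cmat_carrier d])
  have "det B \<noteq> 0"
    unfolding B_def by (rule mat_inv_unique(2)[OF mat_inv_exists(1)[OF cmat_carrier d] cmat_carrier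
      mat_inv_exists(3)[OF cmat_carrier d]])
  obtain b1 where b1: "full_lattice N b1 (mat_image B \<Lambda>1)"
    using full_lattices(1) full_lattice_image[OF B \<open>det B \<noteq> 0\<close>] by metis
  obtain b0 where b0: "full_lattice N b0 (mat_image B \<Lambda>0)"
    using full_lattices(2) full_lattice_image[OF B \<open>det B \<noteq> 0\<close>] by metis
  have inj: "inj_on (\<lambda>x. B *\<^sub>v x) X" if "X \<subseteq> carrier_vec N" for X
    using mat_mult_inj[OF B \<open>det B \<noteq> 0\<close>] that by (intro inj_onI) blast
  have sub: "\<Lambda>1 \<subseteq> carrier_vec N" "\<Lambda>0 \<subseteq> carrier_vec N" using std_carrier by blast+
  have sub01: "\<Lambda>0 \<subseteq> \<Lambda>1" by (rule Gamma0_lattices(4)[OF I P])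
  define a where "a k = - int (E k) - 1" for k
  \<comment> \<open>Since \<open>a k + F k \<le> F k - 1\<close>, this \<open>M\<close> meets the
    bound of \<open>loc_dominated_avg_diff_ke_term\<close> for all coordinates at once, and
    \<open>n = 2 M\<close> differences along each column suffice.\<close>
  define M where "M = (\<Sum>k<N. F k) + 2"
  define n where "n = 2 * M"
  define js where "js = concat (map (\<lambda>k. replicate n (sel k)) [0..<N])"
  have js: "set js \<subseteq> J" using sel by (auto simp: js_def)
  define f where "f s x = ke_product N E F z (B *\<^sub>v x) s" for s x
  define g where "g s k = (avg_diff (\<sigma> ` R) ^^ n) (ke_term (a k) (int (F k)) s)" for s k
  define C where "C = (\<Prod>k<N. fact (E k) :: complex)"
  have difs_f: "W.difs js (f s) x = C * (\<Prod>k<N. g s k (z $ k + \<sigma> ((B *\<^sub>v x) $ k)))" if x: "x \<in> \<Lambda>1" for s x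
  proof -
    have "W.difs js (f s) x = C * W.difs js (coord_prod sel z (\<lambda>k. ke_term (a k) (int (F k)) s)) x"
      unfolding f_def[abs_def] B_def ke_product_coord_prod W.difs_cmult C_def a_def ..
    also have "W.difs js (coord_prod sel z (\<lambda>k. ke_term (a k) (int (F k)) s)) x =
      coord_prod sel z (\<lambda>k. if k \<in> set [0..<N] then g s k else ke_term (a k) (int (F k)) s) x"
      unfolding js_def g_def by (rule difs_columns[OF d sel x]) auto
    also have "\<dots> = (\<Prod>k<N. g s k (z $ k + \<sigma> ((B *\<^sub>v x) $ k)))"
      unfolding coord_prod_def B_def by (intro prod.cong) auto
    finally show ?thesis .
  qed
  have ld: "loc_dominated \<Lambda>1 {s. Re s > - (1/2)} (\<lambda>x s. W.difs js (f s) x)"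
  proof -
    have b1': "b1 \<noteq> 0" using full_latticeD(1)[OF b1] by simp
    interpret L: cm_lattice "\<sigma> \<omega>" "1 / of_int b1" tr nm by (rule cm_lattice) (use b1' in simp)
    have "loc_dominated (fractions b1) {s. Re s > - (1/2)} (\<lambda>x s. g s k (z $ k + \<sigma> x))" if "k < N" for k
    proof -
      have "real (F k) \<le> (\<Sum>k<N. real (F k))" using that by (intro member_le_sum) auto
      hence "of_int (a k + int (F k)) + 5 / 2 \<le> real M" by (simp add: a_def M_def)
      hence "loc_dominated L.L {s. Re s > - (1/2)} (\<lambda>l s. g s k (z $ k + l))"
        unfolding g_def using R(1) R_nonempty
        by (intro L.loc_dominated_avg_diff_ke_term[where M = M]) (auto simp: n_def)
      from loc_dominated_fractions[OF b1' this] show ?thesis .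
    qed
    hence "loc_dominated (mat_image B \<Lambda>1) {s. Re s > - (1/2)} (\<lambda>x s. \<Prod>k<N. g s k (z $ k + \<sigma> (x $ k)))"
      by (intro loc_dominated_lattice[of _ N b1 _ "\<lambda>k x s. g s k (z $ k + \<sigma> x)"] open_Re_gt)
         (use full_latticeD(2,6)[OF b1] in auto)
    hence "loc_dominated \<Lambda>1 {s. Re s > - (1/2)} (\<lambda>x s. \<Prod>k<N. g s k (z $ k + \<sigma> ((B *\<^sub>v x) $ k)))"
      by (rule loc_dominated_reindex[OF _ inj[OF sub(1)]]) simp
    hence "loc_dominated \<Lambda>1 {s. Re s > - (1/2)} (\<lambda>x s. C * (\<Prod>k<N. g s k (z $ k + \<sigma> ((B *\<^sub>v x) $ k))))"
      by (rule loc_dominated_cmult) simp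
    thus ?thesis by (rule loc_dominated_cong[rotated]) (simp add: difs_f)
  qed
  define Q where "Q s = (\<Sum>\<^sub>\<infinity>x\<in>\<Lambda>1. weight x * W.difs js (f s) x)" for s
  have Q: "Q holomorphic_on {s. Re s > - (1/2)}"
    unfolding Q_def[abs_def]
    by (rule loc_dominated_infsum_holomorphic[OF loc_dominated_weight[OF ld W.bound]])
  let ?A = "KE_abscissa N E F" and ?m = "of_nat (ideal_norm P) :: complex"
  define G1 where "G1 s = (\<Sum>\<^sub>\<infinity>y\<in>mat_image B \<Lambda>1. ke_product N E F z y s)" for s
  define G0 where "G0 s = (\<Sum>\<^sub>\<infinity>y\<in>mat_image B \<Lambda>0. ke_product N E F z y s)" for s
  have G: "G1 s - ?m * G0 s = Q s" if s: "Re s > ?A" for s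
  proof -
    have "(\<lambda>y. ke_product N E F z y s) summable_on mat_image B \<Lambda>1"
      using loc_dominated_summable[OF loc_dominated_ke_product[OF b1], of s] s by simp
    hence sm1: "f s summable_on \<Lambda>1"
      by (subst (asm) summable_on_reindex[OF inj[OF sub(1)]]) (simp add: o_def f_def[abs_def])
    have e1: "G1 s = (\<Sum>\<^sub>\<infinity>x\<in>\<Lambda>1. f s x)" and e0: "G0 s = (\<Sum>\<^sub>\<infinity>x\<in>\<Lambda>0. f s x)"
      unfolding G1_def G0_def f_def[abs_def] infsum_reindex[OF inj[OF sub(1)]] infsum_reindex[OF inj[OF sub(2)]] o_def
      by (rule refl)+
    have sm0: "f s summable_on \<Lambda>0" using sm1 sub01 by (rule summable_on_subset_banach)
    have i0: "((\<lambda>x. if x \<in> \<Lambda>0 then f s x else 0) has_sum G0 s) \<Lambda>1"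
    proof -
      have "(f s has_sum G0 s) \<Lambda>0" unfolding e0 using sm0 by (rule has_sum_infsum)
      thus ?thesis by (rule has_sum_cong_neutral[THEN iffD1, rotated 3]) (use sub01 in auto)
    qed
    have "((\<lambda>x. f s x + (- ?m) * (if x \<in> \<Lambda>0 then f s x else 0)) has_sum (G1 s + (- ?m) * G0 s)) \<Lambda>1"
      unfolding e1 by (intro has_sum_add has_sum_cmult_right i0 has_sum_infsum sm1)
    moreover have "(\<lambda>x. f s x + (- ?m) * (if x \<in> \<Lambda>0 then f s x else 0)) = (\<lambda>x. weight x * f s x)"
      by (simp add: fun_eq_iff weight_def algebra_simps)
    ultimately have "G1 s - ?m * G0 s = (\<Sum>\<^sub>\<infinity>x\<in>\<Lambda>1. weight x * f s x)" by (simp add: infsumI)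
    also have "\<dots> = Q s" unfolding Q_def by (rule W.difs_sum(2)[OF js sm1, symmetric])
    finally show ?thesis .
  qed
  obtain D1 h1 where D1: "D1 holomorphic_on UNIV" "D1 0 \<noteq> 0" "h1 holomorphic_on {s. Re s > - (1/2)}"
    "\<forall>s. Re s > ?A \<longrightarrow> D1 s * G1 s = h1 s" "D1 0 * KE N \<sigma> E F z (mat_image B \<Lambda>1) = h1 0"
    using KE_continuation[OF N b1 z1, of "- (1/2)" E F] unfolding G1_def by auto
  obtain D0 h0 where D0: "D0 holomorphic_on UNIV" "D0 0 \<noteq> 0" "h0 holomorphic_on {s. Re s > - (1/2)}"
    "\<forall>s. Re s > ?A \<longrightarrow> D0 s * G0 s = h0 s" "D0 0 * KE N \<sigma> E F z (mat_image B \<Lambda>0) = h0 0"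
    using KE_continuation[OF N b0 z0, of "- (1/2)" E F] unfolding G0_def by auto
  \<comment> \<open>The relation \<open>G1 - m G0 = Q\<close> holds to the right of the abscissa.
    Cleared of denominators it involves only functions holomorphic on \<open>Re s > - 1/2\<close>,
    so it persists to 0.\<close>
  have "D0 0 * h1 0 - ?m * D1 0 * h0 0 - D1 0 * D0 0 * Q 0 = 0"
  proof (rule holomorphic_zero_halfplane[of "\<lambda>s. D0 s * h1 s - ?m * D1 s * h0 s - D1 s * D0 s * Q s"
        "{s. Re s > - (1/2)}" "of_real (max ?A 0 + 1)" ?A])
    show "(\<lambda>s. D0 s * h1 s - ?m * D1 s * h0 s - D1 s * D0 s * Q s) holomorphic_on {s. Re s > - (1/2)}"
      by (intro holomorphic_intros D1(3) D0(3) Q holomorphic_on_subset[OF D1(1)] holomorphic_on_subset[OF D0(1)]) auto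
    fix s assume s: "Re s > ?A"
    have "h1 s = D1 s * G1 s" "h0 s = D0 s * G0 s" using D1(4) D0(4) s by auto
    thus "D0 s * h1 s - ?m * D1 s * h0 s - D1 s * D0 s * Q s = 0"
      unfolding G[OF s, symmetric] by (simp add: algebra_simps)
  qed (auto intro: open_Re_gt connected_Re_gt)
  hence "D1 0 * D0 0 * (KE N \<sigma> E F z (mat_image B \<Lambda>1) - ?m * KE N \<sigma> E F z (mat_image B \<Lambda>0) - Q 0) = 0"
    unfolding D1(5)[symmetric] D0(5)[symmetric] by (simp add: algebra_simps)
  hence "KE N \<sigma> E F z (mat_image B \<Lambda>1) - ?m * KE N \<sigma> E F z (mat_image B \<Lambda>0) = Q 0"
    using D1(2) D0(2) by simp
  moreover have "W.difs js (f 0) summable_on \<Lambda>1" using loc_dominated_summable[OF ld, of 0] by simp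
  ultimately show ?thesis
    unfolding W.regular_sum_def using js by (intro exI[of _ js]) (simp add: Q_def f_def[abs_def])
qed

end

section \<open>The cocycle relation\<close>

lemma (in weighted_sum) regular_sum_cong:
  assumes "regular_sum h v" "\<And>x. x \<in> X \<Longrightarrow> h x = h' x"
  shows "regular_sum h' v"
proof -
  obtain js where js: "set js \<subseteq> J" "difs js h summable_on X" "(\<Sum>\<^sub>\<infinity>x\<in>X. c x * difs js h x) = v"
    using assms(1) unfolding regular_sum_def by blast
  have e: "difs js h x = difs js h' x" if "x \<in> X" for x
    using assms(2) js(1) that by (intro difs_cong) auto
  have "difs js h' summable_on X" using js(2) summable_on_cong[of X "difs js h" "difs js h'"] e by simp
  moreover have "(\<Sum>\<^sub>\<infinity>x\<in>X. c x * difs js h' x) = v"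
    unfolding js(3)[symmetric] using e by (intro infsum_cong) simp
  ultimately show ?thesis unfolding regular_sum_def using js(1) by blast
qed

section \<open>Coefficients of the cocycle as sums over words\<close>

lemma sum_words_prod:
  fixes f :: "nat \<Rightarrow> nat \<Rightarrow> complex"
  shows "(\<Sum>w\<in>words N q. \<Prod>m<q. f m (w ! m)) = (\<Prod>m<q. \<Sum>j<N. f m j)"
proof (induction q arbitrary: f)
  case (Suc q)
  have "(\<Sum>w\<in>words N (Suc q). \<Prod>m<Suc q. f m (w ! m)) =
      (\<Sum>k<N. f 0 k * (\<Sum>w\<in>words N q. \<Prod>m<q. f (Suc m) (w ! m)))"
    unfolding sum_words_Suc prod.lessThan_Suc_shift sum_distrib_left by simp
  also have "\<dots> = (\<Prod>m<Suc q. \<Sum>j<N. f m j)"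
    unfolding Suc.IH[of "\<lambda>m. f (Suc m)"] prod.lessThan_Suc_shift by (simp add: sum_distrib_right)
  finally show ?case .
qed (simp add: words_0)

lemma prod_power_count_list:
  fixes y :: "nat \<Rightarrow> complex"
  assumes "set w \<subseteq> {..<N}"
  shows "(\<Prod>k<N. y k ^ count_list w k) = (\<Prod>m<length w. y (w ! m))"
  using assms
proof (induction w)
  case (Cons a w)
  have "(\<Prod>k<N. y k ^ count_list (a # w) k) = (\<Prod>k<N. (if k = a then y k else 1) * y k ^ count_list w k)"
    by (intro prod.cong) auto
  also have "\<dots> = y a * (\<Prod>m<length w. y (w ! m))"
    unfolding prod.distrib using Cons by simp
  also have "\<dots> = (\<Prod>m<length (a # w). y ((a # w) ! m))"
    unfolding list.size add_0_right add_Suc_right prod.lessThan_Suc_shift by simp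
  finally show ?case .
qed simp

lemma finite_multi_indices [simp]: "finite (multi_indices N p)"
proof (rule finite_subset)
  show "multi_indices N p \<subseteq> {f. \<forall>x. (x \<in> {..<N} \<longrightarrow> f x \<in> {..p}) \<and> (x \<notin> {..<N} \<longrightarrow> f x = 0)}"
    by (auto simp: multi_indices_def intro: member_le_sum)
  show "finite {f :: nat \<Rightarrow> nat. \<forall>x. (x \<in> {..<N} \<longrightarrow> f x \<in> {..p}) \<and> (x \<notin> {..<N} \<longrightarrow> f x = 0)}"
    by (rule finite_set_of_finite_funs) auto
qed

lemma count_list_multi_index:
  assumes "w \<in> words N p"
  shows "count_list w \<in> multi_indices N p"
proof -
  have "count_list w k = 0" if "k \<ge> N" for k using assms that by (auto simp: words_def count_list_0_iff)
  moreover have "(\<Sum>k<N. count_list w k) = sum (count_list w) (set w)"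
    using assms by (intro sum.mono_neutral_right) (auto simp: words_def count_list_0_iff)
  ultimately show ?thesis using assms by (simp add: multi_indices_def words_def sum_count_set)
qed

lemma multi_index_eqI:
  "I \<in> multi_indices N p \<Longrightarrow> I' \<in> multi_indices N p \<Longrightarrow> (\<And>k. k < N \<Longrightarrow> I k = I' k) \<Longrightarrow> I = I'"
proof (rule ext)
  fix k assume "I \<in> multi_indices N p" "I' \<in> multi_indices N p" "\<And>k. k < N \<Longrightarrow> I k = I' k"
  thus "I k = I' k" by (cases "k < N") (auto simp: multi_indices_def)
qed

lemma Vpq_basis_words:
  assumes "u \<in> words N p" "w \<in> words N q" "I \<in> multi_indices N p" "J \<in> multi_indices N q"
  shows "Vpq_basis N I J (u, w) = (if (I, J) = (count_list u, count_list w) then 1 else 0)"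
proof -
  have "I = count_list u \<longleftrightarrow> (\<forall>k<N. count_list u k = I k)" "J = count_list w \<longleftrightarrow> (\<forall>k<N. count_list w k = J k)"
    using multi_index_eqI[OF assms(3) count_list_multi_index[OF assms(1)]]
      multi_index_eqI[OF assms(4) count_list_multi_index[OF assms(2)]] by auto
  thus ?thesis using assms(1,2) by (auto simp: Vpq_basis_def words_def)
qed

text \<open>\<open>Vpq_basis\<close> is 1 on all rearrangements, so every pair of words is met by
  exactly one pair of multi-indices, and the sum over multi-indices becomes an unweighted sum over
  words. This is where the normalisation of the basis enters.\<close>

lemma Phi_words:
  fixes N p q :: nat and \<gamma> :: "nat \<Rightarrow> 'k::field_char_0 mat"
  defines "A \<equiv> first_columns N \<gamma>"
  assumes u: "u \<in> words N p" and w: "w \<in> words N q"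
  shows "snd (Phi N \<sigma> p q P \<II> \<gamma>) z (u, w) = (\<Sum>u'\<in>words N p. \<Sum>w'\<in>words N q.
    (\<Prod>m<p. mat_inv (map_mat \<sigma> A) $$ (u' ! m, u ! m)) * (\<Prod>m<q. cnj (map_mat \<sigma> A $$ (w ! m, w' ! m))) *
    snd (dedekind_smoothed N \<sigma> P (count_list u') (count_list w') A \<II>) z)"
proof -
  let ?MI = "multi_indices N p \<times> multi_indices N q"
  define D where "D IJ = snd (dedekind_smoothed N \<sigma> P (fst IJ) (snd IJ) A \<II>) z" for IJ
  define c where "c u' w' = (\<Prod>m<p. mat_inv (map_mat \<sigma> A) $$ (u' ! m, u ! m)) *
    (\<Prod>m<q. cnj (map_mat \<sigma> A $$ (w ! m, w' ! m)))" for u' w'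
  have "snd (Phi N \<sigma> p q P \<II> \<gamma>) z (u, w) = (\<Sum>IJ\<in>?MI. D IJ * (\<Sum>u'\<in>words N p. \<Sum>w'\<in>words N q.
      c u' w' * Vpq_basis N (fst IJ) (snd IJ) (u', w')))"
    using u w by (simp add: Phi_def pf_sum_def pf_tensor_def case_prod_unfold D_def Vpq_act_def A_def c_def)
  also have "\<dots> = (\<Sum>IJ\<in>?MI. \<Sum>u'\<in>words N p. \<Sum>w'\<in>words N q.
      c u' w' * (D IJ * (if IJ = (count_list u', count_list w') then 1 else 0)))"
    unfolding sum_distrib_left
  proof (intro sum.cong refl)
    fix IJ u' w' assume h: "IJ \<in> ?MI" "u' \<in> words N p" "w' \<in> words N q"
    have "Vpq_basis N (fst IJ) (snd IJ) (u', w') = (if IJ = (count_list u', count_list w') then 1 else 0)"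
      using Vpq_basis_words[OF h(2,3), of "fst IJ" "snd IJ"] h(1) by (simp add: mem_Times_iff)
    thus "D IJ * (c u' w' * Vpq_basis N (fst IJ) (snd IJ) (u', w')) =
        c u' w' * (D IJ * (if IJ = (count_list u', count_list w') then 1 else 0))" by simp
  qed
  also have "\<dots> = (\<Sum>u'\<in>words N p. \<Sum>w'\<in>words N q. c u' w' *
      (\<Sum>IJ\<in>?MI. D IJ * (if IJ = (count_list u', count_list w') then 1 else 0)))"
    unfolding sum_distrib_left by (subst sum.swap, intro sum.cong refl, subst sum.swap, rule refl)
  also have "\<dots> = (\<Sum>u'\<in>words N p. \<Sum>w'\<in>words N q. c u' w' * D (count_list u', count_list w'))"
  proof (intro sum.cong refl arg_cong[where f = "(*) _"])
    fix u' w' assume h: "u' \<in> words N p" "w' \<in> words N q"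
    have "(count_list u', count_list w') \<in> ?MI" using h by (simp add: count_list_multi_index)
    thus "(\<Sum>IJ\<in>?MI. D IJ * (if IJ = (count_list u', count_list w') then 1 else 0)) =
        D (count_list u', count_list w')" by (simp add: if_distrib[of "(*) _"] cong: if_cong)
  qed
  finally show ?thesis unfolding c_def D_def by simp
qed

lemma Phi_not_words:
  "u \<notin> words N p \<or> w \<notin> words N q \<Longrightarrow> snd (Phi N \<sigma> p q P \<II> \<gamma>) z (u, w) = 0"
  by (auto simp: Phi_def pf_sum_def pf_tensor_def case_prod_unfold Vpq_act_def intro!: sum.neutral)

lemma (in field_hom) mat_inv_map:
  assumes A: "A \<in> carrier_mat N N" "det A \<noteq> 0"
  shows "mat_inv (map_mat hom A) = map_mat hom (mat_inv A)"
proof (rule mat_inv_unique(1))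
  note inv = mat_inv_exists[OF A]
  show "map_mat hom A \<in> carrier_mat N N" "map_mat hom (mat_inv A) \<in> carrier_mat N N" using A(1) inv(1) by simp_all
  show "map_mat hom (mat_inv A) * map_mat hom A = 1\<^sub>m N"
    unfolding mat_hom_mult[OF inv(1) A(1), symmetric] inv(2) by (rule mat_hom_one)
qed

lemma first_columns_mat_cols: 
  assumes "\<And>k. k < N \<Longrightarrow> \<gamma> k \<in> carrier_mat N N"
  shows "first_columns N \<gamma> = mat_cols N (\<lambda>k. \<gamma> k *\<^sub>v unit_vec N 0)"
  using assms by (intro eq_matI) (auto simp: first_columns_def mat_cols_def mat_of_cols_index carrier_matD[OF assms])

context smoothing_data
begin

interpretation \<sigma>: field_hom \<sigma> by (rule hom)

lemma first_columns_cmat: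
  "\<forall>k<N. sel k \<in> J \<Longrightarrow> first_columns N (\<lambda>k. \<gamma> (sel k)) = cmat sel"
  unfolding cmat_def vcol_def by (rule first_columns_mat_cols) (simp add: \<gamma>D(1))

lemma inv_cmat_coords:
  assumes d: "det (cmat sel) \<noteq> 0" and z: "z \<in> carrier_vec N" and x: "x \<in> carrier_vec N" and k: "k < N"
  shows "(map_mat \<sigma> (mat_inv (cmat sel)) *\<^sub>v z) $ k + \<sigma> ((mat_inv (cmat sel) *\<^sub>v x) $ k) =
    lin_form N (\<lambda>k j. \<sigma> (mat_inv (cmat sel) $$ (k, j))) k (\<lambda>j. z $ j + \<sigma> (x $ j))"
  using mat_inv_exists(1)[OF cmat_carrier d] z x k
  by (simp add: lin_form_def scalar_prod_def lessThan_atLeast0 hom_distribs sum.distrib distrib_left)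

lemma ke_product_0:
  assumes "\<And>k. k < N \<Longrightarrow> z $ k + \<sigma> (x $ k) \<noteq> 0"
  shows "ke_product N E F z x 0 = (\<Prod>k<N. cnj (z $ k + \<sigma> (x $ k)) ^ F k) *
    (\<Prod>k<N. fact (E k) / (z $ k + \<sigma> (x $ k)) ^ (E k + 1))"
  unfolding ke_product_def prod.distrib[symmetric]
proof (rule prod.cong)
  fix k assume "k \<in> {..<N}"
  hence nz: "z $ k + \<sigma> (x $ k) \<noteq> 0" using assms by simp
  hence "complex_of_real (cmod (z $ k + \<sigma> (x $ k))) powr 0 = 1" by simp
  thus "fact (E k) * ke_term (- int (E k) - 1) (int (F k)) 0 (z $ k + \<sigma> (x $ k)) =
      cnj (z $ k + \<sigma> (x $ k)) ^ F k * (fact (E k) / (z $ k + \<sigma> (x $ k)) ^ (E k + 1))"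
    unfolding ke_term_quotient[OF nz, symmetric] by simp
qed simp

text \<open>The sum over words factors into entries of a matrix-vector product, in which the matrix
  undoes the passage to coordinates of \<open>X\<close>. So the antiholomorphic part does not depend
  on the matrix and becomes a common factor in the cocycle relation.\<close>

lemma conjugate_words:
  assumes d: "det (cmat sel) \<noteq> 0" and w: "w \<in> words N q" and X: "X \<in> carrier_vec N"
  shows "(\<Sum>w'\<in>words N q. (\<Prod>m<q. cnj (map_mat \<sigma> (cmat sel) $$ (w ! m, w' ! m))) *
      (\<Prod>k<N. cnj (lin_form N (\<lambda>k j. \<sigma> (mat_inv (cmat sel) $$ (k, j))) k (($) X)) ^ count_list w' k)) =
    (\<Prod>m<q. cnj (X $ (w ! m)))"
proof -
  let ?A = "map_mat \<sigma> (cmat sel)" and ?B = "map_mat \<sigma> (mat_inv (cmat sel))"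
  note inv = mat_inv_exists[OF cmat_carrier d]
  define y where "y k = lin_form N (\<lambda>k j. \<sigma> (mat_inv (cmat sel) $$ (k, j))) k (($) X)" for k
  have y: "y k = (?B *\<^sub>v X) $ k" if "k < N" for k
    using that inv(1) X by (simp add: y_def lin_form_def scalar_prod_def lessThan_atLeast0)
  have AB: "?A * ?B = 1\<^sub>m N"
    unfolding \<sigma>.mat_hom_mult[OF cmat_carrier inv(1), symmetric] inv(3) by (rule \<sigma>.mat_hom_one)
  have AX: "?A *\<^sub>v (?B *\<^sub>v X) = X"
    using assoc_mult_mat_vec[of ?A N N ?B N X] inv(1) X unfolding AB by simp
  have "(\<Sum>w'\<in>words N q. (\<Prod>m<q. cnj (?A $$ (w ! m, w' ! m))) * (\<Prod>k<N. cnj (y k) ^ count_list w' k)) =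
      (\<Sum>w'\<in>words N q. \<Prod>m<q. cnj (?A $$ (w ! m, w' ! m)) * cnj (y (w' ! m)))"
    by (intro sum.cong refl) (simp add: prod_power_count_list words_def prod.distrib)
  also have "\<dots> = (\<Prod>m<q. \<Sum>j<N. cnj (?A $$ (w ! m, j)) * cnj (y j))" by (rule sum_words_prod)
  also have "\<dots> = (\<Prod>m<q. cnj (X $ (w ! m)))"
  proof (rule prod.cong[OF refl])
    fix m assume "m \<in> {..<q}"
    hence m: "w ! m < N" using w by (force simp: words_def)
    have "(\<Sum>j<N. ?A $$ (w ! m, j) * y j) = (?A *\<^sub>v (?B *\<^sub>v X)) $ (w ! m)"
      using m inv(1) cmat_carrier[of sel] by (simp add: y scalar_prod_def lessThan_atLeast0)
    hence "cnj (\<Sum>j<N. ?A $$ (w ! m, j) * y j) = cnj (X $ (w ! m))" unfolding AX by simp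
    thus "(\<Sum>j<N. cnj (?A $$ (w ! m, j)) * cnj (y j)) = cnj (X $ (w ! m))" by simp
  qed
  finally show ?thesis unfolding y_def .
qed

text \<open>The domain of a Dedekind sum does not depend on its multi-indices, so one pair of them
  decides; the words \<open>u\<close> and \<open>w\<close> supply such a pair.\<close>

lemma Phi_domain:
  assumes d: "det (cmat sel) \<noteq> 0" and sel: "\<forall>k<N. sel k \<in> J"
    and z: "z \<in> fst (Phi N \<sigma> p q P \<II> (\<lambda>k. \<gamma> (sel k)))"
    and u: "u \<in> words N p" and w: "w \<in> words N q"
  shows "z \<in> carrier_vec N"
    "map_mat \<sigma> (mat_inv (cmat sel)) *\<^sub>v z \<in> hyperplane_compl N \<sigma> (mat_image (mat_inv (cmat sel)) \<Lambda>1)"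
    "map_mat \<sigma> (mat_inv (cmat sel)) *\<^sub>v z \<in> hyperplane_compl N \<sigma> (mat_image (mat_inv (cmat sel)) \<Lambda>0)"
proof -
  have "(count_list u, count_list w) \<in> multi_indices N p \<times> multi_indices N q"
    using u w by (simp add: count_list_multi_index)
  hence "z \<in> fst (dedekind_smoothed N \<sigma> P (count_list u) (count_list w) (cmat sel) \<II>)"
    using z unfolding Phi_def pf_sum_def pf_tensor_def first_columns_cmat[OF sel] by auto
  thus "z \<in> carrier_vec N"
    "map_mat \<sigma> (mat_inv (cmat sel)) *\<^sub>v z \<in> hyperplane_compl N \<sigma> (mat_image (mat_inv (cmat sel)) \<Lambda>1)"
    "map_mat \<sigma> (mat_inv (cmat sel)) *\<^sub>v z \<in> hyperplane_compl N \<sigma> (mat_image (mat_inv (cmat sel)) \<Lambda>0)"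
    using d by (simp_all add: dedekind_smoothed_def dedekind_def Let_def)
qed

lemma lin_form_nonzero:
  assumes d: "det (cmat sel) \<noteq> 0" and z: "z \<in> carrier_vec N"
    "map_mat \<sigma> (mat_inv (cmat sel)) *\<^sub>v z \<in> hyperplane_compl N \<sigma> (mat_image (mat_inv (cmat sel)) \<Lambda>1)"
    and x: "x \<in> \<Lambda>1" and k: "k < N"
  shows "lin_form N (\<lambda>k j. \<sigma> (mat_inv (cmat sel) $$ (k, j))) k (\<lambda>j. z $ j + \<sigma> (x $ j)) \<noteq> 0"
proof -
  note inv = mat_inv_exists[OF cmat_carrier d]
  have "det (mat_inv (cmat sel)) \<noteq> 0" by (rule mat_inv_unique(2)[OF inv(1) cmat_carrier inv(3)])
  then obtain b where b: "full_lattice N b (mat_image (mat_inv (cmat sel)) \<Lambda>1)"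
    using full_lattices(1) full_lattice_image[OF inv(1)] by metis
  show ?thesis
    unfolding inv_cmat_coords[OF d z(1) std_carrier[OF x] k, symmetric]
    using x by (intro hyperplane_compl_nonzero[OF b z(2) _ k]) blast
qed

text \<open>Combines \<open>Phi_words\<close> with \<open>regular_sum_KE\<close>. At
  \<open>s = 0\<close> the holomorphic factors add up over \<open>u'\<close> to
  \<open>word_derivative\<close>, the conjugate ones over \<open>w'\<close> to a product independent
  of \<open>sel\<close>.\<close>

theorem regular_sum_Phi:
  assumes d: "det (cmat sel) \<noteq> 0" and sel: "\<forall>k<N. sel k \<in> J"
    and z: "z \<in> fst (Phi N \<sigma> p q P \<II> (\<lambda>k. \<gamma> (sel k)))"
    and u: "u \<in> words N p" and w: "w \<in> words N q"
  shows "W.regular_sum (\<lambda>x. inverse (\<sigma> (det (cmat sel))) *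
      word_derivative N (\<lambda>k j. \<sigma> (mat_inv (cmat sel) $$ (k, j))) u (\<lambda>j. z $ j + \<sigma> (x $ j)) *
      (\<Prod>m<q. cnj (z $ (w ! m) + \<sigma> (x $ (w ! m)))))
    (snd (Phi N \<sigma> p q P \<II> (\<lambda>k. \<gamma> (sel k))) z (u, w))"
proof -
  define A where "A = cmat sel"
  define B where "B = mat_inv A"
  define b where "b = (\<lambda>k j. \<sigma> (B $$ (k, j)))"
  define z' where "z' = map_mat \<sigma> B *\<^sub>v z"
  define c where "c u' w' = (\<Prod>m<p. mat_inv (map_mat \<sigma> A) $$ (u' ! m, u ! m)) *
    (\<Prod>m<q. cnj (map_mat \<sigma> A $$ (w ! m, w' ! m)))" for u' w'
  define V where "V u' w' = KE N \<sigma> (count_list u') (count_list w') z' (mat_image B \<Lambda>1) -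
    of_nat (ideal_norm P) * KE N \<sigma> (count_list u') (count_list w') z' (mat_image B \<Lambda>0)" for u' w'
  note dom = Phi_domain[OF d sel z u w, folded A_def, folded B_def, folded z'_def]
  have dA: "det A \<noteq> 0" and Ac: "A \<in> carrier_mat N N" using d by (simp_all add: A_def)
  note inv = mat_inv_exists[OF Ac dA, folded B_def]
  have val: "snd (Phi N \<sigma> p q P \<II> (\<lambda>k. \<gamma> (sel k))) z (u, w) =
      (\<Sum>u'\<in>words N p. \<Sum>w'\<in>words N q. c u' w' * (inverse (\<sigma> (det A)) * V u' w'))"
    unfolding Phi_words[OF u w] first_columns_cmat[OF sel] A_def[symmetric] c_def[symmetric]
    using dA by (simp add: dedekind_smoothed_def dedekind_def Let_def V_def B_def z'_def right_diff_distrib mult_ac)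
  have "W.regular_sum (\<lambda>x. \<Sum>u'\<in>words N p. \<Sum>w'\<in>words N q. c u' w' * (inverse (\<sigma> (det A)) *
      ke_product N (count_list u') (count_list w') z' (B *\<^sub>v x) 0))
    (snd (Phi N \<sigma> p q P \<II> (\<lambda>k. \<gamma> (sel k))) z (u, w))"
    unfolding val V_def using dom
    by (intro W.regular_sum_sum W.regular_sum_cmult regular_sum_KE[OF d sel, folded A_def, folded B_def]) auto
  thus ?thesis
  proof (rule W.regular_sum_cong)
    fix x assume x: "x \<in> \<Lambda>1"
    define X where "X = z + map_vec \<sigma> x"
    have X: "X \<in> carrier_vec N" using dom(1) std_carrier[OF x] by (simp add: X_def)
    have Xk: "X $ k = z $ k + \<sigma> (x $ k)" if "k < N" for k
      using that dom(1) std_carrier[OF x] by (simp add: X_def)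
    define y where "y k = lin_form N b k (($) X)" for k
    have yX: "y k = lin_form N b k (\<lambda>j. z $ j + \<sigma> (x $ j))" for k
      by (simp add: y_def lin_form_def Xk)
    have yk: "z' $ k + \<sigma> ((B *\<^sub>v x) $ k) = y k" if "k < N" for k
      using inv_cmat_coords[OF d dom(1) std_carrier[OF x] that]
      by (simp add: yX z'_def B_def A_def b_def)
    have nz: "y k \<noteq> 0" if "k < N" for k
      using lin_form_nonzero[OF d dom(1) _ x that] dom(2) by (simp add: yX z'_def B_def A_def b_def)
    have ke: "ke_product N E F z' (B *\<^sub>v x) 0 = (\<Prod>k<N. cnj (y k) ^ F k) * (\<Prod>k<N. fact (E k) / y k ^ (E k + 1))" for E F
    proof -
      have "ke_product N E F z' (B *\<^sub>v x) 0 = (\<Prod>k<N. cnj (z' $ k + \<sigma> ((B *\<^sub>v x) $ k)) ^ F k) *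
          (\<Prod>k<N. fact (E k) / (z' $ k + \<sigma> ((B *\<^sub>v x) $ k)) ^ (E k + 1))"
        by (rule ke_product_0) (simp add: yk nz)
      thus ?thesis by (simp add: yk)
    qed
    have lu: "length u = p" using u by (simp add: words_def)
    have mi: "mat_inv (map_mat \<sigma> A) $$ (u' ! m, u ! m) = b (u' ! m) (u ! m)"
      if "u' \<in> words N p" "m < p" for u' m
    proof -
      have "u' ! m < N" "u ! m < N" using u that by (force simp: words_def)+
      thus ?thesis using inv(1) unfolding \<sigma>.mat_inv_map[OF Ac dA] B_def[symmetric] by (simp add: b_def)
    qed
    have "(\<Sum>u'\<in>words N p. \<Sum>w'\<in>words N q. c u' w' * (inverse (\<sigma> (det A)) *
        ke_product N (count_list u') (count_list w') z' (B *\<^sub>v x) 0)) =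
      (\<Sum>u'\<in>words N p. inverse (\<sigma> (det A)) * (\<Prod>m<p. b (u' ! m) (u ! m)) * (\<Prod>k<N. fact (count_list u' k) / y k ^ (count_list u' k + 1)) *
        (\<Sum>w'\<in>words N q. (\<Prod>m<q. cnj (map_mat \<sigma> A $$ (w ! m, w' ! m))) * (\<Prod>k<N. cnj (y k) ^ count_list w' k)))"
      unfolding sum_distrib_left c_def ke by (intro sum.cong refl) (simp add: mi mult_ac)
    also have "(\<Sum>w'\<in>words N q. (\<Prod>m<q. cnj (map_mat \<sigma> A $$ (w ! m, w' ! m))) * (\<Prod>k<N. cnj (y k) ^ count_list w' k)) =
        (\<Prod>m<q. cnj (X $ (w ! m)))"
      using conjugate_words[OF d w X] unfolding y_def b_def B_def A_def .
    also have "(\<Sum>u'\<in>words N p. inverse (\<sigma> (det A)) * (\<Prod>m<p. b (u' ! m) (u ! m)) *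
        (\<Prod>k<N. fact (count_list u' k) / y k ^ (count_list u' k + 1)) * (\<Prod>m<q. cnj (X $ (w ! m)))) =
      inverse (\<sigma> (det A)) * word_derivative N b u (\<lambda>j. z $ j + \<sigma> (x $ j)) * (\<Prod>m<q. cnj (X $ (w ! m)))"
      unfolding word_derivative_def lu yX sum_distrib_left sum_distrib_right
      by (intro sum.cong refl) (simp only: mult.assoc)
    also have "(\<Prod>m<q. cnj (X $ (w ! m))) = (\<Prod>m<q. cnj (z $ (w ! m) + \<sigma> (x $ (w ! m))))"
    proof (rule prod.cong[OF refl])
      fix m assume "m \<in> {..<q}"
      hence "w ! m < N" using w by (force simp: words_def)
      thus "cnj (X $ (w ! m)) = cnj (z $ (w ! m) + \<sigma> (x $ (w ! m)))" by (simp add: Xk)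
    qed
    finally show "(\<Sum>u'\<in>words N p. \<Sum>w'\<in>words N q. c u' w' * (inverse (\<sigma> (det A)) *
        ke_product N (count_list u') (count_list w') z' (B *\<^sub>v x) 0)) =
      inverse (\<sigma> (det (cmat sel))) *
        word_derivative N (\<lambda>k j. \<sigma> (mat_inv (cmat sel) $$ (k, j))) u (\<lambda>j. z $ j + \<sigma> (x $ j)) *
        (\<Prod>m<q. cnj (z $ (w ! m) + \<sigma> (x $ (w ! m))))"
      unfolding A_def B_def b_def .
  qed
qed

lemma Phi_singular:
  assumes "det (cmat sel) = 0" and sel: "\<forall>k<N. sel k \<in> J"
  shows "snd (Phi N \<sigma> p q P \<II> (\<lambda>k. \<gamma> (sel k))) z m = 0"
  using assms(1) by (simp add: Phi_def pf_sum_def pf_tensor_def case_prod_unfold first_columns_cmat[OF sel]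
    dedekind_smoothed_def dedekind_def Let_def)

lemma vcol_nonzero:
  assumes "j \<in> J"
  shows "\<exists>r<N. vcol j $ r \<noteq> 0"
proof (rule ccontr)
  assume "\<not> ?thesis"
  hence "\<gamma> j *\<^sub>v unit_vec N 0 = \<gamma> j *\<^sub>v 0\<^sub>v N"
    unfolding vcol_def[symmetric] using vcol_carrier[OF assms] \<gamma>D(1)[OF assms] by (intro eq_vecI) auto
  from mat_mult_inj[OF \<gamma>D(1,2)[OF assms] _ _ this] have "unit_vec N 0 = (0\<^sub>v N :: 'k vec)" by simp
  from arg_cong[OF this, of "\<lambda>v. v $ 0"] show False using N by simp
qed

end

text \<open>All \<open>N + 1\<close> values are regularised against the same weight and directions.
  So each coefficient of the alternating sum is a regularised sum of the alternating sum of the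
  summands, which vanishes point by point by \<open>word_derivative_relation\<close>.\<close>

theorem (in smoothing_data) Phi_cocycle:
  assumes J: "J = e ` {..N}"
  shows "pf_eq (pf_sum N {..N} (\<lambda>i. pf_scale ((-1) ^ i) (Phi N \<sigma> p q P \<II> (omit i (\<lambda>k. \<gamma> (e k))))))
    (pf_zero N)"
proof -
  interpret \<sigma>: field_hom \<sigma> by (rule hom)
  define sel where "sel i k = e (skip i k)" for i k
  have sel: "\<forall>k<N. sel i k \<in> J" if "i \<le> N" for i
    using bij_betw_skip[OF that] unfolding J sel_def bij_betw_def by blast
  have om: "omit i (\<lambda>k. \<gamma> (e k)) = (\<lambda>k. \<gamma> (sel i k))" for i by (rule ext) (simp add: omit_skip sel_def)
  define v where "v k = map_vec \<sigma> (vcol (e k))" for k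
  have vJ: "e k \<in> J" if "k \<le> N" for k using that J by blast
  have cm: "mat_cols N (omit i v) = map_mat \<sigma> (cmat (sel i))" if "i \<le> N" for i
  proof -
    have "dim_vec (vcol (sel i k)) = N" if "k < N" for k
      using vcol_carrier sel[OF \<open>i \<le> N\<close>] that carrier_vecD by blast
    thus ?thesis by (intro eq_matI) (auto simp: mat_cols_def cmat_def omit_skip v_def sel_def)
  qed
  have dt: "det (mat_cols N (omit i v)) = \<sigma> (det (cmat (sel i)))" if "i \<le> N" for i
    unfolding cm[OF that] by (rule \<sigma>.hom_det)
  \<comment> \<open>Matrices of determinant 0 contribute 0 by the convention for Dedekind sums; they
    are likewise absent from \<open>rational_cocycle\<close>.\<close>
  define I where "I = {i. i \<le> N \<and> det (cmat (sel i)) \<noteq> 0}"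
  have I_eq: "{i. i \<le> N \<and> det (mat_cols N (omit i v)) \<noteq> 0} = I" using dt by (auto simp: I_def)
  define b where "b i k j = \<sigma> (mat_inv (cmat (sel i)) $$ (k, j))" for i k j
  define d where "d i = (-1) ^ i * inverse (\<sigma> (det (cmat (sel i))))" for i
  have coords: "(mat_inv (mat_cols N (omit i v)) *\<^sub>v vec N x) $ k = lin_form N (b i) k x"
    if "i \<in> I" "k < N" for i k x
  proof -
    have i: "i \<le> N" "det (cmat (sel i)) \<noteq> 0" using that by (simp_all add: I_def)
    show ?thesis
      unfolding cm[OF i(1)] \<sigma>.mat_inv_map[OF cmat_carrier i(2)]
      using mat_inv_exists(1)[OF cmat_carrier i(2)] that(2)
      by (simp add: lin_form_def b_def scalar_prod_def lessThan_atLeast0)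
  qed
  \<comment> \<open>Established for every complex point off the zeros of the forms, not only for the
    points \<open>z + \<sigma> x\<close>, since it will be differentiated.\<close>
  have base: "(\<Sum>i\<in>I. d i / (\<Prod>k<N. lin_form N (b i) k x)) = 0"
    if off: "\<And>i k. i \<in> I \<Longrightarrow> k < N \<Longrightarrow> lin_form N (b i) k x \<noteq> 0" for x
  proof -
    have "(\<Sum>i\<in>{i. i \<le> N \<and> det (mat_cols N (omit i v)) \<noteq> 0}. (-1) ^ i / (det (mat_cols N (omit i v)) *
        (\<Prod>k<N. (mat_inv (mat_cols N (omit i v)) *\<^sub>v vec N x) $ k))) = 0"
    proof (rule rational_cocycle)
      fix i k assume "i \<le> N" "det (mat_cols N (omit i v)) \<noteq> 0" "k < N"
      hence "i \<in> I" using I_eq by blast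
      thus "(mat_inv (mat_cols N (omit i v)) *\<^sub>v vec N x) $ k \<noteq> 0"
        using coords[OF _ \<open>k < N\<close>] off \<open>k < N\<close> by simp
    next
      fix k assume "k \<le> N"
      then obtain r where "r < N" "vcol (e k) $ r \<noteq> 0" using vcol_nonzero[OF vJ] by blast
      thus "\<exists>r<N. v k $ r \<noteq> 0"
        using vcol_carrier[OF vJ[OF \<open>k \<le> N\<close>]] by (intro exI[of _ r]) (simp add: v_def)
    qed simp
    also have "(\<Sum>i\<in>{i. i \<le> N \<and> det (mat_cols N (omit i v)) \<noteq> 0}. (-1) ^ i / (det (mat_cols N (omit i v)) *
        (\<Prod>k<N. (mat_inv (mat_cols N (omit i v)) *\<^sub>v vec N x) $ k))) = (\<Sum>i\<in>I. d i / (\<Prod>k<N. lin_form N (b i) k x))"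
      unfolding I_eq
    proof (rule sum.cong[OF refl])
      fix i assume i: "i \<in> I"
      hence "i \<le> N" by (simp add: I_def)
      thus "(-1) ^ i / (det (mat_cols N (omit i v)) * (\<Prod>k<N. (mat_inv (mat_cols N (omit i v)) *\<^sub>v vec N x) $ k)) =
          d i / (\<Prod>k<N. lin_form N (b i) k x)"
        using coords[OF i] by (simp add: dt d_def divide_inverse)
    qed
    finally show ?thesis .
  qed
  have "(\<Sum>i\<le>N. (-1) ^ i * snd (Phi N \<sigma> p q P \<II> (\<lambda>k. \<gamma> (sel i k))) z m) = 0"
    if z: "\<And>i. i \<le> N \<Longrightarrow> z \<in> fst (Phi N \<sigma> p q P \<II> (\<lambda>k. \<gamma> (sel i k)))" for z m
  proof (cases "fst m \<in> words N p \<and> snd m \<in> words N q")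
    case False
    hence "snd (Phi N \<sigma> p q P \<II> (\<lambda>k. \<gamma> (sel i k))) z m = 0" for i
      using Phi_not_words[of "fst m" N p "snd m" q] by simp
    thus ?thesis by simp
  next
    case True
    define u w where "u = fst m" and "w = snd m"
    have m: "m = (u, w)" and u: "u \<in> words N p" and w: "w \<in> words N q" using True by (simp_all add: u_def w_def)
    define S where "S = (\<Sum>i\<in>I. (-1) ^ i * snd (Phi N \<sigma> p q P \<II> (\<lambda>k. \<gamma> (sel i k))) z (u, w))"
    define h where "h i x = inverse (\<sigma> (det (cmat (sel i)))) * word_derivative N (b i) u (\<lambda>j. z $ j + \<sigma> (x $ j)) *
      (\<Prod>m<q. cnj (z $ (w ! m) + \<sigma> (x $ (w ! m))))" for i x
    have "W.regular_sum (h i) (snd (Phi N \<sigma> p q P \<II> (\<lambda>k. \<gamma> (sel i k))) z (u, w))" if "i \<in> I" for i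
    proof -
      have i: "i \<le> N" "det (cmat (sel i)) \<noteq> 0" using that by (simp_all add: I_def)
      show ?thesis
        using regular_sum_Phi[OF i(2) sel[OF i(1)] z[OF i(1)] u w]
        unfolding h_def[abs_def] b_def[abs_def] by simp
    qed
    hence "W.regular_sum (\<lambda>x. \<Sum>i\<in>I. (-1) ^ i * h i x) S"
      unfolding S_def by (intro W.regular_sum_sum W.regular_sum_cmult)
    moreover have "(\<Sum>i\<in>I. (-1) ^ i * h i x) = 0" if x: "x \<in> \<Lambda>1" for x
    proof -
      have "lin_form N (b i) k (\<lambda>j. z $ j + \<sigma> (x $ j)) \<noteq> 0" if "i \<in> I" "k < N" for i k
      proof -
        have i: "i \<le> N" "det (cmat (sel i)) \<noteq> 0" using that by (simp_all add: I_def)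
        note dom = Phi_domain[OF i(2) sel[OF i(1)] z[OF i(1)] u w]
        show ?thesis using lin_form_nonzero[OF i(2) dom(1,2) x that(2)] unfolding b_def[abs_def] by simp
      qed
      hence "(\<Sum>i\<in>I. d i * word_derivative N (b i) u (\<lambda>j. z $ j + \<sigma> (x $ j))) = 0"
        using u base by (intro word_derivative_relation) (auto simp: I_def words_def)
      moreover have "(\<Sum>i\<in>I. (-1) ^ i * h i x) = (\<Sum>i\<in>I. d i * word_derivative N (b i) u (\<lambda>j. z $ j + \<sigma> (x $ j))) *
          (\<Prod>m<q. cnj (z $ (w ! m) + \<sigma> (x $ (w ! m))))"
        unfolding sum_distrib_right by (intro sum.cong refl) (simp add: h_def d_def mult_ac)
      ultimately show ?thesis by simp
    qed
    ultimately have "S = 0" by (rule W.regular_sum_vanishes)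
    moreover have "(\<Sum>i\<le>N. (-1) ^ i * snd (Phi N \<sigma> p q P \<II> (\<lambda>k. \<gamma> (sel i k))) z m) = S"
      unfolding S_def m
    proof (rule sum.mono_neutral_right)
      show "\<forall>i\<in>{..N} - I. (-1) ^ i * snd (Phi N \<sigma> p q P \<II> (\<lambda>k. \<gamma> (sel i k))) z (u, w) = 0"
      proof
        fix i assume "i \<in> {..N} - I"
        hence "i \<le> N" "det (cmat (sel i)) = 0" by (auto simp: I_def)
        from Phi_singular[OF this(2) sel[OF this(1)]]
        show "(-1) ^ i * snd (Phi N \<sigma> p q P \<II> (\<lambda>k. \<gamma> (sel i k))) z (u, w) = 0" by simp
      qed
    qed (auto simp: I_def)
    ultimately show ?thesis by simp
  qed
  thus ?thesis unfolding pf_eq_def pf_sum_def pf_scale_def pf_zero_def om by (auto simp: fun_eq_iff)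
qed

section \<open>The coefficient space\<close>

lemma sum_swap3:
  "(\<Sum>a\<in>X. \<Sum>c\<in>Y. \<Sum>d\<in>Z. f a c d) = (\<Sum>c\<in>Y. \<Sum>d\<in>Z. \<Sum>a\<in>X. f a c d)"
  by (subst sum.swap, rule sum.cong[OF refl], rule sum.swap)

lemma mat_mult_entry:
  assumes "A \<in> carrier_mat N N" "B \<in> carrier_mat N N" "i < N" "j < N"
  shows "(A * B) $$ (i, j) = (\<Sum>k<N. A $$ (i, k) * B $$ (k, j))"
  using assms by (simp add: scalar_prod_def lessThan_atLeast0)

lemma mat_inv_mult:
  fixes A B :: "'a :: field mat"
  assumes A: "A \<in> carrier_mat N N" "det A \<noteq> 0" and B: "B \<in> carrier_mat N N" "det B \<noteq> 0"
  shows "mat_inv (A * B) = mat_inv B * mat_inv A"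
proof (rule mat_inv_unique(1))
  note a = mat_inv_exists[OF A] and b = mat_inv_exists[OF B]
  show "A * B \<in> carrier_mat N N" "mat_inv B * mat_inv A \<in> carrier_mat N N" using A B a b by auto
  have "mat_inv B * mat_inv A * (A * B) = mat_inv B * (mat_inv A * (A * B))"
    using A B a b by (intro assoc_mult_mat) auto
  also have "mat_inv A * (A * B) = mat_inv A * A * B" using A B a b by (intro assoc_mult_mat[symmetric]) auto
  finally show "mat_inv B * mat_inv A * (A * B) = 1\<^sub>m N" using A B a b by simp
qed

text \<open>Sums over intermediate words factor letter by letter into matrix products; on the dual
  side the reversed order in the inverse of \<open>g * A\<close> matches the transposed
  indices.\<close>

lemma Vpq_act_mult:
  assumes g: "g \<in> carrier_mat N N" "det g \<noteq> 0" and A: "A \<in> carrier_mat N N" "det A \<noteq> 0"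
  shows "Vpq_act N p q (g * A) T = Vpq_act N p q g (Vpq_act N p q A T)"
proof (rule ext)
  fix m :: "nat list \<times> nat list"
  obtain u w where m: "m = (u, w)" by (cases m)
  note gi = mat_inv_exists(1)[OF g] and Ai = mat_inv_exists(1)[OF A]
  show "Vpq_act N p q (g * A) T m = Vpq_act N p q g (Vpq_act N p q A T) m"
  proof (cases "u \<in> words N p \<and> w \<in> words N q")
    case True
    define a where "a u' = (\<Prod>m<p. mat_inv g $$ (u' ! m, u ! m))" for u'
    define b where "b w' = (\<Prod>m<q. cnj (g $$ (w ! m, w' ! m)))" for w'
    define c where "c u'' u' = (\<Prod>m<p. mat_inv A $$ (u'' ! m, u' ! m))" for u'' u'
    define d where "d w'' w' = (\<Prod>m<q. cnj (A $$ (w' ! m, w'' ! m)))" for w'' w'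
    have "x ! i < N" if "x \<in> words N r" "i < r" for x r i using that by (force simp: words_def)
    note nth = this[where r = p] this[where r = q]
    have ac: "(\<Sum>u'\<in>words N p. a u' * c u'' u') = (\<Prod>m<p. mat_inv (g * A) $$ (u'' ! m, u ! m))"
      if u'': "u'' \<in> words N p" for u''
    proof -
      have "(\<Sum>u'\<in>words N p. a u' * c u'' u') = (\<Prod>m<p. \<Sum>j<N. mat_inv g $$ (j, u ! m) * mat_inv A $$ (u'' ! m, j))"
        unfolding a_def c_def prod.distrib[symmetric]
        by (rule sum_words_prod[of "\<lambda>m j. mat_inv g $$ (j, u ! m) * mat_inv A $$ (u'' ! m, j)"])
      also have "\<dots> = (\<Prod>m<p. mat_inv (g * A) $$ (u'' ! m, u ! m))"
        unfolding mat_inv_mult[OF g A] using True u''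
        by (intro prod.cong refl) (simp add: mat_mult_entry[OF Ai gi] nth mult.commute)
      finally show ?thesis .
    qed
    have bd: "(\<Sum>w'\<in>words N q. b w' * d w'' w') = (\<Prod>m<q. cnj ((g * A) $$ (w ! m, w'' ! m)))"
      if w'': "w'' \<in> words N q" for w''
    proof -
      have "(\<Sum>w'\<in>words N q. b w' * d w'' w') = (\<Prod>m<q. \<Sum>j<N. cnj (g $$ (w ! m, j)) * cnj (A $$ (j, w'' ! m)))"
        unfolding b_def d_def prod.distrib[symmetric]
        by (rule sum_words_prod[of "\<lambda>m j. cnj (g $$ (w ! m, j)) * cnj (A $$ (j, w'' ! m))"])
      also have "\<dots> = (\<Prod>m<q. cnj ((g * A) $$ (w ! m, w'' ! m)))"
        using True w'' by (intro prod.cong refl) (simp add: mat_mult_entry[OF g(1) A(1)] nth)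
      finally show ?thesis .
    qed
    have "Vpq_act N p q g (Vpq_act N p q A T) m = (\<Sum>u'\<in>words N p. \<Sum>w'\<in>words N q. a u' * b w' *
        (\<Sum>u''\<in>words N p. \<Sum>w''\<in>words N q. c u'' u' * d w'' w' * T (u'', w'')))"
      using True by (simp add: Vpq_act_def m a_def b_def c_def d_def)
    also have "\<dots> = (\<Sum>u'\<in>words N p. \<Sum>w'\<in>words N q. \<Sum>u''\<in>words N p. \<Sum>w''\<in>words N q.
        a u' * c u'' u' * (b w' * d w'' w') * T (u'', w''))"
      unfolding sum_distrib_left by (intro sum.cong refl) (simp add: mult_ac)
    also have "\<dots> = (\<Sum>u'\<in>words N p. \<Sum>u''\<in>words N p. \<Sum>w''\<in>words N q. \<Sum>w'\<in>words N q.
        a u' * c u'' u' * (b w' * d w'' w') * T (u'', w''))"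
      by (rule sum.cong[OF refl], rule sum_swap3)
    also have "\<dots> = (\<Sum>u''\<in>words N p. \<Sum>w''\<in>words N q. \<Sum>u'\<in>words N p. \<Sum>w'\<in>words N q.
        a u' * c u'' u' * (b w' * d w'' w') * T (u'', w''))"
      by (rule sum_swap3)
    also have "\<dots> = (\<Sum>u''\<in>words N p. \<Sum>w''\<in>words N q.
        (\<Sum>u'\<in>words N p. a u' * c u'' u') * (\<Sum>w'\<in>words N q. b w' * d w'' w') * T (u'', w''))"
      unfolding sum_product by (simp only: sum_distrib_right)
    also have "\<dots> = Vpq_act N p q (g * A) T m"
      using True by (simp add: Vpq_act_def m ac bd)
    finally show ?thesis ..
  next
    case False
    thus ?thesis by (auto simp: Vpq_act_def m)
  qed
qed

lemma Vpq_act_sum: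
  "Vpq_act N p q g (\<lambda>m. \<Sum>i\<in>X. c i * T i m) m = (\<Sum>i\<in>X. c i * Vpq_act N p q g (T i) m)"
proof -
  obtain u w where m: "m = (u, w)" by (cases m)
  show ?thesis
  proof (cases "u \<in> words N p \<and> w \<in> words N q")
    case True
    define a where "a u' w' = (\<Prod>m<p. mat_inv g $$ (u' ! m, u ! m)) * (\<Prod>m<q. cnj (g $$ (w ! m, w' ! m)))" for u' w'
    have act: "Vpq_act N p q g T' m = (\<Sum>u'\<in>words N p. \<Sum>w'\<in>words N q. a u' w' * T' (u', w'))" for T'
      using True by (simp add: Vpq_act_def m a_def)
    have "Vpq_act N p q g (\<lambda>m. \<Sum>i\<in>X. c i * T i m) m =
        (\<Sum>u'\<in>words N p. \<Sum>w'\<in>words N q. \<Sum>i\<in>X. c i * (a u' w' * T i (u', w')))"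
      unfolding act sum_distrib_left by (intro sum.cong refl) (rule mult.left_commute)
    also have "\<dots> = (\<Sum>i\<in>X. \<Sum>u'\<in>words N p. \<Sum>w'\<in>words N q. c i * (a u' w' * T i (u', w')))"
      by (rule sum_swap3[symmetric])
    also have "\<dots> = (\<Sum>i\<in>X. c i * Vpq_act N p q g (T i) m)"
      unfolding act sum_distrib_left ..
    finally show ?thesis .
  next
    case False
    hence "Vpq_act N p q g T' m = 0" for T' by (auto simp: Vpq_act_def m)
    thus ?thesis by simp
  qed
qed

text \<open>If \<open>u\<close> is the rearrangement of \<open>v\<close> by \<pi>, rearrange the
  summation word \<open>u'\<close> in the same way: the product only permutes its factors, and the
  symmetric \<open>t\<close> does not change.\<close>

lemma sum_words_symmetric:
  fixes f :: "nat \<Rightarrow> nat \<Rightarrow> complex"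
  assumes mset: "mset u = mset v" and v: "length v = p"
    and t: "\<And>a b. mset a = mset b \<Longrightarrow> t a = t b"
  shows "(\<Sum>u'\<in>words N p. (\<Prod>m<p. f (u' ! m) (u ! m)) * t u') = (\<Sum>u'\<in>words N p. (\<Prod>m<p. f (u' ! m) (v ! m)) * t u')"
proof -
  obtain \<pi> where \<pi>: "\<pi> permutes {..<length v}" "permute_list \<pi> v = u" using mset_eq_permutation[OF mset] .
  have \<pi>p: "\<pi> permutes {..<p}" using \<pi>(1) v by simp
  note \<pi>i = permutes_inv[OF \<pi>p]
  have "(\<Sum>u'\<in>words N p. (\<Prod>m<p. f (u' ! m) (v ! m)) * t u') = (\<Sum>u'\<in>words N p. (\<Prod>m<p. f (u' ! m) (u ! m)) * t u')"
  proof (rule sum.reindex_bij_witness[where i = "permute_list (inv_into UNIV \<pi>)" and j = "permute_list \<pi>"])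
    fix a assume a: "a \<in> words N p"
    have len: "length a = p" using a by (simp add: words_def)
    show "permute_list (inv_into UNIV \<pi>) (permute_list \<pi> a) = a"
      unfolding permute_list_compose[of "inv_into UNIV \<pi>" a \<pi>, unfolded len, OF \<pi>i, symmetric] permutes_inv_o[OF \<pi>p]
      by (rule permute_list_id)
    show "permute_list \<pi> (permute_list (inv_into UNIV \<pi>) a) = a"
      unfolding permute_list_compose[of \<pi> a "inv_into UNIV \<pi>", unfolded len, OF \<pi>p, symmetric] permutes_inv_o[OF \<pi>p]
      by (rule permute_list_id)
    show "permute_list \<pi> a \<in> words N p" "permute_list (inv_into UNIV \<pi>) a \<in> words N p"
      using a len \<pi>p \<pi>i by (simp_all add: words_def)
    have "(\<Prod>m<p. f (permute_list \<pi> a ! m) (u ! m)) = (\<Prod>m<p. f (a ! \<pi> m) (v ! \<pi> m))"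
      unfolding \<pi>(2)[symmetric] using \<pi>p len v by (intro prod.cong refl) (simp add: permute_list_nth)
    also have "\<dots> = (\<Prod>m<p. f (a ! m) (v ! m))"
      by (subst prod.permute[OF \<pi>p, of "\<lambda>m. f (a ! m) (v ! m)"]) (simp add: o_def)
    finally show "(\<Prod>m<p. f (permute_list \<pi> a ! m) (u ! m)) * t (permute_list \<pi> a) = (\<Prod>m<p. f (a ! m) (v ! m)) * t a"
      using t[of "permute_list \<pi> a" a] \<pi>p len by simp
  qed
  thus ?thesis ..
qed

lemma words_mset:
  assumes "mset u = mset u'"
  shows "u \<in> words N p \<longleftrightarrow> u' \<in> words N p"
  using mset_eq_length[OF assms] mset_eq_setD[OF assms] by (simp add: words_def)

lemma VpqI:
  assumes "\<And>u w. (u, w) \<notin> words N p \<times> words N q \<Longrightarrow> T (u, w) = 0"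
    and "\<And>u w u' w'. mset u = mset u' \<Longrightarrow> mset w = mset w' \<Longrightarrow> T (u, w) = T (u', w')"
  shows "T \<in> Vpq N p q"
  unfolding Vpq_def mem_Collect_eq by (intro conjI allI impI) (erule assms(1), erule conjE, rule assms(2))

lemma Vpq_act_Vpq:
  assumes T: "T \<in> Vpq N p q"
  shows "Vpq_act N p q A T \<in> Vpq N p q"
proof -
  have sym: "T (u, w) = T (u', w')" if "mset u = mset u'" "mset w = mset w'" for u w u' w'
    using T that unfolding Vpq_def by blast
  have main: "Vpq_act N p q A T (u, w) = Vpq_act N p q A T (u', w')" if m: "mset u = mset u'" "mset w = mset w'" for u w u' w'
  proof (cases "u \<in> words N p \<and> w \<in> words N q")
    case True
    hence True': "u' \<in> words N p" "w' \<in> words N q" using words_mset m by blast+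
    hence len: "length u' = p" "length w' = q" by (simp_all add: words_def)
    let ?I = "\<lambda>u u'. \<Prod>m<p. mat_inv A $$ (u' ! m, u ! m)"
      and ?C = "\<lambda>w w'. \<Prod>m<q. cnj (A $$ (w ! m, w' ! m))"
    have "Vpq_act N p q A T (u, w) = (\<Sum>a\<in>words N p. ?I u a * (\<Sum>b\<in>words N q. ?C w b * T (a, b)))"
      using True by (simp add: Vpq_act_def sum_distrib_left mult_ac)
    also have "\<dots> = (\<Sum>a\<in>words N p. ?I u' a * (\<Sum>b\<in>words N q. ?C w b * T (a, b)))"
      by (rule sum_words_symmetric[OF m(1) len(1), where f = "\<lambda>i j. mat_inv A $$ (i, j)"])
         (rule sum.cong[OF refl], rule arg_cong[where f = "(*) _"], rule sym[OF _ refl])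
    also have "\<dots> = (\<Sum>a\<in>words N p. ?I u' a * (\<Sum>b\<in>words N q. ?C w' b * T (a, b)))"
      by (rule sum.cong[OF refl], rule arg_cong[where f = "(*) _"],
        rule sum_words_symmetric[OF m(2) len(2), where f = "\<lambda>i j. cnj (A $$ (j, i))"], rule sym[OF refl])
    also have "\<dots> = Vpq_act N p q A T (u', w')"
      using True' by (simp add: Vpq_act_def sum_distrib_left mult_ac)
    finally show ?thesis .
  next
    case False
    moreover have "\<not> (u' \<in> words N p \<and> w' \<in> words N q)" using words_mset[OF m(1)] words_mset[OF m(2)] False by blast
    ultimately show ?thesis by (auto simp: Vpq_act_def)
  qed
  show ?thesis
  proof (rule VpqI)
    show "Vpq_act N p q A T (u, w) = 0" if "(u, w) \<notin> words N p \<times> words N q" for u w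
      using that by (auto simp: Vpq_act_def)
  qed (rule main)
qed

lemma Vpq_basis_Vpq:
  assumes I: "I \<in> multi_indices N p" and J: "J \<in> multi_indices N q"
  shows "Vpq_basis N I J \<in> Vpq N p q"
proof -
  have len: "length u = p" if "set u \<subseteq> {..<N}" "\<forall>k<N. count_list u k = I k" "I \<in> multi_indices N p" for u I p
  proof -
    have "length u = (\<Sum>k<N. count_list u k)" using sum_count_set[OF that(1)] by simp
    also have "\<dots> = p" using that(2,3) by (simp add: multi_indices_def)
    finally show ?thesis .
  qed
  have 1: "Vpq_basis N I J (u, w) = 0" if "(u, w) \<notin> words N p \<times> words N q" for u w
    using that len[OF _ _ I, of u] len[OF _ _ J, of w] by (auto simp: Vpq_basis_def words_def)
  have 2: "Vpq_basis N I J (u, w) = Vpq_basis N I J (u', w')" if m: "mset u = mset u'" "mset w = mset w'" for u w u' w'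
  proof -
    have "count_list u = count_list u'" "count_list w = count_list w'"
      using m by (simp_all add: fun_eq_iff count_mset[symmetric])
    thus ?thesis using mset_eq_setD[OF m(1)] mset_eq_setD[OF m(2)] by (simp add: Vpq_basis_def)
  qed
  show ?thesis
  proof (rule VpqI)
    show "Vpq_basis N I J (u, w) = 0" if "(u, w) \<notin> words N p \<times> words N q" for u w by (rule 1[OF that])
  qed (rule 2)
qed

lemma Vpq_scale: "T \<in> Vpq N p q \<Longrightarrow> (\<lambda>m. c * T m) \<in> Vpq N p q"
proof (rule VpqI)
  assume T: "T \<in> Vpq N p q"
  show "c * T (u, w) = 0" if "(u, w) \<notin> words N p \<times> words N q" for u w
    using T that unfolding Vpq_def by simp
  show "c * T (u, w) = c * T (u', w')" if "mset u = mset u'" "mset w = mset w'" for u w u' w'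
  proof -
    have "T (u, w) = T (u', w')" using T that unfolding Vpq_def by blast
    thus ?thesis by (rule arg_cong)
  qed
qed

text \<open>Allows an arbitrary finite index set where \<open>F_tensor_V\<close> numbers its
  summands.\<close>

lemma F_tensor_VI:
  assumes X: "finite X" and f: "\<And>x. x \<in> X \<Longrightarrow> f x \<in> F_space N \<sigma>" and T: "\<And>x. x \<in> X \<Longrightarrow> T x \<in> Vpq N p q"
    and dom: "fst \<Psi> = carrier_vec N \<inter> (\<Inter>x\<in>X. fst (f x))"
    and val: "\<And>z m. z \<in> fst \<Psi> \<Longrightarrow> snd \<Psi> z m = (\<Sum>x\<in>X. snd (f x) z * T x m)"
  shows "\<Psi> \<in> F_tensor_V N \<sigma> p q"
proof -
  obtain h where h: "bij_betw h {..<card X} X"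
    using ex_bij_betw_nat_finite[OF X] by (auto simp: lessThan_atLeast0)
  have hX: "h i \<in> X" if "i < card X" for i using bij_betwE[OF h] that by simp
  let ?S = "pf_sum N {..<card X} (\<lambda>i. pf_tensor (f (h i)) (T (h i)))"
  have "(\<Inter>i<card X. fst (f (h i))) = (\<Inter>x\<in>X. fst (f x))"
    using arg_cong[OF bij_betw_imp_surj_on[OF h], of "\<lambda>Y. \<Inter>x\<in>Y. fst (f x)"] by (simp only: image_image)
  hence 1: "fst \<Psi> = fst ?S" using dom by (simp add: pf_sum_def pf_tensor_def)
  have "snd \<Psi> z m = snd ?S z m" if "z \<in> fst \<Psi>" for z m
    using val[OF that] sum.reindex_bij_betw[OF h, of "\<lambda>x. snd (f x) z * T x m"]
    by (simp add: pf_sum_def pf_tensor_def)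
  hence 2: "pf_eq \<Psi> ?S" by (simp add: pf_eq_def fun_eq_iff)
  have "\<forall>i<card X. f (h i) \<in> F_space N \<sigma> \<and> T (h i) \<in> Vpq N p q" using f T hX by blast
  with 1 2 show ?thesis
    unfolding F_tensor_V_def
    by (intro CollectI exI[of _ "card X"] exI[of _ "\<lambda>i. f (h i)"] exI[of _ "\<lambda>i. T (h i)"]) simp
qed

section \<open>Lattices and the function space\<close>

lemma span_overI:
  "x = vec N (\<lambda>k. \<Sum>v\<in>S. c v * v $ k) \<Longrightarrow> c \<in> S \<rightarrow> R \<Longrightarrow> x \<in> span_over N R S"
  unfolding span_over_def by blast

lemma span_over_add:
  assumes "x \<in> span_over N R S" "y \<in> span_over N R S" and R: "\<And>a b. a \<in> R \<Longrightarrow> b \<in> R \<Longrightarrow> a + b \<in> R"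
  shows "x + y \<in> span_over N R S"
proof -
  obtain c c' where c: "c \<in> S \<rightarrow> R" "x = vec N (\<lambda>k. \<Sum>v\<in>S. c v * v $ k)"
    "c' \<in> S \<rightarrow> R" "y = vec N (\<lambda>k. \<Sum>v\<in>S. c' v * v $ k)" using assms(1,2) unfolding span_over_def by blast
  have "x + y = vec N (\<lambda>k. \<Sum>v\<in>S. (c v + c' v) * v $ k)"
    unfolding c(2,4) by (intro eq_vecI) (simp_all add: distrib_right sum.distrib)
  moreover have "(\<lambda>v. c v + c' v) \<in> S \<rightarrow> R" using c(1,3) R by auto
  ultimately show ?thesis by (rule span_overI)
qed

lemma span_over_smult_base:
  assumes S: "finite S" and v: "v \<in> S" "v \<in> carrier_vec N" and R: "0 \<in> R" "a \<in> R"
  shows "a \<cdot>\<^sub>v v \<in> span_over N R S"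
proof -
  have "a \<cdot>\<^sub>v v = vec N (\<lambda>k. \<Sum>w\<in>S. (if w = v then a else 0) * w $ k)"
    using S v by (intro eq_vecI) (auto simp: if_distrib[of "\<lambda>x. x * _"] cong: if_cong)
  moreover have "(\<lambda>w. if w = v then a else 0) \<in> S \<rightarrow> R" using R by auto
  ultimately show ?thesis by (rule span_overI)
qed

lemma span_over_units:
  fixes R :: "'a :: field_char_0 set"
  assumes S: "finite S" "\<And>k. k < N \<Longrightarrow> c \<cdot>\<^sub>v unit_vec N k \<in> S"
    and R: "0 \<in> R" "\<And>a b. a \<in> R \<Longrightarrow> b \<in> R \<Longrightarrow> a + b \<in> R" and y: "\<And>k. k < N \<Longrightarrow> y k \<in> R"
  shows "vec N (\<lambda>k. c * y k) \<in> span_over N R S"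
proof -
  have "vec N (\<lambda>k. if k < m then c * y k else 0) \<in> span_over N R S" if "m \<le> N" for m
    using that
  proof (induction m)
    case 0
    have "vec N (\<lambda>k. if k < (0::nat) then c * y k else 0) = vec N (\<lambda>k. \<Sum>v\<in>S. 0 * v $ k)" by (intro eq_vecI) auto
    moreover have "(\<lambda>v. 0) \<in> S \<rightarrow> R" using R(1) by simp
    ultimately show ?case by (rule span_overI)
  next
    case (Suc m)
    have "vec N (\<lambda>k. if k < Suc m then c * y k else 0) =
        vec N (\<lambda>k. if k < m then c * y k else 0) + y m \<cdot>\<^sub>v (c \<cdot>\<^sub>v unit_vec N m)"
      using Suc.prems by (intro eq_vecI) (auto simp: unit_vec_def less_Suc_eq)
    moreover have "y m \<cdot>\<^sub>v (c \<cdot>\<^sub>v unit_vec N m) \<in> span_over N R S"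
      using Suc.prems S y R(1) by (intro span_over_smult_base) auto
    ultimately show ?case using span_over_add[OF _ _ R(2)] Suc by simp
  qed
  from this[OF order_refl] have "vec N (\<lambda>k. if k < N then c * y k else 0) \<in> span_over N R S" .
  also have "vec N (\<lambda>k. if k < N then c * y k else 0) = vec N (\<lambda>k. c * y k)" by (intro eq_vecI) auto
  finally show ?thesis .
qed

context quadratic_order
begin

interpretation \<sigma>: field_hom \<sigma> by (rule hom)

lemma full_lattice_combination:
  assumes \<Lambda>: "full_lattice N b \<Lambda>" and "finite T" "T \<subseteq> \<Lambda>" "c \<in> T \<rightarrow> {x. algebraic_int x}"
  shows "vec N (\<lambda>k. \<Sum>v\<in>T. c v * v $ k) \<in> \<Lambda>"
  using assms(2-4)
proof (induction T rule: finite_induct)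
  case empty
  have "of_int b \<cdot>\<^sub>v 0\<^sub>v N \<in> \<Lambda>" using int_of_int[of 0] by (intro full_latticeD(5)[OF \<Lambda>]) auto
  also have "of_int b \<cdot>\<^sub>v 0\<^sub>v N = vec N (\<lambda>k. \<Sum>v\<in>{}. c v * v $ k)" by (intro eq_vecI) auto
  finally show ?case .
next
  case (insert v T)
  have v: "v \<in> \<Lambda>" "algebraic_int (c v)" using insert.prems by auto
  have "vec N (\<lambda>k. \<Sum>v\<in>insert v T. c v * v $ k) = c v \<cdot>\<^sub>v v + vec N (\<lambda>k. \<Sum>v\<in>T. c v * v $ k)"
    using insert.hyps full_latticeD(2)[OF \<Lambda> v(1)] by (intro eq_vecI) auto
  also have "\<dots> \<in> \<Lambda>"
    using insert full_latticeD(4)[OF \<Lambda> v(2,1)] by (intro full_latticeD(3)[OF \<Lambda>]) auto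
  finally show ?case .
qed

text \<open>The multiples \<open>b\<close> of the unit vectors and the coset representatives
  together generate \<Lambda> over the integers; the former alone span the whole space.\<close>

lemma full_lattice_is_lattice:
  assumes \<Lambda>: "full_lattice N b \<Lambda>"
  shows "is_lattice N \<Lambda>"
proof -
  obtain R where R: "finite R" "R \<subseteq> \<Lambda>" "bij_betw (\<lambda>(r, g). r + vec N g) (R \<times> ({..<N} \<rightarrow>\<^sub>E multiples b)) \<Lambda>"
    by (rule lattice_residues[OF \<Lambda>])
  define U :: "'k vec set" where "U = (\<lambda>k. of_int b \<cdot>\<^sub>v unit_vec N k) ` {..<N}"
  define S where "S = U \<union> R"
  have S: "finite S" "\<And>k. k < N \<Longrightarrow> of_int b \<cdot>\<^sub>v unit_vec N k \<in> S" using R(1) by (auto simp: S_def U_def)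
  have "of_int b \<cdot>\<^sub>v unit_vec N k \<in> \<Lambda>" if "k < N" for k
    using int_of_int[of 0] int_of_int[of 1] that by (intro full_latticeD(5)[OF \<Lambda>]) (auto simp: unit_vec_def)
  hence S\<Lambda>: "S \<subseteq> \<Lambda>" using R(2) by (auto simp: S_def U_def)
  hence Sc: "S \<subseteq> carrier_vec N" using full_latticeD(2)[OF \<Lambda>] by blast
  have b: "of_int b \<noteq> (0::'k)" using full_latticeD(1)[OF \<Lambda>] by simp
  have "span_over N (carrier int_ring) S \<subseteq> \<Lambda>"
  proof
    fix x :: "'k vec" assume "x \<in> span_over N (carrier int_ring) S"
    then obtain c where c: "c \<in> S \<rightarrow> carrier int_ring" "x = vec N (\<lambda>k. \<Sum>v\<in>S. c v * v $ k)"
      unfolding span_over_def by blast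
    have "c \<in> S \<rightarrow> {x. algebraic_int x}" using c(1) by (simp add: Pi_iff)
    with c(2) show "x \<in> \<Lambda>" using full_lattice_combination[OF \<Lambda> S(1) S\<Lambda>] by simp
  qed
  moreover have "\<Lambda> \<subseteq> span_over N (carrier int_ring) S"
  proof
    fix x assume "x \<in> \<Lambda>"
    hence "x \<in> (\<lambda>(r, g). r + vec N g) ` (R \<times> ({..<N} \<rightarrow>\<^sub>E multiples b))" using bij_betw_imp_surj_on[OF R(3)] by blast
    then obtain r g where rg: "r \<in> R" "g \<in> {..<N} \<rightarrow>\<^sub>E multiples b" "x = r + vec N g" by auto
    have "\<forall>k<N. \<exists>y. algebraic_int y \<and> g k = of_int b * y"
      using rg(2) b by (auto simp: multiples_def PiE_iff)
    then obtain y where y: "\<forall>k<N. algebraic_int (y k) \<and> g k = of_int b * y k" by metis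
    have "r \<in> S" "r \<in> carrier_vec N" using rg(1) Sc by (auto simp: S_def)
    hence "1 \<cdot>\<^sub>v r \<in> span_over N (carrier int_ring) S"
      using S(1) int_of_int[of 0] int_of_int[of 1] by (intro span_over_smult_base) auto
    moreover have "vec N (\<lambda>k. of_int b * y k) \<in> span_over N (carrier int_ring) S"
      using S y int_of_int[of 0] by (intro span_over_units) (auto intro: int_add)
    moreover have "x = 1 \<cdot>\<^sub>v r + vec N (\<lambda>k. of_int b * y k)"
      unfolding rg(3) using y by (intro eq_vecI) auto
    ultimately show "x \<in> span_over N (carrier int_ring) S"
      using span_over_add[of "1 \<cdot>\<^sub>v r" N "carrier int_ring" S] int_add by simp
  qed
  moreover have "span_over N UNIV S = carrier_vec N"
  proof
    show "span_over N UNIV S \<subseteq> carrier_vec N" by (auto simp: span_over_def)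
    show "carrier_vec N \<subseteq> span_over N UNIV S"
    proof
      fix x :: "'k vec" assume x: "x \<in> carrier_vec N"
      have "vec N (\<lambda>k. of_int b * (x $ k / of_int b)) \<in> span_over N UNIV S"
        using S by (intro span_over_units) auto
      also have "vec N (\<lambda>k. of_int b * (x $ k / of_int b)) = x" using x b by (intro eq_vecI) auto
      finally show "x \<in> span_over N UNIV S" .
    qed
  qed
  ultimately show ?thesis unfolding is_lattice_def using S(1) Sc by blast
qed

lemma hyperplane_compl_iff:
  assumes "\<Lambda> \<subseteq> carrier_vec N"
  shows "z \<in> hyperplane_compl N \<sigma> \<Lambda> \<longleftrightarrow> z \<in> carrier_vec N \<and> (\<forall>x\<in>\<Lambda>. \<forall>k<N. z $ k \<noteq> \<sigma> (x $ k))"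
proof -
  have "dim_vec x = N" if "x \<in> \<Lambda>" for x using assms that carrier_vecD by blast
  thus ?thesis by (auto simp: hyperplane_compl_def)
qed

lemma multrow_mat_vec:
  fixes x :: "'a :: field vec"
  assumes "x \<in> carrier_vec N" "k < N"
  shows "(multrow_mat N 0 a *\<^sub>v x) $ k = (if k = 0 then a else 1) * x $ k"
proof -
  have "(multrow_mat N 0 a *\<^sub>v x) $ k = (\<Sum>j<N. row (multrow_mat N 0 a) k $ j * x $ j)"
    using assms by (simp add: scalar_prod_def lessThan_atLeast0)
  also have "\<dots> = (\<Sum>j<N. (if j = k then (if k = 0 then a else 1) * x $ j else 0))"
    using assms by (intro sum.cong) auto
  finally show ?thesis using assms(2) by simp
qed

lemma map_multrow_mat: "map_mat \<sigma> (multrow_mat N 0 a) = multrow_mat N 0 (\<sigma> a)"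
  by (intro eq_matI) auto

text \<open>Scaling the first coordinate reduces an arbitrary matrix to one of determinant one.\<close>

lemma KE_scale:
  fixes a :: 'k
  assumes "N > 0" and \<Lambda>: "full_lattice N b \<Lambda>" and a: "a \<noteq> 0" and z: "z \<in> carrier_vec N"
  shows "multrow_mat N 0 (\<sigma> a) *\<^sub>v z \<in> hyperplane_compl N \<sigma> (mat_image (multrow_mat N 0 a) \<Lambda>) \<longleftrightarrow>
      z \<in> hyperplane_compl N \<sigma> \<Lambda>" (is ?dom)
    "z \<in> hyperplane_compl N \<sigma> \<Lambda> \<Longrightarrow>
      KE N \<sigma> I J (multrow_mat N 0 (\<sigma> a) *\<^sub>v z) (mat_image (multrow_mat N 0 a) \<Lambda>) =
      ke_term (- int (I 0) - 1) (int (J 0)) 0 (\<sigma> a) * KE N \<sigma> I J z \<Lambda>"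
proof -
  let ?F = "multrow_mat N 0 a" and ?G = "multrow_mat N 0 (\<sigma> a)"
  have sub: "\<Lambda> \<subseteq> carrier_vec N" using full_latticeD(2)[OF \<Lambda>] by blast
  have F: "?F \<in> carrier_mat N N" "det ?F \<noteq> 0" using a \<open>N > 0\<close> by (simp_all add: det_multrow_mat)
  have Gz: "?G *\<^sub>v z \<in> carrier_vec N" using z by (intro mult_mat_vec_carrier) auto
  have subF: "mat_image ?F \<Lambda> \<subseteq> carrier_vec N" using F(1) sub by (auto intro!: mult_mat_vec_carrier)
  have Fx: "(?F *\<^sub>v x) $ k = (if k = 0 then a else 1) * x $ k" if "x \<in> \<Lambda>" "k < N" for x k
    using that sub by (intro multrow_mat_vec) auto
  note Gk = multrow_mat_vec[OF z, of _ "\<sigma> a"]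
  have a': "\<sigma> a \<noteq> 0" using a by simp
  show dom: ?dom
    unfolding hyperplane_compl_iff[OF sub] hyperplane_compl_iff[OF subF] ball_simps
  proof -
    have "(?G *\<^sub>v z) $ k \<noteq> \<sigma> ((?F *\<^sub>v x) $ k) \<longleftrightarrow> z $ k \<noteq> \<sigma> (x $ k)" if "x \<in> \<Lambda>" "k < N" for x k
      unfolding Fx[OF that] Gk[OF that(2)] using a' by (simp add: hom_distribs)
    thus "(?G *\<^sub>v z \<in> carrier_vec N \<and> (\<forall>x\<in>\<Lambda>. \<forall>k<N. (?G *\<^sub>v z) $ k \<noteq> \<sigma> ((?F *\<^sub>v x) $ k))) \<longleftrightarrow>
      (z \<in> carrier_vec N \<and> (\<forall>x\<in>\<Lambda>. \<forall>k<N. z $ k \<noteq> \<sigma> (x $ k)))" using Gz z by blast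
  qed
  assume zH: "z \<in> hyperplane_compl N \<sigma> \<Lambda>"
  define c where "c s = ke_term (- int (I 0) - 1) (int (J 0)) s (\<sigma> a)" for s
  obtain b' where b': "full_lattice N b' (mat_image ?F \<Lambda>)" by (rule full_lattice_image[OF F \<Lambda>])
  have prod: "ke_product N I J (?G *\<^sub>v z) (?F *\<^sub>v x) s = c s * ke_product N I J z x s" if x: "x \<in> \<Lambda>" for x s
  proof -
    have "ke_product N I J (?G *\<^sub>v z) (?F *\<^sub>v x) s = (\<Prod>k<N. (if k = 0 then c s else 1) *
        (fact (I k) * ke_term (- int (I k) - 1) (int (J k)) s (z $ k + \<sigma> (x $ k))))"
      unfolding ke_product_def
    proof (rule prod.cong[OF refl])
      fix k assume "k \<in> {..<N}"
      hence k: "k < N" by simp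
      show "fact (I k) * ke_term (- int (I k) - 1) (int (J k)) s ((?G *\<^sub>v z) $ k + \<sigma> ((?F *\<^sub>v x) $ k)) =
        (if k = 0 then c s else 1) * (fact (I k) * ke_term (- int (I k) - 1) (int (J k)) s (z $ k + \<sigma> (x $ k)))"
      proof (cases "k = 0")
        case True
        have "\<sigma> a * z $ 0 + \<sigma> (a * x $ 0) = \<sigma> a * (z $ 0 + \<sigma> (x $ 0))" by (simp add: hom_distribs distrib_left)
        thus ?thesis unfolding Fx[OF x k] Gk[OF k] using True by (simp add: ke_term_mult c_def)
      next
        case False
        thus ?thesis unfolding Fx[OF x k] Gk[OF k] by simp
      qed
    qed
    also have "\<dots> = c s * ke_product N I J z x s"
      unfolding prod.distrib ke_product_def using \<open>N > 0\<close> by simp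
    finally show ?thesis .
  qed
  have series: "(\<Sum>\<^sub>\<infinity>x\<in>mat_image ?F \<Lambda>. ke_product N I J (?G *\<^sub>v z) x s) = c s * (\<Sum>\<^sub>\<infinity>x\<in>\<Lambda>. ke_product N I J z x s)" for s
  proof -
    have "inj_on (\<lambda>x. ?F *\<^sub>v x) \<Lambda>"
      using mat_mult_inj[OF F] sub by (intro inj_onI) blast
    hence "(\<Sum>\<^sub>\<infinity>x\<in>mat_image ?F \<Lambda>. ke_product N I J (?G *\<^sub>v z) x s) = (\<Sum>\<^sub>\<infinity>x\<in>\<Lambda>. ke_product N I J (?G *\<^sub>v z) (?F *\<^sub>v x) s)"
      by (simp add: infsum_reindex o_def)
    also have "\<dots> = (\<Sum>\<^sub>\<infinity>x\<in>\<Lambda>. c s * ke_product N I J z x s)" by (intro infsum_cong) (simp add: prod)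
    also have "\<dots> = c s * (\<Sum>\<^sub>\<infinity>x\<in>\<Lambda>. ke_product N I J z x s)" by (rule infsum_cmult_right')
    finally show ?thesis .
  qed
  obtain D h where D: "D holomorphic_on UNIV" "D 0 \<noteq> 0" "h holomorphic_on {s. Re s > - 1}"
    "\<forall>s. Re s > KE_abscissa N I J \<longrightarrow> D s * (\<Sum>\<^sub>\<infinity>x\<in>\<Lambda>. ke_product N I J z x s) = h s"
    "D 0 * KE N \<sigma> I J z \<Lambda> = h 0"
    by (rule KE_continuation[OF \<open>N > 0\<close> \<Lambda> zH, of "- 1" I J]) auto
  have "D 0 * KE N \<sigma> I J (?G *\<^sub>v z) (mat_image ?F \<Lambda>) = c 0 * h 0"
  proof (rule KE_value[OF \<open>N > 0\<close> b' _ D(1,2), where h = "\<lambda>s. c s * h s" and A = "- 1"])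
    show "?G *\<^sub>v z \<in> hyperplane_compl N \<sigma> (mat_image ?F \<Lambda>)" using dom zH by blast
    show "(\<lambda>s. c s * h s) holomorphic_on {s. Re s > - 1}"
      unfolding c_def by (intro holomorphic_intros D(3))
    fix s assume "Re s > KE_abscissa N I J"
    hence "D s * (\<Sum>\<^sub>\<infinity>x\<in>\<Lambda>. ke_product N I J z x s) = h s" using D(4) by blast
    thus "D s * (\<Sum>\<^sub>\<infinity>x\<in>mat_image ?F \<Lambda>. ke_product N I J (?G *\<^sub>v z) x s) = c s * h s"
      unfolding series by (metis mult.left_commute)
  qed simp
  hence "D 0 * KE N \<sigma> I J (?G *\<^sub>v z) (mat_image ?F \<Lambda>) = D 0 * (c 0 * KE N \<sigma> I J z \<Lambda>)"
    unfolding D(5)[symmetric] by simp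
  thus "KE N \<sigma> I J (?G *\<^sub>v z) (mat_image ?F \<Lambda>) = ke_term (- int (I 0) - 1) (int (J 0)) 0 (\<sigma> a) * KE N \<sigma> I J z \<Lambda>"
    using D(2) unfolding c_def by simp
qed

text \<open>Generators of \<open>F_space\<close> involve only matrices of determinant 1. Therefore
  \<open>A\<close> is replaced by \<open>\<gamma> = A F\<close>, where \<open>F\<close> divides the
  first column by \<open>det A\<close>; the inverse of \<open>A\<close> is then \<open>F\<close>
  times that of \<gamma>, and \<open>KE_scale\<close> turns \<open>F\<close> into a constant
  factor.\<close>

lemma dedekind_F_space:
  assumes "N > 0" and \<Lambda>: "full_lattice N b \<Lambda>" and A: "A \<in> carrier_mat N N"
  shows "dedekind N \<sigma> I J A \<Lambda> \<in> F_space N \<sigma>"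
proof (cases "det A = 0")
  case True
  \<comment> \<open>The zero function is the empty linear combination.\<close>
  thus ?thesis unfolding F_space_def by (intro CollectI exI[of _ "{}"]) (simp add: dedekind_def)
next
  case False
  define F where "F = multrow_mat N 0 (inverse (det A))"
  define \<gamma> where "\<gamma> = A * F"
  have F: "F \<in> carrier_mat N N" "det F = inverse (det A)" using \<open>N > 0\<close> by (simp_all add: F_def det_multrow_mat)
  have \<gamma>: "\<gamma> \<in> carrier_mat N N" "det \<gamma> = 1" using A F False by (simp_all add: \<gamma>_def det_mult)
  have "det \<gamma> \<noteq> 0" using \<gamma>(2) by simp
  note g = mat_inv_exists[OF \<gamma>(1) this] and a = mat_inv_exists[OF A False]
  have "A * (F * mat_inv \<gamma>) = 1\<^sub>m N" using g(3) assoc_mult_mat[OF A F(1) g(1)] by (simp add: \<gamma>_def)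
  have "mat_inv A = mat_inv A * (A * (F * mat_inv \<gamma>))" unfolding \<open>A * (F * mat_inv \<gamma>) = 1\<^sub>m N\<close> using a(1) by simp
  also have "\<dots> = mat_inv A * A * (F * mat_inv \<gamma>)" using A F(1) g(1) a(1) by (intro assoc_mult_mat[symmetric]) auto
  also have "\<dots> = F * mat_inv \<gamma>" unfolding a(2) using F(1) g(1) by (intro left_mult_one_mat) auto
  finally have inv: "mat_inv A = F * mat_inv \<gamma>" .
  have "det (mat_inv \<gamma>) \<noteq> 0" by (rule mat_inv_unique(2)[OF g(1) \<gamma>(1) g(3)])
  then obtain b' where b': "full_lattice N b' (mat_image (mat_inv \<gamma>) \<Lambda>)" using full_lattice_image[OF g(1) _ \<Lambda>] by blast
  let ?\<Lambda> = "mat_image (mat_inv \<gamma>) \<Lambda>" and ?z = "\<lambda>z. map_mat \<sigma> (mat_inv \<gamma>) *\<^sub>v z"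
  have img: "mat_image (mat_inv A) \<Lambda> = mat_image F ?\<Lambda>"
    unfolding inv image_image using assoc_mult_mat_vec[OF F(1) g(1)] full_latticeD(2)[OF \<Lambda>] by (intro image_cong) auto
  have zc: "?z z \<in> carrier_vec N" if "z \<in> carrier_vec N" for z
    using g(1) that by (intro mult_mat_vec_carrier) auto
  have zz: "map_mat \<sigma> (mat_inv A) *\<^sub>v z = multrow_mat N 0 (\<sigma> (inverse (det A))) *\<^sub>v ?z z" if "z \<in> carrier_vec N" for z
    unfolding inv \<sigma>.mat_hom_mult[OF F(1) g(1)] map_multrow_mat[symmetric] F_def[symmetric]
    using F(1) g(1) that by (intro assoc_mult_mat_vec) auto
  have d: "inverse (det A) \<noteq> 0" using False by simp
  define G where "G = ({z \<in> carrier_vec N. ?z z \<in> hyperplane_compl N \<sigma> ?\<Lambda>}, \<lambda>z. KE N \<sigma> I J (?z z) ?\<Lambda>)"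
  have "G \<in> F_generators N \<sigma>"
    unfolding F_generators_def G_def using \<gamma> full_lattice_is_lattice[OF b']
    by (intro CollectI exI[of _ \<gamma>] exI[of _ ?\<Lambda>] exI[of _ I] exI[of _ J]) (simp add: SL_def)
  moreover have dom: "fst (dedekind N \<sigma> I J A \<Lambda>) = fst G"
    using False KE_scale(1)[OF \<open>N > 0\<close> b' d zc] by (auto simp: dedekind_def G_def img F_def zz)
  moreover have "snd (dedekind N \<sigma> I J A \<Lambda>) z =
      inverse (\<sigma> (det A)) * ke_term (- int (I 0) - 1) (int (J 0)) 0 (\<sigma> (inverse (det A))) * snd G z"
    if "z \<in> fst (dedekind N \<sigma> I J A \<Lambda>)" for z
  proof -
    have z: "z \<in> carrier_vec N" "?z z \<in> hyperplane_compl N \<sigma> ?\<Lambda>" using that unfolding dom by (simp_all add: G_def)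
    show ?thesis
      using False KE_scale(2)[OF \<open>N > 0\<close> b' d zc[OF z(1)] z(2)]
      by (simp add: dedekind_def G_def img F_def zz[OF z(1)])
  qed
  moreover have "fst G \<subseteq> carrier_vec N" by (auto simp: G_def)
  ultimately show ?thesis
    unfolding F_space_def
    by (intro CollectI exI[of _ "{G}"]
      exI[of _ "\<lambda>_. inverse (\<sigma> (det A)) * ke_term (- int (I 0) - 1) (int (J 0)) 0 (\<sigma> (inverse (det A)))"]) auto
qed

end

section \<open>Integrality and equivariance\<close>

lemma first_columns_mult:
  fixes g :: "'k::field_char_0 mat"
  assumes g: "g \<in> carrier_mat N N" and \<gamma>: "\<And>k. k < N \<Longrightarrow> \<gamma> k \<in> carrier_mat N N"
  shows "first_columns N (\<lambda>k. g * \<gamma> k) = g * first_columns N \<gamma>"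
proof -
  define w where "w k = \<gamma> k *\<^sub>v unit_vec N 0" for k
  have w: "w k \<in> carrier_vec N" if "k < N" for k
    unfolding w_def by (rule mult_mat_vec_carrier[OF \<gamma>[OF that]]) simp
  have gw: "(g * \<gamma> k) *\<^sub>v unit_vec N 0 = g *\<^sub>v w k" if "k < N" for k
    unfolding w_def by (rule assoc_mult_mat_vec[OF g \<gamma>[OF that]]) simp
  have "first_columns N (\<lambda>k. g * \<gamma> k) = mat_cols N (\<lambda>k. (g * \<gamma> k) *\<^sub>v unit_vec N 0)"
    by (rule first_columns_mat_cols) (rule mult_carrier_mat[OF g \<gamma>])
  also have "\<dots> = mat_cols N (\<lambda>k. g *\<^sub>v w k)"
    by (intro eq_matI) (simp_all add: mat_cols_def gw)
  also have "\<dots> = g * mat_cols N w"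
  proof (rule eq_matI)
    fix i j assume ij: "i < dim_row (g * mat_cols N w)" "j < dim_col (g * mat_cols N w)"
    have "col (mat_cols N w) j = w j"
      using ij w[of j] by (intro eq_vecI) (auto simp: mat_cols_def)
    thus "mat_cols N (\<lambda>k. g *\<^sub>v w k) $$ (i, j) = (g * mat_cols N w) $$ (i, j)"
      using ij g by (simp add: mat_cols_def)
  qed (use g in \<open>simp_all add: mat_cols_def\<close>)
  also have "mat_cols N w = first_columns N \<gamma>"
    unfolding w_def by (rule first_columns_mat_cols[OF \<gamma>, symmetric])
  finally show ?thesis .
qed

context quadratic_order
begin

interpretation \<sigma>: field_hom \<sigma> by (rule hom)

text \<open>\<open>g A\<close> has the determinant of \<open>A\<close>, and the inverse of
  \<open>g\<close> maps \<Lambda> onto itself, so the lattice inside the Dedekind sum stays the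
  same.\<close>

lemma dedekind_equivariant:
  assumes g: "g \<in> Gamma N \<Lambda>" and \<Lambda>: "\<Lambda> \<subseteq> carrier_vec N" and A: "A \<in> carrier_mat N N" and z: "z \<in> carrier_vec N"
  shows "snd (dedekind N \<sigma> I J (g * A) \<Lambda>) z = snd (dedekind N \<sigma> I J A \<Lambda>) (map_mat \<sigma> (mat_inv g) *\<^sub>v z)"
proof -
  have gc: "g \<in> carrier_mat N N" "det g = 1" using GammaD(1,2)[OF g] by simp_all
  have gd: "det g \<noteq> 0" using gc(2) by simp
  have det: "det (g * A) = det A" using det_mult[OF gc(1) A] gc(2) by simp
  show ?thesis
  proof (cases "det A = 0")
    case True
    thus ?thesis by (simp add: dedekind_def det)
  next
    case False
    note gi = mat_inv_exists(1)[OF gc(1) gd] and Ai = mat_inv_exists(1)[OF A False]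
    have inv: "mat_inv (g * A) = mat_inv A * mat_inv g" by (rule mat_inv_mult[OF gc(1) gd A False])
    have "mat_image (mat_inv g) \<Lambda> = mat_image (mat_inv g) (mat_image g \<Lambda>)" using g by (simp add: Gamma_def)
    also have "\<dots> = (\<lambda>x. x) ` \<Lambda>"
      unfolding image_image using mat_inv_mult_vec(1)[OF gc(1) gd] \<Lambda> by (intro image_cong) auto
    finally have g\<Lambda>: "mat_image (mat_inv g) \<Lambda> = \<Lambda>" by simp
    have "mat_image (mat_inv A * mat_inv g) \<Lambda> = mat_image (mat_inv A) (mat_image (mat_inv g) \<Lambda>)"
      unfolding image_image using assoc_mult_mat_vec[OF Ai gi] \<Lambda> by (intro image_cong) auto
    hence img: "mat_image (mat_inv (g * A)) \<Lambda> = mat_image (mat_inv A) \<Lambda>" unfolding inv g\<Lambda> .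
    have "map_mat \<sigma> (mat_inv (g * A)) *\<^sub>v z = map_mat \<sigma> (mat_inv A) *\<^sub>v (map_mat \<sigma> (mat_inv g) *\<^sub>v z)"
      unfolding inv \<sigma>.mat_hom_mult[OF Ai gi] using Ai gi z by (intro assoc_mult_mat_vec) auto
    thus ?thesis using False by (simp add: dedekind_def det img)
  qed
qed

end

context smoothing_data
begin

interpretation \<sigma>: field_hom \<sigma> by (rule hom)

lemma smult_vcol_\<Lambda>0:
  assumes j: "j \<in> J" and t: "t \<in> inverse_ideal \<II>"
  shows "t \<cdot>\<^sub>v vcol j \<in> \<Lambda>0"
  unfolding vcol_shift[OF j] by (rule \<gamma>D(4)[OF j smult_unit_in_std_lattice[OF t]])

text \<open>For \<open>k > 0\<close> use that 1 lies in the inverse ideal of \<II>. The entry at 0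
  multiplies that inverse ideal into itself, and such a multiplier is integral by
  \<open>multiplier_integral\<close>.\<close>

lemma vcol_integral:
  assumes j: "j \<in> J" and k: "k < N"
  shows "algebraic_int (vcol j $ k)"
proof (cases "k = 0")
  case False
  have "1 \<cdot>\<^sub>v vcol j \<in> \<Lambda>0"
    using int_subset_inverse_ideal[OF I(1), of 1] int_of_int[of 1] by (intro smult_vcol_\<Lambda>0[OF j]) simp
  thus ?thesis using False k vcol_carrier[OF j] by (simp add: std_lattice_def)
next
  case True
  obtain e where e: "e > 0" "\<forall>x\<in>inverse_ideal \<II>. algebraic_int (of_int e * x)"
    by (rule inverse_ideal_bounded[OF I])
  have "algebraic_int (vcol j $ 0)"
  proof (rule multiplier_integral[of "inverse_ideal \<II>" e 1])
    show "of_int 1 \<in> inverse_ideal \<II>" "of_int 1 * \<omega> \<in> inverse_ideal \<II>"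
      using int_subset_inverse_ideal[OF I(1), of 1] int_of_int[of 1] int_subset_inverse_ideal[OF I(1) int_\<omega>] by simp_all
    fix x assume "x \<in> inverse_ideal \<II>"
    hence "x \<cdot>\<^sub>v vcol j \<in> \<Lambda>0" by (rule smult_vcol_\<Lambda>0[OF j])
    thus "vcol j $ 0 * x \<in> inverse_ideal \<II>"
      using N vcol_carrier[OF j] by (simp add: std_lattice_def mult.commute)
  qed (use e in \<open>auto intro: inverse_idealD(2)\<close>)
  thus ?thesis using True by simp
qed

lemma cmat_integral:
  assumes sel: "\<forall>k<N. sel k \<in> J"
  shows "elements_mat (cmat sel) \<subseteq> carrier int_ring"
proof
  fix a assume "a \<in> elements_mat (cmat sel)"
  then obtain i j where "i < N" "j < N" "a = cmat sel $$ (i, j)" unfolding elements_mat_def by auto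
  thus "a \<in> carrier int_ring" using vcol_integral sel by (simp add: cmat_def mat_cols_def)
qed

lemma inverse_ideal_sum:
  "(\<And>i. i \<in> X \<Longrightarrow> f i \<in> inverse_ideal K) \<Longrightarrow> (\<Sum>i\<in>X. f i :: 'k) \<in> inverse_ideal K"
  by (induction X rule: infinite_finite_induct) (auto intro: inverse_idealD(1,4))

text \<open>Every coordinate of a point of \<Lambda>0 lies in the inverse ideal of \<II>, which
  contains the integers, and multiples of the columns by its elements stay in \<Lambda>0.\<close>

lemma cmat_lattice_End:
  assumes sel: "\<forall>k<N. sel k \<in> J"
  shows "cmat sel \<in> lattice_End N \<Lambda>0"
proof -
  have "cmat sel *\<^sub>v x \<in> \<Lambda>0" if x: "x \<in> \<Lambda>0" for x
  proof -
    have xk: "x $ k \<in> inverse_ideal \<II>" if "k < N" for k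
      using x that int_subset_inverse_ideal[OF I(1), of "x $ k"] by (cases "k = 0") (auto simp: std_lattice_def)
    have xc: "x \<in> carrier_vec N" by (rule std_carrier[OF x])
    have mem: "x $ k \<cdot>\<^sub>v vcol (sel k) \<in> \<Lambda>0" if "k < N" for k using sel that by (intro smult_vcol_\<Lambda>0 xk) auto
    have ent: "(cmat sel *\<^sub>v x) $ r = (\<Sum>k<N. (x $ k \<cdot>\<^sub>v vcol (sel k)) $ r)" if "r < N" for r
    proof -
      have "(cmat sel *\<^sub>v x) $ r = (\<Sum>k<N. row (cmat sel) r $ k * x $ k)"
        using that xc by (simp add: scalar_prod_def lessThan_atLeast0)
      also have "\<dots> = (\<Sum>k<N. (x $ k \<cdot>\<^sub>v vcol (sel k)) $ r)"
      proof (rule sum.cong[OF refl])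
        fix k assume "k \<in> {..<N}"
        hence k: "k < N" by simp
        have "dim_vec (vcol (sel k)) = N" using vcol_carrier sel k carrier_vecD by blast
        thus "row (cmat sel) r $ k * x $ k = (x $ k \<cdot>\<^sub>v vcol (sel k)) $ r"
          using k that by (simp add: cmat_def mat_cols_def)
      qed
      finally show ?thesis .
    qed
    have "(cmat sel *\<^sub>v x) $ 0 \<in> inverse_ideal \<II>"
      unfolding ent[OF N] using mem by (intro inverse_ideal_sum) (auto simp: std_lattice_def)
    moreover have "algebraic_int ((cmat sel *\<^sub>v x) $ k)" if k: "k \<in> {1..<N}" for k
    proof -
      have "algebraic_int ((x $ i \<cdot>\<^sub>v vcol (sel i)) $ k)" if "i < N" for i
        using mem[OF that] k unfolding std_lattice_def by (simp del: index_smult_vec)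
      moreover have "k < N" using k by simp
      ultimately show ?thesis unfolding ent[OF \<open>k < N\<close>] by (intro int_sum) auto
    qed
    moreover have "cmat sel *\<^sub>v x \<in> carrier_vec N" by (rule mult_mat_vec_carrier[OF cmat_carrier xc])
    ultimately show ?thesis by (simp add: std_lattice_def)
  qed
  thus ?thesis by (auto simp: lattice_End_def)
qed

lemma Phi_F_tensor_V:
  assumes sel: "\<forall>k<N. sel k \<in> J"
  shows "Phi N \<sigma> p q P \<II> (\<lambda>k. \<gamma> (sel k)) \<in> F_tensor_V N \<sigma> p q"
proof -
  obtain b1 where b1: "full_lattice N b1 \<Lambda>1" using full_lattices(1) ..
  obtain b0 where b0: "full_lattice N b0 \<Lambda>0" using full_lattices(2) ..
  let ?A = "cmat sel" and ?MI = "multi_indices N p \<times> multi_indices N q"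
  \<comment> \<open>The boolean separates the two Dedekind sums, each of which lies in
    \<open>F_space\<close>; the factor \<open>- ideal_norm P\<close> goes to the tensor
    \<open>T\<close>.\<close>
  define f where "f x = dedekind N \<sigma> (fst (fst x)) (snd (fst x)) ?A (if snd x then \<Lambda>1 else \<Lambda>0)"
    for x :: "((nat \<Rightarrow> nat) \<times> (nat \<Rightarrow> nat)) \<times> bool"
  define B where "B IJ = Vpq_act N p q (map_mat \<sigma> ?A) (Vpq_basis N (fst IJ) (snd IJ))" for IJ
  define T where "T x = (\<lambda>m. (if snd x then 1 else - of_nat (ideal_norm P)) * B (fst x) m)"
    for x :: "((nat \<Rightarrow> nat) \<times> (nat \<Rightarrow> nat)) \<times> bool"
  show ?thesis
  proof (rule F_tensor_VI[of "?MI \<times> UNIV" f N \<sigma> T p q])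
    fix x assume x: "x \<in> ?MI \<times> (UNIV :: bool set)"
    show "f x \<in> F_space N \<sigma>"
      unfolding f_def using dedekind_F_space[OF N b1 cmat_carrier] dedekind_F_space[OF N b0 cmat_carrier] by simp
    show "T x \<in> Vpq N p q"
      unfolding T_def B_def using x by (intro Vpq_scale Vpq_act_Vpq Vpq_basis_Vpq) auto
  next
    show "fst (Phi N \<sigma> p q P \<II> (\<lambda>k. \<gamma> (sel k))) = carrier_vec N \<inter> (\<Inter>x\<in>?MI \<times> UNIV. fst (f x))"
      unfolding Phi_def pf_sum_def pf_tensor_def first_columns_cmat[OF sel]
      by (fastforce simp: f_def dedekind_smoothed_def Let_def UNIV_bool)
  next
    fix z m
    have "(\<Sum>x\<in>?MI \<times> UNIV. snd (f x) z * T x m) = (\<Sum>IJ\<in>?MI. \<Sum>\<beta>\<in>UNIV. snd (f (IJ, \<beta>)) z * T (IJ, \<beta>) m)"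
      by (simp only: sum.cartesian_product case_prod_unfold prod.collapse)
    also have "\<dots> = snd (Phi N \<sigma> p q P \<II> (\<lambda>k. \<gamma> (sel k))) z m"
      unfolding Phi_def pf_sum_def pf_tensor_def first_columns_cmat[OF sel] case_prod_unfold snd_conv
      by (intro sum.cong refl) (simp add: UNIV_bool f_def T_def B_def dedekind_smoothed_def Let_def algebra_simps)
    finally show "snd (Phi N \<sigma> p q P \<II> (\<lambda>k. \<gamma> (sel k))) z m = (\<Sum>x\<in>?MI \<times> UNIV. snd (f x) z * T x m)" ..
  qed simp
qed

lemma Phi_equivariant:
  assumes g: "g \<in> Gamma0 N P \<II>" and sel: "\<forall>k<N. sel k \<in> J"
  shows "pf_eq (Phi N \<sigma> p q P \<II> (\<lambda>k. g * \<gamma> (sel k))) (pf_act N \<sigma> p q g (Phi N \<sigma> p q P \<II> (\<lambda>k. \<gamma> (sel k))))"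
proof -
  let ?A = "cmat sel" and ?MI = "multi_indices N p \<times> multi_indices N q"
  have g1: "g \<in> Gamma N \<Lambda>1" and g0: "g \<in> Gamma N \<Lambda>0" using g by (simp_all add: Gamma0_def)
  have gc: "g \<in> carrier_mat N N" "det g = 1" using GammaD(1,2)[OF g1] by simp_all
  have sub: "\<Lambda>1 \<subseteq> carrier_vec N" "\<Lambda>0 \<subseteq> carrier_vec N" using std_carrier by blast+
  have fc: "first_columns N (\<lambda>k. g * \<gamma> (sel k)) = g * ?A"
    unfolding first_columns_cmat[OF sel, symmetric] using sel by (intro first_columns_mult[OF gc(1)] \<gamma>D(1)) simp
  have "snd (Phi N \<sigma> p q P \<II> (\<lambda>k. g * \<gamma> (sel k))) z m =
      snd (pf_act N \<sigma> p q g (Phi N \<sigma> p q P \<II> (\<lambda>k. \<gamma> (sel k)))) z m"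
    if z: "z \<in> carrier_vec N" for z m
  proof -
    let ?z = "map_mat \<sigma> (mat_inv g) *\<^sub>v z"
    define D where "D IJ = snd (dedekind_smoothed N \<sigma> P (fst IJ) (snd IJ) ?A \<II>) ?z" for IJ
    have D: "snd (dedekind_smoothed N \<sigma> P (fst IJ) (snd IJ) (g * ?A) \<II>) z = D IJ" for IJ
      using dedekind_equivariant[OF g1 sub(1) cmat_carrier z] dedekind_equivariant[OF g0 sub(2) cmat_carrier z]
      by (simp add: D_def dedekind_smoothed_def Let_def)
    have "snd (Phi N \<sigma> p q P \<II> (\<lambda>k. g * \<gamma> (sel k))) z m =
        (\<Sum>IJ\<in>?MI. D IJ * Vpq_act N p q (map_mat \<sigma> (g * ?A)) (Vpq_basis N (fst IJ) (snd IJ)) m)"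
      by (simp add: Phi_def pf_sum_def pf_tensor_def fc case_prod_unfold D)
    also have "\<dots> = (\<Sum>IJ\<in>?MI. D IJ * Vpq_act N p q (map_mat \<sigma> g)
        (Vpq_act N p q (map_mat \<sigma> ?A) (Vpq_basis N (fst IJ) (snd IJ))) m)"
    proof (rule sum.cong[OF refl])
      fix IJ
      show "D IJ * Vpq_act N p q (map_mat \<sigma> (g * ?A)) (Vpq_basis N (fst IJ) (snd IJ)) m =
        D IJ * Vpq_act N p q (map_mat \<sigma> g) (Vpq_act N p q (map_mat \<sigma> ?A) (Vpq_basis N (fst IJ) (snd IJ))) m"
      \<comment> \<open>\<open>Vpq_act_mult\<close> asks for invertible matrices; for a singular one
        the Dedekind sum is 0.\<close>
      proof (cases "det ?A = 0")
        case True
        hence "D IJ = 0" by (simp add: D_def dedekind_smoothed_def dedekind_def Let_def)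
        thus ?thesis by simp
      next
        case False
        have "Vpq_act N p q (map_mat \<sigma> g * map_mat \<sigma> ?A) T = Vpq_act N p q (map_mat \<sigma> g) (Vpq_act N p q (map_mat \<sigma> ?A) T)" for T
          using False gc by (intro Vpq_act_mult) (simp_all add: \<sigma>.hom_det)
        thus ?thesis unfolding \<sigma>.mat_hom_mult[OF gc(1) cmat_carrier] by simp
      qed
    qed
    also have "\<dots> = snd (pf_act N \<sigma> p q g (Phi N \<sigma> p q P \<II> (\<lambda>k. \<gamma> (sel k)))) z m"
      by (simp add: pf_act_def Phi_def pf_sum_def pf_tensor_def first_columns_cmat[OF sel] case_prod_unfold D_def
        Vpq_act_sum)
    finally show ?thesis .
  qed
  moreover have "fst (Phi N \<sigma> p q P \<II> (\<lambda>k. g * \<gamma> (sel k))) \<subseteq> carrier_vec N"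
    by (auto simp: Phi_def pf_sum_def)
  ultimately show ?thesis unfolding pf_eq_def by (intro ballI ext) blast
qed

end

theorem theorem3p2:
  fixes \<sigma> :: "'k::field_char_0 \<Rightarrow> complex"
    and N p q :: nat
    and \<II> P :: "'k set"
  assumes "N \<ge> 2"
    and "imaginary_quadratic_field TYPE('k)"
    and "field_hom \<sigma>"
    and "ideal \<II> int_ring" and "\<II> \<noteq> {0}"
    and "ideal P int_ring" and "P \<noteq> {0}" and "P \<noteq> carrier int_ring"
    and "\<II> <+>\<^bsub>int_ring\<^esub> P = carrier int_ring"
  shows
    "(\<forall>\<gamma> \<in> {..<N} \<rightarrow> Gamma0 N P \<II>.
        elements_mat (first_columns N \<gamma>) \<subseteq> carrier int_ring \<and>
        first_columns N \<gamma> \<in> lattice_End N (std_lattice N \<II>) \<and>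
        Phi N \<sigma> p q P \<II> \<gamma> \<in> F_tensor_V N \<sigma> p q) \<and>
     (\<forall>g \<in> Gamma0 N P \<II>. \<forall>\<gamma> \<in> {..<N} \<rightarrow> Gamma0 N P \<II>.
        pf_eq (Phi N \<sigma> p q P \<II> (\<lambda>i. g * \<gamma> i))
              (pf_act N \<sigma> p q g (Phi N \<sigma> p q P \<II> \<gamma>))) \<and>
     (\<forall>\<gamma> \<in> {..N} \<rightarrow> Gamma0 N P \<II>.
        pf_eq (pf_sum N {..N} (\<lambda>i. pf_scale ((-1) ^ i) (Phi N \<sigma> p q P \<II> (omit i \<gamma>))))
              (pf_zero N))"
proof -
  have "ring (int_ring :: 'k ring)" using assms(4) by (simp add: ideal_def)
  then obtain \<omega> tr nm where qo: "quadratic_order \<sigma> \<omega> tr nm"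
    by (rule imaginary_quadratic_order[OF assms(2,3)])
  interpret quadratic_order \<sigma> \<omega> tr nm by (rule qo)
  obtain R where R: "finite R" "card R = ideal_norm P" "R \<subseteq> inverse_ideal (P \<cdot>\<^bsub>int_ring\<^esub> \<II>)"
    "\<forall>x\<in>inverse_ideal (P \<cdot>\<^bsub>int_ring\<^esub> \<II>). \<exists>!r. r \<in> R \<and> x - r \<in> inverse_ideal \<II>"
    using coprime_inverse_ideal_residues[OF assms(4-7,9)] by blast
  have N: "N > 0" using assms(1) by simp
  have smoothed: "smoothing_data \<sigma> \<omega> tr nm N \<II> P R J \<gamma>" if "\<gamma> \<in> J \<rightarrow> Gamma0 N P \<II>" for J \<gamma>
    using that by (intro smoothing_data.intro qo smoothing_data_axioms.intro N assms(4-7) R) auto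
  show ?thesis
  proof (intro conjI ballI)
    fix \<gamma> assume "\<gamma> \<in> {..<N} \<rightarrow> Gamma0 N P \<II>"
    then interpret S: smoothing_data \<sigma> \<omega> tr nm N \<II> P R "{..<N}" \<gamma> by (rule smoothed)
    have sel: "\<forall>k<N. k \<in> {..<N}" by simp
    show "elements_mat (first_columns N \<gamma>) \<subseteq> carrier int_ring"
      "first_columns N \<gamma> \<in> lattice_End N (std_lattice N \<II>)"
      using S.cmat_integral[OF sel] S.cmat_lattice_End[OF sel] S.first_columns_cmat[OF sel] by simp_all
    show "Phi N \<sigma> p q P \<II> \<gamma> \<in> F_tensor_V N \<sigma> p q" by (rule S.Phi_F_tensor_V[OF sel])
  next
    fix g \<gamma> assume g: "g \<in> Gamma0 N P \<II>" and "\<gamma> \<in> {..<N} \<rightarrow> Gamma0 N P \<II>"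
    then interpret S: smoothing_data \<sigma> \<omega> tr nm N \<II> P R "{..<N}" \<gamma> by (intro smoothed)
    show "pf_eq (Phi N \<sigma> p q P \<II> (\<lambda>i. g * \<gamma> i)) (pf_act N \<sigma> p q g (Phi N \<sigma> p q P \<II> \<gamma>))"
      by (rule S.Phi_equivariant[OF g]) simp
  next
    fix \<gamma> assume "\<gamma> \<in> {..N} \<rightarrow> Gamma0 N P \<II>"
    then interpret S: smoothing_data \<sigma> \<omega> tr nm N \<II> P R "{..N}" \<gamma> by (rule smoothed)
    show "pf_eq (pf_sum N {..N} (\<lambda>i. pf_scale ((-1) ^ i) (Phi N \<sigma> p q P \<II> (omit i \<gamma>)))) (pf_zero N)"
      by (rule S.Phi_cocycle[where e = "\<lambda>k. k"]) simp
  qed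
qed

end
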